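(* Let $\mathcal{E}$ be a weakly idempotent complete exact category with enough projectives. Endow $Ch_{\ge0}(\mathcal{E})$ and the category $s\mathcal{E}$ of simplicial objects of $\mathcal{E}$ with their projective model structures. Then the Dold–Kan functors $$\Gamma:Ch_{\ge0}(\mathcal{E})\to s\mathcal{E},\qquad N:s\mathcal{E}\to Ch_{\ge0}(\mathcal{E})$$ form a Quillen equivalence.
   Context: Exact categories are in the sense of Quillen; weakly idempotent complete means every retraction has a kernel; $P$ is projective if $\mathrm{Hom}(P,-)$ is exact; enough projectives means every object receives an admissible epimorphism from a projective. $Ch_{\ge0}(\mathcal{E})$ is the category of chain complexes concentrated in non-negative homological degrees. A complex is acyclic if every $d_n$ factors as $X_n\twoheadrightarrow Z_{n-1}\rightarrowtail X_{n-1}$ with every $Z_n\rightarrowtail X_n\twoheadrightarrow Z_{n-1}$ short exact; a map is a quasi-isomorphism if its cone is acyclic. Projective model structure on $Ch_{\ge0}(\mathcal{E})$: weak equivalences are quasi-isomorphisms; fibrations are the maps which are admissible epimorphisms in each strictly positive degree; cofibrations are the maps with the left lifting property against acyclic fibrations. Projective model structure on $s\mathcal{E}$: a map $f:A\to B$ is a weak equivalence (resp. fibration) iff for every projective $P$ of $\mathcal{E}$ the map of simplicial abelian groups $\mathrm{Hom}_{\mathcal{E}}(P,A_\bullet)\to\mathrm{Hom}_{\mathcal{E}}(P,B_\bullet)$ is a weak equivalence (resp. fibration) of underlying simplicial sets. $N$ is the normalized chain complex functor: $(NA)_n=\bigcap_{i=0}^{n-1}\mathrm{Ker}(d_i:A_n\to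 A_{n-1})$ with differential $(-1)^nd_n$, where the $d_i$ are the face maps. $\Gamma$ is the standard inverse: $\Gamma(C)_n=\bigoplus_{\eta:[n]\twoheadrightarrow[p]}C_p$, with the usual simplicial structure maps. *)

theory Defs
  imports "HOL-Algebra.Exact_Sequence" "HOL-Algebra.FiniteProduct"
begin

section \<open>Categories\<close>

record ('o, 'm) cat =
  Obj :: "'o set"
  Arr :: "'m set"
  Dom :: "'m \<Rightarrow> 'o"
  Cod :: "'m \<Rightarrow> 'o"
  Ident :: "'o \<Rightarrow> 'm"
  Comp :: "'m \<Rightarrow> 'm \<Rightarrow> 'm"  (infixl \<open>\<cdot>\<index>\<close> 70)

definition Hom :: "('o, 'm, 'z) cat_scheme \<Rightarrow> 'o \<Rightarrow> 'o \<Rightarrow> 'm set" where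
  "Hom C x y = {f \<in> Arr C. Dom C f = x \<and> Cod C f = y}"

locale category =
  fixes C (structure)
  assumes Dom_Obj: "f \<in> Arr C \<Longrightarrow> Dom C f \<in> Obj C"
    and Cod_Obj: "f \<in> Arr C \<Longrightarrow> Cod C f \<in> Obj C"
    and Ident_Hom: "x \<in> Obj C \<Longrightarrow> Ident C x \<in> Hom C x x"
    and Comp_Hom: "\<lbrakk>f \<in> Hom C x y; g \<in> Hom C y z\<rbrakk> \<Longrightarrow> g \<cdot> f \<in> Hom C x z"
    and Comp_Ident: "f \<in> Hom C x y \<Longrightarrow> f \<cdot> Ident C x = f"
    and Ident_Comp: "f \<in> Hom C x y \<Longrightarrow> Ident C y \<cdot> f = f"
    and Comp_assoc:
      "\<lbrakk>f \<in> Hom C w x; g \<in> Hom C x y; h \<in> Hom C y z\<rbrakk> \<Longrightarrow> (h \<cdot> g) \<cdot> f = h \<cdot> (g \<cdot> f)"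

definition is_initial :: "('o, 'm, 'z) cat_scheme \<Rightarrow> 'o \<Rightarrow> bool" where
  "is_initial C z \<longleftrightarrow> z \<in> Obj C \<and> (\<forall>x\<in>Obj C. \<exists>!f. f \<in> Hom C z x)"

definition is_terminal :: "('o, 'm, 'z) cat_scheme \<Rightarrow> 'o \<Rightarrow> bool" where
  "is_terminal C z \<longleftrightarrow> z \<in> Obj C \<and> (\<forall>x\<in>Obj C. \<exists>!f. f \<in> Hom C x z)"

definition is_zero_obj :: "('o, 'm, 'z) cat_scheme \<Rightarrow> 'o \<Rightarrow> bool" where
  "is_zero_obj C z \<longleftrightarrow> is_initial C z \<and> is_terminal C z"

definition is_iso :: "('o, 'm, 'z) cat_scheme \<Rightarrow> 'm \<Rightarrow> bool" where
  "is_iso C f \<longleftrightarrow> f \<in> Arr C \<and> (\<exists>g \<in> Hom C (Cod C f) (Dom C f).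
     g \<cdot>\<^bsub>C\<^esub> f = Ident C (Dom C f) \<and> f \<cdot>\<^bsub>C\<^esub> g = Ident C (Cod C f))"

definition is_retraction :: "('o, 'm, 'z) cat_scheme \<Rightarrow> 'm \<Rightarrow> bool" where
  "is_retraction C r \<longleftrightarrow> r \<in> Arr C \<and>
     (\<exists>s \<in> Hom C (Cod C r) (Dom C r). r \<cdot>\<^bsub>C\<^esub> s = Ident C (Cod C r))"

definition is_pullback ::
    "('o, 'm, 'z) cat_scheme \<Rightarrow> 'm \<Rightarrow> 'm \<Rightarrow> 'm \<Rightarrow> 'm \<Rightarrow> bool" where
  \<comment> \<open>\<open>p\<close> and \<open>q\<close> are the projections onto the domains of \<open>f\<close> and \<open>g\<close>\<close>
  "is_pullback C f g p q \<longleftrightarrow>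
     f \<in> Arr C \<and> g \<in> Arr C \<and> p \<in> Arr C \<and> q \<in> Arr C \<and> Cod C f = Cod C g \<and>
     Dom C p = Dom C q \<and> Cod C p = Dom C f \<and> Cod C q = Dom C g \<and>
     f \<cdot>\<^bsub>C\<^esub> p = g \<cdot>\<^bsub>C\<^esub> q \<and>
     (\<forall>t\<in>Obj C. \<forall>a \<in> Hom C t (Dom C f). \<forall>b \<in> Hom C t (Dom C g).
        f \<cdot>\<^bsub>C\<^esub> a = g \<cdot>\<^bsub>C\<^esub> b \<longrightarrow>
        (\<exists>!u. u \<in> Hom C t (Dom C p) \<and> p \<cdot>\<^bsub>C\<^esub> u = a \<and> q \<cdot>\<^bsub>C\<^esub> u = b))"

definition is_pushout ::
    "('o, 'm, 'z) cat_scheme \<Rightarrow> 'm \<Rightarrow> 'm \<Rightarrow> 'm \<Rightarrow> 'm \<Rightarrow> bool" where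
  \<comment> \<open>\<open>p\<close> and \<open>q\<close> are the coprojections from the codomains of \<open>f\<close> and \<open>g\<close>\<close>
  "is_pushout C f g p q \<longleftrightarrow>
     f \<in> Arr C \<and> g \<in> Arr C \<and> p \<in> Arr C \<and> q \<in> Arr C \<and> Dom C f = Dom C g \<and>
     Cod C p = Cod C q \<and> Dom C p = Cod C f \<and> Dom C q = Cod C g \<and>
     p \<cdot>\<^bsub>C\<^esub> f = q \<cdot>\<^bsub>C\<^esub> g \<and>
     (\<forall>t\<in>Obj C. \<forall>a \<in> Hom C (Cod C f) t. \<forall>b \<in> Hom C (Cod C g) t.
        a \<cdot>\<^bsub>C\<^esub> f = b \<cdot>\<^bsub>C\<^esub> g \<longrightarrow>
        (\<exists>!u. u \<in> Hom C (Cod C p) t \<and> u \<cdot>\<^bsub>C\<^esub> p = a \<and> u \<cdot>\<^bsub>C\<^esub> q = b))"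

record ('o, 'm, 'o2, 'm2) cfunctor =
  on_Obj :: "'o \<Rightarrow> 'o2"
  on_Arr :: "'m \<Rightarrow> 'm2"

definition is_functor ::
    "('o, 'm, 'z) cat_scheme \<Rightarrow> ('o2, 'm2, 'z2) cat_scheme \<Rightarrow> ('o, 'm, 'o2, 'm2) cfunctor \<Rightarrow> bool"
  where
  "is_functor C D F \<longleftrightarrow>
     (\<forall>x\<in>Obj C. on_Obj F x \<in> Obj D) \<and>
     (\<forall>x\<in>Obj C. \<forall>y\<in>Obj C. \<forall>f \<in> Hom C x y. on_Arr F f \<in> Hom D (on_Obj F x) (on_Obj F y)) \<and>
     (\<forall>x\<in>Obj C. on_Arr F (Ident C x) = Ident D (on_Obj F x)) \<and>
     (\<forall>x\<in>Obj C. \<forall>y\<in>Obj C. \<forall>z\<in>Obj C. \<forall>f \<in> Hom C x y. \<forall>g \<in> Hom C y z.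
        on_Arr F (g \<cdot>\<^bsub>C\<^esub> f) = on_Arr F g \<cdot>\<^bsub>D\<^esub> on_Arr F f)"

definition is_adjunction ::
    "('o, 'm, 'z) cat_scheme \<Rightarrow> ('o2, 'm2, 'z2) cat_scheme \<Rightarrow> ('o, 'm, 'o2, 'm2) cfunctor \<Rightarrow>
     ('o2, 'm2, 'o, 'm) cfunctor \<Rightarrow> ('o \<Rightarrow> 'o2 \<Rightarrow> 'm2 \<Rightarrow> 'm) \<Rightarrow> bool" where
  \<comment> \<open>\<open>F\<close> is left adjoint to \<open>G\<close>, via the bijections \<open>\<phi> x y : Hom (F x) y \<rightarrow> Hom x (G y)\<close>\<close>
  "is_adjunction C D F G \<phi> \<longleftrightarrow> is_functor C D F \<and> is_functor D C G \<and>
     (\<forall>x\<in>Obj C. \<forall>y\<in>Obj D. bij_betw (\<phi> x y) (Hom D (on_Obj F x) y) (Hom C x (on_Obj G y))) \<and>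
     (\<forall>x'\<in>Obj C. \<forall>x\<in>Obj C. \<forall>y\<in>Obj D. \<forall>y'\<in>Obj D.
        \<forall>a \<in> Hom C x' x. \<forall>f \<in> Hom D (on_Obj F x) y. \<forall>b \<in> Hom D y y'.
          \<phi> x' y' (b \<cdot>\<^bsub>D\<^esub> f \<cdot>\<^bsub>D\<^esub> on_Arr F a) = on_Arr G b \<cdot>\<^bsub>C\<^esub> \<phi> x y f \<cdot>\<^bsub>C\<^esub> a)"


section \<open>Model structures and Quillen equivalences\<close>

record ('o, 'm) model_cat = "('o, 'm) cat" +
  Weq :: "'m set"
  Fib :: "'m set"
  Cofib :: "'m set"

definition has_lifting :: "('o, 'm, 'z) cat_scheme \<Rightarrow> 'm \<Rightarrow> 'm \<Rightarrow> bool" where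
  \<comment> \<open>\<open>i\<close> has the left lifting property with respect to \<open>p\<close>\<close>
  "has_lifting C i p \<longleftrightarrow>
     (\<forall>u \<in> Hom C (Dom C i) (Dom C p). \<forall>v \<in> Hom C (Cod C i) (Cod C p).
        p \<cdot>\<^bsub>C\<^esub> u = v \<cdot>\<^bsub>C\<^esub> i \<longrightarrow>
        (\<exists>h \<in> Hom C (Cod C i) (Dom C p). h \<cdot>\<^bsub>C\<^esub> i = u \<and> p \<cdot>\<^bsub>C\<^esub> h = v))"

definition is_retract_of :: "('o, 'm, 'z) cat_scheme \<Rightarrow> 'm \<Rightarrow> 'm \<Rightarrow> bool" where
  "is_retract_of C f g \<longleftrightarrow> f \<in> Arr C \<and> g \<in> Arr C \<and>
     (\<exists>i \<in> Hom C (Dom C f) (Dom C g). \<exists>r \<in> Hom C (Dom C g) (Dom C f).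
      \<exists>j \<in> Hom C (Cod C f) (Cod C g). \<exists>s \<in> Hom C (Cod C g) (Cod C f).
        r \<cdot>\<^bsub>C\<^esub> i = Ident C (Dom C f) \<and> s \<cdot>\<^bsub>C\<^esub> j = Ident C (Cod C f) \<and>
        g \<cdot>\<^bsub>C\<^esub> i = j \<cdot>\<^bsub>C\<^esub> f \<and> f \<cdot>\<^bsub>C\<^esub> r = s \<cdot>\<^bsub>C\<^esub> g)"

text \<open>The axioms of a (closed) model structure: two-out-of-three, retracts, lifting, factorization.
  No limits or colimits are required of the underlying category, because for a general exact
  category \<open>\<E>\<close> the categories of chain complexes and of simplicial objects lack most of them.\<close>

locale model_structure = category M for M (structure) +
  assumes classes_Arr: "Weq M \<subseteq> Arr M" "Fib M \<subseteq> Arr M" "Cofib M \<subseteq> Arr M"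
    and two_of_three:
      "\<lbrakk>f \<in> Arr M; g \<in> Arr M; Cod M f = Dom M g; f \<in> Weq M; g \<in> Weq M\<rbrakk> \<Longrightarrow> g \<cdot> f \<in> Weq M"
      "\<lbrakk>f \<in> Arr M; g \<in> Arr M; Cod M f = Dom M g; f \<in> Weq M; g \<cdot> f \<in> Weq M\<rbrakk> \<Longrightarrow> g \<in> Weq M"
      "\<lbrakk>f \<in> Arr M; g \<in> Arr M; Cod M f = Dom M g; g \<in> Weq M; g \<cdot> f \<in> Weq M\<rbrakk> \<Longrightarrow> f \<in> Weq M"
    and retracts:
      "\<lbrakk>is_retract_of M f g; g \<in> Weq M\<rbrakk> \<Longrightarrow> f \<in> Weq M"
      "\<lbrakk>is_retract_of M f g; g \<in> Fib M\<rbrakk> \<Longrightarrow> f \<in> Fib M"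
      "\<lbrakk>is_retract_of M f g; g \<in> Cofib M\<rbrakk> \<Longrightarrow> f \<in> Cofib M"
    and lifting:
      "\<lbrakk>i \<in> Cofib M \<inter> Weq M; p \<in> Fib M\<rbrakk> \<Longrightarrow> has_lifting M i p"
      "\<lbrakk>i \<in> Cofib M; p \<in> Fib M \<inter> Weq M\<rbrakk> \<Longrightarrow> has_lifting M i p"
    and factorization:
      "f \<in> Arr M \<Longrightarrow> \<exists>i \<in> Cofib M \<inter> Weq M. \<exists>p \<in> Fib M. Cod M i = Dom M p \<and> f = p \<cdot> i"
      "f \<in> Arr M \<Longrightarrow> \<exists>i \<in> Cofib M. \<exists>p \<in> Fib M \<inter> Weq M. Cod M i = Dom M p \<and> f = p \<cdot> i"

definition cofibrant :: "('o, 'm, 'z) model_cat_scheme \<Rightarrow> 'o \<Rightarrow> bool" where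
  "cofibrant M x \<longleftrightarrow> x \<in> Obj M \<and> (\<exists>z. is_initial M z \<and> (\<exists>i \<in> Hom M z x. i \<in> Cofib M))"

definition fibrant :: "('o, 'm, 'z) model_cat_scheme \<Rightarrow> 'o \<Rightarrow> bool" where
  "fibrant M x \<longleftrightarrow> x \<in> Obj M \<and> (\<exists>z. is_terminal M z \<and> (\<exists>p \<in> Hom M x z. p \<in> Fib M))"

definition quillen_adjunction ::
    "('o, 'm, 'z) model_cat_scheme \<Rightarrow> ('o2, 'm2, 'z2) model_cat_scheme \<Rightarrow>
     ('o, 'm, 'o2, 'm2) cfunctor \<Rightarrow> ('o2, 'm2, 'o, 'm) cfunctor \<Rightarrow>
     ('o \<Rightarrow> 'o2 \<Rightarrow> 'm2 \<Rightarrow> 'm) \<Rightarrow> bool" where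
  "quillen_adjunction M M' F G \<phi> \<longleftrightarrow>
     model_structure M \<and> model_structure M' \<and> is_adjunction M M' F G \<phi> \<and>
     (\<forall>i \<in> Cofib M. on_Arr F i \<in> Cofib M') \<and>
     (\<forall>i \<in> Cofib M \<inter> Weq M. on_Arr F i \<in> Cofib M' \<inter> Weq M')"

text \<open>\<open>F\<close> is the left and \<open>G\<close> the right adjoint.  Two adjunction bijections for the same pair of
  functors differ by an automorphism of \<open>F\<close>, so the condition below does not depend on \<open>\<phi>\<close>.\<close>

definition quillen_equivalence ::
    "('o, 'm, 'z) model_cat_scheme \<Rightarrow> ('o2, 'm2, 'z2) model_cat_scheme \<Rightarrow>
     ('o, 'm, 'o2, 'm2) cfunctor \<Rightarrow> ('o2, 'm2, 'o, 'm) cfunctor \<Rightarrow> bool" where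
  "quillen_equivalence M M' F G \<longleftrightarrow> (\<exists>\<phi>. quillen_adjunction M M' F G \<phi> \<and>
     (\<forall>x y. cofibrant M x \<and> fibrant M' y \<longrightarrow>
        (\<forall>f \<in> Hom M' (on_Obj F x) y. f \<in> Weq M' \<longleftrightarrow> \<phi> x y f \<in> Weq M)))"


section \<open>Additive and exact categories\<close>

record ('o, 'm) add_cat = "('o, 'm) cat" +
  Zero :: "'o \<Rightarrow> 'o \<Rightarrow> 'm"
  Add :: "'m \<Rightarrow> 'm \<Rightarrow> 'm"

text \<open>The abelian group structure of a Hom-set, as an abelian group in multiplicative notation.\<close>

definition Hom_grp :: "('o, 'm, 'z) add_cat_scheme \<Rightarrow> 'o \<Rightarrow> 'o \<Rightarrow> 'm monoid" where
  "Hom_grp E x y = \<lparr>carrier = Hom E x y, mult = Add E, one = Zero E x y\<rparr>"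

definition Neg :: "('o, 'm, 'z) add_cat_scheme \<Rightarrow> 'm \<Rightarrow> 'm" where
  "Neg E f = inv\<^bsub>Hom_grp E (Dom E f) (Cod E f)\<^esub> f"

definition sgn_arr :: "('o, 'm, 'z) add_cat_scheme \<Rightarrow> nat \<Rightarrow> 'm \<Rightarrow> 'm" where
  \<comment> \<open>the arrow \<open>(-1)\<^sup>n f\<close>\<close>
  "sgn_arr E n f = (if even n then f else Neg E f)"

definition is_biproduct ::
    "('o, 'm, 'z) add_cat_scheme \<Rightarrow> 'i set \<Rightarrow> ('i \<Rightarrow> 'o) \<Rightarrow> 'o \<Rightarrow> ('i \<Rightarrow> 'm) \<Rightarrow> ('i \<Rightarrow> 'm) \<Rightarrow> bool"
  where
  "is_biproduct E I X B inc prj \<longleftrightarrow> finite I \<and> B \<in> Obj E \<and>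
     (\<forall>i\<in>I. X i \<in> Obj E \<and> inc i \<in> Hom E (X i) B \<and> prj i \<in> Hom E B (X i)) \<and>
     (\<forall>i\<in>I. \<forall>j\<in>I. prj j \<cdot>\<^bsub>E\<^esub> inc i = (if i = j then Ident E (X i) else Zero E (X i) (X j))) \<and>
     finprod (Hom_grp E B B) (\<lambda>i. inc i \<cdot>\<^bsub>E\<^esub> prj i) I = Ident E B"

locale additive_category = category E for E (structure) +
  assumes Hom_comm_group: "\<lbrakk>x \<in> Obj E; y \<in> Obj E\<rbrakk> \<Longrightarrow> comm_group (Hom_grp E x y)"
    and Comp_Add_left:
      "\<lbrakk>f \<in> Hom E x y; g \<in> Hom E y z; h \<in> Hom E y z\<rbrakk> \<Longrightarrow> Add E g h \<cdot> f = Add E (g \<cdot> f) (h \<cdot> f)"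
    and Comp_Add_right:
      "\<lbrakk>f \<in> Hom E x y; g \<in> Hom E x y; h \<in> Hom E y z\<rbrakk> \<Longrightarrow> h \<cdot> Add E f g = Add E (h \<cdot> f) (h \<cdot> g)"
    and zero_obj_ex: "\<exists>z. is_zero_obj E z"
    and biproduct_ex: "\<lbrakk>x \<in> Obj E; y \<in> Obj E\<rbrakk> \<Longrightarrow>
      \<exists>B inc prj. is_biproduct E UNIV (\<lambda>b. if b then x else y) B inc prj"

definition is_kernel :: "('o, 'm, 'z) add_cat_scheme \<Rightarrow> 'm \<Rightarrow> 'm \<Rightarrow> bool" where
  "is_kernel E k f \<longleftrightarrow> k \<in> Arr E \<and> f \<in> Arr E \<and> Cod E k = Dom E f \<and>
     f \<cdot>\<^bsub>E\<^esub> k = Zero E (Dom E k) (Cod E f) \<and>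
     (\<forall>t\<in>Obj E. \<forall>g \<in> Hom E t (Dom E f). f \<cdot>\<^bsub>E\<^esub> g = Zero E t (Cod E f) \<longrightarrow>
        (\<exists>!u. u \<in> Hom E t (Dom E k) \<and> k \<cdot>\<^bsub>E\<^esub> u = g))"

definition is_cokernel :: "('o, 'm, 'z) add_cat_scheme \<Rightarrow> 'm \<Rightarrow> 'm \<Rightarrow> bool" where
  "is_cokernel E c f \<longleftrightarrow> c \<in> Arr E \<and> f \<in> Arr E \<and> Dom E c = Cod E f \<and>
     c \<cdot>\<^bsub>E\<^esub> f = Zero E (Dom E f) (Cod E c) \<and>
     (\<forall>t\<in>Obj E. \<forall>g \<in> Hom E (Cod E f) t. g \<cdot>\<^bsub>E\<^esub> f = Zero E (Dom E f) t \<longrightarrow>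
        (\<exists>!u. u \<in> Hom E (Cod E c) t \<and> u \<cdot>\<^bsub>E\<^esub> c = g))"

text \<open>An exact structure is given by its class of short exact sequences
  \<open>(i, p)\<close>, with \<open>i : A \<rightarrowtail> B\<close> and \<open>p : B \<twoheadrightarrow> C\<close>.\<close>

record ('o, 'm) exact_cat = "('o, 'm) add_cat" +
  Ses :: "('m \<times> 'm) set"

definition adm_mono :: "('o, 'm, 'z) exact_cat_scheme \<Rightarrow> 'm \<Rightarrow> bool" where
  "adm_mono E i \<longleftrightarrow> (\<exists>p. (i, p) \<in> Ses E)"

definition adm_epi :: "('o, 'm, 'z) exact_cat_scheme \<Rightarrow> 'm \<Rightarrow> bool" where
  "adm_epi E p \<longleftrightarrow> (\<exists>i. (i, p) \<in> Ses E)"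

locale exact_category = additive_category E for E (structure) +
  assumes Ses_kernel_cokernel: "(i, p) \<in> Ses E \<Longrightarrow> is_kernel E i p \<and> is_cokernel E p i"
    and Ses_iso_closed:
      "\<lbrakk>(i, p) \<in> Ses E; is_iso E a; is_iso E b; is_iso E c;
        i' \<in> Hom E (Cod E a) (Cod E b); p' \<in> Hom E (Cod E b) (Cod E c);
        Dom E a = Dom E i; Dom E b = Dom E p; Dom E c = Cod E p;
        b \<cdot> i = i' \<cdot> a; c \<cdot> p = p' \<cdot> b\<rbrakk> \<Longrightarrow> (i', p') \<in> Ses E"
    and adm_mono_Ident: "x \<in> Obj E \<Longrightarrow> adm_mono E (Ident E x)"
    and adm_epi_Ident: "x \<in> Obj E \<Longrightarrow> adm_epi E (Ident E x)"
    and adm_mono_Comp: "\<lbrakk>adm_mono E i; adm_mono E j; Cod E i = Dom E j\<rbrakk> \<Longrightarrow> adm_mono E (j \<cdot> i)"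
    and adm_epi_Comp: "\<lbrakk>adm_epi E p; adm_epi E q; Cod E p = Dom E q\<rbrakk> \<Longrightarrow> adm_epi E (q \<cdot> p)"
    and adm_mono_pushout: "\<lbrakk>adm_mono E i; f \<in> Arr E; Dom E f = Dom E i\<rbrakk> \<Longrightarrow>
      \<exists>f' i'. is_pushout E i f f' i' \<and> adm_mono E i'"
    and adm_epi_pullback: "\<lbrakk>adm_epi E p; f \<in> Arr E; Cod E f = Cod E p\<rbrakk> \<Longrightarrow>
      \<exists>f' p'. is_pullback E p f f' p' \<and> adm_epi E p'"

definition weakly_idempotent_complete :: "('o, 'm, 'z) add_cat_scheme \<Rightarrow> bool" where
  "weakly_idempotent_complete E \<longleftrightarrow> (\<forall>r. is_retraction E r \<longrightarrow> (\<exists>k. is_kernel E k r))"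

definition projective :: "('o, 'm, 'z) exact_cat_scheme \<Rightarrow> 'o \<Rightarrow> bool" where
  \<comment> \<open>\<^const>\<open>short_exact_sequence\<close> lists its groups and maps from right to left\<close>
  "projective E P \<longleftrightarrow> P \<in> Obj E \<and>
     (\<forall>(i, p) \<in> Ses E. short_exact_sequence
        (Hom_grp E P (Cod E p)) (Hom_grp E P (Dom E p)) (Hom_grp E P (Dom E i))
        (\<lambda>f. p \<cdot>\<^bsub>E\<^esub> f) (\<lambda>f. i \<cdot>\<^bsub>E\<^esub> f))"

definition enough_projectives :: "('o, 'm, 'z) exact_cat_scheme \<Rightarrow> bool" where
  "enough_projectives E \<longleftrightarrow>
     (\<forall>x\<in>Obj E. \<exists>P. projective E P \<and> (\<exists>p \<in> Hom E P x. adm_epi E p))"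

text \<open>A chosen finite direct sum, with its inclusions.\<close>

definition dsum :: "('o, 'm, 'z) add_cat_scheme \<Rightarrow> 'i set \<Rightarrow> ('i \<Rightarrow> 'o) \<Rightarrow> 'o" where
  "dsum E I X = (SOME B. \<exists>inc prj. is_biproduct E I X B inc prj)"

definition dsum_in :: "('o, 'm, 'z) add_cat_scheme \<Rightarrow> 'i set \<Rightarrow> ('i \<Rightarrow> 'o) \<Rightarrow> 'i \<Rightarrow> 'm" where
  "dsum_in E I X = (SOME inc. \<exists>prj. is_biproduct E I X (dsum E I X) inc prj)"


section \<open>Non-negatively graded chain complexes\<close>

datatype ('a, 'f) arrow = Arrow (src: 'a) (map_of_arrow: 'f) (tgt: 'a)

text \<open>\<open>bd X n\<close> is the differential from degree \<open>n + 1\<close> to degree \<open>n\<close>.\<close>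

datatype ('o, 'm) chain = Chain (ob: "nat \<Rightarrow> 'o") (bd: "nat \<Rightarrow> 'm")

type_synonym ('o, 'm) chain_map = "(('o, 'm) chain, nat \<Rightarrow> 'm) arrow"

definition chain_complexes :: "('o, 'm, 'z) add_cat_scheme \<Rightarrow> ('o, 'm) chain set" where
  "chain_complexes E = {X. (\<forall>n. ob X n \<in> Obj E) \<and>
     (\<forall>n. bd X n \<in> Hom E (ob X (Suc n)) (ob X n)) \<and>
     (\<forall>n. bd X n \<cdot>\<^bsub>E\<^esub> bd X (Suc n) = Zero E (ob X (Suc (Suc n))) (ob X n))}"

definition Ch :: "('o, 'm, 'z) add_cat_scheme \<Rightarrow> (('o, 'm) chain, ('o, 'm) chain_map) cat" where
  "Ch E = \<lparr>
     Obj = chain_complexes E,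
     Arr = {Arrow X f Y | X f Y. X \<in> chain_complexes E \<and> Y \<in> chain_complexes E \<and>
       (\<forall>n. f n \<in> Hom E (ob X n) (ob Y n)) \<and>
       (\<forall>n. bd Y n \<cdot>\<^bsub>E\<^esub> f (Suc n) = f n \<cdot>\<^bsub>E\<^esub> bd X n)},
     Dom = src,
     Cod = tgt,
     Ident = (\<lambda>X. Arrow X (\<lambda>n. Ident E (ob X n)) X),
     Comp = (\<lambda>g f. Arrow (src f) (\<lambda>n. map_of_arrow g n \<cdot>\<^bsub>E\<^esub> map_of_arrow f n) (tgt g))\<rparr>"

text \<open>In \<open>acyclic\<close>, \<open>bd X n\<close> factors as \<open>X\<^sub>n\<^sub>+\<^sub>1 \<twoheadrightarrow> Z\<^sub>n \<rightarrowtail> X\<^sub>n\<close> with the maps \<open>e n\<close> and \<open>m n\<close>.  Since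
  \<open>X\<^sub>-\<^sub>1 = 0\<close>, the object \<open>Z\<^sub>-\<^sub>1\<close> is zero; this is the last condition.\<close>

definition acyclic :: "('o, 'm, 'z) exact_cat_scheme \<Rightarrow> ('o, 'm) chain \<Rightarrow> bool" where
  "acyclic E X \<longleftrightarrow> X \<in> chain_complexes E \<and>
     (\<exists>Z e m.
        (\<forall>n. e n \<in> Hom E (ob X (Suc n)) (Z n) \<and> m n \<in> Hom E (Z n) (ob X n) \<and>
             bd X n = m n \<cdot>\<^bsub>E\<^esub> e n) \<and>
        (\<forall>n. (m (Suc n), e n) \<in> Ses E) \<and>
        (\<exists>t. (m 0, t) \<in> Ses E \<and> is_zero_obj E (Cod E t)))"

text \<open>The mapping cone of \<open>f : X \<rightarrow> Y\<close> is \<open>X\<^sub>n\<^sub>-\<^sub>1 \<oplus> Y\<^sub>n\<close> in degree \<open>n\<close>, with \<open>d (x, y) = (- d x, f x + d y)\<close>.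
  The summands are indexed by \<^const>\<open>False\<close> and \<^const>\<open>True\<close>; in degree \<open>0\<close> only \<open>Y\<^sub>0\<close> is present.\<close>

definition cone_index :: "nat \<Rightarrow> bool set" where
  "cone_index n = (if n = 0 then {True} else UNIV)"

definition cone_family :: "('o, 'm) chain_map \<Rightarrow> nat \<Rightarrow> bool \<Rightarrow> 'o" where
  "cone_family f n b = (if b then ob (tgt f) n else ob (src f) (n - 1))"

definition cone_ob :: "('o, 'm, 'z) add_cat_scheme \<Rightarrow> ('o, 'm) chain_map \<Rightarrow> nat \<Rightarrow> 'o" where
  "cone_ob E f n = dsum E (cone_index n) (cone_family f n)"

definition cone_in :: "('o, 'm, 'z) add_cat_scheme \<Rightarrow> ('o, 'm) chain_map \<Rightarrow> nat \<Rightarrow> bool \<Rightarrow> 'm" where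
  "cone_in E f n = dsum_in E (cone_index n) (cone_family f n)"

definition cone :: "('o, 'm, 'z) add_cat_scheme \<Rightarrow> ('o, 'm) chain_map \<Rightarrow> ('o, 'm) chain" where
  "cone E f = Chain (cone_ob E f) (\<lambda>n.
     THE d. d \<in> Hom E (cone_ob E f (Suc n)) (cone_ob E f n) \<and>
       d \<cdot>\<^bsub>E\<^esub> cone_in E f (Suc n) True = cone_in E f n True \<cdot>\<^bsub>E\<^esub> bd (tgt f) n \<and>
       d \<cdot>\<^bsub>E\<^esub> cone_in E f (Suc n) False =
         (case n of
            0 \<Rightarrow> cone_in E f 0 True \<cdot>\<^bsub>E\<^esub> map_of_arrow f 0
          | Suc k \<Rightarrow> Add E (cone_in E f n True \<cdot>\<^bsub>E\<^esub> map_of_arrow f n)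
                         (cone_in E f n False \<cdot>\<^bsub>E\<^esub> Neg E (bd (src f) k))))"

definition quasi_isos :: "('o, 'm, 'z) exact_cat_scheme \<Rightarrow> ('o, 'm) chain_map set" where
  "quasi_isos E = {f \<in> Arr (Ch E). acyclic E (cone E f)}"

definition Ch_fibrations :: "('o, 'm, 'z) exact_cat_scheme \<Rightarrow> ('o, 'm) chain_map set" where
  "Ch_fibrations E = {f \<in> Arr (Ch E). \<forall>n>0. adm_epi E (map_of_arrow f n)}"

text \<open>A category with prescribed weak equivalences and fibrations, the cofibrations being the maps
  with the left lifting property against the acyclic fibrations.\<close>

definition with_weq_fib :: "('o, 'm) cat \<Rightarrow> 'm set \<Rightarrow> 'm set \<Rightarrow> ('o, 'm) model_cat" where
  "with_weq_fib C W F = \<lparr>Obj = Obj C, Arr = Arr C, Dom = Dom C, Cod = Cod C,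
     Ident = Ident C, Comp = Comp C, Weq = W, Fib = F,
     Cofib = {i \<in> Arr C. \<forall>p \<in> F \<inter> W. has_lifting C i p}\<rparr>"

definition Ch_proj ::
    "('o, 'm, 'z) exact_cat_scheme \<Rightarrow> (('o, 'm) chain, ('o, 'm) chain_map) model_cat" where
  "Ch_proj E = with_weq_fib (Ch E) (quasi_isos E) (Ch_fibrations E)"


section \<open>The simplex category and simplicial objects\<close>

text \<open>The object \<open>[n]\<close> is represented by \<open>n\<close>; an arrow \<open>[m] \<rightarrow> [n]\<close> is a monotone map from \<open>{..m}\<close>
  to \<open>{..n}\<close>, taken to be \<^const>\<open>undefined\<close> outside \<open>{..m}\<close>.\<close>

type_synonym sop = "(nat, nat \<Rightarrow> nat) arrow"

definition Simplex :: "(nat, sop) cat" where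
  "Simplex = \<lparr>
     Obj = UNIV,
     Arr = {Arrow m \<alpha> n | m \<alpha> n. \<alpha> \<in> {..m} \<rightarrow>\<^sub>E {..n} \<and> mono_on {..m} \<alpha>},
     Dom = src,
     Cod = tgt,
     Ident = (\<lambda>n. Arrow n (\<lambda>i\<in>{..n}. i) n),
     Comp = (\<lambda>\<beta> \<alpha>. Arrow (src \<alpha>) (compose {..src \<alpha>} (map_of_arrow \<beta>) (map_of_arrow \<alpha>)) (tgt \<beta>))\<rparr>"

definition coface :: "nat \<Rightarrow> nat \<Rightarrow> sop" where
  \<comment> \<open>the injection \<open>[n] \<rightarrow> [n + 1]\<close> that omits \<open>i\<close>\<close>
  "coface n i = Arrow n (\<lambda>j\<in>{..n}. if j < i then j else Suc j) (Suc n)"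

definition to_point :: "nat \<Rightarrow> sop" where
  \<comment> \<open>the unique map \<open>[n] \<rightarrow> [0]\<close>\<close>
  "to_point n = Arrow n (\<lambda>j\<in>{..n}. 0) 0"

definition surj_sop :: "sop \<Rightarrow> bool" where
  "surj_sop \<alpha> \<longleftrightarrow> \<alpha> \<in> Arr Simplex \<and> map_of_arrow \<alpha> ` {..src \<alpha>} = {..tgt \<alpha>}"

definition inj_sop :: "sop \<Rightarrow> bool" where
  "inj_sop \<alpha> \<longleftrightarrow> \<alpha> \<in> Arr Simplex \<and> inj_on (map_of_arrow \<alpha>) {..src \<alpha>}"

text \<open>A simplicial object is a contravariant functor on the simplex category, normalised to be
  \<^const>\<open>undefined\<close> outside the arrows of that category.\<close>

datatype ('o, 'm) simp_obj = SimpObj (sob: "nat \<Rightarrow> 'o") (sact: "sop \<Rightarrow> 'm")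

type_synonym ('o, 'm) simp_map = "(('o, 'm) simp_obj, nat \<Rightarrow> 'm) arrow"

definition simplicial_objects :: "('o, 'm, 'z) cat_scheme \<Rightarrow> ('o, 'm) simp_obj set" where
  "simplicial_objects E = {A.
     (\<forall>n. sob A n \<in> Obj E) \<and>
     sact A \<in> extensional (Arr Simplex) \<and>
     (\<forall>m n. \<forall>\<alpha> \<in> Hom Simplex m n. sact A \<alpha> \<in> Hom E (sob A n) (sob A m)) \<and>
     (\<forall>n. sact A (Ident Simplex n) = Ident E (sob A n)) \<and>
     (\<forall>l m n. \<forall>\<alpha> \<in> Hom Simplex l m. \<forall>\<beta> \<in> Hom Simplex m n.
        sact A (\<beta> \<cdot>\<^bsub>Simplex\<^esub> \<alpha>) = sact A \<alpha> \<cdot>\<^bsub>E\<^esub> sact A \<beta>)}"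

definition sCat :: "('o, 'm, 'z) cat_scheme \<Rightarrow> (('o, 'm) simp_obj, ('o, 'm) simp_map) cat" where
  "sCat E = \<lparr>
     Obj = simplicial_objects E,
     Arr = {Arrow A f B | A f B. A \<in> simplicial_objects E \<and> B \<in> simplicial_objects E \<and>
       (\<forall>n. f n \<in> Hom E (sob A n) (sob B n)) \<and>
       (\<forall>m n. \<forall>\<alpha> \<in> Hom Simplex m n. sact B \<alpha> \<cdot>\<^bsub>E\<^esub> f n = f m \<cdot>\<^bsub>E\<^esub> sact A \<alpha>)},
     Dom = src,
     Cod = tgt,
     Ident = (\<lambda>A. Arrow A (\<lambda>n. Ident E (sob A n)) A),
     Comp = (\<lambda>g f. Arrow (src f) (\<lambda>n. map_of_arrow g n \<cdot>\<^bsub>E\<^esub> map_of_arrow f n) (tgt g))\<rparr>"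


section \<open>Simplicial sets: Kan fibrations and weak equivalences\<close>

datatype 'a sset = SSet (simps: "nat \<Rightarrow> 'a set") (sset_act: "sop \<Rightarrow> 'a \<Rightarrow> 'a")

definition sface :: "'a sset \<Rightarrow> nat \<Rightarrow> nat \<Rightarrow> 'a \<Rightarrow> 'a" where
  \<comment> \<open>the face map \<open>d\<^sub>i\<close> from dimension \<open>n + 1\<close> to dimension \<open>n\<close>\<close>
  "sface X n i = sset_act X (coface n i)"

text \<open>A horn in \<open>X\<close> of dimension \<open>n + 1\<close> without \<open>k\<close>-th face is a family of \<open>n\<close>-simplices \<open>x i\<close>,
  \<open>i \<noteq> k\<close>, with \<open>d\<^sub>i x\<^sub>j = d\<^sub>j\<^sub>-\<^sub>1 x\<^sub>i\<close> for \<open>i < j\<close>.  (For \<open>n = 0\<close> the last condition is vacuous.)\<close>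

definition kan_fibration :: "'a sset \<Rightarrow> 'b sset \<Rightarrow> (nat \<Rightarrow> 'a \<Rightarrow> 'b) \<Rightarrow> bool" where
  "kan_fibration X Y f \<longleftrightarrow> (\<forall>n. \<forall>k \<le> Suc n. \<forall>x. \<forall>y \<in> simps Y (Suc n).
     (\<forall>i \<le> Suc n. i \<noteq> k \<longrightarrow> x i \<in> simps X n \<and> sface Y n i y = f n (x i)) \<and>
     (\<forall>j \<le> Suc n. \<forall>i < j. i \<noteq> k \<and> j \<noteq> k \<longrightarrow>
        sface X (n - 1) i (x j) = sface X (n - 1) (j - 1) (x i)) \<longrightarrow>
     (\<exists>w \<in> simps X (Suc n). (\<forall>i \<le> Suc n. i \<noteq> k \<longrightarrow> sface X n i w = x i) \<and> f (Suc n) w = y))"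

definition pi0_rel :: "'a sset \<Rightarrow> ('a \<times> 'a) set" where
  "pi0_rel X = {(u, v). u \<in> simps X 0 \<and> v \<in> simps X 0 \<and>
     (\<exists>w \<in> simps X 1. sface X 0 0 w = u \<and> sface X 0 1 w = v)}"

definition spheres :: "'a sset \<Rightarrow> nat \<Rightarrow> 'a \<Rightarrow> 'a set" where
  \<comment> \<open>for \<open>n > 0\<close>, the \<open>n\<close>-simplices all of whose faces are degeneracies of the vertex \<open>v\<close>\<close>
  "spheres X n v = {x \<in> simps X n. \<forall>i \<le> n. sface X (n - 1) i x = sset_act X (to_point (n - 1)) v}"

definition pi_rel :: "'a sset \<Rightarrow> nat \<Rightarrow> 'a \<Rightarrow> ('a \<times> 'a) set" where
  "pi_rel X n v = {(x, y). x \<in> spheres X n v \<and> y \<in> spheres X n v \<and>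
     (\<exists>w \<in> simps X (Suc n). (\<forall>i < n. sface X n i w = sset_act X (to_point n) v) \<and>
        sface X n n w = x \<and> sface X n (Suc n) w = y)}"

text \<open>A weak equivalence between Kan complexes is a map that induces bijections on \<open>\<pi>\<^sub>0\<close> and on all
  simplicial homotopy groups \<open>\<pi>\<^sub>n\<close>, for all base vertices.  For maps of Kan complexes this agrees
  with being a homotopy equivalence after geometric realization; it is only used for underlying
  simplicial sets of simplicial abelian groups, which are Kan complexes.\<close>

definition kan_weak_equivalence :: "'a sset \<Rightarrow> 'b sset \<Rightarrow> (nat \<Rightarrow> 'a \<Rightarrow> 'b) \<Rightarrow> bool" where
  "kan_weak_equivalence X Y f \<longleftrightarrow>
     bij_betw (\<lambda>c. pi0_rel Y `` (f 0 ` c)) (simps X 0 // pi0_rel X) (simps Y 0 // pi0_rel Y) \<and>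
     (\<forall>n>0. \<forall>v \<in> simps X 0.
        bij_betw (\<lambda>c. pi_rel Y n (f 0 v) `` (f n ` c))
          (spheres X n v // pi_rel X n v) (spheres Y n (f 0 v) // pi_rel Y n (f 0 v)))"

definition Hom_sset :: "('o, 'm, 'z) cat_scheme \<Rightarrow> 'o \<Rightarrow> ('o, 'm) simp_obj \<Rightarrow> 'm sset" where
  \<comment> \<open>the underlying simplicial set of \<open>Hom(P, A)\<close>\<close>
  "Hom_sset E P A = SSet (\<lambda>n. Hom E P (sob A n)) (\<lambda>\<alpha> x. sact A \<alpha> \<cdot>\<^bsub>E\<^esub> x)"

definition Hom_sset_map :: "('o, 'm, 'z) cat_scheme \<Rightarrow> ('o, 'm) simp_map \<Rightarrow> nat \<Rightarrow> 'm \<Rightarrow> 'm" where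
  "Hom_sset_map E f n x = map_of_arrow f n \<cdot>\<^bsub>E\<^esub> x"

definition s_weqs :: "('o, 'm, 'z) exact_cat_scheme \<Rightarrow> ('o, 'm) simp_map set" where
  "s_weqs E = {f \<in> Arr (sCat E). \<forall>P. projective E P \<longrightarrow>
     kan_weak_equivalence (Hom_sset E P (src f)) (Hom_sset E P (tgt f)) (Hom_sset_map E f)}"

definition s_fibrations :: "('o, 'm, 'z) exact_cat_scheme \<Rightarrow> ('o, 'm) simp_map set" where
  "s_fibrations E = {f \<in> Arr (sCat E). \<forall>P. projective E P \<longrightarrow>
     kan_fibration (Hom_sset E P (src f)) (Hom_sset E P (tgt f)) (Hom_sset_map E f)}"

definition s_proj ::
    "('o, 'm, 'z) exact_cat_scheme \<Rightarrow> (('o, 'm) simp_obj, ('o, 'm) simp_map) model_cat" where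
  "s_proj E = with_weq_fib (sCat E) (s_weqs E) (s_fibrations E)"


section \<open>The Dold--Kan functors\<close>

text \<open>The intersection of the kernels of a set \<open>D\<close> of arrows out of \<open>x\<close>, as a subobject of \<open>x\<close>:
  the arrow \<open>k\<close> is universal among the arrows into \<open>x\<close> annihilated by all members of \<open>D\<close>.\<close>

definition is_joint_kernel :: "('o, 'm, 'z) add_cat_scheme \<Rightarrow> 'o \<Rightarrow> 'm set \<Rightarrow> 'm \<Rightarrow> bool" where
  "is_joint_kernel E x D k \<longleftrightarrow> k \<in> Arr E \<and> Cod E k = x \<and>
     (\<forall>d\<in>D. d \<cdot>\<^bsub>E\<^esub> k = Zero E (Dom E k) (Cod E d)) \<and>
     (\<forall>t\<in>Obj E. \<forall>g \<in> Hom E t x. (\<forall>d\<in>D. d \<cdot>\<^bsub>E\<^esub> g = Zero E t (Cod E d)) \<longrightarrow>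
        (\<exists>!u. u \<in> Hom E t (Dom E k) \<and> k \<cdot>\<^bsub>E\<^esub> u = g))"

definition norm_in :: "('o, 'm, 'z) add_cat_scheme \<Rightarrow> ('o, 'm) simp_obj \<Rightarrow> nat \<Rightarrow> 'm" where
  \<comment> \<open>a chosen inclusion \<open>(NA)\<^sub>n \<rightarrow> A\<^sub>n\<close>\<close>
  "norm_in E A n = (SOME k. is_joint_kernel E (sob A n) {sact A (coface (n - 1) i) | i. i < n} k)"

definition norm_chain :: "('o, 'm, 'z) add_cat_scheme \<Rightarrow> ('o, 'm) simp_obj \<Rightarrow> ('o, 'm) chain" where
  "norm_chain E A = Chain (\<lambda>n. Dom E (norm_in E A n)) (\<lambda>n.
     THE d. d \<in> Hom E (Dom E (norm_in E A (Suc n))) (Dom E (norm_in E A n)) \<and>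
       norm_in E A n \<cdot>\<^bsub>E\<^esub> d =
         sgn_arr E (Suc n) (sact A (coface n (Suc n))) \<cdot>\<^bsub>E\<^esub> norm_in E A (Suc n))"

definition norm_map :: "('o, 'm, 'z) add_cat_scheme \<Rightarrow> ('o, 'm) simp_map \<Rightarrow> ('o, 'm) chain_map" where
  "norm_map E f = Arrow (norm_chain E (src f))
     (\<lambda>n. THE u. u \<in> Hom E (Dom E (norm_in E (src f) n)) (Dom E (norm_in E (tgt f) n)) \<and>
       norm_in E (tgt f) n \<cdot>\<^bsub>E\<^esub> u = map_of_arrow f n \<cdot>\<^bsub>E\<^esub> norm_in E (src f) n)
     (norm_chain E (tgt f))"

definition DK_N :: "('o, 'm, 'z) add_cat_scheme \<Rightarrow>
    (('o, 'm) simp_obj, ('o, 'm) simp_map, ('o, 'm) chain, ('o, 'm) chain_map) cfunctor" where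
  "DK_N E = \<lparr>on_Obj = norm_chain E, on_Arr = norm_map E\<rparr>"

definition gamma_index :: "nat \<Rightarrow> sop set" where
  \<comment> \<open>the surjections \<open>\<eta> : [n] \<rightarrow> [p]\<close>, for all \<open>p\<close>\<close>
  "gamma_index n = {\<eta>. surj_sop \<eta> \<and> src \<eta> = n}"

definition gamma_ob :: "('o, 'm, 'z) add_cat_scheme \<Rightarrow> ('o, 'm) chain \<Rightarrow> nat \<Rightarrow> 'o" where
  "gamma_ob E C n = dsum E (gamma_index n) (\<lambda>\<eta>. ob C (tgt \<eta>))"

definition gamma_in :: "('o, 'm, 'z) add_cat_scheme \<Rightarrow> ('o, 'm) chain \<Rightarrow> nat \<Rightarrow> sop \<Rightarrow> 'm" where
  "gamma_in E C n = dsum_in E (gamma_index n) (\<lambda>\<eta>. ob C (tgt \<eta>))"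

text \<open>The action \<open>C\<^sub>p \<rightarrow> C\<^sub>q\<close> of an injection \<open>\<mu> : [q] \<rightarrow> [p]\<close>: the identity if \<open>q = p\<close>, the arrow
  \<open>(-1)\<^sup>p d\<close> if \<open>\<mu>\<close> is the coface that omits the last vertex \<open>p = q + 1\<close>, and zero otherwise.  Last vertex and
  sign match the differential \<open>(-1)\<^sup>n d\<^sub>n\<close> of the normalized complex.\<close>

definition gamma_coeff :: "('o, 'm, 'z) add_cat_scheme \<Rightarrow> ('o, 'm) chain \<Rightarrow> sop \<Rightarrow> 'm" where
  "gamma_coeff E C \<mu> =
     (if src \<mu> = tgt \<mu> then Ident E (ob C (tgt \<mu>))
      else if \<mu> = coface (src \<mu>) (Suc (src \<mu>)) then sgn_arr E (tgt \<mu>) (bd C (src \<mu>))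
      else Zero E (ob C (tgt \<mu>)) (ob C (src \<mu>)))"

text \<open>The structure map of \<open>\<alpha> : [m] \<rightarrow> [n]\<close> is determined on the summand of \<open>\<eta>\<close> by the factorization
  \<open>\<eta> \<alpha> = \<mu> \<theta>\<close> into a surjection \<open>\<theta>\<close> followed by an injection \<open>\<mu>\<close>.\<close>

definition gamma_act :: "('o, 'm, 'z) add_cat_scheme \<Rightarrow> ('o, 'm) chain \<Rightarrow> sop \<Rightarrow> 'm" where
  "gamma_act E C = (\<lambda>\<alpha>\<in>Arr Simplex.
     THE u. u \<in> Hom E (gamma_ob E C (tgt \<alpha>)) (gamma_ob E C (src \<alpha>)) \<and>
       (\<forall>\<eta> \<in> gamma_index (tgt \<alpha>). \<forall>\<theta> \<in> gamma_index (src \<alpha>). \<forall>\<mu> \<in> Hom Simplex (tgt \<theta>) (tgt \<eta>).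
          inj_sop \<mu> \<and> \<mu> \<cdot>\<^bsub>Simplex\<^esub> \<theta> = \<eta> \<cdot>\<^bsub>Simplex\<^esub> \<alpha> \<longrightarrow>
          u \<cdot>\<^bsub>E\<^esub> gamma_in E C (tgt \<alpha>) \<eta> = gamma_in E C (src \<alpha>) \<theta> \<cdot>\<^bsub>E\<^esub> gamma_coeff E C \<mu>))"

definition gamma_obj :: "('o, 'm, 'z) add_cat_scheme \<Rightarrow> ('o, 'm) chain \<Rightarrow> ('o, 'm) simp_obj" where
  "gamma_obj E C = SimpObj (gamma_ob E C) (gamma_act E C)"

definition gamma_map :: "('o, 'm, 'z) add_cat_scheme \<Rightarrow> ('o, 'm) chain_map \<Rightarrow> ('o, 'm) simp_map" where
  "gamma_map E f = Arrow (gamma_obj E (src f))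
     (\<lambda>n. THE u. u \<in> Hom E (gamma_ob E (src f) n) (gamma_ob E (tgt f) n) \<and>
       (\<forall>\<eta> \<in> gamma_index n. u \<cdot>\<^bsub>E\<^esub> gamma_in E (src f) n \<eta> =
          gamma_in E (tgt f) n \<eta> \<cdot>\<^bsub>E\<^esub> map_of_arrow f (tgt \<eta>)))
     (gamma_obj E (tgt f))"

definition DK_Gamma :: "('o, 'm, 'z) add_cat_scheme \<Rightarrow>
    (('o, 'm) chain, ('o, 'm) chain_map, ('o, 'm) simp_obj, ('o, 'm) simp_map) cfunctor" where
  "DK_Gamma E = \<lparr>on_Obj = gamma_obj E, on_Arr = gamma_map E\<rparr>"

end

(* A simplicial object decomposes as the direct sum of the degeneracies of its normalization: every
   generalized element is a sum of degenerate normalized ones, and pulling back along maximal sections of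
   surjections recovers the summands triangularly.  Weak idempotent completeness provides the kernels
   that define N, since the degeneracies split the restricted faces.  So N and Gamma are inverse
   equivalences, and the model structure on simplicial objects is the one on chain complexes,
   transported along N, once a simplicial map f is seen to be a fibration or weak equivalence iff Nf is.
   Both can be tested on the abelian groups of maps from projectives: fibrations by filling horns with
   degeneracies, weak equivalences by translating homotopy groups to homology at arbitrary base vertices.
   On chain complexes, admissible epimorphisms and acyclicity are also detected by maps from projectives,
   and the factorizations are built degree by degree from projective covers. *)

theory Submission
  imports Defs
begin

text \<open>Homology of Hom(P, X) is never formed as a group: a generalized element is an arrow out
  of P, and quasi-isomorphisms become the two lifting statements of \<open>hom_quasi_iso\<close>, so
  that two-out-of-three and retracts are chases in Hom-groups. Projectives detect admissible
  epimorphisms because a lift x of a projective cover along g makes g x admissible; cancelling x is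
  what weak idempotent completeness pays for (\<open>adm_epi_factor\<close>). The obstacle is that E
  lacks most kernels, pullbacks and colimits. The complexes needed are built from finite direct
  sums, pullbacks along admissible epimorphisms, and kernels of admissible epimorphisms and of
  retractions. Keeping the face d_n in N fixes the combinatorics: the only proper injection acting
  nontrivially on normalized elements is the coface omitting the last vertex, while maximal sections
  hit the last vertex. Restriction along these sections is therefore unitriangular for the pointwise
  order of surjections, whatever the differential of C is. On the model side only two-out-of-three,
  retracts and two factorizations are carried over; cofibrations, defined by lifting,
  follow.\<close>

abbreviation ap :: "('a, 'f) arrow \<Rightarrow> 'f" where "ap \<equiv> map_of_arrow"

section \<open>Additive categories\<close>

lemma Hom_iff [simp]: "f \<in> Hom C x y \<longleftrightarrow> f \<in> Arr C \<and> Dom C f = x \<and> Cod C f = y"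
  by (simp add: Hom_def)

context category
begin

lemmas Obj_simps [simp] = Dom_Obj Cod_Obj

lemma Ident_simps [simp]:
  "x \<in> Obj C \<Longrightarrow> Ident C x \<in> Arr C"
  "x \<in> Obj C \<Longrightarrow> Dom C (Ident C x) = x"
  "x \<in> Obj C \<Longrightarrow> Cod C (Ident C x) = x"
  using Ident_Hom by simp_all

lemma Comp_simps [simp]:
  assumes "f \<in> Arr C" "g \<in> Arr C" "Cod C f = Dom C g"
  shows "g \<cdot> f \<in> Arr C" "Dom C (g \<cdot> f) = Dom C f" "Cod C (g \<cdot> f) = Cod C g"
  using Comp_Hom[of f "Dom C f" "Dom C g" g "Cod C g"] assms by simp_all

lemma Comp_Ident_simp [simp]: "\<lbrakk>f \<in> Arr C; Dom C f = x\<rbrakk> \<Longrightarrow> f \<cdot> Ident C x = f"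
  and Ident_Comp_simp [simp]: "\<lbrakk>f \<in> Arr C; Cod C f = x\<rbrakk> \<Longrightarrow> Ident C x \<cdot> f = f"
  using Comp_Ident[of f] Ident_Comp[of f] by auto

lemma Comp_assoc_simp [simp]:
  "\<lbrakk>f \<in> Arr C; g \<in> Arr C; h \<in> Arr C; Cod C f = Dom C g; Cod C g = Dom C h\<rbrakk> \<Longrightarrow>
   (h \<cdot> g) \<cdot> f = h \<cdot> (g \<cdot> f)"
  by (rule Comp_assoc) simp_all

text \<open>The simplifier nests composites to the right, so an equation
  \<open>a \<cdot> b = c\<close> no longer matches inside \<open>a \<cdot> (b \<cdot> x)\<close>;
  this form lets it be applied there.\<close>

lemma reassoc:
  "\<lbrakk>a \<cdot> b = c; a \<in> Arr C; b \<in> Arr C; x \<in> Arr C; Cod C b = Dom C a; Cod C x = Dom C b\<rbrakk> \<Longrightarrow>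
   a \<cdot> (b \<cdot> x) = c \<cdot> x"
  using Comp_assoc_simp[of x b a] by simp

end

context additive_category
begin

abbreviation add (infixl \<open>\<boxplus>\<close> 65) where "f \<boxplus> g \<equiv> Add E f g"

lemma Zero_simps [simp]:
  assumes "x \<in> Obj E" "y \<in> Obj E"
  shows "Zero E x y \<in> Arr E" "Dom E (Zero E x y) = x" "Cod E (Zero E x y) = y"
proof -
  interpret G: comm_group "Hom_grp E x y" using assms by (rule Hom_comm_group)
  show "Zero E x y \<in> Arr E" "Dom E (Zero E x y) = x" "Cod E (Zero E x y) = y"
    using G.one_closed by (simp_all add: Hom_grp_def)
qed

text \<open>Three parallel arrows are fixed at once so that the abelian group of their Hom-set is
  interpreted a single time; laws in fewer arrows are obtained below by repeating an
  argument.\<close>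

context
  fixes f g h assumes fgh: "f \<in> Arr E" "g \<in> Arr E" "h \<in> Arr E"
    "Dom E f = Dom E g" "Dom E h = Dom E g" "Cod E f = Cod E g" "Cod E h = Cod E g"
begin

private lemma grp: "comm_group (Hom_grp E (Dom E g) (Cod E g))"
  using fgh by (intro Hom_comm_group) simp_all

interpretation G: comm_group "Hom_grp E (Dom E g) (Cod E g)" by (rule grp)

private lemma car: "f \<in> carrier (Hom_grp E (Dom E g) (Cod E g))"
  "g \<in> carrier (Hom_grp E (Dom E g) (Cod E g))" "h \<in> carrier (Hom_grp E (Dom E g) (Cod E g))"
  using fgh by (simp_all add: Hom_grp_def)

lemma Add_simps0: "f \<boxplus> g \<in> Arr E \<and> Dom E (f \<boxplus> g) = Dom E g \<and> Cod E (f \<boxplus> g) = Cod E g"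
  using G.m_closed[OF car(1,2)] by (simp add: Hom_grp_def)

lemma Add_comm0: "f \<boxplus> g = g \<boxplus> f"
  using G.m_comm[OF car(1,2)] by (simp add: Hom_grp_def)

lemma Add_assoc0: "(f \<boxplus> g) \<boxplus> h = f \<boxplus> (g \<boxplus> h)"
  using G.m_assoc[OF car] by (simp add: Hom_grp_def)

lemma Add_left_comm0: "f \<boxplus> (g \<boxplus> h) = g \<boxplus> (f \<boxplus> h)"
  using G.m_lcomm[OF car] by (simp add: Hom_grp_def)

lemma Add_cancel0: "f \<boxplus> g = f \<boxplus> h \<longleftrightarrow> g = h"
  using G.Units_l_cancel[of f g h, unfolded G.Units_eq, OF car] by (simp add: Hom_grp_def)

lemma Add_Zero0: "g \<boxplus> Zero E (Dom E g) (Cod E g) = g"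
  using G.r_one[OF car(2)] by (simp add: Hom_grp_def)

lemma Neg0: "Neg E g \<in> Arr E \<and> Dom E (Neg E g) = Dom E g \<and> Cod E (Neg E g) = Cod E g
    \<and> Neg E g \<boxplus> g = Zero E (Dom E g) (Cod E g)"
  using G.inv_closed[OF car(2)] G.l_inv[OF car(2)] by (simp add: Hom_grp_def Neg_def)

end

lemma Add_simps [simp]:
  assumes "f \<in> Arr E" "g \<in> Arr E" "Dom E f = Dom E g" "Cod E f = Cod E g"
  shows "f \<boxplus> g \<in> Arr E" "Dom E (f \<boxplus> g) = Dom E g" "Cod E (f \<boxplus> g) = Cod E g"
  using Add_simps0[of f g g] assms by simp_all

lemma Add_comm:
  "\<lbrakk>f \<in> Arr E; g \<in> Arr E; Dom E f = Dom E g; Cod E f = Cod E g\<rbrakk> \<Longrightarrow> f \<boxplus> g = g \<boxplus> f"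
  using Add_comm0[of f g g] by simp

lemma Add_assoc:
  "\<lbrakk>f \<in> Arr E; g \<in> Arr E; h \<in> Arr E; Dom E f = Dom E g; Dom E h = Dom E g;
    Cod E f = Cod E g; Cod E h = Cod E g\<rbrakk> \<Longrightarrow> (f \<boxplus> g) \<boxplus> h = f \<boxplus> (g \<boxplus> h)"
  by (rule Add_assoc0)

lemma Add_left_comm:
  "\<lbrakk>f \<in> Arr E; g \<in> Arr E; h \<in> Arr E; Dom E f = Dom E g; Dom E h = Dom E g;
    Cod E f = Cod E g; Cod E h = Cod E g\<rbrakk> \<Longrightarrow> f \<boxplus> (g \<boxplus> h) = g \<boxplus> (f \<boxplus> h)"
  by (rule Add_left_comm0)

lemmas Add_ac = Add_assoc Add_comm Add_left_comm

lemma Add_cancel [simp]: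
  assumes "f \<in> Arr E" "g \<in> Arr E" "h \<in> Arr E" "Dom E f = Dom E g" "Dom E h = Dom E g"
    "Cod E f = Cod E g" "Cod E h = Cod E g"
  shows "f \<boxplus> g = f \<boxplus> h \<longleftrightarrow> g = h" "g \<boxplus> f = h \<boxplus> f \<longleftrightarrow> g = h"
  using Add_cancel0[of f g h] Add_comm[of f g] Add_comm[of f h] assms by simp_all

lemma Add_Zero [simp]:
  assumes "f \<in> Arr E" "Dom E f = x" "Cod E f = y"
  shows "f \<boxplus> Zero E x y = f" "Zero E x y \<boxplus> f = f"
proof -
  show 1: "f \<boxplus> Zero E x y = f" using Add_Zero0[of f f f] assms by simp
  have "x \<in> Obj E" "y \<in> Obj E" using assms Dom_Obj Cod_Obj by blast+
  then show "Zero E x y \<boxplus> f = f" using Add_comm[of f "Zero E x y"] 1 assms by simp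
qed

lemma Add_cancel_Zero [simp]:
  assumes "f \<in> Arr E" "g \<in> Arr E" "Dom E f = Dom E g" "Cod E f = Cod E g"
  shows "f \<boxplus> g = f \<longleftrightarrow> g = Zero E (Dom E g) (Cod E g)"
    "g \<boxplus> f = f \<longleftrightarrow> g = Zero E (Dom E g) (Cod E g)"
    "f = f \<boxplus> g \<longleftrightarrow> g = Zero E (Dom E g) (Cod E g)"
    "f = g \<boxplus> f \<longleftrightarrow> g = Zero E (Dom E g) (Cod E g)"
proof -
  show 1: "f \<boxplus> g = f \<longleftrightarrow> g = Zero E (Dom E g) (Cod E g)"
    using Add_cancel(1)[of f g "Zero E (Dom E g) (Cod E g)"] assms by simp
  show 2: "g \<boxplus> f = f \<longleftrightarrow> g = Zero E (Dom E g) (Cod E g)"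
    using 1 Add_comm[of f g] assms by simp
  show "f = f \<boxplus> g \<longleftrightarrow> g = Zero E (Dom E g) (Cod E g)"
    "f = g \<boxplus> f \<longleftrightarrow> g = Zero E (Dom E g) (Cod E g)"
    using 1 2 by metis+
qed

lemma Comp_Add [simp]:
  assumes "f \<in> Arr E" "g \<in> Arr E" "Dom E f = Dom E g" "Cod E f = Cod E g" "h \<in> Arr E"
  shows "Dom E h = Cod E g \<Longrightarrow> h \<cdot> (f \<boxplus> g) = h \<cdot> f \<boxplus> h \<cdot> g"
    "Cod E h = Dom E g \<Longrightarrow> (f \<boxplus> g) \<cdot> h = f \<cdot> h \<boxplus> g \<cdot> h"
  using Comp_Add_right[of f "Dom E g" "Cod E g" g h "Cod E h"]
    Comp_Add_left[of h "Dom E h" "Dom E g" f "Cod E g" g] assms by simp_all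

lemma Comp_Zero [simp]:
  assumes "f \<in> Arr E" "x \<in> Obj E"
  shows "Dom E f = y \<Longrightarrow> f \<cdot> Zero E x y = Zero E x (Cod E f)"
    "Cod E f = y \<Longrightarrow> Zero E y x \<cdot> f = Zero E (Dom E f) x"
proof -
  assume y: "Dom E f = y"
  then have yo: "y \<in> Obj E" using assms by auto
  have "f \<cdot> Zero E x y = f \<cdot> (Zero E x y \<boxplus> Zero E x y)" using assms yo by simp
  also have "\<dots> = f \<cdot> Zero E x y \<boxplus> f \<cdot> Zero E x y" using assms yo y by (subst Comp_Add) simp_all
  finally show "f \<cdot> Zero E x y = Zero E x (Cod E f)" using assms yo y by simp
next
  assume y: "Cod E f = y"
  then have yo: "y \<in> Obj E" using assms by auto
  have "Zero E y x \<cdot> f = (Zero E y x \<boxplus> Zero E y x) \<cdot> f" using assms yo by simp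
  also have "\<dots> = Zero E y x \<cdot> f \<boxplus> Zero E y x \<cdot> f" using assms yo y by (subst Comp_Add) simp_all
  finally show "Zero E y x \<cdot> f = Zero E (Dom E f) x" using assms yo y by simp
qed

lemma Neg_simps [simp]:
  assumes "f \<in> Arr E"
  shows "Neg E f \<in> Arr E" "Dom E (Neg E f) = Dom E f" "Cod E (Neg E f) = Cod E f"
    "Neg E f \<boxplus> f = Zero E (Dom E f) (Cod E f)" "f \<boxplus> Neg E f = Zero E (Dom E f) (Cod E f)"
  using Neg0[of f f f] Add_comm[of "Neg E f" f] assms by simp_all

lemma Neg_unique:
  assumes "f \<in> Arr E" "g \<in> Arr E" "Dom E f = Dom E g" "Cod E f = Cod E g"
    "f \<boxplus> g = Zero E (Dom E g) (Cod E g)"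
  shows "f = Neg E g"
  using Add_cancel(2)[of g f "Neg E g"] assms by simp

lemma Neg_Neg [simp]: "f \<in> Arr E \<Longrightarrow> Neg E (Neg E f) = f"
  using Neg_unique[of f "Neg E f"] by simp

lemma Neg_Zero [simp]: "\<lbrakk>x \<in> Obj E; y \<in> Obj E\<rbrakk> \<Longrightarrow> Neg E (Zero E x y) = Zero E x y"
  using Neg_unique[of "Zero E x y" "Zero E x y"] by simp

lemma Neg_eq_Zero [simp]:
  "\<lbrakk>f \<in> Arr E; Dom E f = x; Cod E f = y\<rbrakk> \<Longrightarrow> Neg E f = Zero E x y \<longleftrightarrow> f = Zero E x y"
  by (metis Neg_Neg Neg_Zero Dom_Obj Cod_Obj)

lemma Comp_Neg [simp]:
  assumes "f \<in> Arr E" "g \<in> Arr E" "Cod E f = Dom E g"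
  shows "g \<cdot> Neg E f = Neg E (g \<cdot> f)" "Neg E g \<cdot> f = Neg E (g \<cdot> f)"
proof -
  show "g \<cdot> Neg E f = Neg E (g \<cdot> f)"
    using assms by (intro Neg_unique) (simp_all flip: Comp_Add)
  show "Neg E g \<cdot> f = Neg E (g \<cdot> f)"
    using assms by (intro Neg_unique) (simp_all flip: Comp_Add)
qed

text \<open>Subtraction is offered as an unknown h with h + g = f rather than as f + (-g): applying
  an additive operation to that equation and cancelling lets later chases run with hardly any
  \<open>Neg\<close>.\<close>

lemma diff_ex:
  assumes "f \<in> Arr E" "g \<in> Arr E" "Dom E f = Dom E g" "Cod E f = Cod E g"
  obtains h where "h \<in> Arr E" "Dom E h = Dom E g" "Cod E h = Cod E g" "h \<boxplus> g = f"
  using that[of "f \<boxplus> Neg E g"] assms by (simp add: Add_assoc)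

lemma sgn_arr_simps [simp]:
  assumes "f \<in> Arr E"
  shows "sgn_arr E n f \<in> Arr E" "Dom E (sgn_arr E n f) = Dom E f" "Cod E (sgn_arr E n f) = Cod E f"
    "sgn_arr E n (sgn_arr E n f) = f"
    "\<lbrakk>Dom E f = x; Cod E f = y\<rbrakk> \<Longrightarrow> sgn_arr E n f = Zero E x y \<longleftrightarrow> f = Zero E x y"
  using assms by (simp_all add: sgn_arr_def)

lemma sgn_arr_Zero [simp]:
  "\<lbrakk>x \<in> Obj E; y \<in> Obj E\<rbrakk> \<Longrightarrow> sgn_arr E n (Zero E x y) = Zero E x y"
  by simp

lemma Comp_sgn_arr [simp]:
  "\<lbrakk>f \<in> Arr E; g \<in> Arr E; Cod E f = Dom E g\<rbrakk> \<Longrightarrow> g \<cdot> sgn_arr E n f = sgn_arr E n (g \<cdot> f)"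
  "\<lbrakk>f \<in> Arr E; g \<in> Arr E; Cod E f = Dom E g\<rbrakk> \<Longrightarrow> sgn_arr E n g \<cdot> f = sgn_arr E n (g \<cdot> f)"
  by (simp_all add: sgn_arr_def)

text \<open>\<open>Hom_grp\<close> is written multiplicatively, hence a finite sum of parallel
  arrows is a \<open>finprod\<close>; a constant of its own keeps the group record out of later
  goals.\<close>

definition hsum :: "'a \<Rightarrow> 'a \<Rightarrow> ('i \<Rightarrow> 'b) \<Rightarrow> 'i set \<Rightarrow> 'b" where
  "hsum x y f I = finprod (Hom_grp E x y) f I"

context
  fixes x y assumes xy: "x \<in> Obj E" "y \<in> Obj E"
begin

interpretation G: comm_group "Hom_grp E x y" using xy by (rule Hom_comm_group)

lemma hsum_empty: "hsum x y f {} = Zero E x y"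
  using G.finprod_empty[of f] by (simp only: hsum_def) (simp add: Hom_grp_def)

lemma hsum_insert:
  assumes "finite I" "a \<notin> I" "f a \<in> Hom E x y" "\<And>i. i \<in> I \<Longrightarrow> f i \<in> Hom E x y"
  shows "hsum x y f (insert a I) = f a \<boxplus> hsum x y f I"
proof -
  have "f \<in> I \<rightarrow> carrier (Hom_grp E x y)" "f a \<in> carrier (Hom_grp E x y)"
    using assms(3,4) by (auto simp: Hom_grp_def simp del: Hom_iff)
  then show ?thesis
    using G.finprod_insert[of I a f] assms(1,2) by (simp add: hsum_def Hom_grp_def)
qed

lemma hsum_closed: "(\<And>i. i \<in> I \<Longrightarrow> f i \<in> Hom E x y) \<Longrightarrow> hsum x y f I \<in> Hom E x y"
  using G.finprod_closed[of f I] by (auto simp: hsum_def Hom_grp_def simp del: Hom_iff)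

end

lemma hsum_cong:
  assumes "x \<in> Obj E" "y \<in> Obj E" "finite I" "\<And>i. i \<in> I \<Longrightarrow> f i = g i" "\<And>i. i \<in> I \<Longrightarrow> g i \<in> Hom E x y"
  shows "hsum x y f I = hsum x y g I"
  using assms(3-) by (induction I) (simp_all add: hsum_empty hsum_insert assms)

lemma Comp_hsum:
  assumes "x \<in> Obj E" "finite I" "\<And>i. i \<in> I \<Longrightarrow> f i \<in> Hom E x (Dom E g)" "g \<in> Arr E"
  shows "g \<cdot> hsum x (Dom E g) f I = hsum x (Cod E g) (\<lambda>i. g \<cdot> f i) I"
  using assms(2,3)
proof (induction I)
  case (insert a I)
  then show ?case using assms hsum_closed[of x "Dom E g" I f] by (simp add: hsum_insert)
qed (simp add: hsum_empty assms)

lemma hsum_Comp: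
  assumes "y \<in> Obj E" "finite I" "\<And>i. i \<in> I \<Longrightarrow> f i \<in> Hom E (Cod E g) y" "g \<in> Arr E"
  shows "hsum (Cod E g) y f I \<cdot> g = hsum (Dom E g) y (\<lambda>i. f i \<cdot> g) I"
  using assms(2,3)
proof (induction I)
  case (insert a I)
  then show ?case using assms hsum_closed[of "Cod E g" y I f] by (simp add: hsum_insert)
qed (simp add: hsum_empty assms)

lemma hsum_Zero:
  assumes "x \<in> Obj E" "y \<in> Obj E" "finite I" "\<And>i. i \<in> I \<Longrightarrow> f i = Zero E x y"
  shows "hsum x y f I = Zero E x y"
  using assms(3,4) by (induction I) (simp_all add: hsum_empty hsum_insert assms)

lemma hsum_single:
  assumes "x \<in> Obj E" "y \<in> Obj E" "finite I" "k \<in> I" "f k \<in> Hom E x y"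
    "\<And>i. \<lbrakk>i \<in> I; i \<noteq> k\<rbrakk> \<Longrightarrow> f i = Zero E x y"
  shows "hsum x y f I = f k"
proof -
  have f: "f i \<in> Hom E x y" if "i \<in> I" for i
    using assms that by (cases "i = k") simp_all
  have "hsum x y f (insert k (I - {k})) = f k \<boxplus> hsum x y f (I - {k})"
    using assms f by (intro hsum_insert) auto
  also have "hsum x y f (I - {k}) = Zero E x y" using assms by (intro hsum_Zero) auto
  finally show ?thesis using assms by (simp add: insert_absorb)
qed

section \<open>Finite biproducts and their universal properties\<close>

lemma biproduct_simps:
  assumes "is_biproduct E I X B inc prj"
  shows "finite I" "B \<in> Obj E"
    "\<And>i. i \<in> I \<Longrightarrow> X i \<in> Obj E" "\<And>i. i \<in> I \<Longrightarrow> inc i \<in> Arr E"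
    "\<And>i. i \<in> I \<Longrightarrow> Dom E (inc i) = X i" "\<And>i. i \<in> I \<Longrightarrow> Cod E (inc i) = B"
    "\<And>i. i \<in> I \<Longrightarrow> prj i \<in> Arr E"
    "\<And>i. i \<in> I \<Longrightarrow> Dom E (prj i) = B" "\<And>i. i \<in> I \<Longrightarrow> Cod E (prj i) = X i"
    "\<And>i. i \<in> I \<Longrightarrow> prj i \<cdot> inc i = Ident E (X i)"
    "\<And>i j. \<lbrakk>i \<in> I; j \<in> I; i \<noteq> j\<rbrakk> \<Longrightarrow> prj j \<cdot> inc i = Zero E (X i) (X j)"
    "hsum B B (\<lambda>i. inc i \<cdot> prj i) I = Ident E B"
  using assms by (auto simp: is_biproduct_def hsum_def)

text \<open>The new biproduct is the binary one of \<open>X a\<close> and the old B; the old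
  inclusions and projections are routed through the summand B.\<close>

lemma biproduct_insert:
  assumes "is_biproduct E I X B inc prj" "a \<notin> I" "X a \<in> Obj E"
  shows "\<exists>B inc prj. is_biproduct E (insert a I) X B inc prj"
proof -
  note b = biproduct_simps[OF assms(1)]
  obtain B' i' p' where b'0: "is_biproduct E UNIV (\<lambda>b. if b then X a else B) B' i' p'"
    using biproduct_ex[OF assms(3) b(2)] by blast
  note b' = biproduct_simps[OF b'0]
  note t = b'(4-10)[of True, simplified] and f = b'(4-10)[of False, simplified]
  have tf: "p' False \<cdot> i' True = Zero E (X a) B" "p' True \<cdot> i' False = Zero E B (X a)"
    using b'(11)[of True False] b'(11)[of False True] by simp_all
  define inc' where "inc' i = (if i = a then i' True else i' False \<cdot> inc i)" for i
  define prj' where "prj' i = (if i = a then p' True else prj i \<cdot> p' False)" for i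
  have ne: "i \<noteq> a" if "i \<in> I" for i using that assms(2) by auto
  have id: "Ident E B' = i' True \<cdot> p' True \<boxplus> i' False \<cdot> p' False"
  proof -
    have "Ident E B' = hsum B' B' (\<lambda>i. i' i \<cdot> p' i) (insert True {False})"
      using b'(12) by (simp add: UNIV_bool insert_commute)
    also have "\<dots> = i' True \<cdot> p' True \<boxplus> (i' False \<cdot> p' False \<boxplus> Zero E B' B')"
      using b'(2) t f by (subst hsum_insert; (subst hsum_insert)?) (auto simp: hsum_empty)
    finally show ?thesis using t f by simp
  qed
  have "hsum B' B' (\<lambda>i. inc' i \<cdot> prj' i) (insert a I)
      = i' True \<cdot> p' True \<boxplus> hsum B' B' (\<lambda>i. inc' i \<cdot> prj' i) I"
    using assms(2) b(1) b'(2) t f b ne by (subst hsum_insert) (auto simp: inc'_def prj'_def)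
  also have "hsum B' B' (\<lambda>i. inc' i \<cdot> prj' i) I
      = hsum B' B' (\<lambda>i. i' False \<cdot> ((inc i \<cdot> prj i) \<cdot> p' False)) I"
    using b(1) b'(2) t f b ne by (intro hsum_cong) (simp_all add: inc'_def prj'_def)
  also have "\<dots> = i' False \<cdot> (hsum B B (\<lambda>i. inc i \<cdot> prj i) I \<cdot> p' False)"
    using hsum_Comp[of B I "\<lambda>i. inc i \<cdot> prj i" "p' False"]
      Comp_hsum[of B' I "\<lambda>i. (inc i \<cdot> prj i) \<cdot> p' False" "i' False"] b b'(2) f by simp
  also have "\<dots> = i' False \<cdot> p' False" using b(12) f by simp
  finally have sum: "hsum B' B' (\<lambda>i. inc' i \<cdot> prj' i) (insert a I) = Ident E B'" using id by simp
  have "prj' j \<cdot> inc' i = (if i = j then Ident E (X i) else Zero E (X i) (X j))"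
    if "i \<in> insert a I" "j \<in> insert a I" for i j
  proof -
    consider "i = a" "j = a" | "i = a" "j \<in> I" | "j = a" "i \<in> I" | "i \<in> I" "j \<in> I"
      using \<open>i \<in> insert a I\<close> \<open>j \<in> insert a I\<close> by (metis insertE)
    then show ?thesis
    proof cases
      case 1
      then show ?thesis using t by (simp add: inc'_def prj'_def)
    next
      case 2
      then show ?thesis using t f tf b(3-9) ne[of j] assms(3) by (simp add: inc'_def prj'_def)
    next
      case 3
      then show ?thesis using t f b(3-9) ne[of i] assms(3) reassoc[OF tf(2)]
        by (simp add: inc'_def prj'_def)
    next
      case 4
      then show ?thesis using t f b(3-11) ne[of i] ne[of j] reassoc[OF f(7)]
        by (simp add: inc'_def prj'_def)
    qed
  qed
  then have "is_biproduct E (insert a I) X B' inc' prj'"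
    using b(1-9) b'(2) t f sum ne assms(3)
    by (simp add: is_biproduct_def hsum_def[symmetric]) (simp add: inc'_def prj'_def)
  then show ?thesis by blast
qed

lemma finite_biproduct_ex:
  assumes "finite I" "\<And>i. i \<in> I \<Longrightarrow> X i \<in> Obj E"
  shows "\<exists>B inc prj. is_biproduct E I X B inc prj"
  using assms
proof (induction I)
  case empty
  obtain z where z: "is_zero_obj E z" using zero_obj_ex by blast
  then have zo: "z \<in> Obj E" by (simp add: is_zero_obj_def is_initial_def)
  \<comment> \<open>On a zero object the identity is the zero arrow, which is exactly the empty
    sum.\<close>
  have "\<exists>!f. f \<in> Hom E z z" using z zo by (simp add: is_zero_obj_def is_initial_def)
  then have "Ident E z = Zero E z z" using zo by (metis Ident_simps Zero_simps Hom_iff)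
  then have "is_biproduct E {} X z (\<lambda>_. undefined) (\<lambda>_. undefined)"
    using zo hsum_empty[of z z] by (simp add: is_biproduct_def hsum_def)
  then show ?case by blast
next
  case (insert a I)
  then show ?case using biproduct_insert[of I X _ _ _ a] by blast
qed

text \<open>\<open>dsum\<close> and \<open>dsum_in\<close> choose an object and inclusions only;
  projections compatible with that choice are picked here.\<close>

definition dsum_pr :: "'i set \<Rightarrow> ('i \<Rightarrow> 'a) \<Rightarrow> 'i \<Rightarrow> 'b" where
  "dsum_pr I X = (SOME prj. is_biproduct E I X (dsum E I X) (dsum_in E I X) prj)"

lemma dsum_biproduct:
  assumes "finite I" "\<And>i. i \<in> I \<Longrightarrow> X i \<in> Obj E"
  shows "is_biproduct E I X (dsum E I X) (dsum_in E I X) (dsum_pr I X)"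
proof -
  have "\<exists>inc prj. is_biproduct E I X (dsum E I X) inc prj"
    unfolding dsum_def using finite_biproduct_ex[OF assms] by (rule someI_ex)
  then have "\<exists>prj. is_biproduct E I X (dsum E I X) (dsum_in E I X) prj"
    unfolding dsum_in_def by (rule someI_ex)
  then show ?thesis unfolding dsum_pr_def by (rule someI_ex)
qed

text \<open>Insert the identity of B, written as the sum of the idempotents
  \<open>inc i \<cdot> prj i\<close>, between v and x; one summand is left. This extracts a diagonal
  entry once all other entries are known to vanish.\<close>

lemma biproduct_Comp_single:
  assumes "is_biproduct E I X B inc prj" "x \<in> Arr E" "Cod E x = B" "v \<in> Arr E" "Dom E v = B" "k \<in> I"
    "\<And>i. \<lbrakk>i \<in> I; i \<noteq> k\<rbrakk> \<Longrightarrow> v \<cdot> (inc i \<cdot> (prj i \<cdot> x)) = Zero E (Dom E x) (Cod E v)"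
  shows "v \<cdot> x = v \<cdot> (inc k \<cdot> (prj k \<cdot> x))"
proof -
  note b = biproduct_simps[OF assms(1)]
  have "v \<cdot> x = v \<cdot> (hsum B B (\<lambda>i. inc i \<cdot> prj i) I \<cdot> x)" using b assms by simp
  also have "\<dots> = hsum (Dom E x) (Cod E v) (\<lambda>i. v \<cdot> ((inc i \<cdot> prj i) \<cdot> x)) I"
    using hsum_Comp[of B I "\<lambda>i. inc i \<cdot> prj i" x]
      Comp_hsum[of "Dom E x" I "\<lambda>i. (inc i \<cdot> prj i) \<cdot> x" v] b assms by simp
  also have "\<dots> = v \<cdot> ((inc k \<cdot> prj k) \<cdot> x)"
    using b assms by (intro hsum_single) simp_all
  finally show ?thesis using b assms by simp
qed

lemma biproduct_Comp_Zero:
  assumes "is_biproduct E I X B inc prj" "x \<in> Arr E" "Cod E x = B" "v \<in> Arr E" "Dom E v = B"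
    "\<And>i. i \<in> I \<Longrightarrow> v \<cdot> (inc i \<cdot> (prj i \<cdot> x)) = Zero E (Dom E x) (Cod E v)"
  shows "v \<cdot> x = Zero E (Dom E x) (Cod E v)"
proof -
  note b = biproduct_simps[OF assms(1)]
  have "v \<cdot> x = v \<cdot> (hsum B B (\<lambda>i. inc i \<cdot> prj i) I \<cdot> x)" using b assms by simp
  also have "\<dots> = hsum (Dom E x) (Cod E v) (\<lambda>i. v \<cdot> ((inc i \<cdot> prj i) \<cdot> x)) I"
    using hsum_Comp[of B I "\<lambda>i. inc i \<cdot> prj i" x]
      Comp_hsum[of "Dom E x" I "\<lambda>i. (inc i \<cdot> prj i) \<cdot> x" v] b assms by simp
  also have "\<dots> = Zero E (Dom E x) (Cod E v)"
    using b assms by (intro hsum_Zero) simp_all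
  finally show ?thesis .
qed

lemma biproduct_ext_inc:
  assumes "is_biproduct E I X B inc prj" "u \<in> Arr E" "v \<in> Arr E" "Dom E u = B" "Dom E v = B"
    "Cod E u = Cod E v" "\<And>i. i \<in> I \<Longrightarrow> u \<cdot> inc i = v \<cdot> inc i"
  shows "u = v"
proof -
  note b = biproduct_simps[OF assms(1)]
  obtain w where w: "w \<in> Arr E" "Dom E w = Dom E v" "Cod E w = Cod E v" "w \<boxplus> v = u"
    using diff_ex[of u v] assms by metis
  have "w \<cdot> inc i = Zero E (X i) (Cod E w)" if "i \<in> I" for i
  proof -
    have "(w \<boxplus> v) \<cdot> inc i = v \<cdot> inc i" using w assms(7)[OF that] by simp
    then show ?thesis using w(1-3) assms(2-6) b that by simp
  qed
  then have "w \<cdot> Ident E B = Zero E B (Cod E w)"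
    using biproduct_Comp_Zero[OF assms(1), of "Ident E B" w] b w assms
    by (simp add: reassoc[where a=w])
  then show ?thesis using w assms by simp
qed

lemma biproduct_ext_prj:
  assumes "is_biproduct E I X B inc prj" "u \<in> Arr E" "v \<in> Arr E" "Cod E u = B" "Cod E v = B"
    "Dom E u = Dom E v" "\<And>i. i \<in> I \<Longrightarrow> prj i \<cdot> u = prj i \<cdot> v"
  shows "u = v"
proof -
  note b = biproduct_simps[OF assms(1)]
  obtain w where w: "w \<in> Arr E" "Dom E w = Dom E v" "Cod E w = Cod E v" "w \<boxplus> v = u"
    using diff_ex[of u v] assms by metis
  have "prj i \<cdot> w = Zero E (Dom E w) (X i)" if "i \<in> I" for i
  proof -
    have "prj i \<cdot> (w \<boxplus> v) = prj i \<cdot> v" using w assms(7)[OF that] by simp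
    then show ?thesis using w(1-3) assms(2-6) b that by simp
  qed
  then have "Ident E B \<cdot> w = Zero E (Dom E w) B"
    using biproduct_Comp_Zero[OF assms(1), of w "Ident E B"] b w assms by simp
  then show ?thesis using w assms by simp
qed

definition copair :: "'i set \<Rightarrow> ('i \<Rightarrow> 'a) \<Rightarrow> 'a \<Rightarrow> ('i \<Rightarrow> 'b) \<Rightarrow> 'b" where
  "copair I X y g = hsum (dsum E I X) y (\<lambda>i. g i \<cdot> dsum_pr I X i) I"

lemma copair_simps:
  assumes "finite I" "\<And>i. i \<in> I \<Longrightarrow> g i \<in> Arr E \<and> Dom E (g i) = X i \<and> Cod E (g i) = y" "y \<in> Obj E"
  shows "copair I X y g \<in> Arr E" "Dom E (copair I X y g) = dsum E I X"
    "Cod E (copair I X y g) = y"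
    "\<And>k. k \<in> I \<Longrightarrow> copair I X y g \<cdot> dsum_in E I X k = g k"
proof -
  have X: "X i \<in> Obj E" if "i \<in> I" for i using assms(2)[OF that] Dom_Obj by metis
  note d = biproduct_simps[OF dsum_biproduct[of I X, OF assms(1) X]]
  have "copair I X y g \<in> Hom E (dsum E I X) y"
    unfolding copair_def using d assms by (intro hsum_closed) simp_all
  then show "copair I X y g \<in> Arr E" "Dom E (copair I X y g) = dsum E I X"
    "Cod E (copair I X y g) = y" by simp_all
  show "copair I X y g \<cdot> dsum_in E I X k = g k" if k: "k \<in> I" for k
  proof -
    have "copair I X y g \<cdot> dsum_in E I X k
        = hsum (X k) y (\<lambda>i. (g i \<cdot> dsum_pr I X i) \<cdot> dsum_in E I X k) I"
      using hsum_Comp[of y I "\<lambda>i. g i \<cdot> dsum_pr I X i" "dsum_in E I X k"] d k assms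
      by (simp add: copair_def)
    also have "\<dots> = (g k \<cdot> dsum_pr I X k) \<cdot> dsum_in E I X k"
      using d assms k by (intro hsum_single) simp_all
    finally show ?thesis using d assms k by simp
  qed
qed

lemma copair_ex:
  assumes "finite I" "\<And>i. i \<in> I \<Longrightarrow> g i \<in> Arr E \<and> Dom E (g i) = X i \<and> Cod E (g i) = y" "y \<in> Obj E"
  obtains u where "u \<in> Arr E" "Dom E u = dsum E I X" "Cod E u = y"
    "\<And>k. k \<in> I \<Longrightarrow> u \<cdot> dsum_in E I X k = g k"
  using that[of "copair I X y g"] copair_simps[OF assms, simplified] by simp

end

section \<open>Exact categories with enough projectives\<close>

context additive_category
begin

lemma kernel_simps:
  assumes "is_kernel E k f"
  shows "k \<in> Arr E" "f \<in> Arr E" "Cod E k = Dom E f" "f \<cdot> k = Zero E (Dom E k) (Cod E f)"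
  using assms by (simp_all add: is_kernel_def)

lemma kernel_lift:
  assumes "is_kernel E k f" "g \<in> Arr E" "Cod E g = Dom E f" "f \<cdot> g = Zero E (Dom E g) (Cod E f)"
  obtains u where "u \<in> Arr E" "Dom E u = Dom E g" "Cod E u = Dom E k" "k \<cdot> u = g"
proof -
  have "\<exists>!u. u \<in> Hom E (Dom E g) (Dom E k) \<and> k \<cdot> u = g"
    using assms unfolding is_kernel_def by simp
  then show ?thesis using that by auto
qed

lemma kernel_mono:
  assumes "is_kernel E k f" "u \<in> Arr E" "v \<in> Arr E" "Dom E u = Dom E v"
    "Cod E u = Dom E k" "Cod E v = Dom E k" "k \<cdot> u = k \<cdot> v"
  shows "u = v"
proof -
  note k = kernel_simps[OF assms(1)]
  have "f \<cdot> (k \<cdot> v) = Zero E (Dom E v) (Cod E f)"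
    using k assms reassoc[OF k(4)] by simp
  then have "\<exists>!w. w \<in> Hom E (Dom E v) (Dom E k) \<and> k \<cdot> w = k \<cdot> v"
    using assms k unfolding is_kernel_def by simp
  then show ?thesis using assms by (metis Hom_iff)
qed

lemma cokernel_simps:
  assumes "is_cokernel E c f"
  shows "c \<in> Arr E" "f \<in> Arr E" "Dom E c = Cod E f" "c \<cdot> f = Zero E (Dom E f) (Cod E c)"
  using assms by (simp_all add: is_cokernel_def)

lemma cokernel_lift:
  assumes "is_cokernel E c f" "g \<in> Arr E" "Dom E g = Cod E f" "g \<cdot> f = Zero E (Dom E f) (Cod E g)"
  obtains u where "u \<in> Arr E" "Dom E u = Cod E c" "Cod E u = Cod E g" "u \<cdot> c = g"
proof -
  have "\<exists>!u. u \<in> Hom E (Cod E c) (Cod E g) \<and> u \<cdot> c = g"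
    using assms unfolding is_cokernel_def by simp
  then show ?thesis using that by auto
qed

lemma cokernel_epi:
  assumes "is_cokernel E c f" "u \<in> Arr E" "v \<in> Arr E" "Cod E u = Cod E v"
    "Dom E u = Cod E c" "Dom E v = Cod E c" "u \<cdot> c = v \<cdot> c"
  shows "u = v"
proof -
  note c = cokernel_simps[OF assms(1)]
  have "(v \<cdot> c) \<cdot> f = Zero E (Dom E f) (Cod E v)"
    using c assms by simp
  then have "\<exists>!w. w \<in> Hom E (Cod E c) (Cod E v) \<and> w \<cdot> c = v \<cdot> c"
    using assms c unfolding is_cokernel_def by simp
  then show ?thesis using assms by (metis Hom_iff)
qed

lemma is_isoI:
  assumes "a \<in> Arr E" "b \<in> Arr E" "Dom E b = Cod E a" "Cod E b = Dom E a"
    "b \<cdot> a = Ident E (Dom E a)" "a \<cdot> b = Ident E (Cod E a)"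
  shows "is_iso E a"
  using assms by (auto simp: is_iso_def)

lemma is_iso_Ident: "x \<in> Obj E \<Longrightarrow> is_iso E (Ident E x)"
  by (rule is_isoI[of _ "Ident E x"]) simp_all

end

context exact_category
begin

lemma adm_epi_simps:
  assumes "adm_epi E p"
  shows "p \<in> Arr E" "\<exists>i. (i, p) \<in> Ses E \<and> is_kernel E i p \<and> is_cokernel E p i"
  using assms Ses_kernel_cokernel unfolding adm_epi_def is_kernel_def by blast+

lemma adm_epi_epi:
  assumes "adm_epi E p" "u \<in> Arr E" "v \<in> Arr E" "Cod E u = Cod E v"
    "Dom E u = Cod E p" "Dom E v = Cod E p" "u \<cdot> p = v \<cdot> p"
  shows "u = v"
  using adm_epi_simps(2)[OF assms(1)] cokernel_epi assms by blast

text \<open>Two cokernels of k differ by an isomorphism, along which the short exact sequence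
  provided by admissibility of k is carried to (k, c).\<close>

lemma cokernel_Ses:
  assumes "adm_mono E k" "is_cokernel E c k"
  shows "(k, c) \<in> Ses E"
proof -
  obtain q where q: "(k, q) \<in> Ses E" using assms(1) by (auto simp: adm_mono_def)
  then have qc: "is_cokernel E q k" using Ses_kernel_cokernel by blast
  note cs = cokernel_simps[OF assms(2)] and qs = cokernel_simps[OF qc]
  obtain a where a: "a \<in> Arr E" "Dom E a = Cod E q" "Cod E a = Cod E c" "a \<cdot> q = c"
    using cokernel_lift[OF qc, of c] cs by metis
  obtain b where b: "b \<in> Arr E" "Dom E b = Cod E c" "Cod E b = Cod E q" "b \<cdot> c = q"
    using cokernel_lift[OF assms(2), of q] qs by metis
  have "b \<cdot> a = Ident E (Dom E a)"
    by (rule cokernel_epi[OF qc]) (use a b cs qs in \<open>simp_all\<close>)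
  moreover have "a \<cdot> b = Ident E (Cod E a)"
    by (rule cokernel_epi[OF assms(2)]) (use a b cs qs in \<open>simp_all\<close>)
  ultimately have "is_iso E a" using a b by (intro is_isoI[of a b]) simp_all
  then show ?thesis
    using Ses_iso_closed[OF q, of "Ident E (Dom E k)" "Ident E (Cod E k)" a k c] a cs qs
    by (simp add: is_iso_Ident)
qed

text \<open>Pull \<open>e\<close> back along \<open>g\<close>.  The projection \<open>g'\<close> to the domain of \<open>e\<close> is a retraction, and its
  kernel is the kernel \<open>k\<close> of \<open>g\<close>; moreover \<open>k\<close> is the pushout of the kernel of \<open>e\<close>, hence an
  admissible monomorphism, with cokernel \<open>g\<close>.\<close>

lemma adm_epi_factor:
  assumes wic: "weakly_idempotent_complete E"
    and h: "h \<in> Arr E" and g: "g \<in> Arr E" and hg: "Cod E h = Dom E g" and e: "adm_epi E (g \<cdot> h)"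
  shows "adm_epi E g"
proof -
  define P where "P = Dom E h"
  define X where "X = Dom E g"
  define Y where "Y = Cod E g"
  have obj: "P \<in> Obj E" "X \<in> Obj E" "Y \<in> Obj E" using h g by (simp_all add: P_def X_def Y_def)
  have ht: "Dom E h = P" "Cod E h = X" and gt: "Dom E g = X" "Cod E g = Y"
    using hg by (simp_all add: P_def X_def Y_def)
  obtain g' e' where pb: "is_pullback E (g \<cdot> h) g g' e'" and e'e: "adm_epi E e'"
    using adm_epi_pullback[OF e g] ht gt h g by auto
  define P' where "P' = Dom E g'"
  have gh: "Dom E (g \<cdot> h) = P" using h g ht gt by simp
  note pb' = pb[unfolded is_pullback_def gh gt]
  have t': "g' \<in> Arr E" "e' \<in> Arr E" "Dom E g' = P'" "Dom E e' = P'" "Cod E g' = P" "Cod E e' = X"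
    using pb' unfolding P'_def by argo+
  have "(g \<cdot> h) \<cdot> g' = g \<cdot> e'" using pb' by argo
  then have sq: "g \<cdot> (h \<cdot> g') = g \<cdot> e'" using t' h g ht gt by simp
  have up: "\<exists>!u. u \<in> Hom E t P' \<and> g' \<cdot> u = a \<and> e' \<cdot> u = b"
    if "t \<in> Obj E" "a \<in> Hom E t P" "b \<in> Hom E t X" "(g \<cdot> h) \<cdot> a = g \<cdot> b" for t a b
    using pb' that unfolding P'_def by blast
  have P'o: "P' \<in> Obj E" using t' by (metis Dom_Obj)
  \<comment> \<open>The pair (id, h) is a cone over the pullback diagram, so g' has a section t with
    e' t = h.\<close>
  have "\<exists>!u. u \<in> Hom E P P' \<and> g' \<cdot> u = Ident E P \<and> e' \<cdot> u = h"
    by (rule up) (use h g ht gt obj in \<open>simp_all\<close>)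
  then obtain t where t: "t \<in> Arr E" "Dom E t = P" "Cod E t = P'" "g' \<cdot> t = Ident E P" "e' \<cdot> t = h"
    by auto
  have "is_retraction E g'" using t t' by (auto simp: is_retraction_def)
  then obtain s where s: "is_kernel E s g'"
    using wic by (auto simp: weakly_idempotent_complete_def)
  define K where "K = Dom E s"
  have st: "s \<in> Arr E" "Dom E s = K" "Cod E s = P'" "g' \<cdot> s = Zero E K P"
    using kernel_simps[OF s] t' by (simp_all add: K_def)
  have Ko: "K \<in> Obj E" using st by (metis Dom_Obj)
  define k where "k = e' \<cdot> s"
  have kt: "k \<in> Arr E" "Dom E k = K" "Cod E k = X" using st t' by (simp_all add: k_def)
  have gk: "g \<cdot> k = Zero E K Y"
    using reassoc[OF sq[symmetric]] st t' h g ht gt obj Ko by (simp add: k_def)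
  have kk: "is_kernel E k g"
    unfolding is_kernel_def
  proof (intro conjI ballI impI)
    fix T a assume T: "T \<in> Obj E" and a: "a \<in> Hom E T (Dom E g)" and ga: "g \<cdot> a = Zero E T (Cod E g)"
    have "\<exists>!u. u \<in> Hom E T P' \<and> g' \<cdot> u = Zero E T P \<and> e' \<cdot> u = a"
      by (rule up) (use T a ga h g ht gt obj in \<open>simp_all\<close>)
    then obtain u where u: "u \<in> Arr E" "Dom E u = T" "Cod E u = P'" "g' \<cdot> u = Zero E T P" "e' \<cdot> u = a"
      by auto
    obtain v where v: "v \<in> Arr E" "Dom E v = T" "Cod E v = K" "s \<cdot> v = u"
      using kernel_lift[OF s, of u] u t' K_def by metis
    show "\<exists>!u. u \<in> Hom E T (Dom E k) \<and> k \<cdot> u = a"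
    proof (rule ex1I[of _ v])
      show "v \<in> Hom E T (Dom E k) \<and> k \<cdot> v = a" using u v kt st t' by (simp add: k_def)
      fix w assume "w \<in> Hom E T (Dom E k) \<and> k \<cdot> w = a"
      then have w: "w \<in> Arr E" "Dom E w = T" "Cod E w = K" "(e' \<cdot> s) \<cdot> w = a"
        using kt by (simp_all add: k_def)
      have "\<exists>!u. u \<in> Hom E T P' \<and> g' \<cdot> u = Zero E T P \<and> e' \<cdot> u = a"
        by (rule up) (use T a ga h g ht gt obj in \<open>simp_all\<close>)
      moreover have "s \<cdot> w \<in> Hom E T P' \<and> g' \<cdot> (s \<cdot> w) = Zero E T P \<and> e' \<cdot> (s \<cdot> w) = a"
        using w kt st t' reassoc[OF st(4)] obj by (simp add: k_def)
      moreover have "u \<in> Hom E T P' \<and> g' \<cdot> u = Zero E T P \<and> e' \<cdot> u = a" using u by simp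
      ultimately have sw: "s \<cdot> w = u" by blast
      show "w = v" by (rule kernel_mono[OF s]) (use w(1-3) v st sw in \<open>simp_all\<close>)
    qed
  qed (use kt g gt gk in simp_all)
  \<comment> \<open>e' - h g' is annihilated by g, hence factors through the kernel k as k r. This r
    is the projection of P' onto K complementary to g': below, r s = id and r t = 0.\<close>
  obtain r' where r': "r' \<in> Arr E" "Dom E r' = P'" "Cod E r' = X" "r' \<boxplus> h \<cdot> g' = e'"
    using diff_ex[of e' "h \<cdot> g'"] t' h ht by auto
  have "g \<cdot> (r' \<boxplus> h \<cdot> g') = g \<cdot> e'" using r' by simp
  then have "g \<cdot> r' = Zero E P' Y" using r'(1-3) t' h ht g gt sq by simp
  then obtain r where r: "r \<in> Arr E" "Dom E r = P'" "Cod E r = K" "k \<cdot> r = r'"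
    using kernel_lift[OF kk, of r'] r' gt kt by metis
  have e'_eq: "k \<cdot> r \<boxplus> h \<cdot> g' = e'" using r r' by simp
  obtain j where j: "(j, g \<cdot> h) \<in> Ses E" "is_kernel E j (g \<cdot> h)" "is_cokernel E (g \<cdot> h) j"
    using adm_epi_simps(2)[OF e] by blast
  define J where "J = Dom E j"
  have jt: "j \<in> Arr E" "Dom E j = J" "Cod E j = P" "g \<cdot> (h \<cdot> j) = Zero E J Y"
    using kernel_simps[OF j(2)] h g ht gt by (simp_all add: J_def)
  have Jo: "J \<in> Obj E" using jt by (metis Dom_Obj)
  obtain u where u: "u \<in> Arr E" "Dom E u = J" "Cod E u = K" "k \<cdot> u = h \<cdot> j"
    using kernel_lift[OF kk, of "h \<cdot> j"] jt h ht gt kt by auto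
  obtain \<iota> where \<iota>: "(\<iota>, e') \<in> Ses E" "is_kernel E \<iota> e'" "is_cokernel E e' \<iota>"
    using adm_epi_simps(2)[OF e'e] by blast
  define L where "L = Dom E \<iota>"
  have \<iota>t: "\<iota> \<in> Arr E" "Dom E \<iota> = L" "Cod E \<iota> = P'" "e' \<cdot> \<iota> = Zero E L X"
    using kernel_simps[OF \<iota>(2)] t' by (simp_all add: L_def)
  have Lo: "L \<in> Obj E" using \<iota>t by (metis Dom_Obj)
  \<comment> \<open>On the kernel \<iota> of e', the map g' lands in the kernel j of g h; the
    resulting w will satisfy r \<iota> = - u w.\<close>
  have "g \<cdot> (h \<cdot> (g' \<cdot> \<iota>)) = Zero E L Y"
    using reassoc[OF sq, of \<iota>] \<iota>t t' h ht g gt Lo by simp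
  then obtain w where w: "w \<in> Arr E" "Dom E w = L" "Cod E w = J" "j \<cdot> w = g' \<cdot> \<iota>"
    using kernel_lift[OF j(2), of "g' \<cdot> \<iota>"] \<iota>t t' h ht g gt J_def by auto
  have kz: "v = Zero E T K" if "k \<cdot> v = Zero E T X" "v \<in> Arr E" "Dom E v = T" "Cod E v = K" for v T
    using that kernel_mono[OF kk, of v "Zero E T K"] kt Ko
    by (metis Comp_Zero(1) Dom_Obj Zero_simps)
  have kru: "k \<cdot> (r \<cdot> \<iota> \<boxplus> u \<cdot> w) = (k \<cdot> r \<boxplus> h \<cdot> g') \<cdot> \<iota>"
    using w u r(1-3) kt \<iota>t t' h ht jt reassoc[OF u(4)] by simp
  have r\<iota>: "r \<cdot> \<iota> \<boxplus> u \<cdot> w = Zero E L K"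
    by (rule kz) (use kru \<iota>t t' w u r(1-3) kt in \<open>simp_all add: e'_eq\<close>)
  have "k \<cdot> (r \<cdot> s) = (k \<cdot> r \<boxplus> h \<cdot> g') \<cdot> s"
    using r(1-3) kt st t' h ht obj Ko by simp
  then have krs: "k \<cdot> (r \<cdot> s) = k \<cdot> Ident E K" using kt by (simp add: e'_eq k_def[symmetric])
  have rs: "r \<cdot> s = Ident E K"
    by (rule kernel_mono[OF kk]) (use krs r(1-3) kt st Ko in \<open>simp_all\<close>)
  have "(k \<cdot> r \<boxplus> h \<cdot> g') \<cdot> t = e' \<cdot> t" using e'_eq by simp
  then have krt: "k \<cdot> (r \<cdot> t) = Zero E P X"
    using r(1-3) kt t t' h ht obj by simp
  have rt: "r \<cdot> t = Zero E P K" by (rule kz) (use krt r(1-3) t in \<open>simp_all\<close>)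
  have uniq: "v = v'" if "v \<in> Arr E" "Dom E v = X" "v' \<in> Arr E" "Dom E v' = X" "Cod E v = Cod E v'"
    "v \<cdot> k = v' \<cdot> k" "v \<cdot> h = v' \<cdot> h" for v v'
  proof -
    have vv: "v \<cdot> (k \<cdot> r \<boxplus> h \<cdot> g') = v' \<cdot> (k \<cdot> r \<boxplus> h \<cdot> g')"
      using that r(1-3) kt t' h ht reassoc[OF that(6)] reassoc[OF that(7)] by simp
    show ?thesis by (rule adm_epi_epi[OF e'e]) (use vv[unfolded e'_eq] that(1-5) t' in \<open>simp_all\<close>)
  qed
  \<comment> \<open>K and P glue to X along J: a compatible pair (a, b) gives a r + b g' on P',
    which kills \<iota> and so descends along the cokernel e' of \<iota>. With \<open>uniq\<close>,
    the square of j, u, k, h is a pushout.\<close>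
  have po_ex: "\<exists>v. v \<in> Arr E \<and> Dom E v = X \<and> Cod E v = T \<and> v \<cdot> k = a \<and> v \<cdot> h = b"
    if a: "a \<in> Arr E" "Dom E a = K" "Cod E a = T" and b: "b \<in> Arr E" "Dom E b = P" "Cod E b = T"
      and ab: "b \<cdot> j = a \<cdot> u" for T a b
  proof -
    have T: "T \<in> Obj E" using a by (metis Cod_Obj)
    have "(a \<cdot> r \<boxplus> b \<cdot> g') \<cdot> \<iota> = a \<cdot> (r \<cdot> \<iota> \<boxplus> u \<cdot> w)"
      using a b r(1-3) t' \<iota>t u w jt reassoc[OF ab, of w] by simp
    also have "\<dots> = Zero E L T" using r\<iota> a Lo by simp
    finally obtain v where v: "v \<in> Arr E" "Dom E v = X" "Cod E v = T" "v \<cdot> e' = a \<cdot> r \<boxplus> b \<cdot> g'"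
      using cokernel_lift[OF \<iota>(3), of "a \<cdot> r \<boxplus> b \<cdot> g'"] a b r(1-3) t' \<iota>t by auto
    have "v \<cdot> k = (a \<cdot> r \<boxplus> b \<cdot> g') \<cdot> s"
      using v t' st unfolding k_def by (metis Comp_assoc_simp)
    then have "v \<cdot> k = a" using a b r(1-3) t' st rs Ko T by simp
    moreover have "v \<cdot> h = (a \<cdot> r \<boxplus> b \<cdot> g') \<cdot> t"
      using v t' t by (metis Comp_assoc_simp)
    then have "v \<cdot> h = b" using a b r(1-3) t' t rt obj T by simp
    ultimately show ?thesis using v by blast
  qed
  have cok: "is_cokernel E g k"
    unfolding is_cokernel_def
  proof (intro conjI ballI impI)
    fix T v assume T: "T \<in> Obj E" and v: "v \<in> Hom E (Cod E k) T" and vk: "v \<cdot> k = Zero E (Dom E k) T"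
    have "v \<cdot> (h \<cdot> j) = Zero E J T"
      using reassoc[OF vk, of u] u v kt T Ko by simp
    then obtain w where w: "w \<in> Arr E" "Dom E w = Y" "Cod E w = T" "w \<cdot> (g \<cdot> h) = v \<cdot> h"
      using cokernel_lift[OF j(3), of "v \<cdot> h"] v h ht jt kt g gt by auto
    have wg: "w \<cdot> g = v"
      by (rule uniq) (use w v kt vk g gt gk T h ht Ko in \<open>simp_all\<close>)
    show "\<exists>!u. u \<in> Hom E (Cod E g) T \<and> u \<cdot> g = v"
    proof (rule ex1I[of _ w])
      fix w' assume w': "w' \<in> Hom E (Cod E g) T \<and> w' \<cdot> g = v"
      show "w' = w" by (rule adm_epi_epi[OF e]) (use w w' wg g gt h ht reassoc[of w' g v h] in \<open>simp_all\<close>)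
    qed (use w wg gt in simp)
  qed (use kt g gt gk in simp_all)
  \<comment> \<open>The axiom supplies some pushout of j along u with admissible k1. Uniqueness of
    pushouts identifies k1 with k, which is thereby an admissible monomorphism, with cokernel
    g.\<close>
  have je: "adm_mono E j" using j(1) by (auto simp: adm_mono_def)
  obtain h1 k1 where po: "is_pushout E j u h1 k1" and k1: "adm_mono E k1"
    using adm_mono_pushout[OF je u(1)] u jt by auto
  define X1 where "X1 = Cod E h1"
  note po' = po[unfolded is_pushout_def jt u(1-3)]
  have pt: "h1 \<in> Arr E" "k1 \<in> Arr E" "Cod E h1 = X1" "Cod E k1 = X1" "Dom E h1 = P" "Dom E k1 = K"
    "h1 \<cdot> j = k1 \<cdot> u"
    using po' unfolding X1_def by argo+
  have pup: "\<exists>!v. v \<in> Hom E X1 T \<and> v \<cdot> h1 = a \<and> v \<cdot> k1 = b"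
    if "T \<in> Obj E" "a \<in> Hom E P T" "b \<in> Hom E K T" "a \<cdot> j = b \<cdot> u" for T a b
    using po' that unfolding X1_def by blast
  have X1o: "X1 \<in> Obj E" using pt by (metis Cod_Obj)
  have "\<exists>!v. v \<in> Hom E X1 X \<and> v \<cdot> h1 = h \<and> v \<cdot> k1 = k"
    by (rule pup) (use h ht kt u obj in \<open>simp_all\<close>)
  then obtain v where v: "v \<in> Arr E" "Dom E v = X1" "Cod E v = X" "v \<cdot> h1 = h" "v \<cdot> k1 = k" by auto
  obtain v' where v': "v' \<in> Arr E" "Dom E v' = X" "Cod E v' = X1" "v' \<cdot> k = k1" "v' \<cdot> h = h1"
    using po_ex[OF pt(2) pt(6) pt(4) pt(1) pt(5) pt(3) pt(7)] by blast
  have vv': "v \<cdot> v' = Ident E X"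
    by (rule uniq) (use v v' kt h ht obj in \<open>simp_all\<close>)
  have "\<exists>!v. v \<in> Hom E X1 X1 \<and> v \<cdot> h1 = h1 \<and> v \<cdot> k1 = k1"
    by (rule pup) (use pt X1o in \<open>simp_all\<close>)
  moreover have "v' \<cdot> v \<in> Hom E X1 X1 \<and> (v' \<cdot> v) \<cdot> h1 = h1 \<and> (v' \<cdot> v) \<cdot> k1 = k1"
    using v v' pt by simp
  moreover have "Ident E X1 \<in> Hom E X1 X1 \<and> Ident E X1 \<cdot> h1 = h1 \<and> Ident E X1 \<cdot> k1 = k1"
    using X1o pt by simp
  ultimately have v'v: "v' \<cdot> v = Ident E X1" by blast
  obtain q1 where q1: "(k1, q1) \<in> Ses E" using k1 by (auto simp: adm_mono_def)
  have q1t: "q1 \<in> Arr E" "Dom E q1 = X1"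
    using Ses_kernel_cokernel[OF q1] kernel_simps[of k1 q1] pt by auto
  have "is_iso E v" using v v' vv' v'v by (intro is_isoI[of v v']) simp_all
  then have "(k, q1 \<cdot> v') \<in> Ses E"
    using Ses_iso_closed[OF q1, of "Ident E K" v "Ident E (Cod E q1)" k "q1 \<cdot> v'"]
      v v' kt q1t pt Ko v'v by (simp add: is_iso_Ident)
  then have "(k, g) \<in> Ses E" using cokernel_Ses[OF _ cok] by (auto simp: adm_mono_def)
  then show ?thesis by (auto simp: adm_epi_def)
qed

lemma projective_lift:
  assumes "projective E P" "adm_epi E p" "y \<in> Arr E" "Dom E y = P" "Cod E y = Cod E p"
  obtains x where "x \<in> Arr E" "Dom E x = P" "Cod E x = Dom E p" "p \<cdot> x = y"
proof -
  obtain i where "(i, p) \<in> Ses E" using assms(2) by (auto simp: adm_epi_def)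
  then have "short_exact_sequence
        (Hom_grp E P (Cod E p)) (Hom_grp E P (Dom E p)) (Hom_grp E P (Dom E i))
        (\<lambda>f. p \<cdot> f) (\<lambda>f. i \<cdot> f)"
    using assms(1) by (auto simp: projective_def)
  then have "(\<lambda>f. p \<cdot> f) ` carrier (Hom_grp E P (Dom E p)) = carrier (Hom_grp E P (Cod E p))"
    by (simp add: short_exact_sequence_iff epi_def)
  moreover have "y \<in> carrier (Hom_grp E P (Cod E p))" using assms by (simp add: Hom_grp_def)
  ultimately obtain x where "x \<in> carrier (Hom_grp E P (Dom E p))" "p \<cdot> x = y" by (metis imageE)
  then show ?thesis using that[of x] by (simp add: Hom_grp_def)
qed

end

locale exact_enough_projectives = exact_category E for E (structure) +
  assumes weakly_idempotent_complete: "weakly_idempotent_complete E"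
    and enough_projectives: "enough_projectives E"
begin

lemma projective_cover:
  assumes "x \<in> Obj E"
  obtains P p where "projective E P" "P \<in> Obj E" "adm_epi E p" "p \<in> Arr E" "Dom E p = P" "Cod E p = x"
  using enough_projectives assms that unfolding enough_projectives_def projective_def by auto

text \<open>A lift x of a projective cover of the codomain makes g x an admissible epimorphism, and
  \<open>adm_epi_factor\<close> passes this on to g.\<close>

lemma adm_epiI:
  assumes "g \<in> Arr E" "\<And>P y. \<lbrakk>projective E P; P \<in> Obj E; y \<in> Arr E; Dom E y = P; Cod E y = Cod E g\<rbrakk> \<Longrightarrow>
    \<exists>x\<in>Arr E. Dom E x = P \<and> Cod E x = Dom E g \<and> g \<cdot> x = y"
  shows "adm_epi E g"
proof -
  obtain P p where p: "projective E P" "P \<in> Obj E" "adm_epi E p" "p \<in> Arr E" "Dom E p = P" "Cod E p = Cod E g"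
    using projective_cover[of "Cod E g"] assms(1) by auto
  obtain x where "x \<in> Arr E" "Dom E x = P" "Cod E x = Dom E g" "g \<cdot> x = p"
    using assms(2)[OF p(1,2,4,5,6)] by blast
  then show ?thesis using adm_epi_factor[OF weakly_idempotent_complete, of x g] assms(1) p by simp
qed

end

section \<open>Model structures from two factorizations, and their transport along an equivalence\<close>

lemma with_weq_fib_simps [simp]:
  "Obj (with_weq_fib C W F) = Obj C" "Arr (with_weq_fib C W F) = Arr C"
  "Dom (with_weq_fib C W F) = Dom C" "Cod (with_weq_fib C W F) = Cod C"
  "Ident (with_weq_fib C W F) = Ident C" "Comp (with_weq_fib C W F) = Comp C"
  "Weq (with_weq_fib C W F) = W" "Fib (with_weq_fib C W F) = F"
  "Cofib (with_weq_fib C W F) = {i \<in> Arr C. \<forall>p \<in> F \<inter> W. has_lifting C i p}"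
  by (simp_all add: with_weq_fib_def)

lemma Hom_with_weq_fib [simp]: "Hom (with_weq_fib C W F) = Hom C"
  by (intro ext) (simp add: Hom_def)

lemma has_lifting_with_weq_fib [simp]:
  "has_lifting (with_weq_fib C W F) i p = has_lifting C i p"
  "is_retract_of (with_weq_fib C W F) i p = is_retract_of C i p"
  by (simp_all add: has_lifting_def is_retract_of_def)

lemma has_liftingE:
  assumes "has_lifting C i p" "p \<cdot>\<^bsub>C\<^esub> u = v \<cdot>\<^bsub>C\<^esub> i"
    "u \<in> Arr C" "Dom C u = Dom C i" "Cod C u = Dom C p"
    "v \<in> Arr C" "Dom C v = Cod C i" "Cod C v = Cod C p"
  obtains h where "h \<in> Arr C" "Dom C h = Cod C i" "Cod C h = Dom C p"
    "h \<cdot>\<^bsub>C\<^esub> i = u" "p \<cdot>\<^bsub>C\<^esub> h = v"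
proof -
  have "u \<in> Hom C (Dom C i) (Dom C p)" "v \<in> Hom C (Cod C i) (Cod C p)" using assms(3-8) by simp_all
  then obtain h where "h \<in> Hom C (Cod C i) (Dom C p)" "h \<cdot>\<^bsub>C\<^esub> i = u" "p \<cdot>\<^bsub>C\<^esub> h = v"
    using assms(1,2) unfolding has_lifting_def by blast
  then show ?thesis using that[of h] by simp
qed

context category
begin

lemma functor_simps:
  assumes "is_functor C D F"
  shows "x \<in> Obj C \<Longrightarrow> on_Obj F x \<in> Obj D"
    "f \<in> Arr C \<Longrightarrow> on_Arr F f \<in> Arr D"
    "f \<in> Arr C \<Longrightarrow> Dom D (on_Arr F f) = on_Obj F (Dom C f)"
    "f \<in> Arr C \<Longrightarrow> Cod D (on_Arr F f) = on_Obj F (Cod C f)"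
    "x \<in> Obj C \<Longrightarrow> on_Arr F (Ident C x) = Ident D (on_Obj F x)"
    "\<lbrakk>f \<in> Arr C; g \<in> Arr C; Cod C f = Dom C g\<rbrakk> \<Longrightarrow> on_Arr F (g \<cdot> f) = on_Arr F g \<cdot>\<^bsub>D\<^esub> on_Arr F f"
proof -
  show "x \<in> Obj C \<Longrightarrow> on_Obj F x \<in> Obj D" "x \<in> Obj C \<Longrightarrow> on_Arr F (Ident C x) = Ident D (on_Obj F x)"
    using assms unfolding is_functor_def by blast+
  show "\<lbrakk>f \<in> Arr C; g \<in> Arr C; Cod C f = Dom C g\<rbrakk> \<Longrightarrow> on_Arr F (g \<cdot> f) = on_Arr F g \<cdot>\<^bsub>D\<^esub> on_Arr F f"
    using assms Hom_iff[of f C "Dom C f" "Cod C f"] Hom_iff[of g C "Dom C g" "Cod C g"]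
      Dom_Obj[of f] Cod_Obj[of f] Cod_Obj[of g]
    unfolding is_functor_def by (metis (no_types, lifting))
  have "f \<in> Arr C \<Longrightarrow> on_Arr F f \<in> Hom D (on_Obj F (Dom C f)) (on_Obj F (Cod C f))"
    using assms Hom_iff[of f C "Dom C f" "Cod C f"] Dom_Obj[of f] Cod_Obj[of f]
    unfolding is_functor_def by blast
  then show "f \<in> Arr C \<Longrightarrow> on_Arr F f \<in> Arr D"
    "f \<in> Arr C \<Longrightarrow> Dom D (on_Arr F f) = on_Obj F (Dom C f)"
    "f \<in> Arr C \<Longrightarrow> Cod D (on_Arr F f) = on_Obj F (Cod C f)" by simp_all
qed

lemma retract_Arr: "is_retract_of C f g \<Longrightarrow> f \<in> Arr C"
  by (simp add: is_retract_of_def)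

lemma has_lifting_retract:
  assumes r: "is_retract_of C f g" and l: "has_lifting C g q" and q: "q \<in> Arr C"
  shows "has_lifting C f q"
  unfolding has_lifting_def
proof (intro ballI impI)
  obtain i r j s where fg: "f \<in> Arr C" "g \<in> Arr C"
    and "i \<in> Hom C (Dom C f) (Dom C g)" "r \<in> Hom C (Dom C g) (Dom C f)"
    "j \<in> Hom C (Cod C f) (Cod C g)" "s \<in> Hom C (Cod C g) (Cod C f)"
    and e: "r \<cdot> i = Ident C (Dom C f)" "s \<cdot> j = Ident C (Cod C f)" "g \<cdot> i = j \<cdot> f" "f \<cdot> r = s \<cdot> g"
    using r unfolding is_retract_of_def by blast
  then have t: "i \<in> Arr C" "Dom C i = Dom C f" "Cod C i = Dom C g"
    "r \<in> Arr C" "Dom C r = Dom C g" "Cod C r = Dom C f"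
    "j \<in> Arr C" "Dom C j = Cod C f" "Cod C j = Cod C g"
    "s \<in> Arr C" "Dom C s = Cod C g" "Cod C s = Cod C f" by simp_all
  fix u v assume "u \<in> Hom C (Dom C f) (Dom C q)" "v \<in> Hom C (Cod C f) (Cod C q)"
    and quvf: "q \<cdot> u = v \<cdot> f"
  then have uv: "u \<in> Arr C" "Dom C u = Dom C f" "Cod C u = Dom C q"
    "v \<in> Arr C" "Dom C v = Cod C f" "Cod C v = Cod C q" by simp_all
  have "q \<cdot> (u \<cdot> r) = (v \<cdot> s) \<cdot> g"
    using reassoc[OF quvf, of r] e(4) t uv q fg by simp
  then obtain h where h: "h \<in> Arr C" "Dom C h = Cod C g" "Cod C h = Dom C q"
    and e2: "h \<cdot> g = u \<cdot> r" "q \<cdot> h = v \<cdot> s"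
    by (rule has_liftingE[OF l]) (use t uv q in simp_all)
  have "(h \<cdot> j) \<cdot> f = u"
    using reassoc[OF e2(1), of i] e t uv h fg by simp
  moreover have "q \<cdot> (h \<cdot> j) = v"
    using reassoc[OF e2(2), of j] e t uv h fg q by simp
  ultimately show "\<exists>h\<in>Hom C (Cod C f) (Dom C q). h \<cdot> f = u \<and> q \<cdot> h = v"
    using h t by (intro bexI[of _ "h \<cdot> j"]) simp_all
qed

text \<open>Makes invariance of a class under isomorphism a case of its closure under retracts,
  which is what the model axioms supply.\<close>

lemma retract_of_Comp_iso:
  assumes "a \<in> Arr C" "b \<in> Arr C" "Dom C b = Cod C a" "Cod C b = Dom C a" "b \<cdot> a = Ident C (Dom C a)"
    "a \<cdot> b = Ident C (Cod C a)" "f \<in> Arr C"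
  shows "Dom C f = Dom C a \<Longrightarrow> is_retract_of C (f \<cdot> b) f"
    "Cod C f = Dom C a \<Longrightarrow> is_retract_of C (a \<cdot> f) f"
proof -
  assume d: "Dom C f = Dom C a"
  show "is_retract_of C (f \<cdot> b) f"
    unfolding is_retract_of_def using assms d
    by (intro conjI bexI[of _ b] bexI[of _ a] bexI[of _ "Ident C (Cod C f)"]) simp_all
next
  assume d: "Cod C f = Dom C a"
  show "is_retract_of C (a \<cdot> f) f"
    unfolding is_retract_of_def using assms d reassoc[OF assms(5), of f]
    by (intro conjI bexI[of _ b] bexI[of _ a] bexI[of _ "Ident C (Dom C f)"]) simp_all
qed

end

text \<open>What has to be checked when cofibrations are defined by lifting. The left factor of the
  first factorization is required to lift against every fibration, which is a priori stronger than
  being an acyclic cofibration; the retract argument recovers the lifting axiom from it.\<close>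

locale weq_fib_category = category C for C :: "('o, 'm) cat" (structure) +
  fixes W F :: "'m set"
  assumes W_Arr: "W \<subseteq> Arr C" and F_Arr: "F \<subseteq> Arr C"
    and W_two_of_three:
      "\<lbrakk>f \<in> Arr C; g \<in> Arr C; Cod C f = Dom C g; f \<in> W; g \<in> W\<rbrakk> \<Longrightarrow> g \<cdot> f \<in> W"
      "\<lbrakk>f \<in> Arr C; g \<in> Arr C; Cod C f = Dom C g; f \<in> W; g \<cdot> f \<in> W\<rbrakk> \<Longrightarrow> g \<in> W"
      "\<lbrakk>f \<in> Arr C; g \<in> Arr C; Cod C f = Dom C g; g \<in> W; g \<cdot> f \<in> W\<rbrakk> \<Longrightarrow> f \<in> W"
    and W_retract: "\<lbrakk>is_retract_of C f g; g \<in> W\<rbrakk> \<Longrightarrow> f \<in> W"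
    and F_retract: "\<lbrakk>is_retract_of C f g; g \<in> F\<rbrakk> \<Longrightarrow> f \<in> F"
    and factor_acyclic_cofib: "f \<in> Arr C \<Longrightarrow>
      \<exists>j\<in>W. \<exists>p\<in>F. Cod C j = Dom C p \<and> f = p \<cdot> j \<and> (\<forall>q\<in>F. has_lifting C j q)"
    and factor_acyclic_fib: "f \<in> Arr C \<Longrightarrow>
      \<exists>i\<in>Arr C. \<exists>p\<in>F \<inter> W. Cod C i = Dom C p \<and> f = p \<cdot> i \<and> (\<forall>q\<in>F \<inter> W. has_lifting C i q)"
begin

text \<open>The retract argument: in a factorization i = p j, two-out-of-three makes p an acyclic
  fibration, so i lifts against p and becomes a retract of j, which lifts against all
  fibrations.\<close>

lemma acyclic_cofib_lifting:
  assumes i: "i \<in> Arr C" "\<forall>p\<in>F \<inter> W. has_lifting C i p" "i \<in> W" and q: "q \<in> F"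
  shows "has_lifting C i q"
proof -
  obtain j p where j: "j \<in> W" "p \<in> F" "Cod C j = Dom C p" "i = p \<cdot> j" "\<forall>q\<in>F. has_lifting C j q"
    using factor_acyclic_cofib[OF i(1)] by blast
  have jp: "j \<in> Arr C" "p \<in> Arr C" using j W_Arr F_Arr by auto
  have dc: "Dom C i = Dom C j" "Cod C i = Cod C p" using j(3,4) jp by simp_all
  have "p \<in> W" using W_two_of_three(2)[OF jp j(3,1)] i(3) j(4) by simp
  then have "has_lifting C i p" using i(2) j(2) by blast
  then obtain h where h: "h \<in> Hom C (Cod C i) (Dom C p)" "h \<cdot> i = j" "p \<cdot> h = Ident C (Cod C i)"
    by (rule has_liftingE[of C i p j "Ident C (Cod C i)"]) (use jp i(1) j(3,4) dc in simp_all)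
  have "is_retract_of C i j"
    unfolding is_retract_of_def using h jp i(1) dc j(3,4)
    by (intro conjI bexI[of _ "Ident C (Dom C i)"] bexI[of _ h] bexI[of _ p]) simp_all
  then show ?thesis using has_lifting_retract j(5) q F_Arr by blast
qed

lemma model_structure: "model_structure (with_weq_fib C W F)"
proof
  fix f assume "f \<in> Arr (with_weq_fib C W F)"
  then have f: "f \<in> Arr C" by simp
  show "\<exists>i \<in> Cofib (with_weq_fib C W F) \<inter> Weq (with_weq_fib C W F). \<exists>p \<in> Fib (with_weq_fib C W F).
      Cod (with_weq_fib C W F) i = Dom (with_weq_fib C W F) p \<and> f = p \<cdot>\<^bsub>with_weq_fib C W F\<^esub> i"
    using factor_acyclic_cofib[OF f] W_Arr by (simp add: Bex_def) blast
  show "\<exists>i \<in> Cofib (with_weq_fib C W F). \<exists>p \<in> Fib (with_weq_fib C W F) \<inter> Weq (with_weq_fib C W F).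
      Cod (with_weq_fib C W F) i = Dom (with_weq_fib C W F) p \<and> f = p \<cdot>\<^bsub>with_weq_fib C W F\<^esub> i"
    using factor_acyclic_fib[OF f] by (simp add: Bex_def) blast
next
  fix i p assume "i \<in> Cofib (with_weq_fib C W F) \<inter> Weq (with_weq_fib C W F)" "p \<in> Fib (with_weq_fib C W F)"
  then show "has_lifting (with_weq_fib C W F) i p" using acyclic_cofib_lifting by simp
next
  fix f g assume "is_retract_of (with_weq_fib C W F) f g" "g \<in> Cofib (with_weq_fib C W F)"
  then show "f \<in> Cofib (with_weq_fib C W F)"
    using has_lifting_retract[of f g] F_Arr by (auto dest: retract_Arr)
qed (use W_Arr F_Arr W_two_of_three W_retract F_retract in
  \<open>auto simp: Ident_Hom Comp_Ident Ident_Comp Comp_assoc simp del: Hom_iff intro: Comp_Hom\<close>)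

end

text \<open>An adjoint equivalence, with W' and F' created by R. The counit at y is described as the
  arrow whose adjunct is the identity of R y, so that \<open>\<phi>\<close> is the only adjunction
  data.\<close>

locale weq_fib_transport = weq_fib_category C W F + D: category D
  for C :: "('o, 'm) cat" and W F and D :: "('p, 'n) cat" +
  fixes L :: "('o, 'm, 'p, 'n) cfunctor" and R :: "('p, 'n, 'o, 'm) cfunctor"
    and \<phi> :: "'o \<Rightarrow> 'p \<Rightarrow> 'n \<Rightarrow> 'm" and W' F' :: "'n set"
  assumes adj: "is_adjunction C D L R \<phi>"
    and unit_iso: "x \<in> Obj C \<Longrightarrow> is_iso C (\<phi> x (on_Obj L x) (Ident D (on_Obj L x)))"
    and counit_iso: "y \<in> Obj D \<Longrightarrow>
      \<exists>e\<in>Hom D (on_Obj L (on_Obj R y)) y. is_iso D e \<and> \<phi> (on_Obj R y) y e = Ident C (on_Obj R y)"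
    and W'_iff: "f \<in> W' \<longleftrightarrow> f \<in> Arr D \<and> on_Arr R f \<in> W"
    and F'_iff: "f \<in> F' \<longleftrightarrow> f \<in> Arr D \<and> on_Arr R f \<in> F"
begin

abbreviation "LO \<equiv> on_Obj L"
abbreviation "LA \<equiv> on_Arr L"
abbreviation "RO \<equiv> on_Obj R"
abbreviation "RA \<equiv> on_Arr R"

lemma functor_L: "is_functor C D L" and functor_R: "is_functor D C R"
  using adj by (simp_all add: is_adjunction_def)

lemmas L_simps [simp] = functor_simps[OF functor_L]
lemmas R_simps [simp] = D.functor_simps[OF functor_R]

lemma phi_simps:
  assumes "x \<in> Obj C" "y \<in> Obj D" "f \<in> Arr D" "Dom D f = LO x" "Cod D f = y"
  shows "\<phi> x y f \<in> Arr C" "Dom C (\<phi> x y f) = x" "Cod C (\<phi> x y f) = RO y"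
proof -
  have "bij_betw (\<phi> x y) (Hom D (LO x) y) (Hom C x (RO y))"
    using adj assms(1,2) unfolding is_adjunction_def by blast
  then have "\<phi> x y f \<in> Hom C x (RO y)"
    using assms(3-5) by (auto simp: bij_betw_def simp del: Hom_iff intro: Hom_iff[THEN iffD2])
  then show "\<phi> x y f \<in> Arr C" "Dom C (\<phi> x y f) = x" "Cod C (\<phi> x y f) = RO y" by simp_all
qed

lemma phi_inj:
  assumes "x \<in> Obj C" "y \<in> Obj D" "f \<in> Arr D" "Dom D f = LO x" "Cod D f = y"
    "g \<in> Arr D" "Dom D g = LO x" "Cod D g = y" "\<phi> x y f = \<phi> x y g"
  shows "f = g"
proof -
  have "inj_on (\<phi> x y) (Hom D (LO x) y)"
    using adj assms(1,2) unfolding is_adjunction_def bij_betw_def by blast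
  then show ?thesis using assms(3-9) by (simp add: inj_on_def)
qed

lemma phi_surj:
  assumes "x \<in> Obj C" "y \<in> Obj D" "g \<in> Arr C" "Dom C g = x" "Cod C g = RO y"
  obtains f where "f \<in> Arr D" "Dom D f = LO x" "Cod D f = y" "\<phi> x y f = g"
proof -
  have "\<phi> x y ` Hom D (LO x) y = Hom C x (RO y)"
    using adj assms(1,2) unfolding is_adjunction_def bij_betw_def by blast
  moreover have "g \<in> Hom C x (RO y)" using assms by simp
  ultimately obtain f where "f \<in> Hom D (LO x) y" "\<phi> x y f = g" by (metis imageE)
  then show ?thesis using that[of f] by simp
qed

lemma phi_natural:
  assumes "a \<in> Arr C" "f \<in> Arr D" "Dom D f = LO (Cod C a)" "b \<in> Arr D" "Dom D b = Cod D f"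
  shows "\<phi> (Dom C a) (Cod D b) (b \<cdot>\<^bsub>D\<^esub> (f \<cdot>\<^bsub>D\<^esub> LA a)) = RA b \<cdot>\<^bsub>C\<^esub> (\<phi> (Cod C a) (Cod D f) f \<cdot>\<^bsub>C\<^esub> a)"
proof -
  have "\<forall>x'\<in>Obj C. \<forall>x\<in>Obj C. \<forall>y\<in>Obj D. \<forall>y'\<in>Obj D.
        \<forall>a \<in> Hom C x' x. \<forall>f \<in> Hom D (LO x) y. \<forall>b \<in> Hom D y y'.
          \<phi> x' y' (b \<cdot>\<^bsub>D\<^esub> f \<cdot>\<^bsub>D\<^esub> LA a) = RA b \<cdot>\<^bsub>C\<^esub> \<phi> x y f \<cdot>\<^bsub>C\<^esub> a"
    using adj unfolding is_adjunction_def by blast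
  moreover have "a \<in> Hom C (Dom C a) (Cod C a)" "f \<in> Hom D (LO (Cod C a)) (Cod D f)"
    "b \<in> Hom D (Cod D f) (Cod D b)" using assms by simp_all
  moreover have "Dom C a \<in> Obj C" "Cod C a \<in> Obj C" "Cod D f \<in> Obj D" "Cod D b \<in> Obj D"
    using assms by simp_all
  ultimately have "\<phi> (Dom C a) (Cod D b) (b \<cdot>\<^bsub>D\<^esub> f \<cdot>\<^bsub>D\<^esub> LA a) = RA b \<cdot>\<^bsub>C\<^esub> \<phi> (Cod C a) (Cod D f) f \<cdot>\<^bsub>C\<^esub> a"
    by blast
  then show ?thesis using assms phi_simps[of "Cod C a" "Cod D f" f] by simp
qed

lemma phi_left:
  assumes "a \<in> Arr C" "f \<in> Arr D" "Dom D f = LO (Cod C a)"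
  shows "\<phi> (Dom C a) (Cod D f) (f \<cdot>\<^bsub>D\<^esub> LA a) = \<phi> (Cod C a) (Cod D f) f \<cdot>\<^bsub>C\<^esub> a"
  using phi_natural[of a f "Ident D (Cod D f)"] assms phi_simps[of "Cod C a" "Cod D f" f] by simp

lemma phi_right:
  assumes "x \<in> Obj C" "f \<in> Arr D" "Dom D f = LO x" "b \<in> Arr D" "Dom D b = Cod D f"
  shows "\<phi> x (Cod D b) (b \<cdot>\<^bsub>D\<^esub> f) = RA b \<cdot>\<^bsub>C\<^esub> \<phi> x (Cod D f) f"
  using phi_natural[of "Ident C x" f b] assms phi_simps[of x "Cod D f" f] by simp

definition "unit x = \<phi> x (LO x) (Ident D (LO x))"

lemma unit_simps:
  assumes "x \<in> Obj C"
  shows "unit x \<in> Arr C" "Dom C (unit x) = x" "Cod C (unit x) = RO (LO x)"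
  using phi_simps[of x "LO x" "Ident D (LO x)"] assms by (simp_all add: unit_def)

lemma unit_inv:
  assumes "x \<in> Obj C"
  obtains u where "u \<in> Arr C" "Dom C u = RO (LO x)" "Cod C u = x"
    "u \<cdot>\<^bsub>C\<^esub> unit x = Ident C x" "unit x \<cdot>\<^bsub>C\<^esub> u = Ident C (RO (LO x))"
  using unit_iso[OF assms] unit_simps[OF assms] that
  by (auto simp: is_iso_def unit_def[symmetric])

lemma unit_natural:
  assumes "f \<in> Arr C"
  shows "RA (LA f) \<cdot>\<^bsub>C\<^esub> unit (Dom C f) = unit (Cod C f) \<cdot>\<^bsub>C\<^esub> f"
  using phi_left[of f "Ident D (LO (Cod C f))"] phi_right[of "Dom C f" "Ident D (LO (Dom C f))" "LA f"] assms
  by (simp add: unit_def)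

lemma counit:
  assumes "y \<in> Obj D"
  obtains e d where "e \<in> Arr D" "Dom D e = LO (RO y)" "Cod D e = y" "\<phi> (RO y) y e = Ident C (RO y)"
    "d \<in> Arr D" "Dom D d = y" "Cod D d = LO (RO y)" "e \<cdot>\<^bsub>D\<^esub> d = Ident D y"
    "d \<cdot>\<^bsub>D\<^esub> e = Ident D (LO (RO y))"
  using counit_iso[OF assms] that by (auto simp: is_iso_def)

text \<open>Composed with the counit e, an arrow f has adjunct \<open>RA f\<close>; since e is
  invertible, f is recovered from \<open>RA f\<close>.\<close>

lemma R_faithful:
  assumes fg: "f \<in> Arr D" "g \<in> Arr D" "Dom D f = Dom D g" "Cod D f = Cod D g" and R: "RA f = RA g"
  shows "f = g"
proof -
  define y where "y = Dom D g"
  define z where "z = Cod D g"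
  have t: "Dom D f = y" "Dom D g = y" "Cod D f = z" "Cod D g = z" and yz: "y \<in> Obj D" "z \<in> Obj D"
    using fg by (simp_all add: y_def z_def)
  obtain e d where e: "e \<in> Arr D" "Dom D e = LO (RO y)" "Cod D e = y"
    and d: "d \<in> Arr D" "Dom D d = y" "Cod D d = LO (RO y)" "e \<cdot>\<^bsub>D\<^esub> d = Ident D y"
    using counit[OF yz(1)] by metis
  have "\<phi> (RO y) z (f \<cdot>\<^bsub>D\<^esub> e) = \<phi> (RO y) z (g \<cdot>\<^bsub>D\<^esub> e)"
    using phi_right[of "RO y" e f] phi_right[of "RO y" e g] fg(1,2) t yz e by (simp add: R)
  then have "f \<cdot>\<^bsub>D\<^esub> e = g \<cdot>\<^bsub>D\<^esub> e"
    using phi_inj[of "RO y" z "f \<cdot>\<^bsub>D\<^esub> e" "g \<cdot>\<^bsub>D\<^esub> e"] fg(1,2) t yz e by simp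
  then have "(f \<cdot>\<^bsub>D\<^esub> e) \<cdot>\<^bsub>D\<^esub> d = (g \<cdot>\<^bsub>D\<^esub> e) \<cdot>\<^bsub>D\<^esub> d" by simp
  then show ?thesis using fg(1,2) t e d by simp
qed

text \<open>The same computation read backwards: take the arrow with adjunct h and compose it with
  the inverse d of the counit.\<close>

lemma R_full:
  assumes "h \<in> Arr C" "Dom C h = RO y" "Cod C h = RO z" "y \<in> Obj D" "z \<in> Obj D"
  obtains f where "f \<in> Arr D" "Dom D f = y" "Cod D f = z" "RA f = h"
proof -
  obtain e d where e: "e \<in> Arr D" "Dom D e = LO (RO y)" "Cod D e = y"
    "\<phi> (RO y) y e = Ident C (RO y)"
    and d: "d \<in> Arr D" "Dom D d = y" "Cod D d = LO (RO y)" "d \<cdot>\<^bsub>D\<^esub> e = Ident D (LO (RO y))"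
    using counit[OF assms(4)] by metis
  obtain u where u: "u \<in> Arr D" "Dom D u = LO (RO y)" "Cod D u = z" "\<phi> (RO y) z u = h"
    using phi_surj[of "RO y" z h] assms by auto
  have "\<phi> (RO y) z ((u \<cdot>\<^bsub>D\<^esub> d) \<cdot>\<^bsub>D\<^esub> e) = RA (u \<cdot>\<^bsub>D\<^esub> d)"
    using phi_right[of "RO y" e "u \<cdot>\<^bsub>D\<^esub> d"] e d u assms by simp
  then have "RA (u \<cdot>\<^bsub>D\<^esub> d) = h" using e d u by simp
  then show ?thesis using that[of "u \<cdot>\<^bsub>D\<^esub> d"] u d by simp
qed

text \<open>R is full and faithful, so a diagonal found in C comes from one in D and its two
  triangles commute there.\<close>

lemma has_lifting_R:
  assumes "has_lifting C (RA i) (RA p)" "i \<in> Arr D" "p \<in> Arr D"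
  shows "has_lifting D i p"
  unfolding has_lifting_def
proof (intro ballI impI)
  fix u v assume "u \<in> Hom D (Dom D i) (Dom D p)" "v \<in> Hom D (Cod D i) (Cod D p)"
    and sq: "p \<cdot>\<^bsub>D\<^esub> u = v \<cdot>\<^bsub>D\<^esub> i"
  then have t: "u \<in> Arr D" "Dom D u = Dom D i" "Cod D u = Dom D p"
    "v \<in> Arr D" "Dom D v = Cod D i" "Cod D v = Cod D p" by simp_all
  have "RA (p \<cdot>\<^bsub>D\<^esub> u) = RA (v \<cdot>\<^bsub>D\<^esub> i)" using sq by simp
  then have "RA p \<cdot>\<^bsub>C\<^esub> RA u = RA v \<cdot>\<^bsub>C\<^esub> RA i" using t assms by simp
  moreover have "RA u \<in> Hom C (Dom C (RA i)) (Dom C (RA p))" "RA v \<in> Hom C (Cod C (RA i)) (Cod C (RA p))"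
    using t assms by simp_all
  ultimately obtain h where h: "h \<in> Hom C (Cod C (RA i)) (Dom C (RA p))"
    "h \<cdot>\<^bsub>C\<^esub> RA i = RA u" "RA p \<cdot>\<^bsub>C\<^esub> h = RA v"
    using assms(1) unfolding has_lifting_def by blast
  obtain k where k: "k \<in> Arr D" "Dom D k = Cod D i" "Cod D k = Dom D p" "RA k = h"
    using R_full[of h "Cod D i" "Dom D p"] h assms by auto
  have 1: "k \<cdot>\<^bsub>D\<^esub> i = u" by (rule R_faithful) (use k h t assms in simp_all)
  have 2: "p \<cdot>\<^bsub>D\<^esub> k = v" by (rule R_faithful) (use k h t assms in simp_all)
  show "\<exists>h\<in>Hom D (Cod D i) (Dom D p). h \<cdot>\<^bsub>D\<^esub> i = u \<and> p \<cdot>\<^bsub>D\<^esub> h = v"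
    using 1 2 k by (intro bexI[of _ k]) simp_all
qed

text \<open>Transposition of lifting squares across the adjunction. Since F' and W' are created by
  R, this sends cofibrations of C to cofibrations of D.\<close>

lemma has_lifting_L:
  assumes "has_lifting C i (RA p)" "i \<in> Arr C" "p \<in> Arr D"
  shows "has_lifting D (LA i) p"
  unfolding has_lifting_def
proof (intro ballI impI)
  fix u v assume "u \<in> Hom D (Dom D (LA i)) (Dom D p)" "v \<in> Hom D (Cod D (LA i)) (Cod D p)"
    and sq: "p \<cdot>\<^bsub>D\<^esub> u = v \<cdot>\<^bsub>D\<^esub> LA i"
  then have t: "u \<in> Arr D" "Dom D u = LO (Dom C i)" "Cod D u = Dom D p"
    "v \<in> Arr D" "Dom D v = LO (Cod C i)" "Cod D v = Cod D p" using assms by simp_all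
  let ?u = "\<phi> (Dom C i) (Dom D p) u" and ?v = "\<phi> (Cod C i) (Cod D p) v"
  note tu = phi_simps[of "Dom C i" "Dom D p" u] and tv = phi_simps[of "Cod C i" "Cod D p" v]
  have "RA p \<cdot>\<^bsub>C\<^esub> ?u = ?v \<cdot>\<^bsub>C\<^esub> i"
    using phi_right[of "Dom C i" u p] phi_left[of i v] t assms sq by simp
  moreover have "?u \<in> Hom C (Dom C i) (Dom C (RA p))" "?v \<in> Hom C (Cod C i) (Cod C (RA p))"
    using t tu tv assms by simp_all
  ultimately obtain h where h: "h \<in> Hom C (Cod C i) (Dom C (RA p))"
    "h \<cdot>\<^bsub>C\<^esub> i = ?u" "RA p \<cdot>\<^bsub>C\<^esub> h = ?v"
    using assms(1) unfolding has_lifting_def by blast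
  obtain k where k: "k \<in> Arr D" "Dom D k = LO (Cod C i)" "Cod D k = Dom D p" "\<phi> (Cod C i) (Dom D p) k = h"
    using phi_surj[of "Cod C i" "Dom D p" h] h assms by auto
  have 1: "k \<cdot>\<^bsub>D\<^esub> LA i = u"
    by (rule phi_inj[of "Dom C i" "Dom D p"]) (use phi_left[of i k] k h t assms in simp_all)
  have 2: "p \<cdot>\<^bsub>D\<^esub> k = v"
    by (rule phi_inj[of "Cod C i" "Cod D p"]) (use phi_right[of "Cod C i" k p] k h t assms in simp_all)
  show "\<exists>h\<in>Hom D (Cod D (LA i)) (Dom D p). h \<cdot>\<^bsub>D\<^esub> LA i = u \<and> p \<cdot>\<^bsub>D\<^esub> h = v"
    using 1 2 k assms by (intro bexI[of _ k]) simp_all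
qed

lemma retract_R: "is_retract_of D f g \<Longrightarrow> is_retract_of C (RA f) (RA g)"
proof -
  assume "is_retract_of D f g"
  then obtain i r j s where fg: "f \<in> Arr D" "g \<in> Arr D"
    and "i \<in> Hom D (Dom D f) (Dom D g)" "r \<in> Hom D (Dom D g) (Dom D f)"
    "j \<in> Hom D (Cod D f) (Cod D g)" "s \<in> Hom D (Cod D g) (Cod D f)"
    and e: "r \<cdot>\<^bsub>D\<^esub> i = Ident D (Dom D f)" "s \<cdot>\<^bsub>D\<^esub> j = Ident D (Cod D f)"
      "g \<cdot>\<^bsub>D\<^esub> i = j \<cdot>\<^bsub>D\<^esub> f" "f \<cdot>\<^bsub>D\<^esub> r = s \<cdot>\<^bsub>D\<^esub> g"
    unfolding is_retract_of_def by blast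
  then have t: "i \<in> Arr D" "Dom D i = Dom D f" "Cod D i = Dom D g"
    "r \<in> Arr D" "Dom D r = Dom D g" "Cod D r = Dom D f"
    "j \<in> Arr D" "Dom D j = Cod D f" "Cod D j = Cod D g"
    "s \<in> Arr D" "Dom D s = Cod D g" "Cod D s = Cod D f" by simp_all
  show ?thesis
    unfolding is_retract_of_def using e[THEN arg_cong[of _ _ RA]] t fg
    by (intro conjI bexI[of _ "RA i"] bexI[of _ "RA r"] bexI[of _ "RA j"] bexI[of _ "RA s"]) simp_all
qed

text \<open>The middle object Q of the factorization lies in C and need not be of the form R y; the
  unit isomorphism replaces it by R (L Q), and fullness and faithfulness of R bring both factors to
  D.\<close>

lemma factor_R:
  assumes "f \<in> Arr D" "RA f = p \<cdot>\<^bsub>C\<^esub> j" "j \<in> Arr C" "p \<in> Arr C" "Cod C j = Dom C p"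
  obtains j' p' where "j' \<in> Arr D" "p' \<in> Arr D" "Cod D j' = Dom D p'" "f = p' \<cdot>\<^bsub>D\<^esub> j'"
    "is_retract_of C (RA p') p" "is_retract_of C (RA j') j"
proof -
  let ?Q = "Dom C p"
  have Q: "?Q \<in> Obj C" using assms by simp
  note n = unit_simps[OF Q]
  obtain u where u: "u \<in> Arr C" "Dom C u = RO (LO ?Q)" "Cod C u = ?Q"
    "u \<cdot>\<^bsub>C\<^esub> unit ?Q = Ident C ?Q" "unit ?Q \<cdot>\<^bsub>C\<^esub> u = Ident C (RO (LO ?Q))"
    using unit_inv[OF Q] by metis
  have "Dom C (RA f) = Dom C j" "Cod C (RA f) = Cod C p" using assms by simp_all
  then have d: "Dom C j = RO (Dom D f)" "Cod C p = RO (Cod D f)" using assms(1) by simp_all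
  obtain p' where p': "p' \<in> Arr D" "Dom D p' = LO ?Q" "Cod D p' = Cod D f" "RA p' = p \<cdot>\<^bsub>C\<^esub> u"
    using R_full[of "p \<cdot>\<^bsub>C\<^esub> u" "LO ?Q" "Cod D f"] u d assms Q by auto
  obtain j' where j': "j' \<in> Arr D" "Dom D j' = Dom D f" "Cod D j' = LO ?Q" "RA j' = unit ?Q \<cdot>\<^bsub>C\<^esub> j"
    using R_full[of "unit ?Q \<cdot>\<^bsub>C\<^esub> j" "Dom D f" "LO ?Q"] n d assms Q by auto
  have "f = p' \<cdot>\<^bsub>D\<^esub> j'"
    by (rule R_faithful) (use assms p' j' u n reassoc[OF u(4), of j] in simp_all)
  moreover have "is_retract_of C (RA p') p"
    unfolding p'(4) by (rule retract_of_Comp_iso(1)[of "unit ?Q" u]) (use u n assms in simp_all)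
  moreover have "is_retract_of C (RA j') j"
    unfolding j'(4) by (rule retract_of_Comp_iso(2)[of "unit ?Q" u]) (use u n assms in simp_all)
  ultimately show ?thesis using that p' j' by metis
qed

lemma weq_fib_category_D: "weq_fib_category D W' F'"
proof
  fix f g assume fg: "f \<in> Arr D" "g \<in> Arr D" "Cod D f = Dom D g"
  then have "RA f \<in> Arr C" "RA g \<in> Arr C" "Cod C (RA f) = Dom C (RA g)" "RA (g \<cdot>\<^bsub>D\<^esub> f) = RA g \<cdot>\<^bsub>C\<^esub> RA f"
    by simp_all
  note W = W_two_of_three[OF this(1-3), folded this(4)]
  show "f \<in> W' \<Longrightarrow> g \<in> W' \<Longrightarrow> g \<cdot>\<^bsub>D\<^esub> f \<in> W'"
    "f \<in> W' \<Longrightarrow> g \<cdot>\<^bsub>D\<^esub> f \<in> W' \<Longrightarrow> g \<in> W'"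
    "g \<in> W' \<Longrightarrow> g \<cdot>\<^bsub>D\<^esub> f \<in> W' \<Longrightarrow> f \<in> W'"
    using W fg by (simp_all only: W'_iff D.Comp_simps simp_thms)
next
  fix f g assume r: "is_retract_of D f g"
  show "g \<in> W' \<Longrightarrow> f \<in> W'" "g \<in> F' \<Longrightarrow> f \<in> F'"
    using W_retract[OF retract_R[OF r]] F_retract[OF retract_R[OF r]] r
    by (simp_all add: W'_iff F'_iff is_retract_of_def)
next
  fix f assume f: "f \<in> Arr D"
  obtain j p where j: "j \<in> W" "p \<in> F" "Cod C j = Dom C p" "RA f = p \<cdot>\<^bsub>C\<^esub> j" "\<forall>q\<in>F. has_lifting C j q"
    using factor_acyclic_cofib[of "RA f"] f by auto
  have jp: "j \<in> Arr C" "p \<in> Arr C" using j W_Arr F_Arr by auto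
  obtain j' p' where j': "j' \<in> Arr D" "p' \<in> Arr D" "Cod D j' = Dom D p'" "f = p' \<cdot>\<^bsub>D\<^esub> j'"
    "is_retract_of C (RA p') p" "is_retract_of C (RA j') j"
    using factor_R[OF f j(4) jp j(3)] .
  have "has_lifting D j' q" if "q \<in> F'" for q
    using has_lifting_R[of j' q] has_lifting_retract[OF j'(6), of "RA q"] j(5) j'(1) that
    by (auto simp: F'_iff)
  then show "\<exists>j\<in>W'. \<exists>p\<in>F'. Cod D j = Dom D p \<and> f = p \<cdot>\<^bsub>D\<^esub> j \<and> (\<forall>q\<in>F'. has_lifting D j q)"
    using j' W_retract[OF j'(6) j(1)] F_retract[OF j'(5) j(2)]
    by (intro bexI[of _ j'] bexI[of _ p']) (simp_all add: W'_iff F'_iff)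
next
  fix f assume f: "f \<in> Arr D"
  obtain j p where j: "j \<in> Arr C" "p \<in> F" "p \<in> W" "Cod C j = Dom C p" "RA f = p \<cdot>\<^bsub>C\<^esub> j"
    "\<forall>q\<in>F \<inter> W. has_lifting C j q"
    using factor_acyclic_fib[of "RA f"] f by auto
  have p: "p \<in> Arr C" using j F_Arr by auto
  obtain j' p' where j': "j' \<in> Arr D" "p' \<in> Arr D" "Cod D j' = Dom D p'" "f = p' \<cdot>\<^bsub>D\<^esub> j'"
    "is_retract_of C (RA p') p" "is_retract_of C (RA j') j"
    using factor_R[OF f j(5) j(1) p j(4)] .
  have "has_lifting D j' q" if "q \<in> F' \<inter> W'" for q
    using has_lifting_R[of j' q] has_lifting_retract[OF j'(6), of "RA q"] j(6) j'(1) that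
    by (auto simp: F'_iff W'_iff)
  then show "\<exists>j\<in>Arr D. \<exists>p\<in>F' \<inter> W'. Cod D j = Dom D p \<and> f = p \<cdot>\<^bsub>D\<^esub> j \<and> (\<forall>q\<in>F' \<inter> W'. has_lifting D j q)"
    using j' W_retract[OF j'(5) j(3)] F_retract[OF j'(5) j(2)]
    by (intro bexI[of _ j'] bexI[of _ p']) (simp_all add: W'_iff F'_iff)
qed (auto simp: W'_iff F'_iff)

lemma quillen_equivalence: "quillen_equivalence (with_weq_fib C W F) (with_weq_fib D W' F') L R"
proof -
  have cof: "LA i \<in> Arr D \<and> (\<forall>p\<in>F' \<inter> W'. has_lifting D (LA i) p)"
    if "i \<in> Arr C" "\<forall>p\<in>F \<inter> W. has_lifting C i p" for i
    using that has_lifting_L[of i] by (simp add: F'_iff W'_iff)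
  \<comment> \<open>L preserves all weak equivalences: by naturality of the unit, R (L i) is i
    conjugated by isomorphisms.\<close>
  have weq: "LA i \<in> W'" if i: "i \<in> W" for i
  proof -
    have ia: "i \<in> Arr C" using i W_Arr by auto
    let ?A = "Dom C i" and ?B = "Cod C i"
    have A: "?A \<in> Obj C" "?B \<in> Obj C" using ia by simp_all
    note n = unit_simps[OF A(1)] unit_simps[OF A(2)]
    obtain u where u: "u \<in> Arr C" "Dom C u = RO (LO ?A)" "Cod C u = ?A"
      "u \<cdot>\<^bsub>C\<^esub> unit ?A = Ident C ?A" "unit ?A \<cdot>\<^bsub>C\<^esub> u = Ident C (RO (LO ?A))"
      using unit_inv[OF A(1)] by metis
    obtain v where v: "v \<in> Arr C" "Dom C v = RO (LO ?B)" "Cod C v = ?B"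
      "v \<cdot>\<^bsub>C\<^esub> unit ?B = Ident C ?B" "unit ?B \<cdot>\<^bsub>C\<^esub> v = Ident C (RO (LO ?B))"
      using unit_inv[OF A(2)] by metis
    have "is_retract_of C (unit ?B \<cdot>\<^bsub>C\<^esub> i) i"
      by (rule retract_of_Comp_iso(2)[of "unit ?B" v]) (use v n ia in simp_all)
    then have "unit ?B \<cdot>\<^bsub>C\<^esub> i \<in> W" using W_retract i by blast
    moreover have "is_retract_of C ((unit ?B \<cdot>\<^bsub>C\<^esub> i) \<cdot>\<^bsub>C\<^esub> u) (unit ?B \<cdot>\<^bsub>C\<^esub> i)"
      by (rule retract_of_Comp_iso(1)[of "unit ?A" u]) (use u n ia in simp_all)
    ultimately have "(unit ?B \<cdot>\<^bsub>C\<^esub> i) \<cdot>\<^bsub>C\<^esub> u \<in> W" using W_retract by blast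
    moreover have "(unit ?B \<cdot>\<^bsub>C\<^esub> i) \<cdot>\<^bsub>C\<^esub> u = RA (LA i)"
      unfolding unit_natural[OF ia, symmetric] using u n ia by simp
    ultimately show ?thesis using ia by (simp add: W'_iff)
  qed
  \<comment> \<open>The adjunct of f is R f composed with the unit, so each of the two is a retract
    of the other.\<close>
  have weq_iff: "f \<in> W' \<longleftrightarrow> \<phi> x y f \<in> W"
    if xy: "x \<in> Obj C" "y \<in> Obj D" and f: "f \<in> Arr D" "Dom D f = LO x" "Cod D f = y" for x y f
  proof -
    note n = unit_simps[OF xy(1)]
    obtain u where u: "u \<in> Arr C" "Dom C u = RO (LO x)" "Cod C u = x"
      "u \<cdot>\<^bsub>C\<^esub> unit x = Ident C x" "unit x \<cdot>\<^bsub>C\<^esub> u = Ident C (RO (LO x))"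
      using unit_inv[OF xy(1)] by metis
    have e: "\<phi> x y f = RA f \<cdot>\<^bsub>C\<^esub> unit x"
      using phi_right[of x "Ident D (LO x)" f] xy f by (simp add: unit_def)
    have 1: "is_retract_of C (RA f \<cdot>\<^bsub>C\<^esub> unit x) (RA f)"
      by (rule retract_of_Comp_iso(1)[of u]) (use u n f in simp_all)
    have "is_retract_of C ((RA f \<cdot>\<^bsub>C\<^esub> unit x) \<cdot>\<^bsub>C\<^esub> u) (RA f \<cdot>\<^bsub>C\<^esub> unit x)"
      by (rule retract_of_Comp_iso(1)[of "unit x"]) (use u n f in simp_all)
    then have 2: "is_retract_of C (RA f) (RA f \<cdot>\<^bsub>C\<^esub> unit x)" using u n f by simp
    show ?thesis using W_retract[OF 1] W_retract[OF 2] f(1) unfolding e W'_iff by blast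
  qed
  have "is_adjunction (with_weq_fib C W F) (with_weq_fib D W' F') L R \<phi>"
    using adj by (simp add: is_adjunction_def is_functor_def)
  then have "quillen_adjunction (with_weq_fib C W F) (with_weq_fib D W' F') L R \<phi>"
    using model_structure weq_fib_category.model_structure[OF weq_fib_category_D] cof weq
    by (simp add: quillen_adjunction_def)
  then show ?thesis
    unfolding quillen_equivalence_def using weq_iff
    by (intro exI[of _ \<phi>]) (simp add: cofibrant_def fibrant_def)
qed

end

section \<open>The simplex category\<close>

abbreviation Simplex_Comp :: "sop \<Rightarrow> sop \<Rightarrow> sop" (infixl \<open>\<odot>\<close> 70) where
  "\<beta> \<odot> \<alpha> \<equiv> \<beta> \<cdot>\<^bsub>Simplex\<^esub> \<alpha>"

lemma Simplex_simps [simp]: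
  "Obj Simplex = UNIV" "Dom Simplex = src" "Cod Simplex = tgt"
  by (simp_all add: Simplex_def)

lemma Arr_Simplex:
  "f \<in> Arr Simplex \<longleftrightarrow> ap f \<in> {..src f} \<rightarrow>\<^sub>E {..tgt f} \<and> mono_on {..src f} (ap f)"
  by (cases f) (auto simp: Simplex_def)

lemma ap_le: "\<lbrakk>f \<in> Arr Simplex; i \<le> src f\<rbrakk> \<Longrightarrow> ap f i \<le> tgt f"
  by (auto simp: Arr_Simplex dest: PiE_mem)

lemma ap_mono: "\<lbrakk>f \<in> Arr Simplex; i \<le> j; j \<le> src f\<rbrakk> \<Longrightarrow> ap f i \<le> ap f j"
  by (auto simp: Arr_Simplex mono_on_def)

lemma sop_eqI:
  assumes "f \<in> Arr Simplex" "g \<in> Arr Simplex" "src f = src g" "tgt f = tgt g"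
    "\<And>i. i \<le> src g \<Longrightarrow> ap f i = ap g i"
  shows "f = g"
proof -
  have "ap f = ap g"
    using assms by (intro PiE_ext[of "ap f" "{..src g}" "\<lambda>_. {..tgt g}" "ap g"]) (auto simp: Arr_Simplex)
  then show ?thesis using assms(3,4) by (simp add: arrow.expand)
qed

definition mk_sop :: "nat \<Rightarrow> (nat \<Rightarrow> nat) \<Rightarrow> nat \<Rightarrow> sop" where
  "mk_sop m a n = Arrow m (\<lambda>i\<in>{..m}. a i) n"

lemma mk_sop_simps [simp]:
  "src (mk_sop m a n) = m" "tgt (mk_sop m a n) = n" "i \<le> m \<Longrightarrow> ap (mk_sop m a n) i = a i"
  by (simp_all add: mk_sop_def)

lemma mk_sop_Arr:
  "\<lbrakk>\<And>i. i \<le> m \<Longrightarrow> a i \<le> n; \<And>i j. \<lbrakk>i \<le> j; j \<le> m\<rbrakk> \<Longrightarrow> a i \<le> a j\<rbrakk> \<Longrightarrow> mk_sop m a n \<in> Arr Simplex"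
  by (auto simp: Arr_Simplex mono_on_def mk_sop_def)

lemma Ident_Simplex: "Ident Simplex n = mk_sop n (\<lambda>i. i) n"
  by (simp add: Simplex_def mk_sop_def)

lemma Comp_Simplex:
  "src (g \<odot> f) = src f" "tgt (g \<odot> f) = tgt g"
  "i \<le> src f \<Longrightarrow> ap (g \<odot> f) i = ap g (ap f i)"
  by (simp_all add: Simplex_def compose_def)

lemma Comp_Simplex_Arr:
  assumes "f \<in> Arr Simplex" "g \<in> Arr Simplex" "tgt f = src g"
  shows "g \<odot> f \<in> Arr Simplex"
proof -
  have "g \<odot> f = mk_sop (src f) (\<lambda>i. ap g (ap f i)) (tgt g)"
    by (simp add: Simplex_def mk_sop_def compose_def)
  moreover have "\<dots> \<in> Arr Simplex"
    using assms by (intro mk_sop_Arr) (metis ap_le, metis ap_le ap_mono)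
  ultimately show ?thesis by simp
qed

interpretation Simplex: category Simplex
proof
  show "Ident Simplex x \<in> Hom Simplex x x" for x
    by (simp add: Ident_Simplex mk_sop_Arr)
  show "g \<odot> f \<in> Hom Simplex x z" if "f \<in> Hom Simplex x y" "g \<in> Hom Simplex y z" for f g x y z
    using that by (simp add: Comp_Simplex Comp_Simplex_Arr)
  show "f \<odot> Ident Simplex x = f" if "f \<in> Hom Simplex x y" for f x y
    by (rule sop_eqI) (use that in \<open>simp_all add: Comp_Simplex Comp_Simplex_Arr Ident_Simplex mk_sop_Arr\<close>)
  show "Ident Simplex y \<odot> f = f" if "f \<in> Hom Simplex x y" for f x y
    by (rule sop_eqI)
      (use that ap_le in \<open>auto simp: Comp_Simplex Comp_Simplex_Arr Ident_Simplex mk_sop_Arr\<close>)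
  show "(h \<odot> g) \<odot> f = h \<odot> (g \<odot> f)"
    if "f \<in> Hom Simplex w x" "g \<in> Hom Simplex x y" "h \<in> Hom Simplex y z" for f g h w x y z
    by (rule sop_eqI) (use that ap_le in \<open>auto simp: Comp_Simplex Comp_Simplex_Arr\<close>)
qed auto

lemmas Simplex_Comp_simps [simp] = Comp_Simplex(1,2) Comp_Simplex_Arr

lemma Ident_Simplex_simps [simp]:
  "Ident Simplex n \<in> Arr Simplex" "src (Ident Simplex n) = n" "tgt (Ident Simplex n) = n"
  "i \<le> n \<Longrightarrow> ap (Ident Simplex n) i = i"
  by (simp_all add: Ident_Simplex mk_sop_Arr)

subsection \<open>Faces and degeneracies\<close>

definition codeg :: "nat \<Rightarrow> nat \<Rightarrow> sop" where
  \<comment> \<open>the surjection \<open>[n + 1] \<rightarrow> [n]\<close> that repeats the value \<open>i\<close>\<close>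
  "codeg n i = mk_sop (Suc n) (\<lambda>j. if j \<le> i then j else j - 1) n"

lemma coface_eq: "coface n i = mk_sop n (\<lambda>j. if j < i then j else Suc j) (Suc n)"
  by (simp add: coface_def mk_sop_def)

lemma to_point_eq: "to_point n = mk_sop n (\<lambda>j. 0) 0"
  by (simp add: to_point_def mk_sop_def)

lemma coface_simps [simp]:
  "coface n i \<in> Arr Simplex" "src (coface n i) = n" "tgt (coface n i) = Suc n"
  "j \<le> n \<Longrightarrow> ap (coface n i) j = (if j < i then j else Suc j)"
  by (auto simp: coface_eq intro!: mk_sop_Arr)

lemma codeg_simps [simp]:
  "i \<le> n \<Longrightarrow> codeg n i \<in> Arr Simplex" "src (codeg n i) = Suc n" "tgt (codeg n i) = n"
  "j \<le> Suc n \<Longrightarrow> ap (codeg n i) j = (if j \<le> i then j else j - 1)"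
  by (auto simp: codeg_def intro!: mk_sop_Arr)

lemma to_point_simps [simp]:
  "to_point n \<in> Arr Simplex" "src (to_point n) = n" "tgt (to_point n) = 0"
  "j \<le> n \<Longrightarrow> ap (to_point n) j = 0"
  by (auto simp: to_point_eq intro!: mk_sop_Arr)

lemma to_point_Comp: "\<lbrakk>f \<in> Arr Simplex; tgt f = n\<rbrakk> \<Longrightarrow> to_point n \<odot> f = to_point (src f)"
  by (rule sop_eqI) (auto simp: Comp_Simplex ap_le)

lemma to_point_0: "to_point 0 = Ident Simplex 0"
  by (rule sop_eqI) simp_all

lemma coface_coface:
  assumes "i < j"
  shows "coface (Suc n) j \<odot> coface n i = coface (Suc n) i \<odot> coface n (j - 1)"
  by (rule sop_eqI) (use assms in \<open>auto simp: Comp_Simplex\<close>)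

lemma codeg_coface_less:
  assumes "i < k" "k \<le> Suc n"
  shows "codeg (Suc n) k \<odot> coface (Suc n) i = coface n i \<odot> codeg n (k - 1)"
  by (rule sop_eqI) (use assms in \<open>auto simp: Comp_Simplex\<close>)

lemma codeg_coface_id:
  assumes "k \<le> n" "i = k \<or> i = Suc k"
  shows "codeg n k \<odot> coface n i = Ident Simplex n"
  by (rule sop_eqI) (use assms in \<open>auto simp: Comp_Simplex\<close>)

lemma codeg_coface_greater:
  assumes "Suc k < i" "i \<le> Suc (Suc n)"
  shows "codeg (Suc n) k \<odot> coface (Suc n) i = coface n (i - 1) \<odot> codeg n k"
  by (rule sop_eqI) (use assms in \<open>auto simp: Comp_Simplex\<close>)

subsection \<open>Injections and surjections\<close>

lemma inj_sop_less:
  assumes "inj_sop f" "i < j" "j \<le> src f"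
  shows "ap f i < ap f j"
  using assms ap_mono[of f i j] by (auto simp: inj_sop_def inj_on_def order_less_le)

lemma inj_sop_gap:
  assumes "inj_sop f" "i \<le> j" "j \<le> src f"
  shows "ap f i + (j - i) \<le> ap f j"
  using assms(2,3)
proof (induction j rule: dec_induct)
  case (step j)
  then show ?case using inj_sop_less[OF assms(1), of j "Suc j"] by simp
qed simp

lemma inj_sop_le: "inj_sop f \<Longrightarrow> src f \<le> tgt f"
  using inj_sop_gap[of f 0 "src f"] ap_le[of f "src f"] by (simp add: inj_sop_def)

lemma inj_sop_Ident:
  assumes "inj_sop f" "src f = tgt f"
  shows "f = Ident Simplex (tgt f)"
proof (rule sop_eqI)
  fix i assume "i \<le> src (Ident Simplex (tgt f))"
  then show "ap f i = ap (Ident Simplex (tgt f)) i"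
    using inj_sop_gap[OF assms(1), of 0 i] inj_sop_gap[OF assms(1), of i "src f"]
      ap_le[of f "src f"] assms by (simp add: inj_sop_def)
qed (use assms in \<open>simp_all add: inj_sop_def\<close>)

lemma inj_sop_Comp:
  "\<lbrakk>inj_sop f; inj_sop g; tgt f = src g\<rbrakk> \<Longrightarrow> inj_sop (g \<odot> f)"
  using ap_le[of f] by (simp add: inj_sop_def inj_on_def Comp_Simplex)

lemma inj_sop_cancel:
  assumes "inj_sop g" "f \<in> Arr Simplex" "f' \<in> Arr Simplex" "tgt f = src g" "tgt f' = src g"
    "g \<odot> f = g \<odot> f'"
  shows "f = f'"
proof (rule sop_eqI)
  show s: "src f = src f'" using arg_cong[OF assms(6), of src] by simp
  fix i assume "i \<le> src f'"
  then have "ap g (ap f i) = ap g (ap f' i)"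
    using arg_cong[OF assms(6), of "\<lambda>h. ap h i"] s by (simp add: Comp_Simplex)
  then show "ap f i = ap f' i"
    using assms ap_le[of f i] ap_le[of f' i] \<open>i \<le> src f'\<close> s by (auto simp: inj_sop_def inj_on_def)
qed (use assms in simp_all)

lemma inj_sop_coface: "inj_sop (coface n i)"
  by (auto simp: inj_sop_def inj_on_def split: if_splits)

lemma inj_sop_id: "inj_sop (Ident Simplex n)"
  by (auto simp: inj_sop_def inj_on_def)

lemma factor_coface:
  assumes "f \<in> Arr Simplex" "tgt f = Suc p" "i \<le> Suc p" "\<And>j. j \<le> src f \<Longrightarrow> ap f j \<noteq> i"
  obtains g where "g \<in> Arr Simplex" "src g = src f" "tgt g = p" "f = coface p i \<odot> g"
proof
  define g where "g = mk_sop (src f) (\<lambda>j. if ap f j < i then ap f j else ap f j - 1) p"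
  show g: "g \<in> Arr Simplex"
    unfolding g_def
  proof (rule mk_sop_Arr)
    show "(if ap f j < i then ap f j else ap f j - 1) \<le> p" if "j \<le> src f" for j
      using ap_le[OF assms(1) that] assms(2,3) by auto
    show "(if ap f j < i then ap f j else ap f j - 1) \<le> (if ap f k < i then ap f k else ap f k - 1)"
      if "j \<le> k" "k \<le> src f" for j k
      using ap_mono[OF assms(1) that] assms(4)[of k] that by auto
  qed
  show s: "src g = src f" "tgt g = p" by (simp_all add: g_def)
  show "f = coface p i \<odot> g"
  proof (rule sop_eqI)
    fix j assume "j \<le> src (coface p i \<odot> g)"
    then have j: "j \<le> src f" using s by simp
    then show "ap f j = ap (coface p i \<odot> g) j"
      using assms(4)[OF j] ap_le[OF assms(1) j] ap_le[OF g, of j] s assms(2)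
      by (auto simp: Comp_Simplex g_def)
  qed (use assms g s in simp_all)
qed

text \<open>Separates the one proper coface that N keeps from the injections that act as zero on
  normalized elements, which factor through a coface omitting some i \<le> p.\<close>

lemma inj_sop_cases:
  assumes "inj_sop f" "src f < tgt f"
  shows "f = coface (src f) (Suc (src f)) \<or>
    (\<exists>p i g. tgt f = Suc p \<and> i \<le> p \<and> g \<in> Arr Simplex \<and> src g = src f \<and> tgt g = p \<and>
       f = coface p i \<odot> g)"
proof (cases "\<exists>i<tgt f. \<forall>j\<le>src f. ap f j \<noteq> i")
  case True
  then obtain i where i: "i < tgt f" "\<And>j. j \<le> src f \<Longrightarrow> ap f j \<noteq> i" by blast
  then obtain p where p: "tgt f = Suc p" by (cases "tgt f") auto
  show ?thesis
    using factor_coface[of f p i] i p assms(1) by (metis inj_sop_def less_Suc_eq_le le_SucI)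
next
  case False
  have fA: "f \<in> Arr Simplex" using assms by (simp add: inj_sop_def)
  \<comment> \<open>If no value below the last is omitted, counting forces the codimension to be one
    and the last value to be the omitted one.\<close>
  have "{..<tgt f} \<subseteq> ap f ` {..src f}" using False by auto
  then have "card {..<tgt f} \<le> card {..src f}"
    by (meson card_image_le card_mono finite_atMost finite_imageI le_trans)
  then have t: "tgt f = Suc (src f)" using assms(2) by simp
  have last: "ap f j \<noteq> tgt f" if "j \<le> src f" for j
  proof
    assume "ap f j = tgt f"
    then have "tgt f \<in> ap f ` {..src f}" using that by (metis atMost_iff imageI)
    moreover have "{..tgt f} = insert (tgt f) {..<tgt f}" by (simp add: lessThan_Suc_atMost[symmetric] lessThan_Suc)
    ultimately have "{..tgt f} \<subseteq> ap f ` {..src f}"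
      using \<open>{..<tgt f} \<subseteq> ap f ` {..src f}\<close> by simp
    then have "card {..tgt f} \<le> card {..src f}"
      by (meson card_image_le card_mono finite_atMost finite_imageI le_trans)
    then show False using t by simp
  qed
  obtain g where g: "g \<in> Arr Simplex" "src g = src f" "tgt g = src f"
    "f = coface (src f) (Suc (src f)) \<odot> g"
    using factor_coface[OF fA t, of "Suc (src f)"] last t by auto
  have "inj_on (\<lambda>j. ap f j) {..src f}" using assms by (simp add: inj_sop_def)
  moreover have "ap f j = ap (coface (src f) (Suc (src f))) (ap g j)" if "j \<le> src f" for j
    using that g(2) by (subst g(4)) (simp add: Comp_Simplex)
  ultimately have "inj_sop g" using g(1,2) by (auto simp: inj_sop_def inj_on_def)
  then have "g = Ident Simplex (src f)" using inj_sop_Ident[of g] g by simp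
  then have "coface (src f) (Suc (src f)) \<odot> g = coface (src f) (Suc (src f))"
    by (simp only:) (rule Simplex.Comp_Ident_simp; simp)
  then show ?thesis using g(4) by metis
qed

lemma gamma_index_iff: "\<eta> \<in> gamma_index n \<longleftrightarrow> surj_sop \<eta> \<and> src \<eta> = n"
  by (simp add: gamma_index_def)

lemma gamma_indexD:
  assumes "\<eta> \<in> gamma_index n"
  shows "\<eta> \<in> Arr Simplex" "src \<eta> = n" "surj_sop \<eta>" "\<And>j. j \<le> tgt \<eta> \<Longrightarrow> \<exists>i\<le>n. ap \<eta> i = j"
proof -
  have "{..tgt \<eta>} \<subseteq> ap \<eta> ` {..n}" using assms by (auto simp: gamma_index_def surj_sop_def)
  then show "\<exists>i\<le>n. ap \<eta> i = j" if "j \<le> tgt \<eta>" for j using that by (auto simp: image_iff subset_iff)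
qed (use assms in \<open>auto simp: gamma_index_def surj_sop_def\<close>)

text \<open>A monotone surjection reaches every value up to its value at i already on {..i}; compare
  cardinalities.\<close>

lemma gamma_index_le:
  assumes "\<eta> \<in> gamma_index n" "i \<le> n"
  shows "ap \<eta> i \<le> i"
proof -
  note g = gamma_indexD[OF assms(1)]
  have "{..ap \<eta> i} \<subseteq> ap \<eta> ` {..i}"
  proof
    fix j assume "j \<in> {..ap \<eta> i}"
    then have j: "j \<le> ap \<eta> i" by simp
    then obtain k where k: "k \<le> n" "ap \<eta> k = j"
      using g(4)[of j] ap_le[OF g(1), of i] g(2) assms(2) by auto
    show "j \<in> ap \<eta> ` {..i}"
    proof (cases "k \<le> i")
      case False
      then have "ap \<eta> i \<le> j" using ap_mono[OF g(1), of i k] k g(2) by simp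
      then show ?thesis using j by auto
    qed (use k in auto)
  qed
  then have "card {..ap \<eta> i} \<le> card {..i}"
    by (meson card_image_le card_mono finite_atMost finite_imageI le_trans)
  then show ?thesis by simp
qed

lemma gamma_index_last:
  assumes "\<eta> \<in> gamma_index n"
  shows "ap \<eta> n = tgt \<eta>"
proof -
  note g = gamma_indexD[OF assms]
  obtain i where "i \<le> n" "ap \<eta> i = tgt \<eta>" using g(4)[of "tgt \<eta>"] by auto
  then show ?thesis using ap_mono[OF g(1), of i n] ap_le[OF g(1), of n] g(2) by simp
qed

lemma gamma_index_tgt: "\<eta> \<in> gamma_index n \<Longrightarrow> tgt \<eta> \<le> n"
  using gamma_index_last gamma_index_le by (metis order_refl)

lemma gamma_index_id: "Ident Simplex n \<in> gamma_index n"
  by (auto simp: gamma_index_def surj_sop_def)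

lemma finite_gamma_index: "finite (gamma_index n)"
proof (rule finite_subset)
  show "gamma_index n \<subseteq> (\<Union>p\<in>{..n}. (\<lambda>a. Arrow n a p) ` ({..n} \<rightarrow>\<^sub>E {..p}))"
  proof
    fix \<eta> assume a: "\<eta> \<in> gamma_index n"
    then have "\<eta> = Arrow n (ap \<eta>) (tgt \<eta>)" using gamma_indexD(2)[OF a] by (cases \<eta>) simp
    moreover have "ap \<eta> \<in> {..n} \<rightarrow>\<^sub>E {..tgt \<eta>}" using gamma_indexD(1,2)[OF a] by (simp add: Arr_Simplex)
    ultimately show "\<eta> \<in> (\<Union>p\<in>{..n}. (\<lambda>a. Arrow n a p) ` ({..n} \<rightarrow>\<^sub>E {..p}))"
      using gamma_index_tgt[OF a] by blast
  qed
qed (auto intro!: finite_PiE)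

definition sec :: "sop \<Rightarrow> sop" where
  \<comment> \<open>the maximal section of a surjection\<close>
  "sec \<eta> = mk_sop (tgt \<eta>) (\<lambda>j. Max {i. i \<le> src \<eta> \<and> ap \<eta> i = j}) (src \<eta>)"

lemma sec_props:
  assumes "\<eta> \<in> gamma_index n"
  shows "sec \<eta> \<in> Arr Simplex" "src (sec \<eta>) = tgt \<eta>" "tgt (sec \<eta>) = n"
    "\<And>j. j \<le> tgt \<eta> \<Longrightarrow> ap \<eta> (ap (sec \<eta>) j) = j"
    "\<And>i. i \<le> n \<Longrightarrow> i \<le> ap (sec \<eta>) (ap \<eta> i)"
    "\<eta> \<odot> sec \<eta> = Ident Simplex (tgt \<eta>)" "inj_sop (sec \<eta>)" "ap (sec \<eta>) (tgt \<eta>) = n"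
proof -
  note g = gamma_indexD[OF assms]
  let ?S = "\<lambda>j. {i. i \<le> n \<and> ap \<eta> i = j}"
  have M: "Max (?S j) \<le> n \<and> ap \<eta> (Max (?S j)) = j" if "j \<le> tgt \<eta>" for j
    using Max_in[of "?S j"] g(4)[OF that] by auto
  have ap: "ap (sec \<eta>) j = Max (?S j)" if "j \<le> tgt \<eta>" for j using that g(2) by (simp add: sec_def)
  show A: "sec \<eta> \<in> Arr Simplex"
    unfolding sec_def
  proof (rule mk_sop_Arr)
    show "Max {i. i \<le> src \<eta> \<and> ap \<eta> i = j} \<le> src \<eta>" if "j \<le> tgt \<eta>" for j
      using M[OF that] g(2) by simp
    show "Max {i. i \<le> src \<eta> \<and> ap \<eta> i = j} \<le> Max {i. i \<le> src \<eta> \<and> ap \<eta> i = k}"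
      if "j \<le> k" "k \<le> tgt \<eta>" for j k
    proof (rule ccontr)
      \<comment> \<open>A larger maximum for the smaller value j would, by monotonicity of \<eta>,
        force k \<le> j and hence j = k.\<close>
      assume 1: "\<not> ?thesis"
      then have "k \<le> j" using M[of j] M[of k] ap_mono[OF g(1), of "Max (?S k)" "Max (?S j)"] that g(2) by simp
      then show False using 1 that by simp
    qed
  qed
  show s: "src (sec \<eta>) = tgt \<eta>" "tgt (sec \<eta>) = n" using g(2) by (simp_all add: sec_def)
  show 1: "ap \<eta> (ap (sec \<eta>) j) = j" if "j \<le> tgt \<eta>" for j using M[OF that] ap[OF that] by simp
  show 2: "i \<le> ap (sec \<eta>) (ap \<eta> i)" if "i \<le> n" for i
    using that ap[of "ap \<eta> i"] ap_le[OF g(1), of i] g(2) by (auto intro!: Max_ge)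
  show "\<eta> \<odot> sec \<eta> = Ident Simplex (tgt \<eta>)"
    by (rule sop_eqI) (use A g s 1 in \<open>simp_all add: Comp_Simplex\<close>)
  show "inj_sop (sec \<eta>)" unfolding inj_sop_def inj_on_def using A 1 s by (metis atMost_iff)
  show "ap (sec \<eta>) (tgt \<eta>) = n"
    using 2[of n] gamma_index_last[OF assms] ap_le[OF A, of "tgt \<eta>"] s by simp
qed

text \<open>Induction on the target dimension: a map that is not onto misses a value, and the
  corresponding coface splits off on the left.\<close>

lemma epi_mono_ex:
  assumes "\<alpha> \<in> Arr Simplex"
  obtains \<theta> \<mu> where "\<theta> \<in> gamma_index (src \<alpha>)" "inj_sop \<mu>" "src \<mu> = tgt \<theta>" "tgt \<mu> = tgt \<alpha>"
    "\<mu> \<odot> \<theta> = \<alpha>"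
proof -
  have "\<exists>\<theta> \<mu>. \<theta> \<in> gamma_index (src \<alpha>) \<and> inj_sop \<mu> \<and> src \<mu> = tgt \<theta> \<and> tgt \<mu> = tgt \<alpha> \<and>
    \<mu> \<odot> \<theta> = \<alpha>"
    using assms
  proof (induction "tgt \<alpha>" arbitrary: \<alpha> rule: less_induct)
    case less
    show ?case
    proof (cases "\<alpha> \<in> gamma_index (src \<alpha>)")
      case True
      have "Ident Simplex (tgt \<alpha>) \<odot> \<alpha> = \<alpha>"
        using less(2) by (intro Simplex.Ident_Comp_simp) simp_all
      then show ?thesis using True inj_sop_id[of "tgt \<alpha>"]
        by (intro exI[of _ \<alpha>] exI[of _ "Ident Simplex (tgt \<alpha>)"]) simp
    next
      case False
      then have "ap \<alpha> ` {..src \<alpha>} \<noteq> {..tgt \<alpha>}" using less(2) by (simp add: gamma_index_iff surj_sop_def)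
      moreover have "ap \<alpha> ` {..src \<alpha>} \<subseteq> {..tgt \<alpha>}" using ap_le[OF less(2)] by auto
      ultimately obtain i where i: "i \<le> tgt \<alpha>" "\<And>j. j \<le> src \<alpha> \<Longrightarrow> ap \<alpha> j \<noteq> i" by blast
      obtain p where p: "tgt \<alpha> = Suc p"
      proof (cases "tgt \<alpha>")
        case 0
        then show ?thesis using i(1) i(2)[of 0] ap_le[OF less(2), of 0] by simp
      qed simp
      obtain g where g: "g \<in> Arr Simplex" "src g = src \<alpha>" "tgt g = p" "\<alpha> = coface p i \<odot> g"
        using factor_coface[OF less(2) p, of i] i p by metis
      obtain \<theta> \<mu> where \<theta>: "\<theta> \<in> gamma_index (src g)" "inj_sop \<mu>" "src \<mu> = tgt \<theta>" "tgt \<mu> = tgt g"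
        "\<mu> \<odot> \<theta> = g"
        using less(1)[of g] g(1,3) p by auto
      have "(coface p i \<odot> \<mu>) \<odot> \<theta> = \<alpha>"
        using \<theta>(2-5) g(1,3) gamma_indexD[OF \<theta>(1)] by (subst g(4)) (simp add: inj_sop_def)
      moreover have "inj_sop (coface p i \<odot> \<mu>)"
        using \<theta> g(1-3) by (intro inj_sop_Comp inj_sop_coface) simp_all
      ultimately show ?thesis using \<theta>(1,3,4) g(2,3) p
        by (intro exI[of _ \<theta>] exI[of _ "coface p i \<odot> \<mu>"]) simp
    qed
  qed
  then show ?thesis using that by blast
qed

text \<open>Composing with a section of \<theta> solves for \<mu>. Used in both directions, the
  resulting injections force the two middle dimensions to agree and are then identities.\<close>

lemma epi_mono_tgt_le:
  assumes "\<theta> \<in> gamma_index n" "\<theta>' \<in> gamma_index n" "inj_sop \<mu>" "\<mu>' \<in> Arr Simplex" "src \<mu> = tgt \<theta>"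
    "src \<mu>' = tgt \<theta>'" "\<mu> \<odot> \<theta> = \<mu>' \<odot> \<theta>'"
  shows "\<mu> = \<mu>' \<odot> (\<theta>' \<odot> sec \<theta>)" "inj_sop (\<theta>' \<odot> sec \<theta>)"
proof -
  note t = gamma_indexD[OF assms(1)] gamma_indexD[OF assms(2)] and s = sec_props[OF assms(1)]
  have \<mu>: "\<mu> \<in> Arr Simplex" using assms(3) by (simp add: inj_sop_def)
  have "\<mu> = \<mu> \<odot> (\<theta> \<odot> sec \<theta>)"
    using Simplex.Comp_Ident_simp[of \<mu> "tgt \<theta>"] \<mu> assms(5) s(6) by simp
  also have "\<dots> = (\<mu> \<odot> \<theta>) \<odot> sec \<theta>" using \<mu> t s assms(5) by simp
  also have "\<dots> = \<mu>' \<odot> (\<theta>' \<odot> sec \<theta>)" unfolding assms(7) using t s assms(4,6) by simp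
  finally show e: "\<mu> = \<mu>' \<odot> (\<theta>' \<odot> sec \<theta>)" .
  have c: "ap \<mu> i = ap \<mu>' (ap (\<theta>' \<odot> sec \<theta>) i)" if "i \<le> tgt \<theta>" for i
    using arg_cong[OF e, of "\<lambda>h. ap h i"] that s by (simp add: Comp_Simplex)
  then show "inj_sop (\<theta>' \<odot> sec \<theta>)"
    using assms(3,5) t s unfolding inj_sop_def inj_on_def
    by (simp add: Comp_Simplex(1,2) c)
qed

lemma epi_mono_unique:
  assumes "\<theta> \<in> gamma_index n" "\<theta>' \<in> gamma_index n" "inj_sop \<mu>" "inj_sop \<mu>'" "src \<mu> = tgt \<theta>"
    "src \<mu>' = tgt \<theta>'" "\<mu> \<odot> \<theta> = \<mu>' \<odot> \<theta>'"
  shows "\<mu> = \<mu>'" "\<theta> = \<theta>'"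
proof -
  note t = gamma_indexD[OF assms(1)] gamma_indexD[OF assms(2)]
    and s = sec_props[OF assms(1)] sec_props[OF assms(2)]
  have \<mu>: "\<mu> \<in> Arr Simplex" "\<mu>' \<in> Arr Simplex" using assms(3,4) by (simp_all add: inj_sop_def)
  note a = epi_mono_tgt_le[OF assms(1,2,3) \<mu>(2) assms(5,6,7)]
    and b = epi_mono_tgt_le[OF assms(2,1,4) \<mu>(1) assms(6,5) assms(7)[symmetric]]
  have "tgt \<theta> = tgt \<theta>'" using inj_sop_le[OF a(2)] inj_sop_le[OF b(2)] s by simp
  then have "\<theta>' \<odot> sec \<theta> = Ident Simplex (tgt \<theta>')"
    using inj_sop_Ident[OF a(2)] s by simp
  then show 1: "\<mu> = \<mu>'" using a(1) Simplex.Comp_Ident_simp[of \<mu>' "tgt \<theta>'"] \<mu> assms(6) by simp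
  show "\<theta> = \<theta>'"
    by (rule inj_sop_cancel[OF assms(3)]) (use t assms 1 in simp_all)
qed

text \<open>The triangularity behind the uniqueness of the Dold--Kan decomposition: relative to the
  pointwise order on surjections, pulling back along the maximal section of \<open>\<eta>\<close> only sees
  summands below \<open>\<eta>\<close>.  Since the section hits the last vertex, the one nontrivial coefficient
  of the complex, which belongs to the last coface, cannot occur.\<close>

lemma sec_triangular:
  assumes "\<eta> \<in> gamma_index n" "\<eta>' \<in> gamma_index n" "\<theta> \<in> gamma_index (tgt \<eta>)" "inj_sop \<mu>"
    "src \<mu> = tgt \<theta>" "tgt \<mu> = tgt \<eta>'" "\<mu> \<odot> \<theta> = \<eta>' \<odot> sec \<eta>"
  shows "\<mu> \<noteq> coface (src \<mu>) (Suc (src \<mu>))" "src \<mu> = tgt \<mu> \<Longrightarrow> i \<le> n \<Longrightarrow> ap \<eta>' i \<le> ap \<eta> i"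
proof -
  note e = gamma_indexD[OF assms(1)] and e' = gamma_indexD[OF assms(2)] and t = gamma_indexD[OF assms(3)]
    and s = sec_props[OF assms(1)]
  have ap: "ap \<mu> (ap \<theta> j) = ap \<eta>' (ap (sec \<eta>) j)" if "j \<le> tgt \<eta>" for j
    using arg_cong[OF assms(7), of "\<lambda>h. ap h j"] that s t(2) by (simp add: Comp_Simplex)
  have "ap \<mu> (ap \<theta> (tgt \<eta>)) = tgt \<mu>" using ap[of "tgt \<eta>"] s(8) gamma_index_last[OF assms(2)] assms(6) by simp
  moreover have "ap \<theta> (tgt \<eta>) \<le> src \<mu>" using ap_le[OF t(1), of "tgt \<eta>"] t(2) assms(5) by simp
  ultimately show "\<mu> \<noteq> coface (src \<mu>) (Suc (src \<mu>))"
    using coface_simps(3,4)[of "src \<mu>" "Suc (src \<mu>)"] coface_simps(4)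
    by (metis le_imp_less_Suc less_irrefl_nat)
  assume st: "src \<mu> = tgt \<mu>" and i: "i \<le> n"
  have \<mu>: "\<mu> = Ident Simplex (tgt \<mu>)" using inj_sop_Ident[OF assms(4) st] .
  have ei: "ap \<eta> i \<le> tgt \<eta>" using ap_le[OF e(1)] e(2) i by simp
  have "ap \<eta>' i \<le> ap \<eta>' (ap (sec \<eta>) (ap \<eta> i))"
    using ap_mono[OF e'(1), of i "ap (sec \<eta>) (ap \<eta> i)"] s(5)[OF i] ap_le[OF s(1)] s(2,3) ei e'(2) by simp
  also have "\<dots> = ap \<mu> (ap \<theta> (ap \<eta> i))" using ap[OF ei] by simp
  also have "\<dots> = ap \<theta> (ap \<eta> i)"
    using \<mu> ap_le[OF t(1), of "ap \<eta> i"] t(2) ei assms(5) st by (metis Ident_Simplex_simps(4))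
  also have "\<dots> \<le> ap \<eta> i" using gamma_index_le[OF assms(3) ei] .
  finally show "ap \<eta>' i \<le> ap \<eta> i" .
qed

text \<open>The maximal section of a non-identity surjection hits the last vertex, so among the
  cases for injections only the omission of an earlier vertex is left. Hence restriction along it
  annihilates normalized elements.\<close>

lemma sec_factor_coface:
  assumes "\<eta> \<in> gamma_index n" "\<eta> \<noteq> Ident Simplex n"
  obtains p i g where "n = Suc p" "i \<le> p" "g \<in> Arr Simplex" "src g = tgt \<eta>" "tgt g = p"
    "sec \<eta> = coface p i \<odot> g"
proof -
  note e = gamma_indexD[OF assms(1)] and s = sec_props[OF assms(1)]
  have "src (sec \<eta>) \<noteq> tgt (sec \<eta>)"
  proof
    assume 1: "src (sec \<eta>) = tgt (sec \<eta>)"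
    then have "sec \<eta> = Ident Simplex n" using inj_sop_Ident[OF s(7)] s by simp
    then show False using s(6) 1 Simplex.Comp_Ident_simp[of \<eta> n] e s assms(2) by simp
  qed
  then have "src (sec \<eta>) < tgt (sec \<eta>)" using inj_sop_le[OF s(7)] by simp
  moreover have "sec \<eta> \<noteq> coface (src (sec \<eta>)) (Suc (src (sec \<eta>)))"
    by (metis coface_simps(3,4) lessI less_irrefl_nat order_refl s(2,3,8))
  ultimately show ?thesis using inj_sop_cases[OF s(7)] that s(2,3) by metis
qed

section \<open>Chain complexes and quasi-isomorphisms\<close>

lemma arrow_eqI:
  assumes "src f = src g" "tgt f = tgt g" "\<And>n. ap f n = ap g n"
  shows "f = g"
  using assms by (simp add: arrow.expand ext)

context additive_category
begin

lemma chain_simps [simp]: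
  assumes "X \<in> chain_complexes E"
  shows "ob X n \<in> Obj E" "bd X n \<in> Arr E" "Dom E (bd X n) = ob X (Suc n)" "Cod E (bd X n) = ob X n"
    "bd X n \<cdot> bd X (Suc n) = Zero E (ob X (Suc (Suc n))) (ob X n)"
  using assms by (simp_all add: chain_complexes_def)

lemma bd_bd [simp]:
  assumes "X \<in> chain_complexes E" "x \<in> Arr E" "Cod E x = ob X (Suc (Suc n))"
  shows "bd X n \<cdot> (bd X (Suc n) \<cdot> x) = Zero E (Dom E x) (ob X n)"
  using reassoc[OF chain_simps(5)[of X n], of x] assms by simp

lemma Ch_simps [simp]:
  "Obj (Ch E) = chain_complexes E" "Dom (Ch E) = src" "Cod (Ch E) = tgt"
  by (simp_all add: Ch_def)

lemma Arr_Ch_iff: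
  "f \<in> Arr (Ch E) \<longleftrightarrow> src f \<in> chain_complexes E \<and> tgt f \<in> chain_complexes E \<and>
     (\<forall>n. ap f n \<in> Arr E \<and> Dom E (ap f n) = ob (src f) n \<and>
          Cod E (ap f n) = ob (tgt f) n) \<and>
     (\<forall>n. bd (tgt f) n \<cdot> ap f (Suc n) = ap f n \<cdot> bd (src f) n)"
  by (cases f) (auto simp: Ch_def)

lemma Arr_Ch_simps [simp]:
  assumes "f \<in> Arr (Ch E)"
  shows "src f \<in> chain_complexes E" "tgt f \<in> chain_complexes E"
    "ap f n \<in> Arr E" "Dom E (ap f n) = ob (src f) n"
    "Cod E (ap f n) = ob (tgt f) n"
    "bd (tgt f) n \<cdot> ap f (Suc n) = ap f n \<cdot> bd (src f) n"
  using assms by (simp_all add: Arr_Ch_iff)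

lemma chain_map_bd [simp]:
  assumes "f \<in> Arr (Ch E)" "x \<in> Arr E" "Cod E x = ob (src f) (Suc n)"
  shows "bd (tgt f) n \<cdot> (ap f (Suc n) \<cdot> x) = ap f n \<cdot> (bd (src f) n \<cdot> x)"
  using reassoc[OF Arr_Ch_simps(6)[OF assms(1)], of n x] assms by simp

lemma Ident_Ch [simp]:
  "src (Ident (Ch E) X) = X" "tgt (Ident (Ch E) X) = X"
  "ap (Ident (Ch E) X) n = Ident E (ob X n)"
  by (simp_all add: Ch_def)

lemma Comp_Ch [simp]:
  "src (g \<cdot>\<^bsub>Ch E\<^esub> f) = src f" "tgt (g \<cdot>\<^bsub>Ch E\<^esub> f) = tgt g"
  "ap (g \<cdot>\<^bsub>Ch E\<^esub> f) n = ap g n \<cdot> ap f n"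
  by (simp_all add: Ch_def)

lemma category_Ch: "category (Ch E)"
proof
  show "Ident (Ch E) x \<in> Hom (Ch E) x x" if "x \<in> Obj (Ch E)" for x
    using that by (simp add: Arr_Ch_iff)
  show "g \<cdot>\<^bsub>Ch E\<^esub> f \<in> Hom (Ch E) x z" if a: "f \<in> Hom (Ch E) x y" "g \<in> Hom (Ch E) y z" for f g x y z
  proof -
    have fg: "f \<in> Arr (Ch E)" "g \<in> Arr (Ch E)" "tgt f = src g" using a by simp_all
    have "bd (tgt g) n \<cdot> (ap g (Suc n) \<cdot> ap f (Suc n))
        = ap g n \<cdot> (ap f n \<cdot> bd (src f) n)" for n
      using fg chain_map_bd[OF fg(2), of "ap f (Suc n)" n]
        Arr_Ch_simps(6)[OF fg(1), of n, unfolded fg(3)] by simp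
    then have "g \<cdot>\<^bsub>Ch E\<^esub> f \<in> Arr (Ch E)" unfolding Arr_Ch_iff using fg by simp
    then show ?thesis using a by simp
  qed
  show "f \<cdot>\<^bsub>Ch E\<^esub> Ident (Ch E) x = f" "Ident (Ch E) y \<cdot>\<^bsub>Ch E\<^esub> f = f"
    if "f \<in> Hom (Ch E) x y" for f x y
    by (rule arrow_eqI; use that in simp)+
  show "(h \<cdot>\<^bsub>Ch E\<^esub> g) \<cdot>\<^bsub>Ch E\<^esub> f = h \<cdot>\<^bsub>Ch E\<^esub> (g \<cdot>\<^bsub>Ch E\<^esub> f)"
    if "f \<in> Hom (Ch E) w x" "g \<in> Hom (Ch E) x y" "h \<in> Hom (Ch E) y z" for f g h w x y z
    by (rule arrow_eqI; use that in simp)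
qed simp_all

text \<open>A generalized cycle with domain P. The quantifier over k makes the last condition empty
  in degree 0, where the differential would leave the complex.\<close>

definition cycle :: "('a, 'b) chain \<Rightarrow> nat \<Rightarrow> 'a \<Rightarrow> 'b \<Rightarrow> bool" where
  "cycle X n P x \<longleftrightarrow> x \<in> Arr E \<and> Dom E x = P \<and> Cod E x = ob X n \<and>
     (\<forall>k. n = Suc k \<longrightarrow> bd X k \<cdot> x = Zero E P (ob X k))"

text \<open>In degree 0 this asks that every arrow from P into X_0 be a boundary, matching Z_{-1} =
  0 in \<open>acyclic\<close>.\<close>

definition hom_acyclic :: "'a \<Rightarrow> ('a, 'b) chain \<Rightarrow> bool" where
  "hom_acyclic P X \<longleftrightarrow> (\<forall>n x. cycle X n P x \<longrightarrow>
     (\<exists>a\<in>Arr E. Dom E a = P \<and> Cod E a = ob X (Suc n) \<and> bd X n \<cdot> a = x))"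

text \<open>The map induced by \<open>f\<close> on the homology of \<open>Hom(P, -)\<close> is injective and surjective.\<close>

definition hom_quasi_iso :: "'a \<Rightarrow> ('a, 'b) chain_map \<Rightarrow> bool" where
  "hom_quasi_iso P f \<longleftrightarrow>
     (\<forall>n x b. cycle (src f) n P x \<and> b \<in> Arr E \<and> Dom E b = P \<and> Cod E b = ob (tgt f) (Suc n) \<and>
        bd (tgt f) n \<cdot> b = ap f n \<cdot> x \<longrightarrow>
        (\<exists>a\<in>Arr E. Dom E a = P \<and> Cod E a = ob (src f) (Suc n) \<and> bd (src f) n \<cdot> a = x)) \<and>
     (\<forall>n y. cycle (tgt f) n P y \<longrightarrow>
        (\<exists>x b. cycle (src f) n P x \<and> b \<in> Arr E \<and> Dom E b = P \<and> Cod E b = ob (tgt f) (Suc n) \<and>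
           ap f n \<cdot> x \<boxplus> bd (tgt f) n \<cdot> b = y))"

lemma cycle_simps:
  assumes "cycle X n P x"
  shows "x \<in> Arr E" "Dom E x = P" "Cod E x = ob X n" "n = Suc k \<Longrightarrow> bd X k \<cdot> x = Zero E P (ob X k)"
  using assms by (simp_all add: cycle_def)

lemma cycle_0: "cycle X 0 P x \<longleftrightarrow> x \<in> Arr E \<and> Dom E x = P \<and> Cod E x = ob X 0"
  by (simp add: cycle_def)

lemma cycle_Suc: "cycle X (Suc n) P x \<longleftrightarrow> x \<in> Arr E \<and> Dom E x = P \<and> Cod E x = ob X (Suc n) \<and>
    bd X n \<cdot> x = Zero E P (ob X n)"
  by (auto simp: cycle_def)

lemma cycle_bd:
  assumes "X \<in> chain_complexes E" "a \<in> Arr E" "Dom E a = P" "Cod E a = ob X (Suc n)"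
  shows "cycle X n P (bd X n \<cdot> a)"
  using assms by (auto simp: cycle_def)

lemma cycle_map:
  assumes "f \<in> Arr (Ch E)" "cycle (src f) n P x"
  shows "cycle (tgt f) n P (ap f n \<cdot> x)"
  using assms by (auto simp: cycle_def)

lemma cycle_Add:
  assumes "X \<in> chain_complexes E" "P \<in> Obj E" "cycle X n P x" "cycle X n P y"
  shows "cycle X n P (x \<boxplus> y)"
  using assms by (auto simp: cycle_def)

lemma cycle_Neg:
  assumes "X \<in> chain_complexes E" "cycle X n P x"
  shows "cycle X n P (Neg E x)"
  using assms by (auto simp: cycle_def)

subsection \<open>The mapping cone\<close>

context
  fixes f :: "('a, 'b) chain_map" assumes f: "f \<in> Arr (Ch E)"
begin

private abbreviation (input) "X \<equiv> src f"
private abbreviation (input) "Y \<equiv> tgt f"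
private abbreviation (input) "F \<equiv> ap f"
private abbreviation (input) "iT n \<equiv> cone_in E f n True"
private abbreviation (input) "iF n \<equiv> cone_in E f (Suc n) False"
private abbreviation (input) "pT n \<equiv> dsum_pr (cone_index n) (cone_family f n) True"
private abbreviation (input) "pF n \<equiv> dsum_pr (cone_index (Suc n)) (cone_family f (Suc n)) False"

lemma cone_biproduct: "is_biproduct E (cone_index n) (cone_family f n) (cone_ob E f n)
    (cone_in E f n) (dsum_pr (cone_index n) (cone_family f n))"
  unfolding cone_ob_def cone_in_def
  by (rule dsum_biproduct) (use f in \<open>simp_all add: cone_index_def cone_family_def\<close>)

lemma cone_simps [simp]:
  "cone_ob E f n \<in> Obj E"
  "iT n \<in> Arr E" "Dom E (iT n) = ob Y n" "Cod E (iT n) = cone_ob E f n"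
  "iF n \<in> Arr E" "Dom E (iF n) = ob X n" "Cod E (iF n) = cone_ob E f (Suc n)"
  "pT n \<in> Arr E" "Dom E (pT n) = cone_ob E f n" "Cod E (pT n) = ob Y n"
  "pF n \<in> Arr E" "Dom E (pF n) = cone_ob E f (Suc n)" "Cod E (pF n) = ob X n"
  "pT n \<cdot> iT n = Ident E (ob Y n)" "pF n \<cdot> iF n = Ident E (ob X n)"
  "pT (Suc n) \<cdot> iF n = Zero E (ob X n) (ob Y (Suc n))" "pF n \<cdot> iT (Suc n) = Zero E (ob Y (Suc n)) (ob X n)"
  using biproduct_simps(2)[OF cone_biproduct[of n]] biproduct_simps(4-10)[OF cone_biproduct[of n], of True]
    biproduct_simps(4-10)[OF cone_biproduct[of "Suc n"], of False]
    biproduct_simps(11)[OF cone_biproduct[of "Suc n"], of False True]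
    biproduct_simps(11)[OF cone_biproduct[of "Suc n"], of True False]
  by (simp_all add: cone_index_def cone_family_def)

lemma cone_ext:
  assumes "u \<in> Arr E" "v \<in> Arr E" "Dom E u = cone_ob E f n" "Dom E v = cone_ob E f n" "Cod E u = Cod E v"
    "u \<cdot> iT n = v \<cdot> iT n" "\<And>k. n = Suc k \<Longrightarrow> u \<cdot> iF k = v \<cdot> iF k"
  shows "u = v"
proof (rule biproduct_ext_inc[OF cone_biproduct[of n]])
  fix i assume "i \<in> cone_index n"
  then show "u \<cdot> cone_in E f n i = v \<cdot> cone_in E f n i"
    using assms(6,7) by (cases i; cases n) (simp_all add: cone_index_def)
qed (use assms in simp_all)

lemma cone_elem_0:
  assumes "z \<in> Arr E" "Cod E z = cone_ob E f 0"
  shows "z = iT 0 \<cdot> (pT 0 \<cdot> z)"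
proof -
  have "Ident E (cone_ob E f 0) = iT 0 \<cdot> pT 0"
    by (rule cone_ext) (use f in auto)
  then have "Ident E (cone_ob E f 0) \<cdot> z = (iT 0 \<cdot> pT 0) \<cdot> z" by simp
  then show ?thesis using assms by simp
qed

lemma cone_elem_Suc:
  assumes "z \<in> Arr E" "Cod E z = cone_ob E f (Suc n)"
  shows "z = iT (Suc n) \<cdot> (pT (Suc n) \<cdot> z) \<boxplus> iF n \<cdot> (pF n \<cdot> z)"
proof -
  have "Ident E (cone_ob E f (Suc n)) = iT (Suc n) \<cdot> pT (Suc n) \<boxplus> iF n \<cdot> pF n"
    by (rule cone_ext) (use f in auto)
  then have "Ident E (cone_ob E f (Suc n)) \<cdot> z = (iT (Suc n) \<cdot> pT (Suc n) \<boxplus> iF n \<cdot> pF n) \<cdot> z" by simp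
  then show ?thesis using assms by simp
qed

lemma iT_mono [simp]:
  assumes "y \<in> Arr E" "y' \<in> Arr E" "Dom E y = Dom E y'" "Cod E y = ob Y n" "Cod E y' = ob Y n"
  shows "iT n \<cdot> y = iT n \<cdot> y' \<longleftrightarrow> y = y'"
proof
  assume "iT n \<cdot> y = iT n \<cdot> y'"
  then have "pT n \<cdot> (iT n \<cdot> y) = pT n \<cdot> (iT n \<cdot> y')" by simp
  then show "y = y'" using assms reassoc[OF cone_simps(14)[of n]] f by simp
qed simp

lemma cone_elem_eq:
  assumes "y \<in> Arr E" "y' \<in> Arr E" "Dom E y = P" "Cod E y = ob Y (Suc n)" "Dom E y' = P" "Cod E y' = ob Y (Suc n)"
    "x \<in> Arr E" "x' \<in> Arr E" "Dom E x = P" "Cod E x = ob X n" "Dom E x' = P" "Cod E x' = ob X n"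
  shows "iT (Suc n) \<cdot> y \<boxplus> iF n \<cdot> x = iT (Suc n) \<cdot> y' \<boxplus> iF n \<cdot> x' \<longleftrightarrow> y = y' \<and> x = x'"
proof
  assume e: "iT (Suc n) \<cdot> y \<boxplus> iF n \<cdot> x = iT (Suc n) \<cdot> y' \<boxplus> iF n \<cdot> x'"
  note r = reassoc[OF cone_simps(14)[of "Suc n"]] reassoc[OF cone_simps(15)[of n]]
    reassoc[OF cone_simps(16)[of n]] reassoc[OF cone_simps(17)[of n]]
  have "pT (Suc n) \<cdot> (iT (Suc n) \<cdot> y \<boxplus> iF n \<cdot> x) = pT (Suc n) \<cdot> (iT (Suc n) \<cdot> y' \<boxplus> iF n \<cdot> x')"
    "pF n \<cdot> (iT (Suc n) \<cdot> y \<boxplus> iF n \<cdot> x) = pF n \<cdot> (iT (Suc n) \<cdot> y' \<boxplus> iF n \<cdot> x')"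
    using e by simp_all
  then show "y = y' \<and> x = x'" using assms r f by simp
qed simp

text \<open>The differential is specified by its values on the summands: \<open>copair_ex\<close>
  gives existence and \<open>cone_ext\<close> uniqueness, which gives the definite description its
  value.\<close>

lemma bd_cone:
  "bd (cone E f) n \<in> Arr E" "Dom E (bd (cone E f) n) = cone_ob E f (Suc n)"
  "Cod E (bd (cone E f) n) = cone_ob E f n"
  "bd (cone E f) n \<cdot> iT (Suc n) = iT n \<cdot> bd Y n"
  "n = 0 \<Longrightarrow> bd (cone E f) n \<cdot> iF n = iT n \<cdot> F n"
  "n = Suc k \<Longrightarrow> bd (cone E f) n \<cdot> iF n = iT n \<cdot> F n \<boxplus> iF k \<cdot> Neg E (bd X k)"
proof -
  let ?g = "\<lambda>b. if b then iT n \<cdot> bd Y n else (case n of 0 \<Rightarrow> iT 0 \<cdot> F 0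
    | Suc k \<Rightarrow> iT n \<cdot> F n \<boxplus> iF k \<cdot> Neg E (bd X k))"
  let ?Q = "\<lambda>d. d \<in> Hom E (cone_ob E f (Suc n)) (cone_ob E f n) \<and>
       d \<cdot> iT (Suc n) = iT n \<cdot> bd Y n \<and>
       d \<cdot> iF n = (case n of 0 \<Rightarrow> iT 0 \<cdot> F 0
          | Suc k \<Rightarrow> iT n \<cdot> F n \<boxplus> cone_in E f n False \<cdot> Neg E (bd X k))"
  obtain u where u: "u \<in> Arr E" "Dom E u = dsum E (cone_index (Suc n)) (cone_family f (Suc n))"
    "Cod E u = cone_ob E f n"
    "\<And>k. k \<in> cone_index (Suc n) \<Longrightarrow> u \<cdot> dsum_in E (cone_index (Suc n)) (cone_family f (Suc n)) k = ?g k"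
  proof (rule copair_ex[where g="?g" and y="cone_ob E f n"])
    show "?g i \<in> Arr E \<and> Dom E (?g i) = cone_family f (Suc n) i \<and> Cod E (?g i) = cone_ob E f n"
      if "i \<in> cone_index (Suc n)" for i
      using f by (simp add: cone_family_def split: nat.split)
  qed (simp_all add: cone_index_def)
  have Qu: "?Q u" using u(1-3) u(4)[of True] u(4)[of False]
    by (simp add: cone_ob_def cone_in_def cone_index_def split: nat.split)
  have uniq: "d = u" if "?Q d" for d
    by (rule cone_ext[of _ _ "Suc n"]) (use that Qu in auto)
  have "bd (cone E f) n = (THE d. ?Q d)" by (simp only: cone_def chain.sel)
  then have "?Q (bd (cone E f) n)" by (rule ssubst) (rule theI[of ?Q, OF Qu uniq])
  then show "bd (cone E f) n \<in> Arr E" "Dom E (bd (cone E f) n) = cone_ob E f (Suc n)"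
    "Cod E (bd (cone E f) n) = cone_ob E f n"
    "bd (cone E f) n \<cdot> iT (Suc n) = iT n \<cdot> bd Y n"
    "n = 0 \<Longrightarrow> bd (cone E f) n \<cdot> iF n = iT n \<cdot> F n"
    "n = Suc k \<Longrightarrow> bd (cone E f) n \<cdot> iF n = iT n \<cdot> F n \<boxplus> iF k \<cdot> Neg E (bd X k)"
    by auto
qed

lemma ob_cone [simp]: "ob (cone E f) n = cone_ob E f n"
  by (simp add: cone_def)

lemma bd_cone_elem:
  assumes x: "x \<in> Arr E" "Dom E x = P" "Cod E x = ob X n" and y: "y \<in> Arr E" "Dom E y = P" "Cod E y = ob Y (Suc n)"
  shows "n = 0 \<Longrightarrow> bd (cone E f) n \<cdot> (iT (Suc n) \<cdot> y \<boxplus> iF n \<cdot> x) = iT n \<cdot> (bd Y n \<cdot> y \<boxplus> F n \<cdot> x)"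
    "n = Suc k \<Longrightarrow> bd (cone E f) n \<cdot> (iT (Suc n) \<cdot> y \<boxplus> iF n \<cdot> x)
      = iT n \<cdot> (bd Y n \<cdot> y \<boxplus> F n \<cdot> x) \<boxplus> iF k \<cdot> Neg E (bd X k \<cdot> x)"
  using reassoc[OF bd_cone(4)[of n], of y] reassoc[OF bd_cone(5)[of n], of x]
    reassoc[OF bd_cone(6)[of n k], of x] bd_cone(1-3)[of n] f assms
  by (simp_all add: Add_ac)

lemma cone_chain: "cone E f \<in> chain_complexes E"
proof -
  have "bd (cone E f) n \<cdot> bd (cone E f) (Suc n) = Zero E (cone_ob E f (Suc (Suc n))) (cone_ob E f n)" for n
  proof (rule cone_ext[of _ _ "Suc (Suc n)"])
    show "(bd (cone E f) n \<cdot> bd (cone E f) (Suc n)) \<cdot> iT (Suc (Suc n))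
        = Zero E (cone_ob E f (Suc (Suc n))) (cone_ob E f n) \<cdot> iT (Suc (Suc n))"
      using bd_cone(1-4)[of n] bd_cone(1-4)[of "Suc n"] reassoc[OF bd_cone(4)[of n], of "bd Y (Suc n)"] f by simp
    fix k assume "Suc (Suc n) = Suc k"
    then have k: "k = Suc n" by simp
    have "bd (cone E f) n \<cdot> (iT (Suc n) \<cdot> F (Suc n) \<boxplus> iF n \<cdot> Neg E (bd X n))
        = Zero E (ob X (Suc n)) (cone_ob E f n)"
    proof (cases n)
      case 0
      then show ?thesis
        using bd_cone_elem(1)[of "Neg E (bd X n)" "ob X (Suc n)" n "F (Suc n)"] f by simp
    next
      case (Suc m)
      then show ?thesis
        using bd_cone_elem(2)[of "Neg E (bd X n)" "ob X (Suc n)" n "F (Suc n)" m] f by simp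
    qed
    then show "(bd (cone E f) n \<cdot> bd (cone E f) (Suc n)) \<cdot> iF k
        = Zero E (cone_ob E f (Suc (Suc n))) (cone_ob E f n) \<cdot> iF k"
      using bd_cone(1-3)[of n] bd_cone(1-3)[of "Suc n"] bd_cone(6)[of "Suc n" n] f by (simp add: k)
  qed (use bd_cone(1-3)[of n] bd_cone(1-3)[of "Suc n"] f in simp_all)
  moreover have "bd (cone E f) n \<in> Hom E (cone_ob E f (Suc n)) (cone_ob E f n)" for n
    using bd_cone(1-3)[of n] by simp
  ultimately show ?thesis unfolding chain_complexes_def mem_Collect_eq ob_cone using cone_simps(1) by blast
qed

lemma cone_cycle:
  assumes x: "x \<in> Arr E" "Dom E x = P" "Cod E x = ob X n" and y: "y \<in> Arr E" "Dom E y = P" "Cod E y = ob Y (Suc n)"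
  shows "cycle (cone E f) (Suc n) P (iT (Suc n) \<cdot> y \<boxplus> iF n \<cdot> x) \<longleftrightarrow>
    cycle X n P x \<and> bd Y n \<cdot> y \<boxplus> F n \<cdot> x = Zero E P (ob Y n)"
proof -
  have P: "P \<in> Obj E" using x by auto
  show ?thesis
  proof (cases n)
    case 0
    then show ?thesis
      using bd_cone_elem(1)[OF x y] iT_mono[of "bd Y n \<cdot> y \<boxplus> F n \<cdot> x" "Zero E P (ob Y n)" n] f assms P
      by (simp add: cycle_Suc cycle_0)
  next
    case (Suc k)
    then show ?thesis
      using bd_cone_elem(2)[OF x y, of k] f assms P
        cone_elem_eq[of "bd Y n \<cdot> y \<boxplus> F n \<cdot> x" "Zero E P (ob Y n)" P k "Neg E (bd X k \<cdot> x)" "Zero E P (ob X k)"]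
      by (auto simp: cycle_Suc)
  qed
qed

text \<open>If f x = d b, then (-b, x) is a cycle of the cone, written with the Y-component first,
  and the X-component of a chain bounding it bounds x up to sign. If y is a cycle of Y, the
  components of a chain bounding (y, 0) solve f x + d b = y.\<close>

lemma hom_acyclic_cone_imp:
  assumes P: "P \<in> Obj E" and ac: "hom_acyclic P (cone E f)"
  shows "hom_quasi_iso P f"
  unfolding hom_quasi_iso_def
proof (intro conjI allI impI; (elim conjE)?)
  fix n x b assume x: "cycle X n P x" and b: "b \<in> Arr E" "Dom E b = P" "Cod E b = ob Y (Suc n)"
    "bd Y n \<cdot> b = F n \<cdot> x"
  note xs = cycle_simps(1-3)[OF x]
  have "cycle (cone E f) (Suc n) P (iT (Suc n) \<cdot> Neg E b \<boxplus> iF n \<cdot> x)"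
    by (subst cone_cycle) (use x xs b f P in simp_all)
  then obtain w where w: "w \<in> Arr E" "Dom E w = P" "Cod E w = cone_ob E f (Suc (Suc n))"
    "bd (cone E f) (Suc n) \<cdot> w = iT (Suc n) \<cdot> Neg E b \<boxplus> iF n \<cdot> x"
    using ac unfolding hom_acyclic_def by auto
  let ?y = "pT (Suc (Suc n)) \<cdot> w" and ?x = "pF (Suc n) \<cdot> w"
  have "iT (Suc n) \<cdot> (bd Y (Suc n) \<cdot> ?y \<boxplus> F (Suc n) \<cdot> ?x) \<boxplus> iF n \<cdot> Neg E (bd X n \<cdot> ?x)
      = iT (Suc n) \<cdot> Neg E b \<boxplus> iF n \<cdot> x"
    using bd_cone_elem(2)[of ?x P "Suc n" ?y n] cone_elem_Suc[of w "Suc n"] w f by simp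
  then have "Neg E (bd X n \<cdot> ?x) = x"
    using cone_elem_eq[of "bd Y (Suc n) \<cdot> ?y \<boxplus> F (Suc n) \<cdot> ?x" "Neg E b" P n "Neg E (bd X n \<cdot> ?x)" x]
      w xs b f by simp
  then show "\<exists>a\<in>Arr E. Dom E a = P \<and> Cod E a = ob X (Suc n) \<and> bd X n \<cdot> a = x"
    using w f by (intro bexI[of _ "Neg E ?x"]) simp_all
next
  fix n y assume y: "cycle Y n P y"
  note ys = cycle_simps(1-3)[OF y]
  have "cycle (cone E f) n P (iT n \<cdot> y)"
  proof (cases n)
    case (Suc k)
    then show ?thesis using y reassoc[OF bd_cone(4)[of k], of y] bd_cone(1-3)[of k] f P
      by (simp add: cycle_Suc)
  qed (use ys in \<open>simp add: cycle_0\<close>)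
  then obtain w where w: "w \<in> Arr E" "Dom E w = P" "Cod E w = cone_ob E f (Suc n)"
    "bd (cone E f) n \<cdot> w = iT n \<cdot> y"
    using ac unfolding hom_acyclic_def by auto
  let ?y = "pT (Suc n) \<cdot> w" and ?x = "pF n \<cdot> w"
  have "bd Y n \<cdot> ?y \<boxplus> F n \<cdot> ?x = y \<and> cycle X n P ?x"
  proof (cases n)
    case 0
    then have "iT n \<cdot> (bd Y n \<cdot> ?y \<boxplus> F n \<cdot> ?x) = iT n \<cdot> y"
      using bd_cone_elem(1)[of ?x P n ?y] cone_elem_Suc[of w n] w f by simp
    then show ?thesis using iT_mono[of "bd Y n \<cdot> ?y \<boxplus> F n \<cdot> ?x" y n] w ys f 0 by (simp add: cycle_0)
  next
    case (Suc k)
    then have "iT n \<cdot> (bd Y n \<cdot> ?y \<boxplus> F n \<cdot> ?x) \<boxplus> iF k \<cdot> Neg E (bd X k \<cdot> ?x) = iT n \<cdot> y \<boxplus> iF k \<cdot> Zero E P (ob X k)"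
      using bd_cone_elem(2)[of ?x P n ?y k] cone_elem_Suc[of w n] w f ys P by simp
    then show ?thesis
      using cone_elem_eq[of "bd Y n \<cdot> ?y \<boxplus> F n \<cdot> ?x" y P k "Neg E (bd X k \<cdot> ?x)" "Zero E P (ob X k)"] w ys f Suc P
      by (simp add: cycle_Suc)
  qed
  then show "\<exists>x b. cycle X n P x \<and> b \<in> Arr E \<and> Dom E b = P \<and> Cod E b = ob Y (Suc n) \<and> F n \<cdot> x \<boxplus> bd Y n \<cdot> b = y"
    using w f by (intro exI[of _ ?x] exI[of _ ?y]) (simp add: Add_comm)
qed

text \<open>For a cycle (y, x) of the cone, f x = d (-y), so x = d a by injectivity. Then y + f a is
  a cycle of Y, equal to f x' + d b by surjectivity, and (b, x' - a) bounds (y, x).\<close>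

lemma hom_acyclic_cone:
  assumes P: "P \<in> Obj E" and q: "hom_quasi_iso P f"
  shows "hom_acyclic P (cone E f)"
  unfolding hom_acyclic_def
proof (intro allI impI)
  note inj = q[unfolded hom_quasi_iso_def, THEN conjunct1, rule_format]
    and surj = q[unfolded hom_quasi_iso_def, THEN conjunct2, rule_format]
  fix n z assume z: "cycle (cone E f) n P z"
  note zs = cycle_simps(1-3)[OF z, unfolded ob_cone]
  show "\<exists>w\<in>Arr E. Dom E w = P \<and> Cod E w = ob (cone E f) (Suc n) \<and> bd (cone E f) n \<cdot> w = z"
  proof (cases n)
    case 0
    let ?y = "pT 0 \<cdot> z"
    have ze: "z = iT 0 \<cdot> ?y" using cone_elem_0[of z] zs 0 by simp
    have "cycle Y 0 P ?y" using zs 0 by (simp add: cycle_0)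
    then obtain x b where x: "cycle X 0 P x" and b: "b \<in> Arr E" "Dom E b = P" "Cod E b = ob Y (Suc 0)"
      "F 0 \<cdot> x \<boxplus> bd Y 0 \<cdot> b = ?y"
      using surj by blast
    note xs = cycle_simps(1-3)[OF x]
    have "bd (cone E f) 0 \<cdot> (iT (Suc 0) \<cdot> b \<boxplus> iF 0 \<cdot> x) = z"
      using bd_cone_elem(1)[OF xs b(1-3)] Add_comm[of "bd Y 0 \<cdot> b" "F 0 \<cdot> x"] b xs f ze by simp
    then show ?thesis using 0 b xs by (intro bexI[of _ "iT (Suc 0) \<cdot> b \<boxplus> iF 0 \<cdot> x"]) simp_all
  next
    case (Suc k)
    let ?y = "pT n \<cdot> z" and ?x = "pF k \<cdot> z"
    have ze: "z = iT n \<cdot> ?y \<boxplus> iF k \<cdot> ?x" using cone_elem_Suc[of z k] zs Suc by simp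
    have yx: "?x \<in> Arr E" "Dom E ?x = P" "Cod E ?x = ob X k" "?y \<in> Arr E" "Dom E ?y = P" "Cod E ?y = ob Y (Suc k)"
      using zs Suc by simp_all
    have "cycle (cone E f) (Suc k) P (iT (Suc k) \<cdot> ?y \<boxplus> iF k \<cdot> ?x)" using z ze Suc by simp
    then have c: "cycle X k P ?x" "bd Y k \<cdot> ?y \<boxplus> F k \<cdot> ?x = Zero E P (ob Y k)"
      using cone_cycle[OF yx] by simp_all
    have "bd Y k \<cdot> Neg E ?y = F k \<cdot> ?x"
      using Neg_unique[of "F k \<cdot> ?x" "bd Y k \<cdot> ?y"] c(2) Add_comm[of "bd Y k \<cdot> ?y" "F k \<cdot> ?x"] yx f by simp
    then obtain a where a: "a \<in> Arr E" "Dom E a = P" "Cod E a = ob X (Suc k)" "bd X k \<cdot> a = ?x"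
      using inj[of k ?x "Neg E ?y"] c(1) yx by auto
    have "cycle Y n P (?y \<boxplus> F n \<cdot> a)" using a yx c(2) f Suc by (simp add: cycle_Suc)
    then obtain x b where x: "cycle X n P x" and b: "b \<in> Arr E" "Dom E b = P" "Cod E b = ob Y (Suc n)"
      "F n \<cdot> x \<boxplus> bd Y n \<cdot> b = ?y \<boxplus> F n \<cdot> a"
      using surj by blast
    note xs = cycle_simps(1-3)[OF x]
    obtain x' where x': "x' \<in> Arr E" "Dom E x' = P" "Cod E x' = ob X n" "x' \<boxplus> a = x"
      using diff_ex[of x a] xs a Suc by auto
    have "F n \<cdot> (x' \<boxplus> a) \<boxplus> bd Y n \<cdot> b = ?y \<boxplus> F n \<cdot> a" using b x' by simp
    then have "F n \<cdot> a \<boxplus> (bd Y n \<cdot> b \<boxplus> F n \<cdot> x') = F n \<cdot> a \<boxplus> ?y"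
      using x'(1-3) a(1-3) b(1-3) yx f Suc by (simp add: Add_ac)
    then have e1: "bd Y n \<cdot> b \<boxplus> F n \<cdot> x' = ?y"
      using x'(1-3) a(1-3) b(1-3) yx f Suc by simp
    have "bd X k \<cdot> (x' \<boxplus> a) = Zero E P (ob X k)" using cycle_simps(4)[OF x Suc] x' by simp
    then have "bd X k \<cdot> x' \<boxplus> ?x = Zero E P (ob X k)" using x'(1-3) a f Suc by simp
    then have e2: "Neg E (bd X k \<cdot> x') = ?x"
      using Neg_unique[of "bd X k \<cdot> x'" ?x] x'(1-3) yx f Suc by simp
    have "bd (cone E f) n \<cdot> (iT (Suc n) \<cdot> b \<boxplus> iF n \<cdot> x') = z"
      unfolding bd_cone_elem(2)[OF x'(1-3) b(1-3) Suc] e1 e2 using ze by simp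
    then show ?thesis using x' b by (intro bexI[of _ "iT (Suc n) \<cdot> b \<boxplus> iF n \<cdot> x'"]) simp_all
  qed
qed

end

end

section \<open>Acyclicity and quasi-isomorphisms tested on projectives\<close>

context exact_enough_projectives
begin

lemma acyclic_imp_hom_acyclic:
  assumes ac: "acyclic E X" and P: "projective E P"
  shows "hom_acyclic P X"
proof -
  have X: "X \<in> chain_complexes E" using ac by (simp add: acyclic_def)
  obtain Z e m t where em: "\<And>n. e n \<in> Hom E (ob X (Suc n)) (Z n)" "\<And>n. m n \<in> Hom E (Z n) (ob X n)"
      "\<And>n. bd X n = m n \<cdot> e n"
    and ses: "\<And>n. (m (Suc n), e n) \<in> Ses E" and t: "(m 0, t) \<in> Ses E" "is_zero_obj E (Cod E t)"
    using ac unfolding acyclic_def by blast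
  have ts: "e n \<in> Arr E" "Dom E (e n) = ob X (Suc n)" "Cod E (e n) = Z n"
    "m n \<in> Arr E" "Dom E (m n) = Z n" "Cod E (m n) = ob X n" for n
    using em(1)[of n] em(2)[of n] by simp_all
  have Zo: "Z n \<in> Obj E" for n using ts(1,3)[of n] by (metis Cod_Obj)
  have ker: "is_kernel E (m (Suc n)) (e n)" for n using Ses_kernel_cokernel[OF ses] by blast
  have kt: "is_kernel E (m 0) t" using Ses_kernel_cokernel[OF t(1)] by blast
  have Po: "P \<in> Obj E" using P by (simp add: projective_def)
  \<comment> \<open>Cycles factor through Z_n: in degree 0 because \<open>m 0\<close> is the kernel
    of a map to a zero object, above that because \<open>m k\<close> is monic and
    \<open>m (Suc k)\<close> is the kernel of \<open>e k\<close>.\<close>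
  have fac: "\<exists>u\<in>Arr E. Dom E u = P \<and> Cod E u = Z n \<and> m n \<cdot> u = x" if x: "cycle X n P x" for n x
  proof (cases n)
    case 0
    note xs = cycle_simps(1-3)[OF x] and k = kernel_simps[OF kt]
    have "\<exists>!g. g \<in> Hom E P (Cod E t)" using t(2) Po by (simp add: is_zero_obj_def is_terminal_def)
    moreover have "t \<cdot> x \<in> Hom E P (Cod E t)" "Zero E P (Cod E t) \<in> Hom E P (Cod E t)"
      using xs k ts(6)[of 0] Po 0 by simp_all
    ultimately have "t \<cdot> x = Zero E (Dom E x) (Cod E t)" using xs by auto
    then obtain u where "u \<in> Arr E" "Dom E u = Dom E x" "Cod E u = Dom E (m 0)" "m 0 \<cdot> u = x"
      using kernel_lift[OF kt, of x] xs k ts(6)[of 0] 0 by auto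
    then show ?thesis using xs ts 0 by auto
  next
    case (Suc k)
    note xs = cycle_simps(1-3)[OF x]
    have "m k \<cdot> (e k \<cdot> x) = m k \<cdot> Zero E P (Z k)"
      using cycle_simps(4)[OF x Suc] em(3)[of k] ts xs Suc Po Zo by simp
    then have "e k \<cdot> x = Zero E P (Z k)"
      using kernel_mono[OF ker[of "k - 1"], of "e k \<cdot> x" "Zero E P (Z k)"]
        kernel_mono[OF kt, of "e k \<cdot> x" "Zero E P (Z k)"] ts xs Suc Po Zo by (cases k) simp_all
    then obtain u where "u \<in> Arr E" "Dom E u = Dom E x" "Cod E u = Dom E (m (Suc k))" "m (Suc k) \<cdot> u = x"
      using kernel_lift[OF ker[of k], of x] xs ts Suc by auto
    then show ?thesis using xs ts Suc by auto
  qed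
  show ?thesis
    unfolding hom_acyclic_def
  proof (intro allI impI)
    fix n x assume x: "cycle X n P x"
    obtain u where u: "u \<in> Arr E" "Dom E u = P" "Cod E u = Z n" "m n \<cdot> u = x" using fac[OF x] by blast
    have "adm_epi E (e n)" using ses by (auto simp: adm_epi_def)
    then obtain a where "a \<in> Arr E" "Dom E a = P" "Cod E a = Dom E (e n)" "e n \<cdot> a = u"
      using projective_lift[OF P, of "e n" u] u ts by metis
    then show "\<exists>a\<in>Arr E. Dom E a = P \<and> Cod E a = ob X (Suc n) \<and> bd X n \<cdot> a = x"
      using u ts em(3)[of n] by (intro bexI[of _ a]) simp_all
  qed
qed

text \<open>As cokernel of an identity, t is both zero and epic; hence the identity of its codomain
  is zero.\<close>

lemma zero_obj_cokernel_Ident: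
  assumes "(Ident E x, t) \<in> Ses E" "x \<in> Obj E"
  shows "is_zero_obj E (Cod E t)"
proof -
  have c: "is_cokernel E t (Ident E x)" using Ses_kernel_cokernel[OF assms(1)] by blast
  note cs = cokernel_simps[OF c]
  let ?z = "Cod E t"
  have z: "?z \<in> Obj E" using cs by simp
  have t: "t \<in> Arr E" "Dom E t = x" using cs assms(2) by simp_all
  have "t \<cdot> Ident E x = Zero E x ?z" using cs(4) assms(2) by simp
  then have "t = Zero E x ?z" using Comp_Ident_simp[OF t] by metis
  moreover have "Ident E ?z \<cdot> t = t" "Zero E ?z ?z \<cdot> t = Zero E x ?z" using t z by simp_all
  ultimately have "Ident E ?z \<cdot> t = Zero E ?z ?z \<cdot> t" by metis
  then have id: "Ident E ?z = Zero E ?z ?z"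
    using cokernel_epi[OF c, of "Ident E ?z" "Zero E ?z ?z"] z by simp
  have "g = Zero E ?z y" if "g \<in> Hom E ?z y" for g y
  proof -
    have "g \<cdot> Ident E ?z = g" using that by simp
    then show ?thesis using that z by (simp add: id)
  qed
  moreover have "g = Zero E y ?z" if "g \<in> Hom E y ?z" for g y
  proof -
    have "Ident E ?z \<cdot> g = g" using that by simp
    then show ?thesis using that z by (simp add: id)
  qed
  ultimately show ?thesis
    unfolding is_zero_obj_def is_initial_def is_terminal_def using z
    by (metis Hom_iff Zero_simps)
qed

text \<open>The objects Z_n are found by recursion as representing objects for cycles:
  \<open>good n k\<close> says that k is an admissible monomorphism into X_n through which all
  cycles factor. The differential factors through it, acyclicity on projectives makes the factor e
  an admissible epimorphism, and the kernel of e represents the cycles one degree up.\<close>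

lemma hom_acyclic_imp_acyclic:
  assumes X: "X \<in> chain_complexes E" and ac: "\<And>P. projective E P \<Longrightarrow> hom_acyclic P X"
  shows "acyclic E X"
proof -
  define good where "good n k \<longleftrightarrow> adm_mono E k \<and> k \<in> Arr E \<and> Cod E k = ob X n \<and>
    cycle X n (Dom E k) k \<and>
    (\<forall>P x. cycle X n P x \<longrightarrow> (\<exists>u\<in>Arr E. Dom E u = P \<and> Cod E u = Dom E k \<and> k \<cdot> u = x))" for n k
  define nxt where "nxt n k k' \<longleftrightarrow> (\<exists>e\<in>Arr E. Dom E e = ob X (Suc n) \<and> Cod E e = Dom E k \<and>
    k \<cdot> e = bd X n \<and> (k', e) \<in> Ses E)" for n :: nat and k k'
  \<comment> \<open>Every arrow into X_0 is a cycle, so Z_0 = X_0; the last condition of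
    \<open>acyclic\<close> will hold because the cokernel of an identity is zero.\<close>
  have g0: "good 0 (Ident E (ob X 0))"
    unfolding good_def using X adm_mono_Ident by (auto simp: cycle_0)
  have step: "\<exists>k'. good (Suc n) k' \<and> nxt n k k'" if g: "good n k" for n k
  proof -
    have k: "adm_mono E k" "k \<in> Arr E" "Cod E k = ob X n" "cycle X n (Dom E k) k"
      and fac: "\<And>P x. cycle X n P x \<Longrightarrow> \<exists>u\<in>Arr E. Dom E u = P \<and> Cod E u = Dom E k \<and> k \<cdot> u = x"
      using g by (auto simp: good_def)
    have "cycle X n (ob X (Suc n)) (bd X n \<cdot> Ident E (ob X (Suc n)))"
      using X by (intro cycle_bd) simp_all
    then obtain e where e: "e \<in> Arr E" "Dom E e = ob X (Suc n)" "Cod E e = Dom E k" "k \<cdot> e = bd X n"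
      using fac[of "ob X (Suc n)" "bd X n"] X by auto
    obtain q where "(k, q) \<in> Ses E" using k(1) by (auto simp: adm_mono_def)
    then have kk: "is_kernel E k q" using Ses_kernel_cokernel by blast
    have "adm_epi E e"
    proof (rule adm_epiI[OF e(1)])
      fix P y assume P: "projective E P" "P \<in> Obj E" and y: "y \<in> Arr E" "Dom E y = P" "Cod E y = Cod E e"
      have "cycle X n P (k \<cdot> y)"
        using k y e cycle_simps(4)[OF k(4)] X reassoc[OF cycle_simps(4)[OF k(4)], of _ y]
        by (cases n) (simp_all add: cycle_0 cycle_Suc)
      then obtain a where a: "a \<in> Arr E" "Dom E a = P" "Cod E a = ob X (Suc n)" "bd X n \<cdot> a = k \<cdot> y"
        using ac[OF P(1)] unfolding hom_acyclic_def by blast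
      have "k \<cdot> (e \<cdot> a) = k \<cdot> y" using reassoc[OF e(4), of a] a e k by simp
      then have "e \<cdot> a = y"
        using kernel_mono[OF kk, of "e \<cdot> a" y] a e y k by simp
      then show "\<exists>x\<in>Arr E. Dom E x = P \<and> Cod E x = Dom E e \<and> e \<cdot> x = y" using a e by auto
    qed
    then obtain k' where k': "(k', e) \<in> Ses E" "is_kernel E k' e" using adm_epi_simps(2) by blast
    note ks = kernel_simps[OF k'(2)]
    have "good (Suc n) k'"
      unfolding good_def
    proof (intro conjI allI impI)
      show "adm_mono E k'" using k'(1) by (auto simp: adm_mono_def)
      show "k' \<in> Arr E" "Cod E k' = ob X (Suc n)" using ks e by simp_all
      have ek: "bd X n \<cdot> k' = k \<cdot> (e \<cdot> k')" using e(1-3) ks k by (simp flip: e(4))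
      show "cycle X (Suc n) (Dom E k') k'"
        using ek ks e(1-3) k X by (simp add: cycle_Suc)
      fix P x assume x: "cycle X (Suc n) P x"
      note xs = cycle_simps(1-3)[OF x] cycle_simps(4)[OF x refl]
      have Po: "P \<in> Obj E" "Dom E k \<in> Obj E" using xs k by auto
      have "k \<cdot> (e \<cdot> x) = k \<cdot> Zero E P (Dom E k)" using reassoc[OF e(4), of x] xs e(1-3) k Po by simp
      then have "e \<cdot> x = Zero E P (Dom E k)"
        using kernel_mono[OF kk, of "e \<cdot> x" "Zero E P (Dom E k)"] xs e(1-3) k Po by simp
      then show "\<exists>u\<in>Arr E. Dom E u = P \<and> Cod E u = Dom E k' \<and> k' \<cdot> u = x"
        using kernel_lift[OF k'(2), of x] xs e(1-3) by (metis (no_types, lifting))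
    qed
    moreover have "nxt n k k'" unfolding nxt_def using e k' by blast
    ultimately show ?thesis by blast
  qed
  have "\<exists>m. (\<forall>n. (good n (m n) \<and> (n = 0 \<longrightarrow> m n = Ident E (ob X 0))) \<and> nxt n (m n) (m (Suc n)))"
    using dependent_nat_choice[of "\<lambda>n k. good n k \<and> (n = 0 \<longrightarrow> k = Ident E (ob X 0))" nxt] g0 step by auto
  then obtain m where m: "\<And>n. good n (m n)" "m 0 = Ident E (ob X 0)" "\<And>n. nxt n (m n) (m (Suc n))" by blast
  then obtain e where e: "\<And>n. e n \<in> Arr E" "\<And>n. Dom E (e n) = ob X (Suc n)" "\<And>n. Cod E (e n) = Dom E (m n)"
    "\<And>n. m n \<cdot> e n = bd X n" "\<And>n. (m (Suc n), e n) \<in> Ses E"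
    unfolding nxt_def Bex_def by metis
  obtain t where t: "(m 0, t) \<in> Ses E" using m(1)[of 0] by (auto simp: good_def adm_mono_def)
  then have "is_zero_obj E (Cod E t)" using zero_obj_cokernel_Ident m(2) X by simp
  moreover have "m n \<in> Arr E \<and> Cod E (m n) = ob X n" for n using m(1)[of n] by (simp add: good_def)
  ultimately show ?thesis
    unfolding acyclic_def using X e t
    by (intro conjI exI[of _ "\<lambda>n. Dom E (m n)"] exI[of _ e] exI[of _ m]) auto
qed

lemma quasi_isos_iff:
  "f \<in> quasi_isos E \<longleftrightarrow> f \<in> Arr (Ch E) \<and> (\<forall>P. projective E P \<longrightarrow> hom_quasi_iso P f)"
proof -
  have "acyclic E (cone E f) \<longleftrightarrow> (\<forall>P. projective E P \<longrightarrow> hom_quasi_iso P f)" if f: "f \<in> Arr (Ch E)"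
    using acyclic_imp_hom_acyclic hom_acyclic_imp_acyclic[OF cone_chain[OF f]]
      hom_acyclic_cone_imp[OF f] hom_acyclic_cone[OF f]
    by (metis projective_def)
  then show ?thesis by (auto simp: quasi_isos_def)
qed

lemma Ch_fibrations_iff:
  "f \<in> Ch_fibrations E \<longleftrightarrow> f \<in> Arr (Ch E) \<and> (\<forall>n P y. projective E P \<and> y \<in> Arr E \<and> Dom E y = P \<and>
     Cod E y = ob (tgt f) (Suc n) \<longrightarrow>
     (\<exists>x\<in>Arr E. Dom E x = P \<and> Cod E x = ob (src f) (Suc n) \<and> ap f (Suc n) \<cdot> x = y))"
  (is "_ \<longleftrightarrow> _ \<and> ?R")
proof -
  have "(\<forall>n>0. adm_epi E (ap f n)) \<longleftrightarrow> ?R" if f: "f \<in> Arr (Ch E)"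
  proof
    assume a: "\<forall>n>0. adm_epi E (ap f n)"
    show ?R
    proof (intro allI impI, elim conjE)
      fix n P y assume y: "projective E P" "y \<in> Arr E" "Dom E y = P" "Cod E y = ob (tgt f) (Suc n)"
      show "\<exists>x\<in>Arr E. Dom E x = P \<and> Cod E x = ob (src f) (Suc n) \<and> ap f (Suc n) \<cdot> x = y"
        using projective_lift[of P "ap f (Suc n)" y] a y f by (metis Arr_Ch_simps(4,5) zero_less_Suc)
    qed
  next
    assume R: ?R
    have "adm_epi E (ap f (Suc n))" for n
    proof (rule adm_epiI)
      fix P y assume "projective E P" "y \<in> Arr E" "Dom E y = P" "Cod E y = Cod E (ap f (Suc n))"
      then show "\<exists>x\<in>Arr E. Dom E x = P \<and> Cod E x = Dom E (ap f (Suc n)) \<and> ap f (Suc n) \<cdot> x = y"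
        using R[rule_format, of P y n] f by simp
    qed (use f in simp)
    then show "\<forall>n>0. adm_epi E (ap f n)" by (metis gr0_implies_Suc)
  qed
  then show ?thesis unfolding Ch_fibrations_def by blast
qed

end

section \<open>The projective model structure on chain complexes\<close>

context additive_category
begin

lemma hom_quasi_iso_inj:
  assumes "hom_quasi_iso P f" "cycle (src f) n P x" "b \<in> Arr E" "Dom E b = P" "Cod E b = ob (tgt f) (Suc n)"
    "bd (tgt f) n \<cdot> b = ap f n \<cdot> x"
  obtains a where "a \<in> Arr E" "Dom E a = P" "Cod E a = ob (src f) (Suc n)" "bd (src f) n \<cdot> a = x"
  using assms unfolding hom_quasi_iso_def by blast

lemma hom_quasi_iso_surj:
  assumes "hom_quasi_iso P f" "cycle (tgt f) n P y"
  obtains x b where "cycle (src f) n P x" "b \<in> Arr E" "Dom E b = P" "Cod E b = ob (tgt f) (Suc n)"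
    "ap f n \<cdot> x \<boxplus> bd (tgt f) n \<cdot> b = y"
  using assms unfolding hom_quasi_iso_def by blast

lemma hom_quasi_isoI:
  assumes "\<And>n x b. \<lbrakk>cycle (src f) n P x; b \<in> Arr E; Dom E b = P; Cod E b = ob (tgt f) (Suc n);
      bd (tgt f) n \<cdot> b = ap f n \<cdot> x\<rbrakk> \<Longrightarrow>
      \<exists>a\<in>Arr E. Dom E a = P \<and> Cod E a = ob (src f) (Suc n) \<and> bd (src f) n \<cdot> a = x"
    "\<And>n y. cycle (tgt f) n P y \<Longrightarrow>
      \<exists>x b. cycle (src f) n P x \<and> b \<in> Arr E \<and> Dom E b = P \<and> Cod E b = ob (tgt f) (Suc n) \<and>
        ap f n \<cdot> x \<boxplus> bd (tgt f) n \<cdot> b = y"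
  shows "hom_quasi_iso P f"
  unfolding hom_quasi_iso_def using assms by blast

lemma hom_quasi_iso_two_of_three:
  assumes f: "f \<in> Arr (Ch E)" and g: "g \<in> Arr (Ch E)" and fg: "tgt f = src g" and P: "P \<in> Obj E"
  shows "\<lbrakk>hom_quasi_iso P f; hom_quasi_iso P g\<rbrakk> \<Longrightarrow> hom_quasi_iso P (g \<cdot>\<^bsub>Ch E\<^esub> f)"
    "\<lbrakk>hom_quasi_iso P f; hom_quasi_iso P (g \<cdot>\<^bsub>Ch E\<^esub> f)\<rbrakk> \<Longrightarrow> hom_quasi_iso P g"
    "\<lbrakk>hom_quasi_iso P g; hom_quasi_iso P (g \<cdot>\<^bsub>Ch E\<^esub> f)\<rbrakk> \<Longrightarrow> hom_quasi_iso P f"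
proof -
  have X: "src f \<in> chain_complexes E" and Y: "src g \<in> chain_complexes E" and Z: "tgt g \<in> chain_complexes E"
    using f g by simp_all
  have ft: "ap f n \<in> Arr E" "Dom E (ap f n) = ob (src f) n"
    "Cod E (ap f n) = ob (src g) n" for n using f fg by simp_all
  have fd: "ap f n \<cdot> (bd (src f) n \<cdot> x) = bd (src g) n \<cdot> (ap f (Suc n) \<cdot> x)"
    if "x \<in> Arr E" "Cod E x = ob (src f) (Suc n)" for n x
    using chain_map_bd[OF f that] fg by simp
  have cf: "cycle (src g) n P (ap f n \<cdot> x)" if "cycle (src f) n P x" for n x
    using cycle_map[OF f that] fg by simp
  {
    assume qf: "hom_quasi_iso P f" and qg: "hom_quasi_iso P g"
    show "hom_quasi_iso P (g \<cdot>\<^bsub>Ch E\<^esub> f)"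
    proof (rule hom_quasi_isoI; unfold Comp_Ch)
      fix n x b assume x: "cycle (src f) n P x" and b: "b \<in> Arr E" "Dom E b = P" "Cod E b = ob (tgt g) (Suc n)"
        "bd (tgt g) n \<cdot> b = ap g n \<cdot> ap f n \<cdot> x"
      note xs = cycle_simps(1-3)[OF x]
      obtain c where c: "c \<in> Arr E" "Dom E c = P" "Cod E c = ob (src g) (Suc n)" "bd (src g) n \<cdot> c = ap f n \<cdot> x"
        by (rule hom_quasi_iso_inj[OF qg cf[OF x] b(1-3)]) (use b xs ft g in simp_all)
      obtain a where "a \<in> Arr E" "Dom E a = P" "Cod E a = ob (src f) (Suc n)" "bd (src f) n \<cdot> a = x"
        by (rule hom_quasi_iso_inj[OF qf x, of c]) (use c fg in simp_all)
      then show "\<exists>a\<in>Arr E. Dom E a = P \<and> Cod E a = ob (src f) (Suc n) \<and> bd (src f) n \<cdot> a = x" by blast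
    next
      fix n z assume z: "cycle (tgt g) n P z"
      obtain y c where y: "cycle (src g) n P y" and c: "c \<in> Arr E" "Dom E c = P" "Cod E c = ob (tgt g) (Suc n)"
        "ap g n \<cdot> y \<boxplus> bd (tgt g) n \<cdot> c = z" using hom_quasi_iso_surj[OF qg z] .
      obtain x b where x: "cycle (src f) n P x" and b: "b \<in> Arr E" "Dom E b = P" "Cod E b = ob (src g) (Suc n)"
        "ap f n \<cdot> x \<boxplus> bd (src g) n \<cdot> b = y"
        using hom_quasi_iso_surj[OF qf, unfolded fg, OF y] .
      note xs = cycle_simps(1-3)[OF x]
      have "ap g n \<cdot> (ap f n \<cdot> x \<boxplus> bd (src g) n \<cdot> b) \<boxplus> bd (tgt g) n \<cdot> c = z"
        using b c by simp
      then have "ap g n \<cdot> ap f n \<cdot> x \<boxplus> bd (tgt g) n \<cdot> (ap g (Suc n) \<cdot> b \<boxplus> c) = z"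
        using xs b(1-3) c(1-3) ft g Y Z by (simp add: Add_assoc)
      then show "\<exists>x b. cycle (src f) n P x \<and> b \<in> Arr E \<and> Dom E b = P \<and> Cod E b = ob (tgt g) (Suc n) \<and>
        ap g n \<cdot> ap f n \<cdot> x \<boxplus> bd (tgt g) n \<cdot> b = z"
        using x b(1-3) c(1-3) g by (intro exI[of _ x] exI[of _ "ap g (Suc n) \<cdot> b \<boxplus> c"]) simp
    qed
  next
    assume qf: "hom_quasi_iso P f" and qgf: "hom_quasi_iso P (g \<cdot>\<^bsub>Ch E\<^esub> f)"
    note inj = hom_quasi_iso_inj[OF qgf, unfolded Comp_Ch] and surj = hom_quasi_iso_surj[OF qgf, unfolded Comp_Ch]
    show "hom_quasi_iso P g"
    proof (rule hom_quasi_isoI)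
      fix n y c assume y: "cycle (src g) n P y" and c: "c \<in> Arr E" "Dom E c = P" "Cod E c = ob (tgt g) (Suc n)"
        "bd (tgt g) n \<cdot> c = ap g n \<cdot> y"
      obtain x b where x: "cycle (src f) n P x" and b: "b \<in> Arr E" "Dom E b = P" "Cod E b = ob (src g) (Suc n)"
        "ap f n \<cdot> x \<boxplus> bd (src g) n \<cdot> b = y"
        using hom_quasi_iso_surj[OF qf, unfolded fg, OF y] .
      note xs = cycle_simps(1-3)[OF x]
      obtain c' where c': "c' \<in> Arr E" "Dom E c' = P" "Cod E c' = ob (tgt g) (Suc n)"
        "c' \<boxplus> ap g (Suc n) \<cdot> b = c"
        using diff_ex[of c "ap g (Suc n) \<cdot> b"] c b g by auto
      have "bd (tgt g) n \<cdot> (c' \<boxplus> ap g (Suc n) \<cdot> b) = ap g n \<cdot> (ap f n \<cdot> x \<boxplus> bd (src g) n \<cdot> b)"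
        using c c' b by simp
      then have "bd (tgt g) n \<cdot> c' = ap g n \<cdot> ap f n \<cdot> x"
        using xs b(1-3) c'(1-3) ft g Y Z by simp
      then obtain a where a: "a \<in> Arr E" "Dom E a = P" "Cod E a = ob (src f) (Suc n)" "bd (src f) n \<cdot> a = x"
        using inj[OF x c'(1-3)] by metis
      have "bd (src g) n \<cdot> (ap f (Suc n) \<cdot> a \<boxplus> b) = y"
        using a b(1-3) ft fd[of a n, symmetric] Y b(4) by simp
      then show "\<exists>a\<in>Arr E. Dom E a = P \<and> Cod E a = ob (src g) (Suc n) \<and> bd (src g) n \<cdot> a = y"
        using a b ft by (intro bexI[of _ "ap f (Suc n) \<cdot> a \<boxplus> b"]) simp_all
    next
      fix n z assume z: "cycle (tgt g) n P z"
      obtain x c where x: "cycle (src f) n P x" and c: "c \<in> Arr E" "Dom E c = P" "Cod E c = ob (tgt g) (Suc n)"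
        "ap g n \<cdot> ap f n \<cdot> x \<boxplus> bd (tgt g) n \<cdot> c = z" using surj[OF z] .
      note xs = cycle_simps(1-3)[OF x]
      show "\<exists>x b. cycle (src g) n P x \<and> b \<in> Arr E \<and> Dom E b = P \<and> Cod E b = ob (tgt g) (Suc n) \<and>
        ap g n \<cdot> x \<boxplus> bd (tgt g) n \<cdot> b = z"
        using cf[OF x] c xs ft g by (intro exI[of _ "ap f n \<cdot> x"] exI[of _ c]) simp
    qed
  next
    assume qg: "hom_quasi_iso P g" and qgf: "hom_quasi_iso P (g \<cdot>\<^bsub>Ch E\<^esub> f)"
    note inj = hom_quasi_iso_inj[OF qgf, unfolded Comp_Ch] and surj = hom_quasi_iso_surj[OF qgf, unfolded Comp_Ch]
    show "hom_quasi_iso P f"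
    proof (rule hom_quasi_isoI; unfold fg)
      fix n x b assume x: "cycle (src f) n P x" and b: "b \<in> Arr E" "Dom E b = P" "Cod E b = ob (src g) (Suc n)"
        "bd (src g) n \<cdot> b = ap f n \<cdot> x"
      note xs = cycle_simps(1-3)[OF x]
      have "bd (tgt g) n \<cdot> (ap g (Suc n) \<cdot> b) = ap g n \<cdot> ap f n \<cdot> x"
        using b xs ft g by simp
      moreover have "ap g (Suc n) \<cdot> b \<in> Arr E" "Dom E (ap g (Suc n) \<cdot> b) = P"
        "Cod E (ap g (Suc n) \<cdot> b) = ob (tgt g) (Suc n)" using b(1-3) g by simp_all
      ultimately obtain a where "a \<in> Arr E" "Dom E a = P" "Cod E a = ob (src f) (Suc n)" "bd (src f) n \<cdot> a = x"
        using inj[OF x, of "ap g (Suc n) \<cdot> b"] by metis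
      then show "\<exists>a\<in>Arr E. Dom E a = P \<and> Cod E a = ob (src f) (Suc n) \<and> bd (src f) n \<cdot> a = x" by blast
    next
      fix n y assume y: "cycle (src g) n P y"
      note ys = cycle_simps(1-3)[OF y]
      obtain x c where x: "cycle (src f) n P x" and c: "c \<in> Arr E" "Dom E c = P" "Cod E c = ob (tgt g) (Suc n)"
        "ap g n \<cdot> ap f n \<cdot> x \<boxplus> bd (tgt g) n \<cdot> c = ap g n \<cdot> y"
        using surj[OF cycle_map[OF g y]] .
      note xs = cycle_simps(1-3)[OF x]
      let ?fx = "ap f n \<cdot> x"
      have fx: "?fx \<in> Arr E" "Dom E ?fx = P" "Cod E ?fx = ob (src g) n" using xs ft by simp_all
      \<comment> \<open>y and f x are so far known to be homologous only after applying g. Their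
        difference w is a cycle whose image under g bounds, so w bounds by injectivity for
        g.\<close>
      have "cycle (src g) n P (y \<boxplus> Neg E ?fx)" by (rule cycle_Add[OF Y P y cycle_Neg[OF Y cf[OF x]]])
      moreover have "?fx \<boxplus> (y \<boxplus> Neg E ?fx) = y" using ys fx Add_left_comm[of ?fx y "Neg E ?fx"] by simp
      ultimately obtain w where w: "cycle (src g) n P w" and yw: "?fx \<boxplus> w = y" by blast
      note wt = cycle_simps(1-3)[OF w]
      have "ap g n \<cdot> ?fx \<boxplus> bd (tgt g) n \<cdot> c = ap g n \<cdot> (?fx \<boxplus> w)"
        unfolding yw using c(4) xs ft g by simp
      then have e: "bd (tgt g) n \<cdot> c = ap g n \<cdot> w"
        using fx wt c(1-3) xs ft g Z by simp
      obtain b where "b \<in> Arr E" "Dom E b = P" "Cod E b = ob (src g) (Suc n)" "bd (src g) n \<cdot> b = w"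
        by (rule hom_quasi_iso_inj[OF qg w c(1-3) e])
      then show "\<exists>x b. cycle (src f) n P x \<and> b \<in> Arr E \<and> Dom E b = P \<and> Cod E b = ob (src g) (Suc n) \<and>
        ap f n \<cdot> x \<boxplus> bd (src g) n \<cdot> b = y"
        using x yw by (intro exI[of _ x] exI[of _ b]) simp
    qed
  }
qed

lemma hom_quasi_iso_retract:
  assumes r: "is_retract_of (Ch E) f g" and q: "hom_quasi_iso P g"
  shows "hom_quasi_iso P f"
proof -
  obtain i r j s where fg: "f \<in> Arr (Ch E)" "g \<in> Arr (Ch E)"
    and "i \<in> Hom (Ch E) (src f) (src g)" "r \<in> Hom (Ch E) (src g) (src f)"
    "j \<in> Hom (Ch E) (tgt f) (tgt g)" "s \<in> Hom (Ch E) (tgt g) (tgt f)"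
    and eqs: "r \<cdot>\<^bsub>Ch E\<^esub> i = Ident (Ch E) (src f)" "s \<cdot>\<^bsub>Ch E\<^esub> j = Ident (Ch E) (tgt f)"
      "g \<cdot>\<^bsub>Ch E\<^esub> i = j \<cdot>\<^bsub>Ch E\<^esub> f" "f \<cdot>\<^bsub>Ch E\<^esub> r = s \<cdot>\<^bsub>Ch E\<^esub> g"
    using r unfolding is_retract_of_def Ch_simps by blast
  then have t: "i \<in> Arr (Ch E)" "src i = src f" "tgt i = src g" "r \<in> Arr (Ch E)" "src r = src g" "tgt r = src f"
    "j \<in> Arr (Ch E)" "src j = tgt f" "tgt j = tgt g" "s \<in> Arr (Ch E)" "src s = tgt g" "tgt s = tgt f"
    by simp_all
  have e: "ap r n \<cdot> ap i n = Ident E (ob (src f) n)"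
      "ap s n \<cdot> ap j n = Ident E (ob (tgt f) n)"
      "ap g n \<cdot> ap i n = ap j n \<cdot> ap f n"
      "ap f n \<cdot> ap r n = ap s n \<cdot> ap g n" for n
    using eqs[THEN arg_cong[of _ _ "\<lambda>h. ap h n"]] by simp_all
  have T: "ap i n \<in> Arr E" "Dom E (ap i n) = ob (src f) n" "Cod E (ap i n) = ob (src g) n"
    "ap r n \<in> Arr E" "Dom E (ap r n) = ob (src g) n" "Cod E (ap r n) = ob (src f) n"
    "ap j n \<in> Arr E" "Dom E (ap j n) = ob (tgt f) n" "Cod E (ap j n) = ob (tgt g) n"
    "ap s n \<in> Arr E" "Dom E (ap s n) = ob (tgt g) n" "Cod E (ap s n) = ob (tgt f) n"
    "ap f n \<in> Arr E" "Dom E (ap f n) = ob (src f) n" "Cod E (ap f n) = ob (tgt f) n"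
    "ap g n \<in> Arr E" "Dom E (ap g n) = ob (src g) n" "Cod E (ap g n) = ob (tgt g) n"
    "ob (src f) n \<in> Obj E" "ob (tgt f) n \<in> Obj E" for n
    using t fg by simp_all
  have ri: "ap r n \<cdot> (ap i n \<cdot> x) = x" if "x \<in> Arr E" "Cod E x = ob (src f) n" for x n
    using reassoc[OF e(1)[of n], of x] T[of n] that by simp
  have sj: "ap s n \<cdot> (ap j n \<cdot> x) = x" if "x \<in> Arr E" "Cod E x = ob (tgt f) n" for x n
    using reassoc[OF e(2)[of n], of x] T[of n] that by simp
  have gi: "ap g n \<cdot> (ap i n \<cdot> x) = ap j n \<cdot> (ap f n \<cdot> x)"
    if "x \<in> Arr E" "Cod E x = ob (src f) n" for x n
    using reassoc[OF e(3)[of n], of x] T[of n] that by simp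
  have fr: "ap f n \<cdot> (ap r n \<cdot> x) = ap s n \<cdot> (ap g n \<cdot> x)"
    if "x \<in> Arr E" "Cod E x = ob (src g) n" for x n
    using reassoc[OF e(4)[of n], of x] T[of n] that by simp
  show ?thesis
  proof (rule hom_quasi_isoI)
    fix n x b assume x: "cycle (src f) n P x" and b: "b \<in> Arr E" "Dom E b = P" "Cod E b = ob (tgt f) (Suc n)"
      "bd (tgt f) n \<cdot> b = ap f n \<cdot> x"
    note xs = cycle_simps(1-3)[OF x]
    have c: "cycle (src g) n P (ap i n \<cdot> x)" using cycle_map[of i n P x] x t by simp
    have "bd (tgt g) n \<cdot> (ap j (Suc n) \<cdot> b) = ap g n \<cdot> (ap i n \<cdot> x)"
      using chain_map_bd[OF t(7), of b n] b t(8,9) gi xs by simp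
    then obtain a where a: "a \<in> Arr E" "Dom E a = P" "Cod E a = ob (src g) (Suc n)" "bd (src g) n \<cdot> a = ap i n \<cdot> x"
      using hom_quasi_iso_inj[OF q c, of "ap j (Suc n) \<cdot> b"] b T[of "Suc n"] by (metis Comp_simps)
    have "bd (src f) n \<cdot> (ap r (Suc n) \<cdot> a) = x"
      using chain_map_bd[OF t(4), of a n] a t(5,6) ri[of x n] xs by simp
    then show "\<exists>a\<in>Arr E. Dom E a = P \<and> Cod E a = ob (src f) (Suc n) \<and> bd (src f) n \<cdot> a = x"
      using a T[of "Suc n"] by (intro bexI[of _ "ap r (Suc n) \<cdot> a"]) simp_all
  next
    fix n y assume y: "cycle (tgt f) n P y"
    note ys = cycle_simps(1-3)[OF y]
    have "cycle (tgt g) n P (ap j n \<cdot> y)" using cycle_map[of j n P y] y t by simp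
    then obtain x b where x: "cycle (src g) n P x" and b: "b \<in> Arr E" "Dom E b = P" "Cod E b = ob (tgt g) (Suc n)"
      "ap g n \<cdot> x \<boxplus> bd (tgt g) n \<cdot> b = ap j n \<cdot> y"
      using hom_quasi_iso_surj[OF q] by metis
    note xs = cycle_simps(1-3)[OF x]
    have c: "cycle (src f) n P (ap r n \<cdot> x)" using cycle_map[of r n P x] x t by simp
    have tg: "tgt g \<in> chain_complexes E" using fg by simp
    have "ap s n \<cdot> (ap g n \<cdot> x \<boxplus> bd (tgt g) n \<cdot> b) = y"
      using b(4) sj[of y n] ys by simp
    then have "ap f n \<cdot> (ap r n \<cdot> x) \<boxplus> bd (tgt f) n \<cdot> (ap s (Suc n) \<cdot> b) = y"
      using xs b(1-3) T[of n] tg fr[of x n] chain_map_bd[OF t(10), of b n] t(11,12) by simp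
    then show "\<exists>x b. cycle (src f) n P x \<and> b \<in> Arr E \<and> Dom E b = P \<and> Cod E b = ob (tgt f) (Suc n) \<and>
        ap f n \<cdot> x \<boxplus> bd (tgt f) n \<cdot> b = y"
      using c b T[of "Suc n"] by (intro exI[of _ "ap r n \<cdot> x"] exI[of _ "ap s (Suc n) \<cdot> b"]) simp
  qed
qed

end

context exact_enough_projectives
begin

lemma Ch_fibration_lift:
  assumes "p \<in> Ch_fibrations E" "projective E P" "y \<in> Arr E" "Dom E y = P" "Cod E y = ob (tgt p) (Suc n)"
  obtains x where "x \<in> Arr E" "Dom E x = P" "Cod E x = ob (src p) (Suc n)" "ap p (Suc n) \<cdot> x = y"
  using assms unfolding Ch_fibrations_iff by blast

text \<open>Argued with arrows from projectives, where a lift of y along f is r applied to a lift of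
  j y along g.\<close>

lemma Ch_fibrations_retract:
  assumes r: "is_retract_of (Ch E) f g" and g: "g \<in> Ch_fibrations E"
  shows "f \<in> Ch_fibrations E"
proof -
  obtain i r j s where fg: "f \<in> Arr (Ch E)" "g \<in> Arr (Ch E)"
    and "i \<in> Hom (Ch E) (src f) (src g)" "r \<in> Hom (Ch E) (src g) (src f)"
    "j \<in> Hom (Ch E) (tgt f) (tgt g)" "s \<in> Hom (Ch E) (tgt g) (tgt f)"
    and eqs: "s \<cdot>\<^bsub>Ch E\<^esub> j = Ident (Ch E) (tgt f)" "f \<cdot>\<^bsub>Ch E\<^esub> r = s \<cdot>\<^bsub>Ch E\<^esub> g"
    using r unfolding is_retract_of_def Ch_simps by blast
  then have t: "r \<in> Arr (Ch E)" "src r = src g" "tgt r = src f"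
    "j \<in> Arr (Ch E)" "src j = tgt f" "tgt j = tgt g" "s \<in> Arr (Ch E)" "src s = tgt g" "tgt s = tgt f"
    by simp_all
  have e: "ap s n \<cdot> ap j n = Ident E (ob (tgt f) n)"
      "ap f n \<cdot> ap r n = ap s n \<cdot> ap g n" for n
    using eqs[THEN arg_cong[of _ _ "\<lambda>h. ap h n"]] by simp_all
  show ?thesis
    unfolding Ch_fibrations_iff
  proof (intro conjI allI impI, rule fg(1), elim conjE)
    fix n P y assume y: "projective E P" "y \<in> Arr E" "Dom E y = P" "Cod E y = ob (tgt f) (Suc n)"
    have T: "ap r (Suc n) \<in> Arr E" "Dom E (ap r (Suc n)) = ob (src g) (Suc n)"
      "Cod E (ap r (Suc n)) = ob (src f) (Suc n)"
      "ap j (Suc n) \<in> Arr E" "Dom E (ap j (Suc n)) = ob (tgt f) (Suc n)"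
      "Cod E (ap j (Suc n)) = ob (tgt g) (Suc n)"
      "ap s (Suc n) \<in> Arr E" "Dom E (ap s (Suc n)) = ob (tgt g) (Suc n)"
      "Cod E (ap s (Suc n)) = ob (tgt f) (Suc n)"
      using t by simp_all
    obtain x where x: "x \<in> Arr E" "Dom E x = P" "Cod E x = ob (src g) (Suc n)"
      "ap g (Suc n) \<cdot> x = ap j (Suc n) \<cdot> y"
      using Ch_fibration_lift[OF g y(1), of "ap j (Suc n) \<cdot> y" n] y T by auto
    have "ap f (Suc n) \<cdot> (ap r (Suc n) \<cdot> x) = y"
      using reassoc[OF e(1)[of "Suc n"], of y] reassoc[OF e(2)[of "Suc n"], of x] x y T fg by simp
    then show "\<exists>x\<in>Arr E. Dom E x = P \<and> Cod E x = ob (src f) (Suc n) \<and> ap f (Suc n) \<cdot> x = y"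
      using x T by (intro bexI[of _ "ap r (Suc n) \<cdot> x"]) simp_all
  qed
qed

text \<open>Quasi-isomorphy solves each lifting problem up to a boundary in the target, and that
  boundary is removed by lifting the chain it comes from, which lies in positive degree, where p is
  surjective on arrows from P.\<close>

lemma acyclic_fibration_lift:
  assumes pF: "p \<in> Ch_fibrations E" and pW: "p \<in> quasi_isos E" and P: "projective E P"
  shows "\<lbrakk>y \<in> Arr E; Dom E y = P; Cod E y = ob (tgt p) 0\<rbrakk> \<Longrightarrow>
      \<exists>x\<in>Arr E. Dom E x = P \<and> Cod E x = ob (src p) 0 \<and> ap p 0 \<cdot> x = y"
    "\<lbrakk>cycle (src p) n P a; b \<in> Arr E; Dom E b = P; Cod E b = ob (tgt p) (Suc n);
      bd (tgt p) n \<cdot> b = ap p n \<cdot> a\<rbrakk> \<Longrightarrow>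
      \<exists>c\<in>Arr E. Dom E c = P \<and> Cod E c = ob (src p) (Suc n) \<and> bd (src p) n \<cdot> c = a \<and>
        ap p (Suc n) \<cdot> c = b"
proof -
  have p: "p \<in> Arr (Ch E)" using pW by (simp add: quasi_isos_iff)
  have q: "hom_quasi_iso P p" using pW P by (simp add: quasi_isos_iff)
  have Po: "P \<in> Obj E" using P by (simp add: projective_def)
  {
    assume y: "y \<in> Arr E" "Dom E y = P" "Cod E y = ob (tgt p) 0"
    then have "cycle (tgt p) 0 P y" by (simp add: cycle_0)
    then obtain x b where x: "cycle (src p) 0 P x" and b: "b \<in> Arr E" "Dom E b = P" "Cod E b = ob (tgt p) (Suc 0)"
      "ap p 0 \<cdot> x \<boxplus> bd (tgt p) 0 \<cdot> b = y" using hom_quasi_iso_surj[OF q] by metis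
    obtain c where c: "c \<in> Arr E" "Dom E c = P" "Cod E c = ob (src p) (Suc 0)" "ap p (Suc 0) \<cdot> c = b"
      using Ch_fibration_lift[OF pF P b(1-3)] .
    note xs = cycle_simps(1-3)[OF x]
    have "bd (tgt p) 0 \<cdot> b = ap p 0 \<cdot> (bd (src p) 0 \<cdot> c)"
      using chain_map_bd[OF p, of c 0] c by simp
    then have "ap p 0 \<cdot> (x \<boxplus> bd (src p) 0 \<cdot> c) = y"
      using b(4) c(1-3) xs p by simp
    then show "\<exists>x\<in>Arr E. Dom E x = P \<and> Cod E x = ob (src p) 0 \<and> ap p 0 \<cdot> x = y"
      using xs c p by (intro bexI[of _ "x \<boxplus> bd (src p) 0 \<cdot> c"]) simp_all
  next
    assume a: "cycle (src p) n P a" and b: "b \<in> Arr E" "Dom E b = P" "Cod E b = ob (tgt p) (Suc n)"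
      "bd (tgt p) n \<cdot> b = ap p n \<cdot> a"
    obtain a' where a': "a' \<in> Arr E" "Dom E a' = P" "Cod E a' = ob (src p) (Suc n)" "bd (src p) n \<cdot> a' = a"
      using hom_quasi_iso_inj[OF q a b] .
    \<comment> \<open>Start from any a' bounding a. The error e = b - p a' is a cycle, equal to p x
      + d b' for a cycle x, and a lift c of b' gives the corrected chain x + d c + a'.\<close>
    obtain e where e: "e \<in> Arr E" "Dom E e = P" "Cod E e = ob (tgt p) (Suc n)" "e \<boxplus> ap p (Suc n) \<cdot> a' = b"
      using diff_ex[of b "ap p (Suc n) \<cdot> a'"] a' b p by auto
    have "bd (tgt p) n \<cdot> (e \<boxplus> ap p (Suc n) \<cdot> a') = ap p n \<cdot> a" using e b by simp
    then have "bd (tgt p) n \<cdot> e = Zero E P (ob (tgt p) n)"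
      using e(1-3) a' cycle_simps(1-3)[OF a] p by simp
    then have "cycle (tgt p) (Suc n) P e" using e by (simp add: cycle_Suc)
    then obtain x b' where x: "cycle (src p) (Suc n) P x" and b': "b' \<in> Arr E" "Dom E b' = P" "Cod E b' = ob (tgt p) (Suc (Suc n))"
      "ap p (Suc n) \<cdot> x \<boxplus> bd (tgt p) (Suc n) \<cdot> b' = e" using hom_quasi_iso_surj[OF q] by metis
    note xs = cycle_simps(1-3)[OF x] cycle_simps(4)[OF x refl]
    obtain c where c: "c \<in> Arr E" "Dom E c = P" "Cod E c = ob (src p) (Suc (Suc n))" "ap p (Suc (Suc n)) \<cdot> c = b'"
      using Ch_fibration_lift[OF pF P b'(1-3)] .
    have "bd (tgt p) (Suc n) \<cdot> b' = ap p (Suc n) \<cdot> (bd (src p) (Suc n) \<cdot> c)"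
      using chain_map_bd[OF p, of c "Suc n"] c by simp
    then have e': "ap p (Suc n) \<cdot> (x \<boxplus> bd (src p) (Suc n) \<cdot> c) = e"
      using b'(4) c(1-3) xs p by simp
    let ?c = "(x \<boxplus> bd (src p) (Suc n) \<cdot> c) \<boxplus> a'"
    have "bd (src p) n \<cdot> ?c = a" using xs c(1-3) a' p Po cycle_simps(1-3)[OF a] by simp
    moreover have "ap p (Suc n) \<cdot> ?c = b"
      using e(4) e' xs c(1-3) a'(1-3) p by (simp del: Comp_Add add: Comp_Add(1)[of "x \<boxplus> bd (src p) (Suc n) \<cdot> c" a'])
    moreover have "?c \<in> Arr E" "Dom E ?c = P" "Cod E ?c = ob (src p) (Suc n)" using xs c a' p by simp_all
    ultimately show "\<exists>c\<in>Arr E. Dom E c = P \<and> Cod E c = ob (src p) (Suc n) \<and> bd (src p) n \<cdot> c = a \<and>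
        ap p (Suc n) \<cdot> c = b" by blast
  }
qed

text \<open>Converse of \<open>acyclic_fibration_lift\<close>. The two lifting properties stand in
  for surjectivity onto the pullback of cycles of the source and chains of the target, without
  forming that pullback.\<close>

lemma acyclic_fibrationI:
  assumes p: "p \<in> Arr (Ch E)"
    and lift0: "\<And>P y. \<lbrakk>projective E P; y \<in> Arr E; Dom E y = P; Cod E y = ob (tgt p) 0\<rbrakk> \<Longrightarrow>
      \<exists>x\<in>Arr E. Dom E x = P \<and> Cod E x = ob (src p) 0 \<and> ap p 0 \<cdot> x = y"
    and lift: "\<And>P n a b. \<lbrakk>projective E P; cycle (src p) n P a; b \<in> Arr E; Dom E b = P; Cod E b = ob (tgt p) (Suc n);
      bd (tgt p) n \<cdot> b = ap p n \<cdot> a\<rbrakk> \<Longrightarrow>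
      \<exists>c\<in>Arr E. Dom E c = P \<and> Cod E c = ob (src p) (Suc n) \<and> bd (src p) n \<cdot> c = a \<and>
        ap p (Suc n) \<cdot> c = b"
  shows "p \<in> Ch_fibrations E \<inter> quasi_isos E"
proof -
  \<comment> \<open>Cycles lift to cycles: in positive degree, apply \<open>lift\<close> with a =
    0.\<close>
  have cyc: "\<exists>x. cycle (src p) n P x \<and> ap p n \<cdot> x = y"
    if P: "projective E P" and y: "cycle (tgt p) n P y" for P n y
  proof (cases n)
    case 0
    then show ?thesis using lift0[OF P] y by (auto simp: cycle_0)
  next
    case (Suc k)
    note ys = cycle_simps(1-3)[OF y] cycle_simps(4)[OF y Suc]
    have Po: "P \<in> Obj E" using P by (simp add: projective_def)
    have "cycle (src p) k P (Zero E P (ob (src p) k))" using Po p by (auto simp: cycle_def)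
    then obtain c where "c \<in> Arr E" "Dom E c = P" "Cod E c = ob (src p) (Suc k)"
      "bd (src p) k \<cdot> c = Zero E P (ob (src p) k)" "ap p (Suc k) \<cdot> c = y"
      using lift[OF P, of k "Zero E P (ob (src p) k)" y] ys Suc Po p by auto
    then show ?thesis using Suc by (auto simp: cycle_Suc)
  qed
  have "p \<in> quasi_isos E"
    unfolding quasi_isos_iff
  proof (intro conjI allI impI p hom_quasi_isoI)
    fix P n x b assume "projective E P" "cycle (src p) n P x" "b \<in> Arr E" "Dom E b = P"
      "Cod E b = ob (tgt p) (Suc n)" "bd (tgt p) n \<cdot> b = ap p n \<cdot> x"
    then show "\<exists>a\<in>Arr E. Dom E a = P \<and> Cod E a = ob (src p) (Suc n) \<and> bd (src p) n \<cdot> a = x" using lift by blast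
  next
    fix P n y assume P: "projective E P" and y: "cycle (tgt p) n P y"
    have Po: "P \<in> Obj E" using P by (simp add: projective_def)
    obtain x where x: "cycle (src p) n P x" "ap p n \<cdot> x = y" using cyc[OF P y] by blast
    then show "\<exists>x b. cycle (src p) n P x \<and> b \<in> Arr E \<and> Dom E b = P \<and> Cod E b = ob (tgt p) (Suc n) \<and>
        ap p n \<cdot> x \<boxplus> bd (tgt p) n \<cdot> b = y"
      using cycle_simps(1-3)[OF x(1)] cycle_simps(1-3)[OF y] Po p
      by (intro exI[of _ x] exI[of _ "Zero E P (ob (tgt p) (Suc n))"]) simp
  qed
  moreover have "p \<in> Ch_fibrations E"
    unfolding Ch_fibrations_iff
  proof (intro conjI allI impI p, elim conjE)
    fix n P y assume P: "projective E P" and y: "y \<in> Arr E" "Dom E y = P" "Cod E y = ob (tgt p) (Suc n)"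
    have "cycle (tgt p) n P (bd (tgt p) n \<cdot> y)" using y p by (intro cycle_bd) simp_all
    then obtain x where "cycle (src p) n P x" "ap p n \<cdot> x = bd (tgt p) n \<cdot> y" using cyc[OF P] by blast
    then show "\<exists>x\<in>Arr E. Dom E x = P \<and> Cod E x = ob (src p) (Suc n) \<and> ap p (Suc n) \<cdot> x = y"
      using lift[OF P, of n x y] y by auto
  qed
  ultimately show ?thesis by blast
qed

end

context category
begin

lemma pullback_simps:
  assumes "is_pullback C f g p q"
  shows "f \<in> Arr C" "g \<in> Arr C" "p \<in> Arr C" "q \<in> Arr C" "Cod C f = Cod C g" "Dom C q = Dom C p"
    "Cod C p = Dom C f" "Cod C q = Dom C g" "f \<cdot> p = g \<cdot> q"
  using assms unfolding is_pullback_def by simp_all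

lemma pullback_lift:
  assumes "is_pullback C f g p q" "a \<in> Arr C" "b \<in> Arr C" "Dom C a = Dom C b"
    "Cod C a = Dom C f" "Cod C b = Dom C g" "f \<cdot> a = g \<cdot> b"
  obtains u where "u \<in> Arr C" "Dom C u = Dom C b" "Cod C u = Dom C p" "p \<cdot> u = a" "q \<cdot> u = b"
proof -
  have "Dom C b \<in> Obj C" "a \<in> Hom C (Dom C b) (Dom C f)" "b \<in> Hom C (Dom C b) (Dom C g)"
    using assms by simp_all
  then obtain u where "u \<in> Hom C (Dom C b) (Dom C p)" "p \<cdot> u = a" "q \<cdot> u = b"
    using assms(1,7) unfolding is_pullback_def by blast
  then show ?thesis using that[of u] by simp
qed

lemma pullback_ext:
  assumes pb: "is_pullback C f g p q" and u: "u \<in> Arr C" "Cod C u = Dom C p"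
    and v: "v \<in> Arr C" "Cod C v = Dom C p" "Dom C u = Dom C v"
    and e: "p \<cdot> u = p \<cdot> v" "q \<cdot> u = q \<cdot> v"
  shows "u = v"
proof -
  note t = pullback_simps[OF pb]
  have "Dom C v \<in> Obj C" "p \<cdot> v \<in> Hom C (Dom C v) (Dom C f)" "q \<cdot> v \<in> Hom C (Dom C v) (Dom C g)"
    using t v by simp_all
  moreover have "f \<cdot> (p \<cdot> v) = g \<cdot> (q \<cdot> v)" using reassoc[OF t(9), of v] t v by simp
  ultimately have "\<exists>!w. w \<in> Hom C (Dom C v) (Dom C p) \<and> p \<cdot> w = p \<cdot> v \<and> q \<cdot> w = q \<cdot> v"
    using pb unfolding is_pullback_def by blast
  moreover have "u \<in> Hom C (Dom C v) (Dom C p)" "v \<in> Hom C (Dom C v) (Dom C p)" using u v by simp_all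
  ultimately show ?thesis using e by blast
qed

end

section \<open>Lifting and factorizations for chain complexes\<close>

context exact_enough_projectives
begin

text \<open>The universal property of a coproduct in terms of its two injections, so that later
  arguments see neither the chosen direct sum nor its projections.\<close>

definition coprod :: "'b \<Rightarrow> 'b \<Rightarrow> bool" where
  "coprod j k \<longleftrightarrow> (\<forall>a b. a \<in> Arr E \<and> b \<in> Arr E \<and> Dom E a = Dom E j \<and> Dom E b = Dom E k \<and> Cod E a = Cod E b \<longrightarrow>
       (\<exists>t\<in>Arr E. Dom E t = Cod E j \<and> Cod E t = Cod E a \<and> t \<cdot> j = a \<and> t \<cdot> k = b)) \<and>
     (\<forall>t t'. t \<in> Arr E \<and> t' \<in> Arr E \<and> Dom E t = Cod E j \<and> Dom E t' = Cod E j \<and> Cod E t = Cod E t' \<and>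
       t \<cdot> j = t' \<cdot> j \<and> t \<cdot> k = t' \<cdot> k \<longrightarrow> t = t')"

lemma coprod_ex:
  assumes "coprod j k" "a \<in> Arr E" "b \<in> Arr E" "Dom E a = Dom E j" "Dom E b = Dom E k" "Cod E a = Cod E b"
  obtains t where "t \<in> Arr E" "Dom E t = Cod E j" "Cod E t = Cod E b" "t \<cdot> j = a" "t \<cdot> k = b"
  using assms unfolding coprod_def by metis

lemma coprod_ext:
  assumes "coprod j k" "t \<in> Arr E" "t' \<in> Arr E" "Dom E t = Cod E j" "Dom E t' = Cod E j" "Cod E t = Cod E t'"
    "t \<cdot> j = t' \<cdot> j" "t \<cdot> k = t' \<cdot> k"
  shows "t = t'"
  using assms unfolding coprod_def by blast

text \<open>Add a projective cover R of w to x. The restriction of h to R is an admissible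
  epimorphism, so h is one by \<open>adm_epi_factor\<close>, while h still extends g.\<close>

lemma coprod_cover:
  assumes g: "g \<in> Arr E" "Dom E g = x" "Cod E g = w"
  obtains h j k where "adm_epi E h" "h \<in> Arr E" "Cod E h = w" "j \<in> Arr E" "Dom E j = x" "Cod E j = Dom E h"
    "k \<in> Arr E" "Cod E k = Dom E h" "projective E (Dom E k)" "h \<cdot> j = g" "coprod j k"
proof -
  have xw: "x \<in> Obj E" "w \<in> Obj E" using g by auto
  obtain R r where r: "projective E R" "R \<in> Obj E" "adm_epi E r" "r \<in> Arr E" "Dom E r = R" "Cod E r = w"
    using projective_cover[OF xw(2)] by metis
  let ?X = "\<lambda>b. if b then x else R"
  have B: "is_biproduct E UNIV ?X (dsum E UNIV ?X) (dsum_in E UNIV ?X) (dsum_pr UNIV ?X)"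
    by (rule dsum_biproduct) (use xw r in simp_all)
  note b = biproduct_simps[OF B]
  let ?j = "dsum_in E UNIV ?X True" and ?k = "dsum_in E UNIV ?X False"
  have jk: "?j \<in> Arr E" "Dom E ?j = x" "Cod E ?j = dsum E UNIV ?X" "?k \<in> Arr E" "Dom E ?k = R" "Cod E ?k = dsum E UNIV ?X"
    using b(4-6)[of True] b(4-6)[of False] by simp_all
  have ex: "\<exists>t\<in>Arr E. Dom E t = dsum E UNIV ?X \<and> Cod E t = y \<and> t \<cdot> ?j = a \<and> t \<cdot> ?k = c"
    if ac: "a \<in> Arr E" "c \<in> Arr E" "Dom E a = x" "Dom E c = R" "Cod E a = y" "Cod E c = y" for a c y
  proof -
    have y: "y \<in> Obj E" using ac by auto
    obtain t where "t \<in> Arr E" "Dom E t = dsum E UNIV ?X" "Cod E t = y"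
      "\<And>i. i \<in> UNIV \<Longrightarrow> t \<cdot> dsum_in E UNIV ?X i = (if i then a else c)"
      by (rule copair_ex[of UNIV "\<lambda>i. if i then a else c" ?X y]) (use ac y in simp_all)
    then show ?thesis by (intro bexI[of _ t]) simp_all
  qed
  have cop: "coprod ?j ?k"
    unfolding coprod_def
  proof (intro conjI allI impI; elim conjE)
    fix a c assume "a \<in> Arr E" "c \<in> Arr E" "Dom E a = Dom E ?j" "Dom E c = Dom E ?k" "Cod E a = Cod E c"
    then show "\<exists>t\<in>Arr E. Dom E t = Cod E ?j \<and> Cod E t = Cod E a \<and> t \<cdot> ?j = a \<and> t \<cdot> ?k = c"
      using ex[of a c "Cod E c"] jk by simp
  next
    fix t t' assume t: "t \<in> Arr E" "t' \<in> Arr E" "Dom E t = Cod E ?j" "Dom E t' = Cod E ?j" "Cod E t = Cod E t'"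
      "t \<cdot> ?j = t' \<cdot> ?j" "t \<cdot> ?k = t' \<cdot> ?k"
    show "t = t'"
    proof (rule biproduct_ext_inc[OF B])
      show "t \<cdot> dsum_in E UNIV ?X i = t' \<cdot> dsum_in E UNIV ?X i" for i
        using t(6,7) by (cases i) simp_all
    qed (use t jk in simp_all)
  qed
  obtain h where h: "h \<in> Arr E" "Dom E h = dsum E UNIV ?X" "Cod E h = w" "h \<cdot> ?j = g" "h \<cdot> ?k = r"
    using ex[of g r w] g r by blast
  have "adm_epi E h"
    using adm_epi_factor[OF weakly_idempotent_complete, of ?k h] h jk r by simp
  then show ?thesis using that[of h ?j ?k] h jk r cop by simp
qed

text \<open>In each degree i is the inclusion of a summand with projective complement. The diagonal
  is forced on the domain of i and comes from \<open>acyclic_fibration_lift\<close> on the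
  complement; the degrees are joined by dependent choice.\<close>

lemma has_lifting_acyclic_fibration:
  assumes i: "i \<in> Arr (Ch E)"
    and cop: "\<And>n. coprod (ap i n) (k n)" "\<And>n. k n \<in> Arr E" "\<And>n. Cod E (k n) = ob (tgt i) n"
      "\<And>n. projective E (Dom E (k n))"
    and q: "q \<in> Ch_fibrations E \<inter> quasi_isos E"
  shows "has_lifting (Ch E) i q"
  unfolding has_lifting_def
proof (intro ballI impI)
  have qA: "q \<in> Arr (Ch E)" using q by (simp add: quasi_isos_iff)
  fix u v assume "u \<in> Hom (Ch E) (Dom (Ch E) i) (Dom (Ch E) q)" "v \<in> Hom (Ch E) (Cod (Ch E) i) (Cod (Ch E) q)"
    and sq: "q \<cdot>\<^bsub>Ch E\<^esub> u = v \<cdot>\<^bsub>Ch E\<^esub> i"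
  then have uv: "u \<in> Arr (Ch E)" "src u = src i" "tgt u = src q" "v \<in> Arr (Ch E)" "src v = tgt i" "tgt v = tgt q" by simp_all
  define X Q A B I U V p where "X = src i" and "Q = tgt i" and "A = src q" and "B = tgt q"
    and "I = ap i" and "U = ap u" and "V = ap v" and "p = ap q"
  note defs = X_def Q_def A_def B_def I_def U_def V_def p_def
  have cc: "X \<in> chain_complexes E" "Q \<in> chain_complexes E" "A \<in> chain_complexes E" "B \<in> chain_complexes E"
    using i qA by (simp_all add: defs)
  have t: "I n \<in> Arr E" "Dom E (I n) = ob X n" "Cod E (I n) = ob Q n" "U n \<in> Arr E" "Dom E (U n) = ob X n" "Cod E (U n) = ob A n"
    "V n \<in> Arr E" "Dom E (V n) = ob Q n" "Cod E (V n) = ob B n" "p n \<in> Arr E" "Dom E (p n) = ob A n" "Cod E (p n) = ob B n" for n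
    using i qA uv by (simp_all add: defs)
  have d: "bd Q n \<cdot> I (Suc n) = I n \<cdot> bd X n" "bd A n \<cdot> U (Suc n) = U n \<cdot> bd X n"
    "bd B n \<cdot> V (Suc n) = V n \<cdot> bd Q n" "bd B n \<cdot> p (Suc n) = p n \<cdot> bd A n" for n
    using Arr_Ch_simps(6)[OF i, of n] Arr_Ch_simps(6)[OF qA, of n] Arr_Ch_simps(6)[OF uv(1), of n] Arr_Ch_simps(6)[OF uv(4), of n] uv
    by (simp_all add: defs)
  have pu: "p n \<cdot> U n = V n \<cdot> I n" for n using arg_cong[OF sq, of "\<lambda>h. ap h n"] by (simp add: defs)
  have k: "coprod (I n) (k n)" "k n \<in> Arr E" "Cod E (k n) = ob Q n" "projective E (Dom E (k n))" for n
    using cop by (simp_all add: defs)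
  \<comment> \<open>The last clause, that t composed with the next differential is a cycle, is the
    hypothesis under which the lift exists one degree higher.\<close>
  define good where "good n t \<longleftrightarrow> t \<in> Arr E \<and> Dom E t = ob Q n \<and> Cod E t = ob A n \<and> t \<cdot> I n = U n \<and> p n \<cdot> t = V n \<and>
    cycle A n (ob Q (Suc n)) (t \<cdot> bd Q n)" for n t
  have "\<exists>s\<in>Arr E. Dom E s = Dom E (k 0) \<and> Cod E s = ob A 0 \<and> p 0 \<cdot> s = V 0 \<cdot> k 0"
    using acyclic_fibration_lift(1)[of q "Dom E (k 0)" "V 0 \<cdot> k 0"] q k[of 0] t[of 0] by (simp add: defs)
  then obtain s where s: "s \<in> Arr E" "Dom E s = Dom E (k 0)" "Cod E s = ob A 0" "p 0 \<cdot> s = V 0 \<cdot> k 0" by blast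
  obtain t0 where t0: "t0 \<in> Arr E" "Dom E t0 = ob Q 0" "Cod E t0 = ob A 0" "t0 \<cdot> I 0 = U 0" "t0 \<cdot> k 0 = s"
    using coprod_ex[OF k(1)[of 0], of "U 0" s] s t[of 0] by auto
  have "p 0 \<cdot> t0 = V 0"
    by (rule coprod_ext[OF k(1)[of 0]]) (use t0 s t[of 0] pu[of 0] k[of 0] in simp_all)
  then have g0: "good 0 t0" using t0 cc by (simp add: good_def cycle_0)
  have step: "\<exists>t'. good (Suc n) t' \<and> bd A n \<cdot> t' = t1 \<cdot> bd Q n" if g: "good n t1" for n t1
  proof -
    have t1: "t1 \<in> Arr E" "Dom E t1 = ob Q n" "Cod E t1 = ob A n" "t1 \<cdot> I n = U n" "p n \<cdot> t1 = V n"
      and c: "cycle A n (ob Q (Suc n)) (t1 \<cdot> bd Q n)" using g by (simp_all add: good_def)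
    let ?k = "k (Suc n)"
    have Ro: "Dom E ?k \<in> Obj E" using k(2) by simp
    have "cycle A n (Dom E ?k) (t1 \<cdot> (bd Q n \<cdot> ?k))"
    proof (cases n)
      case (Suc m)
      then have "bd A m \<cdot> (t1 \<cdot> bd Q n) = Zero E (ob Q (Suc n)) (ob A m)" using cycle_simps(4)[OF c] by simp
      then have "(bd A m \<cdot> (t1 \<cdot> bd Q n)) \<cdot> ?k = Zero E (ob Q (Suc n)) (ob A m) \<cdot> ?k" by simp
      then show ?thesis using Suc t1 k(2,3)[of "Suc n"] cc by (simp add: cycle_Suc)
    qed (use t1 k[of "Suc n"] cc in \<open>simp add: cycle_0\<close>)
    moreover have "bd B n \<cdot> (V (Suc n) \<cdot> ?k) = p n \<cdot> (t1 \<cdot> (bd Q n \<cdot> ?k))"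
      using reassoc[OF d(3)[of n], of ?k] reassoc[OF t1(5), of "bd Q n \<cdot> ?k"] t[of n] t[of "Suc n"] t1 k[of "Suc n"] cc by simp
    ultimately obtain s where s: "s \<in> Arr E" "Dom E s = Dom E ?k" "Cod E s = ob A (Suc n)"
      "bd A n \<cdot> s = t1 \<cdot> (bd Q n \<cdot> ?k)" "p (Suc n) \<cdot> s = V (Suc n) \<cdot> ?k"
      using acyclic_fibration_lift(2)[of q "Dom E ?k" n "t1 \<cdot> (bd Q n \<cdot> ?k)" "V (Suc n) \<cdot> ?k"] q k[of "Suc n"] t[of "Suc n"]
      unfolding defs by auto
    obtain t' where t': "t' \<in> Arr E" "Dom E t' = ob Q (Suc n)" "Cod E t' = ob A (Suc n)" "t' \<cdot> I (Suc n) = U (Suc n)" "t' \<cdot> ?k = s"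
      using coprod_ex[OF k(1)[of "Suc n"], of "U (Suc n)" s] s t[of "Suc n"] by auto
    have p': "p (Suc n) \<cdot> t' = V (Suc n)"
      by (rule coprod_ext[OF k(1)[of "Suc n"]]) (use t' s t[of "Suc n"] pu[of "Suc n"] k[of "Suc n"] in simp_all)
    have d': "bd A n \<cdot> t' = t1 \<cdot> bd Q n"
    proof (rule coprod_ext[OF k(1)[of "Suc n"]])
      show "(bd A n \<cdot> t') \<cdot> I (Suc n) = (t1 \<cdot> bd Q n) \<cdot> I (Suc n)"
        using t' t[of "Suc n"] t[of n] t1 d(1,2)[of n] reassoc[OF t1(4), of "bd X n"] cc by simp
      show "(bd A n \<cdot> t') \<cdot> ?k = (t1 \<cdot> bd Q n) \<cdot> ?k" using t' s t1 k[of "Suc n"] cc by simp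
    qed (use t' t1 t[of "Suc n"] cc in simp_all)
    have "good (Suc n) t'"
      unfolding good_def cycle_Suc using t' p' reassoc[OF d', of "bd Q (Suc n)"] t1 cc by simp
    then show ?thesis using d' by blast
  qed
  obtain h where h: "\<And>n. good n (h n)" "\<And>n. bd A n \<cdot> h (Suc n) = h n \<cdot> bd Q n"
    using dependent_nat_choice[of good "\<lambda>n t t'. bd A n \<cdot> t' = t \<cdot> bd Q n"] g0 step by metis
  have ht: "h n \<in> Arr E" "Dom E (h n) = ob Q n" "Cod E (h n) = ob A n" "h n \<cdot> I n = U n" "p n \<cdot> h n = V n" for n
    using h(1)[of n] by (simp_all add: good_def)
  let ?h = "Arrow Q h A"
  have "?h \<in> Arr (Ch E)" using ht(1-3) h(2) cc by (simp add: Arr_Ch_iff)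
  moreover have "?h \<cdot>\<^bsub>Ch E\<^esub> i = u" "q \<cdot>\<^bsub>Ch E\<^esub> ?h = v"
    by (rule arrow_eqI; use ht(4,5) uv in \<open>simp add: defs\<close>)+
  ultimately show "\<exists>h\<in>Hom (Ch E) (Cod (Ch E) i) (Dom (Ch E) q). h \<cdot>\<^bsub>Ch E\<^esub> i = u \<and> q \<cdot>\<^bsub>Ch E\<^esub> h = v"
    by (intro bexI[of _ ?h]) (simp_all add: defs)
qed

text \<open>The complex \<open>Q\<close> is built degree by degree: \<open>W\<^sub>0 = Y\<^sub>0\<close>, then \<open>h\<^sub>n : Q\<^sub>n = X\<^sub>n \<oplus> R\<^sub>n \<twoheadrightarrow> W\<^sub>n\<close> with \<open>R\<^sub>n\<close>
  projective, and \<open>W\<^sub>n\<^sub>+\<^sub>1\<close> is the pullback of \<open>h\<^sub>n\<close> along the map \<open>c\<^sub>n : Y\<^sub>n\<^sub>+\<^sub>1 \<rightarrow> W\<^sub>n\<close> induced by the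
  differential; its projections \<open>\<alpha>\<^sub>n, \<beta>\<^sub>n\<close> give the differential of \<open>Q\<close> and the map \<open>Q \<rightarrow> Y\<close>.\<close>

lemma acyclic_fibration_factorization:
  assumes f: "f \<in> Arr (Ch E)"
  shows "\<exists>i\<in>Arr (Ch E). \<exists>p\<in>Ch_fibrations E \<inter> quasi_isos E. tgt i = src p \<and> f = p \<cdot>\<^bsub>Ch E\<^esub> i \<and>
    (\<forall>q\<in>Ch_fibrations E \<inter> quasi_isos E. has_lifting (Ch E) i q)"
proof -
  define X Y F where "X = src f" and "Y = tgt f" and "F = ap f"
  note defs = X_def Y_def F_def
  have cc: "X \<in> chain_complexes E" "Y \<in> chain_complexes E" using f by (simp_all add: defs)
  have Ft: "F n \<in> Arr E" "Dom E (F n) = ob X n" "Cod E (F n) = ob Y n" for n using f by (simp_all add: defs)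
  have Fd: "bd Y n \<cdot> F (Suc n) = F n \<cdot> bd X n" for n using Arr_Ch_simps(6)[OF f, of n] by (simp add: defs)
  \<comment> \<open>One tuple per degree: c : Y_{n+1} -> W_n and g : X_n -> W_n, the cover h : Q_n
    -> W_n, and the injections j, k of X_n and of the projective summand into Q_n. The clause for n
    = 0 anchors the recursion at W_0 = Y_0.\<close>
  define good where "good n = (\<lambda>(c, g, h, j, k). c \<in> Arr E \<and> Dom E c = ob Y (Suc n) \<and> g \<in> Arr E \<and> Dom E g = ob X n \<and>
     Cod E g = Cod E c \<and> c \<cdot> bd Y (Suc n) = Zero E (ob Y (Suc (Suc n))) (Cod E c) \<and> g \<cdot> bd X n = c \<cdot> F (Suc n) \<and>
     adm_epi E h \<and> h \<in> Arr E \<and> Cod E h = Cod E c \<and> j \<in> Arr E \<and> Dom E j = ob X n \<and> Cod E j = Dom E h \<and>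
     k \<in> Arr E \<and> Cod E k = Dom E h \<and> projective E (Dom E k) \<and> h \<cdot> j = g \<and> coprod j k \<and>
     (n = 0 \<longrightarrow> c = bd Y 0 \<and> g = F 0))" for n
  \<comment> \<open>W_{n+1} is the common domain of \<alpha> and \<beta>; into this pullback c' is
    induced by (0, d) and g' by (j d, F).\<close>
  define nxt :: "nat \<Rightarrow> 'b \<times> 'b \<times> 'b \<times> 'b \<times> 'b \<Rightarrow> 'b \<times> 'b \<times> 'b \<times> 'b \<times> 'b \<Rightarrow> bool"
    where "nxt n = (\<lambda>(c, g, h, j, k) (c', g', h', j', k'). \<exists>\<alpha> \<beta>. is_pullback E h c \<alpha> \<beta> \<and> Cod E c' = Dom E \<alpha> \<and>
     \<alpha> \<cdot> c' = Zero E (ob Y (Suc (Suc n))) (Dom E h) \<and> \<beta> \<cdot> c' = bd Y (Suc n) \<and> \<alpha> \<cdot> g' = j \<cdot> bd X n \<and> \<beta> \<cdot> g' = F (Suc n))" for n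
  have ext: "\<exists>s. good n s \<and> fst s = c \<and> fst (snd s) = g"
    if cg: "c \<in> Arr E" "Dom E c = ob Y (Suc n)" "g \<in> Arr E" "Dom E g = ob X n"
      "Cod E g = Cod E c" "c \<cdot> bd Y (Suc n) = Zero E (ob Y (Suc (Suc n))) (Cod E c)" "g \<cdot> bd X n = c \<cdot> F (Suc n)"
      "n = 0 \<Longrightarrow> c = bd Y 0 \<and> g = F 0" for n c g
  proof -
    obtain h j k where "adm_epi E h" "h \<in> Arr E" "Cod E h = Cod E c" "j \<in> Arr E" "Dom E j = ob X n" "Cod E j = Dom E h"
      "k \<in> Arr E" "Cod E k = Dom E h" "projective E (Dom E k)" "h \<cdot> j = g" "coprod j k"
      using coprod_cover[OF cg(3,4,5)] by metis
    then show ?thesis using cg by (intro exI[of _ "(c, g, h, j, k)"]) (simp add: good_def)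
  qed
  have g0: "\<exists>s. good 0 s"
  proof -
    have "\<exists>s. good 0 s \<and> fst s = bd Y 0 \<and> fst (snd s) = F 0"
      using cc Ft[of 0] Fd[of 0] by (intro ext) simp_all
    then show ?thesis by blast
  qed
  have step: "\<exists>s'. good (Suc n) s' \<and> nxt n s s'" if gs: "good n s" for n s
  proof -
    obtain c g h j k where s: "s = (c, g, h, j, k)" by (cases s) auto
    have c: "c \<in> Arr E" "Dom E c = ob Y (Suc n)" "c \<cdot> bd Y (Suc n) = Zero E (ob Y (Suc (Suc n))) (Cod E c)"
      and g: "g \<in> Arr E" "Dom E g = ob X n" "Cod E g = Cod E c" "g \<cdot> bd X n = c \<cdot> F (Suc n)"
      and h: "adm_epi E h" "h \<in> Arr E" "Cod E h = Cod E c" and j: "j \<in> Arr E" "Dom E j = ob X n" "Cod E j = Dom E h" "h \<cdot> j = g"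
      using gs by (simp_all add: s good_def)
    obtain \<beta> \<alpha> where pb: "is_pullback E h c \<alpha> \<beta>" using adm_epi_pullback[OF h(1) c(1)] h(3) by auto
    note pt = pullback_simps[OF pb]
    have Qo: "Dom E h \<in> Obj E" using h by simp
    obtain c' where c': "c' \<in> Arr E" "Dom E c' = ob Y (Suc (Suc n))" "Cod E c' = Dom E \<alpha>"
      "\<alpha> \<cdot> c' = Zero E (ob Y (Suc (Suc n))) (Dom E h)" "\<beta> \<cdot> c' = bd Y (Suc n)"
      using pullback_lift[OF pb, of "Zero E (ob Y (Suc (Suc n))) (Dom E h)" "bd Y (Suc n)"] cc c h Qo by auto
    have "h \<cdot> (j \<cdot> bd X n) = c \<cdot> F (Suc n)" using reassoc[OF j(4), of "bd X n"] j h g cc by simp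
    then obtain g' where g': "g' \<in> Arr E" "Dom E g' = ob X (Suc n)" "Cod E g' = Dom E \<alpha>"
      "\<alpha> \<cdot> g' = j \<cdot> bd X n" "\<beta> \<cdot> g' = F (Suc n)"
      using pullback_lift[OF pb, of "j \<cdot> bd X n" "F (Suc n)"] cc c h j Ft[of "Suc n"] by auto
    have \<alpha>o: "Dom E \<alpha> \<in> Obj E" using pt by simp
    have "c' \<cdot> bd Y (Suc (Suc n)) = Zero E (ob Y (Suc (Suc (Suc n)))) (Dom E \<alpha>)"
      by (rule pullback_ext[OF pb])
        (use reassoc[OF c'(4), of "bd Y (Suc (Suc n))"] reassoc[OF c'(5), of "bd Y (Suc (Suc n))"] c' pt c cc Qo \<alpha>o in simp_all)
    moreover have "g' \<cdot> bd X (Suc n) = c' \<cdot> F (Suc (Suc n))"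
      by (rule pullback_ext[OF pb])
        (use reassoc[OF c'(4), of "F (Suc (Suc n))"] reassoc[OF c'(5), of "F (Suc (Suc n))"] reassoc[OF g'(4), of "bd X (Suc n)"]
          reassoc[OF g'(5), of "bd X (Suc n)"] c' g' pt c j cc Qo Ft[of "Suc n"] Ft[of "Suc (Suc n)"] Fd[of "Suc n"] in simp_all)
    ultimately have "\<exists>s. good (Suc n) s \<and> fst s = c' \<and> fst (snd s) = g'"
      using c' g' by (intro ext) simp_all
    then obtain s' where s': "good (Suc n) s'" "fst s' = c'" "fst (snd s') = g'" by blast
    have "nxt n s s'"
      unfolding nxt_def s using s'(2,3) pb c' g' by (cases s') auto
    then show ?thesis using s'(1) by blast
  qed
  obtain s where s: "\<And>n. good n (s n)" "\<And>n. nxt n (s n) (s (Suc n))"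
    using dependent_nat_choice[of good nxt] g0 step by metis
  define c g h j k where "c n = fst (s n)" and "g n = fst (snd (s n))" and "h n = fst (snd (snd (s n)))"
    and "j n = fst (snd (snd (snd (s n))))" and "k n = snd (snd (snd (snd (s n))))" for n
  note sdefs = c_def g_def h_def j_def k_def
  have S: "c n \<in> Arr E" "Dom E (c n) = ob Y (Suc n)" "g n \<in> Arr E" "Dom E (g n) = ob X n"
     "Cod E (g n) = Cod E (c n)" "adm_epi E (h n)" "h n \<in> Arr E" "Cod E (h n) = Cod E (c n)" "j n \<in> Arr E" "Dom E (j n) = ob X n"
     "Cod E (j n) = Dom E (h n)" "k n \<in> Arr E" "Cod E (k n) = Dom E (h n)" "projective E (Dom E (k n))" "h n \<cdot> j n = g n"
     "coprod (j n) (k n)" "c 0 = bd Y 0" "g 0 = F 0" for n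
    using s(1)[of n] s(1)[of 0] by (simp_all add: sdefs good_def case_prod_beta)
  have "\<forall>n. \<exists>\<alpha> \<beta>. is_pullback E (h n) (c n) \<alpha> \<beta> \<and> Cod E (c (Suc n)) = Dom E \<alpha> \<and>
     \<alpha> \<cdot> c (Suc n) = Zero E (ob Y (Suc (Suc n))) (Dom E (h n)) \<and> \<beta> \<cdot> c (Suc n) = bd Y (Suc n) \<and>
     \<alpha> \<cdot> g (Suc n) = j n \<cdot> bd X n \<and> \<beta> \<cdot> g (Suc n) = F (Suc n)"
    using s(2) by (simp add: sdefs nxt_def case_prod_beta)
  then obtain \<alpha> \<beta> where ab: "\<And>n. is_pullback E (h n) (c n) (\<alpha> n) (\<beta> n)" "\<And>n. Cod E (c (Suc n)) = Dom E (\<alpha> n)"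
     "\<And>n. \<alpha> n \<cdot> c (Suc n) = Zero E (ob Y (Suc (Suc n))) (Dom E (h n))" "\<And>n. \<beta> n \<cdot> c (Suc n) = bd Y (Suc n)"
     "\<And>n. \<alpha> n \<cdot> g (Suc n) = j n \<cdot> bd X n" "\<And>n. \<beta> n \<cdot> g (Suc n) = F (Suc n)"
    by metis
  have pt: "\<alpha> n \<in> Arr E" "\<beta> n \<in> Arr E" "Dom E (\<beta> n) = Dom E (\<alpha> n)" "Cod E (\<alpha> n) = Dom E (h n)" "Cod E (\<beta> n) = ob Y (Suc n)"
    "h n \<cdot> \<alpha> n = c n \<cdot> \<beta> n" for n
    using pullback_simps[OF ab(1)[of n]] S(2)[of n] by simp_all
  define Q where "Q = Chain (\<lambda>n. Dom E (h n)) (\<lambda>n. \<alpha> n \<cdot> h (Suc n))"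
  define p where "p n = (case n of 0 \<Rightarrow> h 0 | Suc m \<Rightarrow> \<beta> m \<cdot> h (Suc m))" for n
  have Qt: "ob Q n = Dom E (h n)" "bd Q n = \<alpha> n \<cdot> h (Suc n)" "Dom E (h n) \<in> Obj E" for n
    using S(7)[of n] by (simp_all add: Q_def)
  have p0: "p 0 = h 0" and pS: "p (Suc m) = \<beta> m \<cdot> h (Suc m)" for m by (simp_all add: p_def)
  note T = S(1,2,3,4,5,7,8,9,10,11) pt(1-5)
  have hSt: "Cod E (h (Suc n)) = Dom E (\<alpha> n)" for n using S(8)[of "Suc n"] ab(2)[of n] by simp
  have Qd: "(\<alpha> n \<cdot> h (Suc n)) \<cdot> (\<alpha> (Suc n) \<cdot> h (Suc (Suc n))) = Zero E (Dom E (h (Suc (Suc n)))) (Dom E (h n))" for n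
  proof -
    \<comment> \<open>The pullback square gives h \<alpha> = c \<beta>, and \<alpha> c = 0, so the
      differential squares to zero.\<close>
    have "(\<alpha> n \<cdot> h (Suc n)) \<cdot> (\<alpha> (Suc n) \<cdot> h (Suc (Suc n))) = \<alpha> n \<cdot> ((h (Suc n) \<cdot> \<alpha> (Suc n)) \<cdot> h (Suc (Suc n)))"
      using T[of n] T[of "Suc n"] T[of "Suc (Suc n)"] hSt[of n] hSt[of "Suc n"] by simp
    also have "\<dots> = (\<alpha> n \<cdot> c (Suc n)) \<cdot> (\<beta> (Suc n) \<cdot> h (Suc (Suc n)))"
      unfolding pt(6) using T[of n] T[of "Suc n"] T[of "Suc (Suc n)"] hSt[of n] hSt[of "Suc n"] ab(2)[of n] by simp
    finally show ?thesis unfolding ab(3)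
      using T[of n] T[of "Suc n"] T[of "Suc (Suc n)"] hSt[of n] hSt[of "Suc n"] Qt(3) by simp
  qed
  have Qc: "Q \<in> chain_complexes E"
    unfolding chain_complexes_def mem_Collect_eq Qt(1,2)
    using Qd Qt(3) T hSt by (intro conjI allI) simp_all
  have jd: "bd Q n \<cdot> j (Suc n) = j n \<cdot> bd X n" for n
    using T[of n] T[of "Suc n"] hSt[of n] S(15)[of "Suc n"] ab(5)[of n] by (simp add: Qt)
  have pT: "p n \<in> Arr E" "Dom E (p n) = ob Q n" "Cod E (p n) = ob Y n" for n
    using T[of n] T[of "n - 1"] hSt[of "n - 1"] S(17) cc(2) by (cases n; simp add: p0 pS Qt)+
  have pd: "bd Y n \<cdot> p (Suc n) = p n \<cdot> bd Q n" for n
  proof (cases n)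
    case 0
    have "(c 0 \<cdot> \<beta> 0) \<cdot> h (Suc 0) = (h 0 \<cdot> \<alpha> 0) \<cdot> h (Suc 0)" by (simp only: pt(6))
    then show ?thesis using T[of 0] T[of "Suc 0"] hSt[of 0] S(17) cc(2) 0 by (simp add: p0 pS Qt)
  next
    case (Suc m)
    have "(\<beta> m \<cdot> (c (Suc m) \<cdot> \<beta> (Suc m))) \<cdot> h (Suc (Suc m)) = (\<beta> m \<cdot> (h (Suc m) \<cdot> \<alpha> (Suc m))) \<cdot> h (Suc (Suc m))"
      by (simp only: pt(6))
    then show ?thesis
      using reassoc[OF ab(4)[of m], of "\<beta> (Suc m) \<cdot> h (Suc (Suc m))"]
        T[of m] T[of "Suc m"] T[of "Suc (Suc m)"] hSt[of m] hSt[of "Suc m"] ab(2)[of m] cc(2) Suc by (simp add: p0 pS Qt)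
  qed
  have pj: "p n \<cdot> j n = F n" for n
  proof (cases n)
    case 0
    then show ?thesis using S(15)[of 0] S(18) p0 by metis
  next
    case (Suc m)
    then show ?thesis using T[of m] T[of "Suc m"] hSt[of m] S(15)[of "Suc m"] ab(6)[of m] by (simp add: pS)
  qed
  have iA: "Arrow X j Q \<in> Arr (Ch E)" using cc Qc S(9-11) jd by (simp add: Arr_Ch_iff Qt(1))
  have pA: "Arrow Q p Y \<in> Arr (Ch E)" using cc Qc pT pd by (simp add: Arr_Ch_iff)
  have pFW: "Arrow Q p Y \<in> Ch_fibrations E \<inter> quasi_isos E"
  proof (rule acyclic_fibrationI[OF pA]; unfold arrow.sel)
    fix P y assume P: "projective E P" and y: "y \<in> Arr E" "Dom E y = P" "Cod E y = ob Y 0"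
    have "Cod E y = Cod E (h 0)" using y S(8)[of 0] S(17) cc(2) by simp
    then show "\<exists>x\<in>Arr E. Dom E x = P \<and> Cod E x = ob Q 0 \<and> p 0 \<cdot> x = y"
      using projective_lift[OF P S(6)[of 0], of y] y by (metis Qt(1) p0)
  next
    fix P n a b assume P: "projective E P" and a: "cycle Q n P a" and b: "b \<in> Arr E" "Dom E b = P" "Cod E b = ob Y (Suc n)"
      "bd Y n \<cdot> b = p n \<cdot> a"
    note as = cycle_simps(1-3)[OF a]
    have Po: "P \<in> Obj E" using P by (simp add: projective_def)
    \<comment> \<open>This says that a cycle a of Q_n and a b with d b = p a form a compatible pair
      for the pullback W_{n+1}. The induced arrow, lifted along the cover \<open>h (Suc n)\<close>,
      yields a chain over b that bounds a.\<close>
    have "h n \<cdot> a = c n \<cdot> b"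
    proof (cases n)
      case 0
      then show ?thesis using b(4) p0 S(17) by metis
    next
      case (Suc m)
      show ?thesis
        unfolding Suc
      proof (rule pullback_ext[OF ab(1)[of m]])
        have "\<alpha> m \<cdot> (h (Suc m) \<cdot> a) = Zero E P (Dom E (h m))"
          using cycle_simps(4)[OF a Suc] as Suc T[of m] T[of "Suc m"] hSt[of m] by (simp add: Qt)
        moreover have "\<alpha> m \<cdot> (c (Suc m) \<cdot> b) = Zero E P (Dom E (h m))"
          using reassoc[OF ab(3)[of m], of b] b Suc T[of m] T[of "Suc m"] ab(2)[of m] Qt(3)[of m] by simp
        ultimately show "\<alpha> m \<cdot> (h (Suc m) \<cdot> a) = \<alpha> m \<cdot> (c (Suc m) \<cdot> b)" by simp
        have "\<beta> m \<cdot> (h (Suc m) \<cdot> a) = p n \<cdot> a"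
          using as Suc T[of m] T[of "Suc m"] hSt[of m] by (simp add: pS Qt)
        also have "\<dots> = (\<beta> m \<cdot> c (Suc m)) \<cdot> b" using b(4) Suc ab(4)[of m] by simp
        finally show "\<beta> m \<cdot> (h (Suc m) \<cdot> a) = \<beta> m \<cdot> (c (Suc m) \<cdot> b)"
          using b Suc T[of m] T[of "Suc m"] ab(2)[of m] by simp
      qed (use as b Suc T[of "Suc m"] hSt[of m] ab(2)[of m] in \<open>simp_all add: Qt\<close>)
    qed
    then obtain w where w: "w \<in> Arr E" "Dom E w = P" "Cod E w = Dom E (\<alpha> n)" "\<alpha> n \<cdot> w = a" "\<beta> n \<cdot> w = b"
      using pullback_lift[OF ab(1)[of n], of a b] as b S(2)[of n] by (auto simp: Qt)
    obtain e where e: "e \<in> Arr E" "Dom E e = P" "Cod E e = Dom E (h (Suc n))" "h (Suc n) \<cdot> e = w"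
      using projective_lift[OF P S(6)[of "Suc n"] w(1,2)] w(3) hSt[of n] by metis
    show "\<exists>c\<in>Arr E. Dom E c = P \<and> Cod E c = ob Q (Suc n) \<and> bd Q n \<cdot> c = a \<and> p (Suc n) \<cdot> c = b"
      using e w T[of n] T[of "Suc n"] hSt[of n] by (intro bexI[of _ e]) (simp_all add: Qt pS)
  qed
  have "f = Arrow Q p Y \<cdot>\<^bsub>Ch E\<^esub> Arrow X j Q"
    by (rule arrow_eqI) (simp_all add: pj, simp_all add: defs)
  moreover have "has_lifting (Ch E) (Arrow X j Q) q" if "q \<in> Ch_fibrations E \<inter> quasi_isos E" for q
    by (rule has_lifting_acyclic_fibration[OF iA _ _ _ _ that, of k]) (use S(12-14,16) in \<open>simp_all add: Qt(1)\<close>)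
  ultimately show ?thesis using iA pFW by (intro bexI[of _ "Arrow X j Q"] bexI[of _ "Arrow Q p Y"]) simp_all
qed

text \<open>Add to \<open>X\<close> the disks on projective covers \<open>R\<^sub>n \<twoheadrightarrow> Y\<^sub>n\<close>, \<open>n > 0\<close>: in degree \<open>n\<close> this gives
  \<open>X\<^sub>n \<oplus> R\<^sub>n \<oplus> R\<^sub>n\<^sub>+\<^sub>1\<close>, with \<open>R\<^sub>0 = 0\<close> and the identity of \<open>R\<^sub>n\<^sub>+\<^sub>1\<close> as differential.\<close>

lemma acyclic_cofibration_factorization:
  assumes f: "f \<in> Arr (Ch E)"
  shows "\<exists>j\<in>quasi_isos E. \<exists>p\<in>Ch_fibrations E. tgt j = src p \<and> f = p \<cdot>\<^bsub>Ch E\<^esub> j \<and>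
    (\<forall>q\<in>Ch_fibrations E. has_lifting (Ch E) j q)"
proof -
  define X Y F where "X = src f" and "Y = tgt f" and "F = ap f"
  note defs = X_def Y_def F_def
  have cc: "X \<in> chain_complexes E" "Y \<in> chain_complexes E" using f by (simp_all add: defs)
  have Ft: "F n \<in> Arr E" "Dom E (F n) = ob X n" "Cod E (F n) = ob Y n" for n using f by (simp_all add: defs)
  have Fd: "bd Y n \<cdot> F (Suc n) = F n \<cdot> bd X n" for n using Arr_Ch_simps(6)[OF f, of n] by (simp add: defs)
  obtain z where z: "is_zero_obj E z" using zero_obj_ex by blast
  then have zo: "z \<in> Obj E" by (simp add: is_zero_obj_def is_initial_def)
  have "\<exists>!f. f \<in> Hom E z z" using z zo by (simp add: is_zero_obj_def is_initial_def)
  moreover have "Ident E z \<in> Hom E z z" "Zero E z z \<in> Hom E z z" using zo by simp_all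
  ultimately have idz: "Ident E z = Zero E z z" by blast
  have "\<forall>n. \<exists>r. adm_epi E r \<and> r \<in> Arr E \<and> Cod E r = ob Y (Suc n) \<and> projective E (Dom E r)"
    using projective_cover cc(2) chain_simps(1) by metis
  then obtain r' where r': "\<And>n. adm_epi E (r' n) \<and> r' n \<in> Arr E \<and> Cod E (r' n) = ob Y (Suc n) \<and> projective E (Dom E (r' n))"
    by metis
  \<comment> \<open>The cover in degree 0 is replaced by a zero object, since a fibration need not
    lift arrows into degree 0.\<close>
  define r where "r n = (case n of 0 \<Rightarrow> Zero E z (ob Y 0) | Suc m \<Rightarrow> r' m)" for n
  define R where "R n = Dom E (r n)" for n
  have rt: "r n \<in> Arr E" "Dom E (r n) = R n" "Cod E (r n) = ob Y n" "R n \<in> Obj E" for n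
    using r'[of "n - 1"] cc(2) zo by (cases n; simp add: r_def R_def)+
  have rS: "adm_epi E (r (Suc n))" "projective E (R (Suc n))" for n using r'[of n] by (simp_all add: r_def R_def)
  have R0: "Ident E (R 0) = Zero E (R 0) (R 0)" using idz cc(2) zo by (simp add: r_def R_def)
  define I :: "nat set" where "I = {0, 1, 2}"
  define fam where "fam n i = (if i = 0 then ob X n else if i = 1 then R n else R (Suc n))" for n and i :: nat
  define Q where "Q n = dsum E I (fam n)" for n
  define i0 i1 i2 where "i0 n = dsum_in E I (fam n) 0" and "i1 n = dsum_in E I (fam n) 1" and "i2 n = dsum_in E I (fam n) 2" for n
  define e0 e1 e2 where "e0 n = dsum_pr I (fam n) 0" and "e1 n = dsum_pr I (fam n) 1" and "e2 n = dsum_pr I (fam n) 2" for n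
  have fI: "finite I" by (simp add: I_def)
  have bp: "is_biproduct E I (fam n) (Q n) (dsum_in E I (fam n)) (dsum_pr I (fam n))" for n
    unfolding Q_def by (rule dsum_biproduct) (use fI cc rt(4) in \<open>simp_all add: fam_def\<close>)
  have T: "Q n \<in> Obj E" "i0 n \<in> Arr E" "Dom E (i0 n) = ob X n" "Cod E (i0 n) = Q n"
    "i1 n \<in> Arr E" "Dom E (i1 n) = R n" "Cod E (i1 n) = Q n"
    "i2 n \<in> Arr E" "Dom E (i2 n) = R (Suc n)" "Cod E (i2 n) = Q n"
    "e0 n \<in> Arr E" "Dom E (e0 n) = Q n" "Cod E (e0 n) = ob X n"
    "e1 n \<in> Arr E" "Dom E (e1 n) = Q n" "Cod E (e1 n) = R n"
    "e2 n \<in> Arr E" "Dom E (e2 n) = Q n" "Cod E (e2 n) = R (Suc n)"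
    "e0 n \<cdot> i0 n = Ident E (ob X n)" "e1 n \<cdot> i1 n = Ident E (R n)" "e2 n \<cdot> i2 n = Ident E (R (Suc n))"
    "e1 n \<cdot> i0 n = Zero E (ob X n) (R n)" "e2 n \<cdot> i0 n = Zero E (ob X n) (R (Suc n))"
    "e0 n \<cdot> i1 n = Zero E (R n) (ob X n)" "e2 n \<cdot> i1 n = Zero E (R n) (R (Suc n))"
    "e0 n \<cdot> i2 n = Zero E (R (Suc n)) (ob X n)" "e1 n \<cdot> i2 n = Zero E (R (Suc n)) (R n)" for n
    using biproduct_simps(2)[OF bp[of n]] biproduct_simps(4-10)[OF bp[of n], of 0] biproduct_simps(4-10)[OF bp[of n], of 1]
      biproduct_simps(4-10)[OF bp[of n], of 2] biproduct_simps(11)[OF bp[of n], of 0 1] biproduct_simps(11)[OF bp[of n], of 0 2]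
      biproduct_simps(11)[OF bp[of n], of 1 0] biproduct_simps(11)[OF bp[of n], of 1 2]
      biproduct_simps(11)[OF bp[of n], of 2 0] biproduct_simps(11)[OF bp[of n], of 2 1]
    by (simp_all add: i0_def i1_def i2_def e0_def e1_def e2_def I_def fam_def)
  have ext_in: "u = v" if uv: "u \<in> Arr E" "v \<in> Arr E" "Dom E u = Q n" "Dom E v = Q n" "Cod E u = Cod E v"
    "u \<cdot> i0 n = v \<cdot> i0 n" "u \<cdot> i1 n = v \<cdot> i1 n" "u \<cdot> i2 n = v \<cdot> i2 n" for u v n
  proof (rule biproduct_ext_inc[OF bp[of n]])
    fix i assume "i \<in> I"
    then consider "i = 0" | "i = 1" | "i = 2" by (auto simp: I_def)
    then show "u \<cdot> dsum_in E I (fam n) i = v \<cdot> dsum_in E I (fam n) i"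
      using uv(6-8) by cases (simp_all add: i0_def i1_def i2_def)
  qed (use uv in simp_all)
  have ext_pr: "u = v" if uv: "u \<in> Arr E" "v \<in> Arr E" "Cod E u = Q n" "Cod E v = Q n" "Dom E u = Dom E v"
    "e0 n \<cdot> u = e0 n \<cdot> v" "e1 n \<cdot> u = e1 n \<cdot> v" "e2 n \<cdot> u = e2 n \<cdot> v" for u v n
  proof (rule biproduct_ext_prj[OF bp[of n]])
    fix i assume "i \<in> I"
    then consider "i = 0" | "i = 1" | "i = 2" by (auto simp: I_def)
    then show "dsum_pr I (fam n) i \<cdot> u = dsum_pr I (fam n) i \<cdot> v"
      using uv(6-8) by cases (simp_all add: e0_def e1_def e2_def)
  qed (use uv in simp_all)
  define cp where "cp n y a b c = copair I (fam n) y (\<lambda>i. if i = 0 then a else if i = 1 then b else c)" for n y a b c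
  have cp: "cp n y a b c \<in> Arr E" "Dom E (cp n y a b c) = Q n" "Cod E (cp n y a b c) = y"
    "cp n y a b c \<cdot> i0 n = a" "cp n y a b c \<cdot> i1 n = b" "cp n y a b c \<cdot> i2 n = c"
    if abc: "a \<in> Arr E" "Dom E a = ob X n" "Cod E a = y" "b \<in> Arr E" "Dom E b = R n" "Cod E b = y"
      "c \<in> Arr E" "Dom E c = R (Suc n)" "Cod E c = y" for n y a b c
  proof -
    have y: "y \<in> Obj E" using abc by auto
    have g: "(if i = 0 then a else if i = 1 then b else c) \<in> Arr E \<and>
        Dom E (if i = 0 then a else if i = 1 then b else c) = fam n i \<and> Cod E (if i = 0 then a else if i = 1 then b else c) = y"
      for i :: nat using abc by (simp add: fam_def)
    note cs = copair_simps[of I "\<lambda>i. if i = 0 then a else if i = 1 then b else c" "fam n" y, OF fI g y]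
    show "cp n y a b c \<in> Arr E" "Dom E (cp n y a b c) = Q n" "Cod E (cp n y a b c) = y"
      "cp n y a b c \<cdot> i0 n = a" "cp n y a b c \<cdot> i1 n = b" "cp n y a b c \<cdot> i2 n = c"
      using cs(1-3) cs(4)[of 0] cs(4)[of 1] cs(4)[of 2]
      by (simp_all add: cp_def Q_def i0_def i1_def i2_def I_def)
  qed
  \<comment> \<open>The disk on R_{n+1} occupies the slot \<open>i1\<close> in degree n + 1 and the
    slot \<open>i2\<close> in degree n, with the identity between them as differential.\<close>
  define D where "D n = cp (Suc n) (Q n) (i0 n \<cdot> bd X n) (i2 n) (Zero E (R (Suc (Suc n))) (Q n))" for n
  have D: "D n \<in> Arr E" "Dom E (D n) = Q (Suc n)" "Cod E (D n) = Q n" "D n \<cdot> i0 (Suc n) = i0 n \<cdot> bd X n"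
    "D n \<cdot> i1 (Suc n) = i2 n" "D n \<cdot> i2 (Suc n) = Zero E (R (Suc (Suc n))) (Q n)" for n
    using cp[of "i0 n \<cdot> bd X n" "Suc n" "Q n" "i2 n" "Zero E (R (Suc (Suc n))) (Q n)"] T[of n] cc(1) rt(4) by (simp_all add: D_def)
  define p where "p n = cp n (ob Y n) (F n) (r n) (bd Y n \<cdot> r (Suc n))" for n
  have p: "p n \<in> Arr E" "Dom E (p n) = Q n" "Cod E (p n) = ob Y n" "p n \<cdot> i0 n = F n"
    "p n \<cdot> i1 n = r n" "p n \<cdot> i2 n = bd Y n \<cdot> r (Suc n)" for n
    using cp[of "F n" n "ob Y n" "r n" "bd Y n \<cdot> r (Suc n)"] Ft[of n] rt[of n] rt[of "Suc n"] cc(2) by (simp_all add: p_def)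
  have DD: "D n \<cdot> D (Suc n) = Zero E (Q (Suc (Suc n))) (Q n)" for n
    by (rule ext_in[of _ _ "Suc (Suc n)"])
      (use D[of n] D[of "Suc n"] T[of n] T[of "Suc n"] T[of "Suc (Suc n)"] cc(1) rt(4) reassoc[OF D(4)[of n], of "bd X (Suc n)"]
        in simp_all)
  have eD: "e0 n \<cdot> D n = bd X n \<cdot> e0 (Suc n)" "e2 n \<cdot> D n = e1 (Suc n)" for n
    by (rule ext_in[of _ _ "Suc n"]; use D[of n] T[of n] T[of "Suc n"] cc(1) rt(4) reassoc[OF T(20)[of n], of "bd X n"]
        reassoc[OF T(24)[of n], of "bd X n"] in simp)+
  have pD: "bd Y n \<cdot> p (Suc n) = p n \<cdot> D n" for n
    by (rule ext_in[of _ _ "Suc n"])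
      (use p[of n] p[of "Suc n"] D[of n] T[of n] T[of "Suc n"] cc rt(4) rt(1-3)[of "Suc (Suc n)"] Ft[of "Suc n"] Fd[of n]
        reassoc[OF p(4)[of n], of "bd X n"] in simp_all)
  let ?Q = "Chain Q D"
  let ?j = "Arrow X i0 ?Q" and ?p = "Arrow ?Q p Y"
  have Qc: "?Q \<in> chain_complexes E"
    unfolding chain_complexes_def mem_Collect_eq chain.sel Hom_iff using T(1) D(1-3) DD by blast
  have jA: "?j \<in> Arr (Ch E)" using cc Qc T(2-4) D(4) by (simp add: Arr_Ch_iff)
  have pA: "?p \<in> Arr (Ch E)" using cc Qc p(1-3) pD by (simp add: Arr_Ch_iff)
  have "adm_epi E (p (Suc n))" for n
    using adm_epi_factor[OF weakly_idempotent_complete, of "i1 (Suc n)" "p (Suc n)"] T[of "Suc n"] p[of "Suc n"] rS(1)[of n] by simp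
  then have pF: "?p \<in> Ch_fibrations E" using pA by (auto simp: Ch_fibrations_def gr0_conv_Suc)
  \<comment> \<open>\<open>e0\<close> retracts the inclusion of X, and \<open>i1\<close> after
    \<open>e2\<close> contracts the disks: a cycle y has zero \<open>e1\<close> component and equals
    i0 (e0 y) + D (i1 (e2 y)).\<close>
  have jW: "?j \<in> quasi_isos E"
    unfolding quasi_isos_iff
  proof (intro conjI allI impI jA hom_quasi_isoI; unfold arrow.sel chain.sel)
    fix P n x b assume x: "cycle X n P x" and b: "b \<in> Arr E" "Dom E b = P" "Cod E b = Q (Suc n)" "D n \<cdot> b = i0 n \<cdot> x"
    note xs = cycle_simps(1-3)[OF x]
    have "bd X n \<cdot> (e0 (Suc n) \<cdot> b) = x"
      using reassoc[OF eD(1)[of n, symmetric], of b] reassoc[OF T(20)[of n], of x] b xs T[of n] T[of "Suc n"] D[of n] cc(1) by simp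
    then show "\<exists>a\<in>Arr E. Dom E a = P \<and> Cod E a = ob X (Suc n) \<and> bd X n \<cdot> a = x"
      using b T[of "Suc n"] by (intro bexI[of _ "e0 (Suc n) \<cdot> b"]) simp_all
  next
    fix P n y assume P: "projective E P" and y: "cycle ?Q n P y"
    note ys = cycle_simps(1-3)[OF y, unfolded chain.sel]
    have Po: "P \<in> Obj E" using P by (simp add: projective_def)
    have e1: "e1 n \<cdot> y = Zero E P (R n)"
    proof (cases n)
      case 0
      have "Ident E (R 0) \<cdot> (e1 0 \<cdot> y) = Zero E (R 0) (R 0) \<cdot> (e1 0 \<cdot> y)" by (simp only: R0)
      then show ?thesis using ys T[of 0] rt(4) 0 by simp
    next
      case (Suc k)
      have "e2 k \<cdot> (D k \<cdot> y) = Zero E P (R (Suc k))" using cycle_simps(4)[OF y Suc] T[of k] Po by simp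
      then show ?thesis using reassoc[OF eD(2)[of k], of y] ys T[of k] D[of k] Suc by simp
    qed
    have cx: "cycle X n P (e0 n \<cdot> y)"
    proof (cases n)
      case (Suc k)
      have "e0 k \<cdot> (D k \<cdot> y) = Zero E P (ob X k)" using cycle_simps(4)[OF y Suc] T[of k] Po by simp
      then show ?thesis using reassoc[OF eD(1)[of k], of y] ys T[of k] T[of "Suc k"] D[of k] cc(1) Suc by (simp add: cycle_Suc)
    qed (use ys T[of n] in \<open>simp add: cycle_0\<close>)
    have De: "D n \<cdot> (i1 (Suc n) \<cdot> (e2 n \<cdot> y)) = i2 n \<cdot> (e2 n \<cdot> y)"
      using reassoc[OF D(5)[of n], of "e2 n \<cdot> y"] ys T[of n] T[of "Suc n"] D[of n] by simp
    have "i0 n \<cdot> (e0 n \<cdot> y) \<boxplus> D n \<cdot> (i1 (Suc n) \<cdot> (e2 n \<cdot> y)) = y"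
      unfolding De by (rule ext_pr[of _ _ n])
        (use ys T[of n] e1 Po rt(4) cc(1) reassoc[OF T(20)[of n], of "e0 n \<cdot> y"] reassoc[OF T(23)[of n], of "e0 n \<cdot> y"]
          reassoc[OF T(24)[of n], of "e0 n \<cdot> y"] reassoc[OF T(22)[of n], of "e2 n \<cdot> y"]
          reassoc[OF T(27)[of n], of "e2 n \<cdot> y"] reassoc[OF T(28)[of n], of "e2 n \<cdot> y"] in simp_all)
    then show "\<exists>x b. cycle X n P x \<and> b \<in> Arr E \<and> Dom E b = P \<and> Cod E b = Q (Suc n) \<and> i0 n \<cdot> x \<boxplus> D n \<cdot> b = y"
      using cx ys T[of n] T[of "Suc n"]
      by (intro exI[of _ "e0 n \<cdot> y"] exI[of _ "i1 (Suc n) \<cdot> (e2 n \<cdot> y)"]) simp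
  qed
  have lift: "has_lifting (Ch E) ?j q" if q: "q \<in> Ch_fibrations E" for q
    unfolding has_lifting_def
  proof (intro ballI impI)
    fix u v assume "u \<in> Hom (Ch E) (Dom (Ch E) ?j) (Dom (Ch E) q)" "v \<in> Hom (Ch E) (Cod (Ch E) ?j) (Cod (Ch E) q)"
      and sq: "q \<cdot>\<^bsub>Ch E\<^esub> u = v \<cdot>\<^bsub>Ch E\<^esub> ?j"
    then have uv: "u \<in> Arr (Ch E)" "src u = X" "tgt u = src q" "v \<in> Arr (Ch E)" "src v = ?Q" "tgt v = tgt q" by simp_all
    have qA: "q \<in> Arr (Ch E)" using q by (simp add: Ch_fibrations_def)
    define A B U V G where "A = src q" and "B = tgt q" and "U = ap u" and "V = ap v" and "G = ap q"
    note defs' = A_def B_def U_def V_def G_def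
    have cc': "A \<in> chain_complexes E" "B \<in> chain_complexes E" using qA by (simp_all add: defs')
    have t: "U n \<in> Arr E" "Dom E (U n) = ob X n" "Cod E (U n) = ob A n"
      "V n \<in> Arr E" "Dom E (V n) = Q n" "Cod E (V n) = ob B n" "G n \<in> Arr E" "Dom E (G n) = ob A n" "Cod E (G n) = ob B n" for n
      using qA uv by (simp_all add: defs')
    have d: "bd A n \<cdot> U (Suc n) = U n \<cdot> bd X n" "bd B n \<cdot> V (Suc n) = V n \<cdot> D n" "bd B n \<cdot> G (Suc n) = G n \<cdot> bd A n" for n
      using Arr_Ch_simps(6)[OF qA, of n] Arr_Ch_simps(6)[OF uv(1), of n] Arr_Ch_simps(6)[OF uv(4), of n] uv
      by (simp_all add: defs')
    have gu: "G n \<cdot> U n = V n \<cdot> i0 n" for n using arg_cong[OF sq, of "\<lambda>h. ap h n"] by (simp add: defs')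
    \<comment> \<open>A map out of the disks is determined by its values on the slots
      \<open>i1\<close>, which can be lifted freely: R_n is projective and q surjective in positive
      degrees, and R_0 is zero.\<close>
    have "\<exists>l. l \<in> Arr E \<and> Dom E l = R n \<and> Cod E l = ob A n \<and> G n \<cdot> l = V n \<cdot> i1 n" for n
    proof (cases n)
      case 0
      have "(V 0 \<cdot> i1 0) \<cdot> Ident E (R 0) = (V 0 \<cdot> i1 0) \<cdot> Zero E (R 0) (R 0)" by (simp only: R0)
      then have "V 0 \<cdot> i1 0 = Zero E (R 0) (ob B 0)" using t[of 0] T[of 0] rt(4) by simp
      then show ?thesis using 0 t[of 0] rt(4)[of 0] cc' by (intro exI[of _ "Zero E (R 0) (ob A 0)"]) simp
    next
      case (Suc k)
      have "V n \<cdot> i1 n \<in> Arr E" "Dom E (V n \<cdot> i1 n) = R n" "Cod E (V n \<cdot> i1 n) = ob (tgt q) (Suc k)"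
        using t[of n] T[of n] Suc by (simp_all add: defs')
      then obtain l where "l \<in> Arr E" "Dom E l = R n" "Cod E l = ob (src q) (Suc k)" "ap q (Suc k) \<cdot> l = V n \<cdot> i1 n"
        using Ch_fibration_lift[OF q, of "R n" "V n \<cdot> i1 n" k] rS(2)[of k] Suc by metis
      then show ?thesis using Suc by (auto simp: defs')
    qed
    then obtain l where l: "\<And>n. l n \<in> Arr E" "\<And>n. Dom E (l n) = R n" "\<And>n. Cod E (l n) = ob A n" "\<And>n. G n \<cdot> l n = V n \<cdot> i1 n"
      by metis
    define h where "h n = cp n (ob A n) (U n) (l n) (bd A n \<cdot> l (Suc n))" for n
    have h: "h n \<in> Arr E" "Dom E (h n) = Q n" "Cod E (h n) = ob A n" "h n \<cdot> i0 n = U n" "h n \<cdot> i1 n = l n"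
      "h n \<cdot> i2 n = bd A n \<cdot> l (Suc n)" for n
      using cp[of "U n" n "ob A n" "l n" "bd A n \<cdot> l (Suc n)"] t[of n] l(1-3)[of n] l(1-3)[of "Suc n"] cc'(1) by (simp_all add: h_def)
    have hd: "bd A n \<cdot> h (Suc n) = h n \<cdot> D n" for n
      by (rule ext_in[of _ _ "Suc n"])
        (use h[of n] h[of "Suc n"] D[of n] T[of n] T[of "Suc n"] t[of n] l(1-3)[of "Suc (Suc n)"] d(1)[of n] cc cc' rt(4)
          reassoc[OF h(4)[of n], of "bd X n"] in simp_all)
    have gd: "G n \<cdot> (bd A n \<cdot> l (Suc n)) = V n \<cdot> i2 n" for n
      using reassoc[OF d(3)[of n, symmetric], of "l (Suc n)"] reassoc[OF d(2)[of n], of "i1 (Suc n)"] l[of "Suc n"]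
        t[of n] t[of "Suc n"] T[of "Suc n"] D[of n] cc' by simp
    have gh: "G n \<cdot> h n = V n" for n
      by (rule ext_in[of _ _ n]) (use h[of n] T[of n] t[of n] l(4)[of n] gu[of n] gd[of n] in simp_all)
    let ?h = "Arrow ?Q h A"
    have "?h \<in> Arr (Ch E)" using h(1-3) hd cc' Qc by (simp add: Arr_Ch_iff)
    moreover have "?h \<cdot>\<^bsub>Ch E\<^esub> ?j = u" "q \<cdot>\<^bsub>Ch E\<^esub> ?h = v"
      by (rule arrow_eqI; use h(4) gh uv in \<open>simp add: defs'\<close>)+
    ultimately show "\<exists>h\<in>Hom (Ch E) (Cod (Ch E) ?j) (Dom (Ch E) q). h \<cdot>\<^bsub>Ch E\<^esub> ?j = u \<and> q \<cdot>\<^bsub>Ch E\<^esub> h = v"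
      by (intro bexI[of _ ?h]) (simp_all add: defs')
  qed
  have "f = ?p \<cdot>\<^bsub>Ch E\<^esub> ?j"
    by (rule arrow_eqI) (simp_all add: p(4), simp_all add: defs)
  then show ?thesis using jW pF lift by (intro bexI[of _ ?j] bexI[of _ ?p]) simp_all
qed

lemma weq_fib_category_Ch: "weq_fib_category (Ch E) (quasi_isos E) (Ch_fibrations E)"
proof -
  interpret Ch: category "Ch E" by (rule category_Ch)
  show ?thesis
  proof
    fix f g assume fg: "f \<in> Arr (Ch E)" "g \<in> Arr (Ch E)" "Cod (Ch E) f = Dom (Ch E) g"
    have qf: "f \<in> quasi_isos E \<longleftrightarrow> (\<forall>P. projective E P \<longrightarrow> hom_quasi_iso P f)"
      and qg: "g \<in> quasi_isos E \<longleftrightarrow> (\<forall>P. projective E P \<longrightarrow> hom_quasi_iso P g)"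
      and qgf: "g \<cdot>\<^bsub>Ch E\<^esub> f \<in> quasi_isos E \<longleftrightarrow> (\<forall>P. projective E P \<longrightarrow> hom_quasi_iso P (g \<cdot>\<^bsub>Ch E\<^esub> f))"
      using fg(1,2) Ch.Comp_simps(1)[OF fg] by (simp_all only: quasi_isos_iff simp_thms)
    have Po: "projective E P \<Longrightarrow> P \<in> Obj E" for P by (simp add: projective_def)
    note tt = hom_quasi_iso_two_of_three[of f g, OF fg[unfolded Ch_simps]]
    show "f \<in> quasi_isos E \<Longrightarrow> g \<in> quasi_isos E \<Longrightarrow> g \<cdot>\<^bsub>Ch E\<^esub> f \<in> quasi_isos E"
      "f \<in> quasi_isos E \<Longrightarrow> g \<cdot>\<^bsub>Ch E\<^esub> f \<in> quasi_isos E \<Longrightarrow> g \<in> quasi_isos E"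
      "g \<in> quasi_isos E \<Longrightarrow> g \<cdot>\<^bsub>Ch E\<^esub> f \<in> quasi_isos E \<Longrightarrow> f \<in> quasi_isos E"
      using tt Po unfolding qf qg qgf by blast+
  next
    fix f g assume "is_retract_of (Ch E) f g" "g \<in> quasi_isos E"
    then show "f \<in> quasi_isos E"
      using hom_quasi_iso_retract Ch.retract_Arr by (metis quasi_isos_iff)
  next
    fix f g assume "is_retract_of (Ch E) f g" "g \<in> Ch_fibrations E"
    then show "f \<in> Ch_fibrations E" by (rule Ch_fibrations_retract)
  next
    show "quasi_isos E \<subseteq> Arr (Ch E)" "Ch_fibrations E \<subseteq> Arr (Ch E)"
      by (auto simp: quasi_isos_def Ch_fibrations_def)
  qed (use acyclic_cofibration_factorization acyclic_fibration_factorization in simp_all)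
qed

end

section \<open>Simplicial objects and the normalized complex\<close>

abbreviation face :: "('o, 'm) simp_obj \<Rightarrow> nat \<Rightarrow> nat \<Rightarrow> 'm" where
  "face A n i \<equiv> sact A (coface n i)"

abbreviation degen :: "('o, 'm) simp_obj \<Rightarrow> nat \<Rightarrow> nat \<Rightarrow> 'm" where
  "degen A n i \<equiv> sact A (codeg n i)"

lemma sCat_simps [simp]:
  "Obj (sCat E) = simplicial_objects E" "Dom (sCat E) = src" "Cod (sCat E) = tgt"
  by (simp_all add: sCat_def)

lemma Ident_sCat [simp]:
  "src (Ident (sCat E) A) = A" "tgt (Ident (sCat E) A) = A"
  "ap (Ident (sCat E) A) n = Ident E (sob A n)"
  by (simp_all add: sCat_def)

lemma Comp_sCat [simp]:
  "src (g \<cdot>\<^bsub>sCat E\<^esub> f) = src f" "tgt (g \<cdot>\<^bsub>sCat E\<^esub> f) = tgt g"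
  "ap (g \<cdot>\<^bsub>sCat E\<^esub> f) n = ap g n \<cdot>\<^bsub>E\<^esub> ap f n"
  by (simp_all add: sCat_def)

context category
begin

lemma sact_simps [simp]:
  assumes "A \<in> simplicial_objects C"
  shows "sob A n \<in> Obj C"
    "\<alpha> \<in> Arr Simplex \<Longrightarrow> sact A \<alpha> \<in> Arr C" "\<alpha> \<in> Arr Simplex \<Longrightarrow> Dom C (sact A \<alpha>) = sob A (tgt \<alpha>)"
    "\<alpha> \<in> Arr Simplex \<Longrightarrow> Cod C (sact A \<alpha>) = sob A (src \<alpha>)"
    "sact A (Ident Simplex n) = Ident C (sob A n)"
proof -
  have "\<forall>m n. \<forall>\<alpha> \<in> Hom Simplex m n. sact A \<alpha> \<in> Hom C (sob A n) (sob A m)"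
    using assms unfolding simplicial_objects_def by blast
  moreover have "\<alpha> \<in> Arr Simplex \<Longrightarrow> \<alpha> \<in> Hom Simplex (src \<alpha>) (tgt \<alpha>)" by simp
  ultimately have "\<alpha> \<in> Arr Simplex \<Longrightarrow> sact A \<alpha> \<in> Hom C (sob A (tgt \<alpha>)) (sob A (src \<alpha>))" by blast
  then show "\<alpha> \<in> Arr Simplex \<Longrightarrow> sact A \<alpha> \<in> Arr C" "\<alpha> \<in> Arr Simplex \<Longrightarrow> Dom C (sact A \<alpha>) = sob A (tgt \<alpha>)"
    "\<alpha> \<in> Arr Simplex \<Longrightarrow> Cod C (sact A \<alpha>) = sob A (src \<alpha>)" by simp_all
  show "sob A n \<in> Obj C" "sact A (Ident Simplex n) = Ident C (sob A n)"
    using assms unfolding simplicial_objects_def by blast+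
qed

lemma sact_Comp:
  assumes "A \<in> simplicial_objects C" "\<alpha> \<in> Arr Simplex" "\<beta> \<in> Arr Simplex" "tgt \<alpha> = src \<beta>"
  shows "sact A (\<beta> \<odot> \<alpha>) = sact A \<alpha> \<cdot> sact A \<beta>"
proof -
  have "\<alpha> \<in> Hom Simplex (src \<alpha>) (src \<beta>)" "\<beta> \<in> Hom Simplex (src \<beta>) (tgt \<beta>)" using assms by simp_all
  then show ?thesis using assms(1) unfolding simplicial_objects_def by blast
qed

lemma sact_sact:
  assumes "A \<in> simplicial_objects C" "\<alpha> \<in> Arr Simplex" "\<beta> \<in> Arr Simplex" "tgt \<alpha> = src \<beta>"
    "x \<in> Arr C" "Cod C x = sob A (tgt \<beta>)"
  shows "sact A \<alpha> \<cdot> (sact A \<beta> \<cdot> x) = sact A (\<beta> \<odot> \<alpha>) \<cdot> x"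
  using assms by (simp add: sact_Comp)

lemma Arr_sCat_iff:
  "f \<in> Arr (sCat C) \<longleftrightarrow> src f \<in> simplicial_objects C \<and> tgt f \<in> simplicial_objects C \<and>
     (\<forall>n. ap f n \<in> Arr C \<and> Dom C (ap f n) = sob (src f) n \<and>
          Cod C (ap f n) = sob (tgt f) n) \<and>
     (\<forall>\<alpha>\<in>Arr Simplex. sact (tgt f) \<alpha> \<cdot> ap f (tgt \<alpha>) = ap f (src \<alpha>) \<cdot> sact (src f) \<alpha>)"
proof -
  obtain A g B where f: "f = Arrow A g B" by (cases f)
  have "(\<forall>m n. \<forall>\<alpha>\<in>Hom Simplex m n. sact B \<alpha> \<cdot> g n = g m \<cdot> sact A \<alpha>) \<longleftrightarrow>
      (\<forall>\<alpha>\<in>Arr Simplex. sact B \<alpha> \<cdot> g (tgt \<alpha>) = g (src \<alpha>) \<cdot> sact A \<alpha>)"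
    unfolding Ball_def Hom_iff Simplex_simps by metis
  moreover have "f \<in> Arr (sCat C) \<longleftrightarrow> A \<in> simplicial_objects C \<and> B \<in> simplicial_objects C \<and>
       (\<forall>n. g n \<in> Hom C (sob A n) (sob B n)) \<and>
       (\<forall>m n. \<forall>\<alpha>\<in>Hom Simplex m n. sact B \<alpha> \<cdot> g n = g m \<cdot> sact A \<alpha>)"
    unfolding f sCat_def by simp
  ultimately show ?thesis unfolding f by simp
qed

lemma Arr_sCat_simps [simp]:
  assumes "f \<in> Arr (sCat C)"
  shows "src f \<in> simplicial_objects C" "tgt f \<in> simplicial_objects C"
    "ap f n \<in> Arr C" "Dom C (ap f n) = sob (src f) n" "Cod C (ap f n) = sob (tgt f) n"
  using assms unfolding Arr_sCat_iff by blast+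

lemma simp_map_sact:
  assumes "f \<in> Arr (sCat C)" "\<alpha> \<in> Arr Simplex" "tgt \<alpha> = n"
  shows "sact (tgt f) \<alpha> \<cdot> ap f n = ap f (src \<alpha>) \<cdot> sact (src f) \<alpha>"
  using assms(1,2) unfolding Arr_sCat_iff assms(3)[symmetric] by blast

lemma simp_map_sact_elem:
  assumes "f \<in> Arr (sCat C)" "\<alpha> \<in> Arr Simplex" "tgt \<alpha> = n" "x \<in> Arr C" "Cod C x = sob (src f) n"
  shows "sact (tgt f) \<alpha> \<cdot> (ap f n \<cdot> x) = ap f (src \<alpha>) \<cdot> (sact (src f) \<alpha> \<cdot> x)"
  using reassoc[OF simp_map_sact[OF assms(1-3)], of x] assms by simp

lemma category_sCat: "category (sCat C)"
proof
  show "Ident (sCat C) x \<in> Hom (sCat C) x x" if "x \<in> Obj (sCat C)" for x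
    using that by (simp add: Arr_sCat_iff)
  show "g \<cdot>\<^bsub>sCat C\<^esub> f \<in> Hom (sCat C) x z" if a: "f \<in> Hom (sCat C) x y" "g \<in> Hom (sCat C) y z" for f g x y z
  proof -
    have fg: "f \<in> Arr (sCat C)" "g \<in> Arr (sCat C)" "tgt f = src g" using a by simp_all
    have "sact (tgt g) \<alpha> \<cdot> (ap g (tgt \<alpha>) \<cdot> ap f (tgt \<alpha>))
        = ap g (src \<alpha>) \<cdot> (ap f (src \<alpha>) \<cdot> sact (src f) \<alpha>)" if "\<alpha> \<in> Arr Simplex" for \<alpha>
      using fg simp_map_sact_elem[OF fg(2) that refl, of "ap f (tgt \<alpha>)"]
        simp_map_sact[OF fg(1) that refl, unfolded fg(3)] by simp
    then have "g \<cdot>\<^bsub>sCat C\<^esub> f \<in> Arr (sCat C)" unfolding Arr_sCat_iff using fg by simp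
    then show ?thesis using a by simp
  qed
  show "f \<cdot>\<^bsub>sCat C\<^esub> Ident (sCat C) x = f" "Ident (sCat C) y \<cdot>\<^bsub>sCat C\<^esub> f = f"
    if "f \<in> Hom (sCat C) x y" for f x y
    by (rule arrow_eqI; use that in simp)+
  show "(h \<cdot>\<^bsub>sCat C\<^esub> g) \<cdot>\<^bsub>sCat C\<^esub> f = h \<cdot>\<^bsub>sCat C\<^esub> (g \<cdot>\<^bsub>sCat C\<^esub> f)"
    if "f \<in> Hom (sCat C) w x" "g \<in> Hom (sCat C) x y" "h \<in> Hom (sCat C) y z" for f g h w x y z
    by (rule arrow_eqI; use that in simp)
qed simp_all

context
  fixes A assumes A: "A \<in> simplicial_objects C"
begin

lemma face_face:
  assumes "i < j" "x \<in> Arr C" "Cod C x = sob A (Suc (Suc n))"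
  shows "face A n i \<cdot> (face A (Suc n) j \<cdot> x) = face A n (j - 1) \<cdot> (face A (Suc n) i \<cdot> x)"
  using assms A by (simp add: sact_sact coface_coface)

lemma face_degen_less:
  assumes "i < k" "k \<le> Suc n" "x \<in> Arr C" "Cod C x = sob A (Suc n)"
  shows "face A (Suc n) i \<cdot> (degen A (Suc n) k \<cdot> x) = degen A n (k - 1) \<cdot> (face A n i \<cdot> x)"
  using assms A by (simp add: sact_sact codeg_coface_less)

lemma face_degen_id:
  assumes "k \<le> n" "i = k \<or> i = Suc k" "x \<in> Arr C" "Cod C x = sob A n"
  shows "face A n i \<cdot> (degen A n k \<cdot> x) = x"
  using assms A by (simp add: sact_sact codeg_coface_id[OF assms(1,2)])

lemma face_degen_greater:
  assumes "Suc k < i" "i \<le> Suc (Suc n)" "x \<in> Arr C" "Cod C x = sob A (Suc n)"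
  shows "face A (Suc n) i \<cdot> (degen A (Suc n) k \<cdot> x) = degen A n k \<cdot> (face A n (i - 1) \<cdot> x)"
  using assms A by (simp add: sact_sact codeg_coface_greater)

end

end

section \<open>Joint kernels of faces and normalized elements\<close>

context additive_category
begin

lemma joint_kernel_lift:
  assumes "is_joint_kernel E x D k" "g \<in> Arr E" "Cod E g = x" "\<And>d. d \<in> D \<Longrightarrow> d \<cdot> g = Zero E (Dom E g) (Cod E d)"
  obtains u where "u \<in> Arr E" "Dom E u = Dom E g" "Cod E u = Dom E k" "k \<cdot> u = g"
proof -
  have "Dom E g \<in> Obj E" "g \<in> Hom E (Dom E g) x" using assms by simp_all
  then obtain u where "u \<in> Hom E (Dom E g) (Dom E k)" "k \<cdot> u = g"
    using assms(1,4) unfolding is_joint_kernel_def by blast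
  then show ?thesis using that[of u] by simp
qed

lemma joint_kernel_mono:
  assumes k: "is_joint_kernel E x D k" and D: "\<And>d. d \<in> D \<Longrightarrow> d \<in> Arr E \<and> Dom E d = x"
    and u: "u \<in> Arr E" "Cod E u = Dom E k" and v: "v \<in> Arr E" "Cod E v = Dom E k" "Dom E u = Dom E v"
    and e: "k \<cdot> u = k \<cdot> v"
  shows "u = v"
proof -
  have kt: "k \<in> Arr E" "Cod E k = x" "\<And>d. d \<in> D \<Longrightarrow> d \<cdot> k = Zero E (Dom E k) (Cod E d)"
    using k unfolding is_joint_kernel_def by blast+
  have "d \<cdot> (k \<cdot> v) = Zero E (Dom E v) (Cod E d)" if "d \<in> D" for d
    using reassoc[OF kt(3)[OF that], of v] D[OF that] kt(1,2) v by simp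
  moreover have "k \<cdot> v \<in> Hom E (Dom E v) x" "Dom E v \<in> Obj E" using kt v by simp_all
  ultimately have "\<exists>!w. w \<in> Hom E (Dom E v) (Dom E k) \<and> k \<cdot> w = k \<cdot> v"
    using k unfolding is_joint_kernel_def by blast
  moreover have "u \<in> Hom E (Dom E v) (Dom E k)" "v \<in> Hom E (Dom E v) (Dom E k)" using u v by simp_all
  ultimately show ?thesis using e by blast
qed

text \<open>One face at a time: the kernel of \<open>d\<^sub>k\<close> on the joint kernel of \<open>d\<^sub>0, \<dots>, d\<^sub>k\<^sub>-\<^sub>1\<close> exists because that
  restriction is a retraction, split by \<open>s\<^sub>k\<close>.\<close>

lemma joint_kernel_ex:
  assumes wic: "weakly_idempotent_complete E" and A: "A \<in> simplicial_objects E" and "k \<le> n"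
  shows "\<exists>\<kappa>. is_joint_kernel E (sob A n) {face A (n - 1) i | i. i < k} \<kappa>"
  using assms(3)
proof (induction k arbitrary: n)
  case 0
  have "is_joint_kernel E (sob A n) {face A (n - 1) i | i. i < 0} (Ident E (sob A n))"
    using A by (auto simp: is_joint_kernel_def)
  then show ?case by blast
next
  case (Suc k)
  then obtain m where n: "n = Suc m" "k \<le> m" by (cases n) auto
  let ?D = "\<lambda>n. {face A (n - 1) i | i. i < k}"
  obtain \<kappa> where k: "is_joint_kernel E (sob A n) (?D n) \<kappa>" using Suc.IH[of n] Suc.prems by auto
  obtain \<kappa>' where k': "is_joint_kernel E (sob A m) (?D m) \<kappa>'" using Suc.IH[of m] n by auto
  have kt: "\<kappa> \<in> Arr E" "Cod E \<kappa> = sob A (Suc m)" "\<And>i. i < k \<Longrightarrow> face A m i \<cdot> \<kappa> = Zero E (Dom E \<kappa>) (sob A m)"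
    using k A n unfolding is_joint_kernel_def by auto
  have kt': "\<kappa>' \<in> Arr E" "Cod E \<kappa>' = sob A m"
    "\<And>i p. \<lbrakk>i < k; m = Suc p\<rbrakk> \<Longrightarrow> face A p i \<cdot> \<kappa>' = Zero E (Dom E \<kappa>') (sob A p)"
    using k' A unfolding is_joint_kernel_def by auto
  \<comment> \<open>d_k carries the joint kernel of d_0, ..., d_{k-1} in degree m + 1 into the one
    in degree m, because d_i d_k = d_{k-1} d_i for i < k.\<close>
  obtain d where d: "d \<in> Arr E" "Dom E d = Dom E \<kappa>" "Cod E d = Dom E \<kappa>'" "\<kappa>' \<cdot> d = face A m k \<cdot> \<kappa>"
  proof (rule joint_kernel_lift[OF k', of "face A m k \<cdot> \<kappa>"])
    fix e assume "e \<in> ?D m"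
    then obtain i where i: "e = face A (m - 1) i" "i < k" by blast
    then obtain p where p: "m = Suc p" using n by (cases m) auto
    have "face A p i \<cdot> (face A (Suc p) k \<cdot> \<kappa>) = face A p (k - 1) \<cdot> (face A m i \<cdot> \<kappa>)"
      using face_face[OF A i(2), of \<kappa> p] kt p by simp
    then show "e \<cdot> (face A m k \<cdot> \<kappa>) = Zero E (Dom E (face A m k \<cdot> \<kappa>)) (Cod E e)"
      using i kt p A by simp
  qed (use kt A in simp_all)
  \<comment> \<open>Likewise s_k restricts, since d_i s_k = s_{k-1} d_i for i < k; then d_k s_k = id
    exhibits d as a retraction.\<close>
  obtain s where s: "s \<in> Arr E" "Dom E s = Dom E \<kappa>'" "Cod E s = Dom E \<kappa>" "\<kappa> \<cdot> s = degen A m k \<cdot> \<kappa>'"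
  proof (rule joint_kernel_lift[OF k, of "degen A m k \<cdot> \<kappa>'"])
    fix e assume "e \<in> ?D n"
    then obtain i where i: "e = face A m i" "i < k" using n by auto
    then obtain p where p: "m = Suc p" using n by (cases m) auto
    have "face A m i \<cdot> (degen A m k \<cdot> \<kappa>') = degen A p (k - 1) \<cdot> (face A p i \<cdot> \<kappa>')"
      using face_degen_less[OF A i(2), of p \<kappa>'] kt' p n by simp
    moreover have "k - 1 \<le> p" using p n i by simp
    ultimately show "e \<cdot> (degen A m k \<cdot> \<kappa>') = Zero E (Dom E (degen A m k \<cdot> \<kappa>')) (Cod E e)"
      using i kt'(1,2) kt'(3)[OF i(2) p] p A n by simp
  qed (use kt' A n in simp_all)
  have D': "e \<in> Arr E \<and> Dom E e = sob A m" if e: "e \<in> ?D m" for e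
  proof -
    obtain i where i: "e = face A (m - 1) i" "i < k" using e by blast
    then have "Suc (m - 1) = m" using n by simp
    then show ?thesis using i A by simp
  qed
  have "\<kappa>' \<cdot> (d \<cdot> s) = \<kappa>' \<cdot> Ident E (Dom E \<kappa>')"
    using reassoc[OF d(4), of s] s d kt kt' A n face_degen_id[OF A n(2), of k \<kappa>'] by simp
  then have "d \<cdot> s = Ident E (Dom E \<kappa>')"
    using joint_kernel_mono[OF k' D', of "d \<cdot> s" "Ident E (Dom E \<kappa>')"] d(1-3) s(1-3) kt'(1) by simp
  then have "is_retraction E d" using d s by (auto simp: is_retraction_def)
  then obtain \<nu> where l: "is_kernel E \<nu> d" using wic by (auto simp: weakly_idempotent_complete_def)
  note ls = kernel_simps[OF l]
  have D: "e \<in> Arr E \<and> Dom E e = sob A n" if "e \<in> ?D n" for e using that A n by auto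
  have "is_joint_kernel E (sob A n) {face A (n - 1) i | i. i < Suc k} (\<kappa> \<cdot> \<nu>)"
    unfolding is_joint_kernel_def
  proof (intro conjI ballI impI)
    show "\<kappa> \<cdot> \<nu> \<in> Arr E" "Cod E (\<kappa> \<cdot> \<nu>) = sob A n" using ls kt d n by simp_all
    fix e assume "e \<in> {face A (n - 1) i | i. i < Suc k}"
    then obtain i where i: "e = face A m i" "i < k \<or> i = k" using n by (auto simp: less_Suc_eq)
    have "face A m i \<cdot> (\<kappa> \<cdot> \<nu>) = Zero E (Dom E \<nu>) (sob A m)"
    proof (cases "i < k")
      case True
      then show ?thesis using reassoc[OF kt(3)[OF True], of \<nu>] ls kt(1,2) d A by simp
    next
      case False
      then have "i = k" using i by simp
      then show ?thesis
        using reassoc[OF d(4)[symmetric], of \<nu>] ls d(1-3) kt(1,2) kt'(1,2) A by simp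
    qed
    then show "e \<cdot> (\<kappa> \<cdot> \<nu>) = Zero E (Dom E (\<kappa> \<cdot> \<nu>)) (Cod E e)" using i ls kt(1,2) d A by simp
  next
    fix T g assume T: "T \<in> Obj E" and "g \<in> Hom E T (sob A n)"
      and z0: "\<forall>d\<in>{face A (n - 1) i | i. i < Suc k}. d \<cdot> g = Zero E T (Cod E d)"
    then have g: "g \<in> Arr E" "Dom E g = T" "Cod E g = sob A n" by simp_all
    have z: "face A m i \<cdot> g = Zero E T (sob A m)" if "i \<le> k" for i
      using z0 that n A by (auto simp: less_Suc_eq_le)
    obtain u where u: "u \<in> Arr E" "Dom E u = T" "Cod E u = Dom E \<kappa>" "\<kappa> \<cdot> u = g"
    proof (rule joint_kernel_lift[OF k g(1,3)])
      fix e assume "e \<in> ?D n"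
      then obtain i where i: "e = face A m i" "i < k" using n by auto
      then show "e \<cdot> g = Zero E (Dom E g) (Cod E e)" using z[of i] g A by simp
    qed (use g in blast)
    have "\<kappa>' \<cdot> (d \<cdot> u) = \<kappa>' \<cdot> Zero E T (Dom E \<kappa>')"
      using reassoc[OF d(4), of u] u d(1-3) kt(1,2) kt'(1,2) z[of k] A T by simp
    then have "d \<cdot> u = Zero E T (Dom E \<kappa>')"
      using joint_kernel_mono[OF k' D', of "d \<cdot> u" "Zero E T (Dom E \<kappa>')"] d(1-3) u T kt'(1) by simp
    then obtain v where v: "v \<in> Arr E" "Dom E v = T" "Cod E v = Dom E \<nu>" "\<nu> \<cdot> v = u"
      using kernel_lift[OF l, of u] u d(1-3) by auto
    show "\<exists>!u. u \<in> Hom E T (Dom E (\<kappa> \<cdot> \<nu>)) \<and> (\<kappa> \<cdot> \<nu>) \<cdot> u = g"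
    proof (rule ex1I[of _ v])
      show "v \<in> Hom E T (Dom E (\<kappa> \<cdot> \<nu>)) \<and> (\<kappa> \<cdot> \<nu>) \<cdot> v = g" using v u ls kt(1,2) d(1-3) by simp
      fix w assume "w \<in> Hom E T (Dom E (\<kappa> \<cdot> \<nu>)) \<and> (\<kappa> \<cdot> \<nu>) \<cdot> w = g"
      then have w: "w \<in> Arr E" "Dom E w = T" "Cod E w = Dom E \<nu>" "\<kappa> \<cdot> (\<nu> \<cdot> w) = g"
        using ls kt(1,2) d(1-3) by auto
      have "\<nu> \<cdot> w = u"
        by (rule joint_kernel_mono[OF k D]) (use w u ls d(1-3) in simp_all)
      then show "w = v" using kernel_mono[OF l, of w v] w v by simp
    qed
  qed
  then show ?case by blast
qed

text \<open>Generalized elements of NA with arbitrary domain, independent of a representing object.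
  The index m is there because faces out of degree n exist only for n > 0.\<close>

definition normalized :: "('a, 'b) simp_obj \<Rightarrow> nat \<Rightarrow> 'b \<Rightarrow> bool" where
  "normalized A n x \<longleftrightarrow> x \<in> Arr E \<and> Cod E x = sob A n \<and>
     (\<forall>m i. n = Suc m \<and> i < n \<longrightarrow> face A m i \<cdot> x = Zero E (Dom E x) (sob A m))"

text \<open>If d_0, ..., d_{k-1} kill x, then x - s_k d_k x is killed by d_k as well, at the price
  of a degenerate correction. After all steps x is normalized up to degeneracies of elements one
  dimension lower, to which the induction on n applies.\<close>

lemma simplicial_induct:
  fixes S :: "nat \<Rightarrow> 'b \<Rightarrow> bool"
  assumes A: "A \<in> simplicial_objects E"
    and norm: "\<And>n x. \<lbrakk>normalized A n x; Dom E x = T\<rbrakk> \<Longrightarrow> S n x"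
    and add: "\<And>n x y. \<lbrakk>x \<in> Arr E; Dom E x = T; Cod E x = sob A n; y \<in> Arr E; Dom E y = T; Cod E y = sob A n;
      S n x; S n y\<rbrakk> \<Longrightarrow> S n (x \<boxplus> y)"
    and degen: "\<And>n k x. \<lbrakk>x \<in> Arr E; Dom E x = T; Cod E x = sob A n; k \<le> n; S n x\<rbrakk> \<Longrightarrow> S (Suc n) (degen A n k \<cdot> x)"
    and x: "x \<in> Arr E" "Dom E x = T" "Cod E x = sob A n"
  shows "S n x"
  using x
proof (induction n arbitrary: x)
  case 0
  then show ?case using norm[of 0 x] by (simp add: normalized_def)
next
  case (Suc m)
  note IH = Suc.IH
  have "S (Suc m) x" if "k \<le> Suc m" "x \<in> Arr E" "Dom E x = T" "Cod E x = sob A (Suc m)"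
    "\<And>i. i < k \<Longrightarrow> face A m i \<cdot> x = Zero E T (sob A m)" for k x
    using that
  proof (induction "Suc m - k" arbitrary: k x)
    case 0
    then have "normalized A (Suc m) x" unfolding normalized_def by auto
    then show ?case using norm 0 by blast
  next
    case (Suc l)
    then have k: "k \<le> m" by simp
    note xt = Suc.prems(2-4) and xz = Suc.prems(5)
    let ?z = "face A m k \<cdot> x"
    have z: "?z \<in> Arr E" "Dom E ?z = T" "Cod E ?z = sob A m" using xt A by simp_all
    have Sz: "S m ?z" using IH[OF z] .
    obtain y where y: "y \<in> Arr E" "Dom E y = T" "Cod E y = sob A (Suc m)" "y \<boxplus> degen A m k \<cdot> ?z = x"
      using diff_ex[of x "degen A m k \<cdot> ?z"] xt A k by auto
    have "face A m i \<cdot> y = Zero E T (sob A m)" if i: "i < Suc k" for i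
    proof -
      have sum: "face A m i \<cdot> y \<boxplus> face A m i \<cdot> (degen A m k \<cdot> ?z) = face A m i \<cdot> x"
        using arg_cong[OF y(4), of "\<lambda>w. face A m i \<cdot> w"] y(1-3) xt z A k by simp
      show ?thesis
      proof (cases "i = k")
        case True
        then show ?thesis using sum face_degen_id[OF A k, of k ?z] z y(1-3) A by simp
      next
        case False
        then have ik: "i < k" using i by simp
        then obtain p where p: "m = Suc p" using k by (cases m) auto
        have "face A m i \<cdot> (degen A m k \<cdot> ?z) = degen A p (k - 1) \<cdot> (face A p i \<cdot> ?z)"
          using face_degen_less[OF A ik, of p ?z] z p k by simp
        also have "face A p i \<cdot> ?z = face A p (k - 1) \<cdot> (face A m i \<cdot> x)"
          using face_face[OF A ik, of x p] xt p by simp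
        finally have "face A m i \<cdot> (degen A m k \<cdot> ?z) = Zero E T (sob A m)"
          using xz[OF ik] xt A p k Dom_Obj[OF xt(1)] by simp
        then show ?thesis using sum xz[OF ik] y(1-3) A Dom_Obj[OF xt(1)] xt(2) by simp
      qed
    qed
    then have "S (Suc m) y" using Suc.hyps(1)[of "Suc k" y] Suc.hyps(2) y k by simp
    then show ?case using add[of y "Suc m" "degen A m k \<cdot> ?z"] degen[OF z k Sz] y z A k by simp
  qed
  then show ?case using Suc.prems by blast
qed

end

section \<open>The normalized chain complex functor\<close>

context exact_enough_projectives
begin

lemma norm_in_joint_kernel:
  assumes "A \<in> simplicial_objects E"
  shows "is_joint_kernel E (sob A n) {face A (n - 1) i | i. i < n} (norm_in E A n)"
  unfolding norm_in_def
  by (rule someI_ex) (rule joint_kernel_ex[OF weakly_idempotent_complete assms order_refl])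

lemma norm_in_simps [simp]:
  assumes "A \<in> simplicial_objects E"
  shows "norm_in E A n \<in> Arr E" "Cod E (norm_in E A n) = sob A n" "Dom E (norm_in E A n) \<in> Obj E"
  using norm_in_joint_kernel[OF assms, of n] by (simp_all add: is_joint_kernel_def)

lemma face_norm_in:
  assumes A: "A \<in> simplicial_objects E" and "i \<le> n" and u: "u \<in> Arr E" "Cod E u = Dom E (norm_in E A (Suc n))"
  shows "face A n i \<cdot> (norm_in E A (Suc n) \<cdot> u) = Zero E (Dom E u) (sob A n)"
proof -
  have "face A n i \<in> {face A (Suc n - 1) i | i. i < Suc n}" using assms(2) by auto
  then have "face A n i \<cdot> norm_in E A (Suc n) = Zero E (Dom E (norm_in E A (Suc n))) (Cod E (face A n i))"
    using norm_in_joint_kernel[OF A, of "Suc n"] unfolding is_joint_kernel_def by blast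
  then show ?thesis using reassoc[of "face A n i" "norm_in E A (Suc n)" _ u] A u by simp
qed

lemma normalized_norm_in:
  assumes "A \<in> simplicial_objects E" "u \<in> Arr E" "Cod E u = Dom E (norm_in E A n)"
  shows "normalized A n (norm_in E A n \<cdot> u)"
  using assms face_norm_in[OF assms(1)] by (auto simp: normalized_def less_Suc_eq_le)

lemma norm_lift:
  assumes A: "A \<in> simplicial_objects E" and x: "normalized A n x"
  obtains u where "u \<in> Arr E" "Dom E u = Dom E x" "Cod E u = Dom E (norm_in E A n)" "norm_in E A n \<cdot> u = x"
proof (rule joint_kernel_lift[OF norm_in_joint_kernel[OF A, of n], of x])
  show "x \<in> Arr E" "Cod E x = sob A n" using x by (simp_all add: normalized_def)
  fix d assume "d \<in> {face A (n - 1) i | i. i < n}"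
  then obtain i where i: "d = face A (n - 1) i" "i < n" by blast
  then have "n = Suc (n - 1)" by simp
  then have "face A (n - 1) i \<cdot> x = Zero E (Dom E x) (sob A (n - 1))" using x i unfolding normalized_def by blast
  then show "d \<cdot> x = Zero E (Dom E x) (Cod E d)" using i A by simp
qed (use that in blast)

lemma norm_mono:
  assumes A: "A \<in> simplicial_objects E" and uv: "u \<in> Arr E" "v \<in> Arr E" "Dom E u = Dom E v"
    "Cod E u = Dom E (norm_in E A n)" "Cod E v = Dom E (norm_in E A n)"
  shows "norm_in E A n \<cdot> u = norm_in E A n \<cdot> v \<longleftrightarrow> u = v"
proof
  assume e: "norm_in E A n \<cdot> u = norm_in E A n \<cdot> v"
  have D: "d \<in> Arr E \<and> Dom E d = sob A n" if d: "d \<in> {face A (n - 1) i | i. i < n}" for d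
  proof -
    obtain i where "d = face A (n - 1) i" "i < n" using d by blast
    then show ?thesis using A by simp
  qed
  show "u = v" by (rule joint_kernel_mono[OF norm_in_joint_kernel[OF A] D]) (use uv e in simp_all)
qed simp

lemma norm_chain_simps:
  assumes A: "A \<in> simplicial_objects E"
  shows "ob (norm_chain E A) n = Dom E (norm_in E A n)"
    "bd (norm_chain E A) n \<in> Arr E" "Dom E (bd (norm_chain E A) n) = Dom E (norm_in E A (Suc n))"
    "Cod E (bd (norm_chain E A) n) = Dom E (norm_in E A n)"
    "norm_in E A n \<cdot> bd (norm_chain E A) n = sgn_arr E (Suc n) (face A n (Suc n) \<cdot> norm_in E A (Suc n))"
proof -
  show "ob (norm_chain E A) n = Dom E (norm_in E A n)" by (simp add: norm_chain_def)
  let ?Q = "\<lambda>d. d \<in> Hom E (Dom E (norm_in E A (Suc n))) (Dom E (norm_in E A n)) \<and>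
       norm_in E A n \<cdot> d = sgn_arr E (Suc n) (face A n (Suc n)) \<cdot> norm_in E A (Suc n)"
  \<comment> \<open>The last face maps (NA)_{n+1} into (NA)_n: for i < n, d_i d_{n+1} = d_n d_i,
    which is zero there. Hence the definite description has a value.\<close>
  have "normalized A n (sgn_arr E (Suc n) (face A n (Suc n)) \<cdot> norm_in E A (Suc n))"
    unfolding normalized_def
  proof (intro conjI allI impI)
    fix m i assume mi: "n = Suc m \<and> i < n"
    have z: "face A (Suc m) i \<cdot> norm_in E A (Suc (Suc m)) = Zero E (Dom E (norm_in E A (Suc (Suc m)))) (sob A (Suc m))"
      using face_norm_in[OF A, of i "Suc m" "Ident E (Dom E (norm_in E A (Suc (Suc m))))"] mi A by simp
    have "face A m i \<cdot> (face A (Suc m) (Suc n) \<cdot> norm_in E A (Suc (Suc m))) = Zero E (Dom E (norm_in E A (Suc (Suc m)))) (sob A m)"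
      using face_face[OF A, of i "Suc n" "norm_in E A (Suc (Suc m))" m] z mi A by simp
    then show "face A m i \<cdot> (sgn_arr E (Suc n) (face A n (Suc n)) \<cdot> norm_in E A (Suc n))
        = Zero E (Dom E (sgn_arr E (Suc n) (face A n (Suc n)) \<cdot> norm_in E A (Suc n))) (sob A m)"
      using mi A by simp
  qed (use A in simp_all)
  then obtain d where "d \<in> Arr E" "Dom E d = Dom E (sgn_arr E (Suc n) (face A n (Suc n)) \<cdot> norm_in E A (Suc n))"
    "Cod E d = Dom E (norm_in E A n)" "norm_in E A n \<cdot> d = sgn_arr E (Suc n) (face A n (Suc n)) \<cdot> norm_in E A (Suc n)"
    by (rule norm_lift[OF A])
  then have Qd: "?Q d" using A by simp
  have uniq: "d' = d" if "?Q d'" for d'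
    using norm_mono[OF A, of d' d n] that Qd by simp
  have "?Q (bd (norm_chain E A) n)" unfolding norm_chain_def chain.sel by (rule theI[of ?Q, OF Qd uniq])
  then show "bd (norm_chain E A) n \<in> Arr E" "Dom E (bd (norm_chain E A) n) = Dom E (norm_in E A (Suc n))"
    "Cod E (bd (norm_chain E A) n) = Dom E (norm_in E A n)"
    "norm_in E A n \<cdot> bd (norm_chain E A) n = sgn_arr E (Suc n) (face A n (Suc n) \<cdot> norm_in E A (Suc n))"
    using A by simp_all
qed

lemma norm_bd_elem:
  assumes A: "A \<in> simplicial_objects E" and u: "u \<in> Arr E" "Cod E u = Dom E (norm_in E A (Suc n))"
  shows "norm_in E A n \<cdot> (bd (norm_chain E A) n \<cdot> u) = sgn_arr E (Suc n) (face A n (Suc n) \<cdot> (norm_in E A (Suc n) \<cdot> u))"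
  using reassoc[OF norm_chain_simps(5)[OF A, of n], of u] norm_chain_simps(1-4)[OF A, of n] A u by simp

lemma norm_chain_complex:
  assumes A: "A \<in> simplicial_objects E"
  shows "norm_chain E A \<in> chain_complexes E"
proof -
  note s = norm_chain_simps[OF A]
  have "bd (norm_chain E A) n \<cdot> bd (norm_chain E A) (Suc n)
      = Zero E (Dom E (norm_in E A (Suc (Suc n)))) (Dom E (norm_in E A n))" for n
  proof -
    let ?i = "norm_in E A (Suc (Suc n))"
    \<comment> \<open>The composite of the two last faces equals d_{n+1} after d_{n+1}, and the
      inner one vanishes on (NA)_{n+2}.\<close>
    have "face A (Suc n) (Suc n) \<cdot> ?i = Zero E (Dom E ?i) (sob A (Suc n))"
      using face_norm_in[OF A, of "Suc n" "Suc n" "Ident E (Dom E ?i)"] A by simp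
    then have "face A n (Suc n) \<cdot> (face A (Suc n) (Suc (Suc n)) \<cdot> ?i) = Zero E (Dom E ?i) (sob A n)"
      using face_face[OF A, of "Suc n" "Suc (Suc n)" ?i n] A by simp
    then have "norm_in E A n \<cdot> (bd (norm_chain E A) n \<cdot> bd (norm_chain E A) (Suc n)) = Zero E (Dom E ?i) (sob A n)"
      using norm_bd_elem[OF A, of "bd (norm_chain E A) (Suc n)" n] s(2-5)[of "Suc n"] A by simp
    then show ?thesis
      using norm_mono[OF A, of "bd (norm_chain E A) n \<cdot> bd (norm_chain E A) (Suc n)" "Zero E (Dom E ?i) (Dom E (norm_in E A n))" n]
        s(2-4)[of n] s(2-4)[of "Suc n"] A by simp
  qed
  then show ?thesis
    unfolding chain_complexes_def mem_Collect_eq s(1) Hom_iff using s(2-4) norm_in_simps(3)[OF A] by blast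
qed

lemma norm_map_simps:
  assumes f: "f \<in> Arr (sCat E)"
  shows "src (norm_map E f) = norm_chain E (src f)" "tgt (norm_map E f) = norm_chain E (tgt f)"
    "ap (norm_map E f) n \<in> Arr E" "Dom E (ap (norm_map E f) n) = Dom E (norm_in E (src f) n)"
    "Cod E (ap (norm_map E f) n) = Dom E (norm_in E (tgt f) n)"
    "norm_in E (tgt f) n \<cdot> ap (norm_map E f) n = ap f n \<cdot> norm_in E (src f) n"
proof -
  note AB = Arr_sCat_simps(1,2)[OF f]
  show "src (norm_map E f) = norm_chain E (src f)" "tgt (norm_map E f) = norm_chain E (tgt f)"
    by (simp_all add: norm_map_def)
  let ?Q = "\<lambda>u. u \<in> Hom E (Dom E (norm_in E (src f) n)) (Dom E (norm_in E (tgt f) n)) \<and>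
       norm_in E (tgt f) n \<cdot> u = ap f n \<cdot> norm_in E (src f) n"
  have "normalized (tgt f) n (ap f n \<cdot> norm_in E (src f) n)"
    unfolding normalized_def
  proof (intro conjI allI impI)
    fix m i assume mi: "n = Suc m \<and> i < n"
    have "face (src f) m i \<cdot> norm_in E (src f) (Suc m) = Zero E (Dom E (norm_in E (src f) (Suc m))) (sob (src f) m)"
      using face_norm_in[OF AB(1), of i m "Ident E (Dom E (norm_in E (src f) (Suc m)))"] mi AB by simp
    then show "face (tgt f) m i \<cdot> (ap f n \<cdot> norm_in E (src f) n)
        = Zero E (Dom E (ap f n \<cdot> norm_in E (src f) n)) (sob (tgt f) m)"
      using simp_map_sact_elem[OF f, of "coface m i" n "norm_in E (src f) n"] mi AB f by simp
  qed (use AB f in simp_all)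
  then obtain u where "u \<in> Arr E" "Dom E u = Dom E (ap f n \<cdot> norm_in E (src f) n)"
    "Cod E u = Dom E (norm_in E (tgt f) n)" "norm_in E (tgt f) n \<cdot> u = ap f n \<cdot> norm_in E (src f) n"
    by (rule norm_lift[OF AB(2)])
  then have Qu: "?Q u" using AB f by simp
  have uniq: "v = u" if "?Q v" for v
    using norm_mono[OF AB(2), of v u n] that Qu by simp
  have "?Q (ap (norm_map E f) n)" unfolding norm_map_def arrow.sel by (rule theI[of ?Q, OF Qu uniq])
  then show "ap (norm_map E f) n \<in> Arr E" "Dom E (ap (norm_map E f) n) = Dom E (norm_in E (src f) n)"
    "Cod E (ap (norm_map E f) n) = Dom E (norm_in E (tgt f) n)"
    "norm_in E (tgt f) n \<cdot> ap (norm_map E f) n = ap f n \<cdot> norm_in E (src f) n"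
    by simp_all
qed

lemma norm_map_elem:
  assumes f: "f \<in> Arr (sCat E)" and x: "x \<in> Arr E" "Cod E x = Dom E (norm_in E (src f) n)"
  shows "norm_in E (tgt f) n \<cdot> (ap (norm_map E f) n \<cdot> x) = ap f n \<cdot> (norm_in E (src f) n \<cdot> x)"
  using reassoc[OF norm_map_simps(6)[OF f, of n], of x] norm_map_simps(3-5)[OF f, of n] f x by simp

lemma norm_map_Arr:
  assumes f: "f \<in> Arr (sCat E)"
  shows "norm_map E f \<in> Arr (Ch E)"
proof -
  note AB = Arr_sCat_simps(1,2)[OF f] and m = norm_map_simps[OF f]
  note a = norm_chain_simps[OF AB(1)] and b = norm_chain_simps[OF AB(2)]
  have "bd (norm_chain E (tgt f)) n \<cdot> ap (norm_map E f) (Suc n)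
      = ap (norm_map E f) n \<cdot> bd (norm_chain E (src f)) n" for n
  proof -
    have "norm_in E (tgt f) n \<cdot> (bd (norm_chain E (tgt f)) n \<cdot> ap (norm_map E f) (Suc n))
        = sgn_arr E (Suc n) (face (tgt f) n (Suc n) \<cdot> (ap f (Suc n) \<cdot> norm_in E (src f) (Suc n)))"
      using norm_bd_elem[OF AB(2), of "ap (norm_map E f) (Suc n)" n] m(3-6)[of "Suc n"] by simp
    also have "face (tgt f) n (Suc n) \<cdot> (ap f (Suc n) \<cdot> norm_in E (src f) (Suc n))
        = ap f n \<cdot> (face (src f) n (Suc n) \<cdot> norm_in E (src f) (Suc n))"
      using simp_map_sact_elem[OF f, of "coface n (Suc n)" "Suc n" "norm_in E (src f) (Suc n)"] AB by simp
    also have "sgn_arr E (Suc n) \<dots> = norm_in E (tgt f) n \<cdot> (ap (norm_map E f) n \<cdot> bd (norm_chain E (src f)) n)"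
      using norm_map_elem[OF f, of "bd (norm_chain E (src f)) n" n] a(2-5)[of n] AB f by simp
    finally show ?thesis
      using norm_mono[OF AB(2), of "bd (norm_chain E (tgt f)) n \<cdot> ap (norm_map E f) (Suc n)"
          "ap (norm_map E f) n \<cdot> bd (norm_chain E (src f)) n" n] m(3-5)[of n] m(3-5)[of "Suc n"] a(2-4)[of n] b(2-4)[of n] by simp
  qed
  then show ?thesis
    unfolding Arr_Ch_iff m(1,2) a(1) b(1) using m(3-5) norm_chain_complex AB by blast
qed

lemma is_functor_N: "is_functor (sCat E) (Ch E) (DK_N E)"
proof -
  interpret S: category "sCat E" by (rule category_sCat)
  have id: "norm_map E (Ident (sCat E) A) = Ident (Ch E) (norm_chain E A)" if A: "A \<in> simplicial_objects E" for A
  proof (rule arrow_eqI)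
    have I: "Ident (sCat E) A \<in> Arr (sCat E)" using A by simp
    note m = norm_map_simps[OF I, unfolded Ident_sCat]
    show "ap (norm_map E (Ident (sCat E) A)) n = ap (Ident (Ch E) (norm_chain E A)) n" for n
      using norm_mono[OF A, of "ap (norm_map E (Ident (sCat E) A)) n" "Ident E (Dom E (norm_in E A n))" n] m(3-6)[of n] A
      by (simp add: norm_chain_simps(1)[OF A])
  qed (simp_all add: norm_map_def)
  have comp: "norm_map E (g \<cdot>\<^bsub>sCat E\<^esub> f) = norm_map E g \<cdot>\<^bsub>Ch E\<^esub> norm_map E f"
    if f: "f \<in> Arr (sCat E)" and g: "g \<in> Arr (sCat E)" and fg: "tgt f = src g" for f g
  proof (rule arrow_eqI)
    have gf: "g \<cdot>\<^bsub>sCat E\<^esub> f \<in> Arr (sCat E)" using S.Comp_simps(1)[of f g] f g fg by simp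
    note m = norm_map_simps[OF f] norm_map_simps[OF g] norm_map_simps[OF gf, unfolded Comp_sCat]
    note fs = Arr_sCat_simps[OF f] and gs = Arr_sCat_simps[OF g]
    show "ap (norm_map E (g \<cdot>\<^bsub>sCat E\<^esub> f)) n = ap (norm_map E g \<cdot>\<^bsub>Ch E\<^esub> norm_map E f) n" for n
    proof -
      have "norm_in E (tgt g) n \<cdot> (ap (norm_map E g) n \<cdot> ap (norm_map E f) n)
          = ap g n \<cdot> (ap f n \<cdot> norm_in E (src f) n)"
        using norm_map_elem[OF g, of "ap (norm_map E f) n" n] m(3-6)[of n] fg by simp
      also have "\<dots> = norm_in E (tgt g) n \<cdot> ap (norm_map E (g \<cdot>\<^bsub>sCat E\<^esub> f)) n"
        using m(18)[of n] fs(1) fs(3-5)[of n] gs(3-5)[of n] fg by simp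
      finally show ?thesis
        using norm_mono[OF gs(2), of "ap (norm_map E g) n \<cdot> ap (norm_map E f) n"
            "ap (norm_map E (g \<cdot>\<^bsub>sCat E\<^esub> f)) n" n] m(3-5)[of n] m(9-11)[of n] m(15-17)[of n] fg by simp
    qed
  qed (simp_all add: norm_map_def)
  show ?thesis
    unfolding is_functor_def DK_N_def cfunctor.simps sCat_simps Ch_simps
    using norm_chain_complex norm_map_Arr norm_map_simps(1,2) id comp by simp
qed

section \<open>Kan fibrations and degreewise surjectivity of the normalization\<close>

text \<open>A horn in the kernel of Hom(P, A) -> Hom(P, B), spelled out elementwise. Writing n =
  \<open>Suc m\<close> leaves the compatibility condition empty for horns in a 1-simplex.\<close>

definition ker_horn :: "('a, 'b) simp_map \<Rightarrow> 'a \<Rightarrow> nat \<Rightarrow> nat \<Rightarrow> (nat \<Rightarrow> 'b) \<Rightarrow> bool" where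
  "ker_horn f P n k e \<longleftrightarrow>
     (\<forall>i\<le>Suc n. i \<noteq> k \<longrightarrow> e i \<in> Arr E \<and> Dom E (e i) = P \<and> Cod E (e i) = sob (src f) n \<and>
        ap f n \<cdot> e i = Zero E P (sob (tgt f) n)) \<and>
     (\<forall>m i j. n = Suc m \<and> j \<le> Suc n \<and> i < j \<and> i \<noteq> k \<and> j \<noteq> k \<longrightarrow>
        face (src f) m i \<cdot> e j = face (src f) m (j - 1) \<cdot> e i)"

definition ker_filler :: "('a, 'b) simp_map \<Rightarrow> 'a \<Rightarrow> nat \<Rightarrow> nat \<Rightarrow> (nat \<Rightarrow> 'b) \<Rightarrow> bool" where
  "ker_filler f P n k e \<longleftrightarrow> (\<exists>v\<in>Arr E. Dom E v = P \<and> Cod E v = sob (src f) (Suc n) \<and>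
     ap f (Suc n) \<cdot> v = Zero E P (sob (tgt f) (Suc n)) \<and>
     (\<forall>i\<le>Suc n. i \<noteq> k \<longrightarrow> face (src f) n i \<cdot> v = e i))"

text \<open>Fillers add up: once the faces of w are subtracted, it suffices to fill the rest. This
  is the inductive step in both passes of the filling.\<close>

lemma ker_horn_diff:
  assumes f: "f \<in> Arr (sCat E)" and e: "ker_horn f P n k e"
    and w: "w \<in> Arr E" "Dom E w = P" "Cod E w = sob (src f) (Suc n)"
      "ap f (Suc n) \<cdot> w = Zero E P (sob (tgt f) (Suc n))"
  obtains e' where "ker_horn f P n k e'" "\<And>i. \<lbrakk>i \<le> Suc n; i \<noteq> k\<rbrakk> \<Longrightarrow> e' i \<boxplus> face (src f) n i \<cdot> w = e i"
    "ker_filler f P n k e' \<Longrightarrow> ker_filler f P n k e"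
proof -
  note AB = Arr_sCat_simps(1,2)[OF f]
  have P: "P \<in> Obj E" using w by auto
  have et: "e i \<in> Arr E" "Dom E (e i) = P" "Cod E (e i) = sob (src f) n" "ap f n \<cdot> e i = Zero E P (sob (tgt f) n)"
    if "i \<le> Suc n" "i \<noteq> k" for i using e that by (simp_all add: ker_horn_def)
  have "\<exists>h. i \<le> Suc n \<and> i \<noteq> k \<longrightarrow> h \<in> Arr E \<and> Dom E h = P \<and> Cod E h = sob (src f) n \<and> h \<boxplus> face (src f) n i \<cdot> w = e i" for i
  proof (cases "i \<le> Suc n \<and> i \<noteq> k")
    case True
    then obtain h where "h \<in> Arr E" "Dom E h = Dom E (face (src f) n i \<cdot> w)" "Cod E h = Cod E (face (src f) n i \<cdot> w)"
      "h \<boxplus> face (src f) n i \<cdot> w = e i"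
      using diff_ex[of "e i" "face (src f) n i \<cdot> w"] et[of i] w AB by auto
    then show ?thesis using w AB by auto
  qed blast
  then obtain e' where e': "\<And>i. i \<le> Suc n \<and> i \<noteq> k \<longrightarrow> e' i \<in> Arr E \<and> Dom E (e' i) = P \<and> Cod E (e' i) = sob (src f) n \<and>
      e' i \<boxplus> face (src f) n i \<cdot> w = e i" by metis
  have 1: "ker_horn f P n k e'"
    unfolding ker_horn_def
  proof (intro conjI allI impI; (elim conjE)?)
    fix i assume i: "i \<le> Suc n" "i \<noteq> k"
    show t: "e' i \<in> Arr E" "Dom E (e' i) = P" "Cod E (e' i) = sob (src f) n" using e' i by blast+
    have "ap f n \<cdot> (face (src f) n i \<cdot> w) = Zero E P (sob (tgt f) n)"
      using simp_map_sact_elem[OF f, of "coface n i" "Suc n" w] w AB P by simp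
    moreover have "ap f n \<cdot> (e' i \<boxplus> face (src f) n i \<cdot> w) = Zero E P (sob (tgt f) n)" using e' i et by simp
    ultimately show "ap f n \<cdot> e' i = Zero E P (sob (tgt f) n)" using t w f AB P by simp
  next
    fix m i j assume a: "n = Suc m" "j \<le> Suc n" "i < j" "i \<noteq> k" "j \<noteq> k"
    then have i: "i \<le> Suc n" by simp
    have c: "face (src f) m i \<cdot> (e' j \<boxplus> face (src f) n j \<cdot> w) = face (src f) m (j - 1) \<cdot> (e' i \<boxplus> face (src f) n i \<cdot> w)"
      using e a e' i unfolding ker_horn_def by simp
    have t: "e' j \<in> Arr E" "Dom E (e' j) = P" "Cod E (e' j) = sob (src f) (Suc m)"
      "e' i \<in> Arr E" "Dom E (e' i) = P" "Cod E (e' i) = sob (src f) (Suc m)" using e'[of i] e'[of j] a i by simp_all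
    show "face (src f) m i \<cdot> e' j = face (src f) m (j - 1) \<cdot> e' i"
      using c t w AB face_face[OF AB(1) a(3), of w m] a(1) by simp
  qed
  have 2: "ker_filler f P n k e" if fl: "ker_filler f P n k e'"
  proof -
    obtain v where v: "v \<in> Arr E" "Dom E v = P" "Cod E v = sob (src f) (Suc n)"
      "ap f (Suc n) \<cdot> v = Zero E P (sob (tgt f) (Suc n))" "\<And>i. \<lbrakk>i \<le> Suc n; i \<noteq> k\<rbrakk> \<Longrightarrow> face (src f) n i \<cdot> v = e' i"
      using fl unfolding ker_filler_def by blast
    show ?thesis
      unfolding ker_filler_def using v w f AB P e' by (intro bexI[of _ "v \<boxplus> w"]) simp_all
  qed
  show ?thesis using that[of e'] 1 2 e' by blast
qed

lemma ker_horn_simps: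
  assumes "ker_horn f P n k e" "i \<le> Suc n" "i \<noteq> k"
  shows "e i \<in> Arr E" "Dom E (e i) = P" "Cod E (e i) = sob (src f) n" "ap f n \<cdot> e i = Zero E P (sob (tgt f) n)"
  using assms by (simp_all add: ker_horn_def)

lemma ker_horn_compat:
  assumes "ker_horn f P (Suc m) k e" "j \<le> Suc (Suc m)" "i < j" "i \<noteq> k" "j \<noteq> k"
  shows "face (src f) m i \<cdot> e j = face (src f) m (j - 1) \<cdot> e i"
  using assms unfolding ker_horn_def by blast

lemma ker_horn_degen:
  assumes f: "f \<in> Arr (sCat E)" and e: "ker_horn f P n k e" and P: "P \<in> Obj E" and r: "r \<le> Suc n" "r \<noteq> k" and l: "l \<le> n"
  shows "degen (src f) n l \<cdot> e r \<in> Arr E" "Dom E (degen (src f) n l \<cdot> e r) = P"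
    "Cod E (degen (src f) n l \<cdot> e r) = sob (src f) (Suc n)"
    "ap f (Suc n) \<cdot> (degen (src f) n l \<cdot> e r) = Zero E P (sob (tgt f) (Suc n))"
  using ker_horn_simps[OF e r] simp_map_sact_elem[OF f, of "codeg n l" n "e r"] Arr_sCat_simps(1,2)[OF f] l P by simp_all

text \<open>Second pass, for the faces above k, from the top down: s_r e_{r+1} has face e_{r+1} at
  index r + 1, and compatibility with the entries that are already zero gives zero faces above r + 1
  and below k. Faces strictly between k and r + 1 may change; they are treated later.\<close>

lemma ker_filler_upper:
  assumes f: "f \<in> Arr (sCat E)" and P: "P \<in> Obj E" and "ker_horn f P n k e"
    and "\<And>i. i < k \<Longrightarrow> i \<le> Suc n \<Longrightarrow> e i = Zero E P (sob (src f) n)"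
    and "\<And>i. r < i \<Longrightarrow> i \<le> Suc n \<Longrightarrow> i \<noteq> k \<Longrightarrow> e i = Zero E P (sob (src f) n)"
    and "r \<le> Suc n"
  shows "ker_filler f P n k e"
  using assms(3-6)
proof (induction r arbitrary: e)
  note AB = Arr_sCat_simps(1,2)[OF f]
  have zero: "ker_filler f P n k e" if "\<And>i. i \<le> Suc n \<Longrightarrow> i \<noteq> k \<Longrightarrow> e i = Zero E P (sob (src f) n)" for e
    unfolding ker_filler_def using that AB P f by (intro bexI[of _ "Zero E P (sob (src f) (Suc n))"]) simp_all
  case 0
  have "e i = Zero E P (sob (src f) n)" if "i \<le> Suc n" "i \<noteq> k" for i
    using 0 that by (cases "i < k") auto
  then show ?case by (rule zero)
next
  case (Suc r)
  note AB = Arr_sCat_simps(1,2)[OF f] and e = Suc.prems(1) and lo = Suc.prems(2) and hi = Suc.prems(3) and rn = Suc.prems(4)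
  show ?case
  proof (cases "k < Suc r")
    case False
    have "e i = Zero E P (sob (src f) n)" if "r < i" "i \<le> Suc n" "i \<noteq> k" for i
    proof (cases "i < k")
      case True
      then show ?thesis using lo that by blast
    next
      case 2: False
      then have "Suc r < i" using False that by simp
      then show ?thesis using hi that by blast
    qed
    then show ?thesis using Suc.IH[OF e lo] rn by simp
  next
    case True
    then have R: "Suc r \<le> Suc n" "Suc r \<noteq> k" and l: "r \<le> n" using rn by simp_all
    note et = ker_horn_simps[OF e]
    let ?w = "degen (src f) n r \<cdot> e (Suc r)"
    note w = ker_horn_degen[OF f e P R l]
    obtain e' where e': "ker_horn f P n k e'" "\<And>i. \<lbrakk>i \<le> Suc n; i \<noteq> k\<rbrakk> \<Longrightarrow> e' i \<boxplus> face (src f) n i \<cdot> ?w = e i"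
      "ker_filler f P n k e' \<Longrightarrow> ker_filler f P n k e"
      using ker_horn_diff[OF f e w] by blast
    note et' = ker_horn_simps[OF e'(1)]
    have z: "e' i = Zero E P (sob (src f) n)"
      if i: "i \<le> Suc n" "i \<noteq> k" and fw: "face (src f) n i \<cdot> ?w = e i" for i
      using e'(2)[OF i] et'(1-3)[OF i] et(1-3)[OF i] unfolding fw by simp
    have lo': "e' i = Zero E P (sob (src f) n)" if i: "i < k" "i \<le> Suc n" for i
    proof (rule z)
      have ir: "i < r" using i True by simp
      then obtain m where m: "n = Suc m" using l by (cases n) auto
      have "face (src f) m i \<cdot> e (Suc r) = face (src f) m r \<cdot> e i"
        using ker_horn_compat[OF e[unfolded m], of "Suc r" i] i ir True R m by simp
      also have "\<dots> = Zero E P (sob (src f) m)" using lo[OF i] AB P m by simp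
      finally show "face (src f) n i \<cdot> ?w = e i"
        using face_degen_less[OF AB(1) ir, of m "e (Suc r)"] et(1-3)[OF R] lo[OF i] l m AB P by simp
    qed (use i in simp_all)
    have hi': "e' i = Zero E P (sob (src f) n)" if i: "r < i" "i \<le> Suc n" "i \<noteq> k" for i
    proof (rule z[OF i(2,3)])
      show "face (src f) n i \<cdot> ?w = e i"
      proof (cases "i = Suc r")
        case True
        then show ?thesis using face_degen_id[OF AB(1) l, of i "e (Suc r)"] et(1-3)[OF R] by simp
      next
        case False
        then have ir: "Suc r < i" using i by simp
        then obtain m where m: "n = Suc m" using i by (cases n) auto
        have "face (src f) m (i - 1) \<cdot> e (Suc r) = face (src f) m (Suc r) \<cdot> e i"
          using ker_horn_compat[OF e[unfolded m], of i "Suc r"] i ir R m by simp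
        also have "\<dots> = Zero E P (sob (src f) m)" using hi[OF ir i(2,3)] AB P m by simp
        moreover have "r \<le> m" using ir i(2) m by simp
        ultimately show ?thesis
          using face_degen_greater[OF AB(1) ir, of m "e (Suc r)"] et(1-3)[OF R] hi[OF ir i(2,3)] i m AB P by simp
      qed
    qed
    have "ker_filler f P n k e'" using Suc.IH[OF e'(1) lo' hi'] rn by simp
    then show ?thesis by (rule e'(3))
  qed
qed

text \<open>First pass, for the faces below k, from the bottom up: s_r e_r has face e_r at index r
  and, by compatibility, zero faces at all smaller indices. When r reaches k,
  \<open>ker_filler_upper\<close> takes over with the bound n + 1.\<close>

lemma ker_filler_ex:
  assumes f: "f \<in> Arr (sCat E)" and P: "P \<in> Obj E" and k: "k \<le> Suc n" and e: "ker_horn f P n k e"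
  shows "ker_filler f P n k e"
proof -
  note AB = Arr_sCat_simps(1,2)[OF f]
  have "ker_filler f P n k e" if "r \<le> k" "ker_horn f P n k e" "\<And>i. i < r \<Longrightarrow> e i = Zero E P (sob (src f) n)" for r e
    using that
  proof (induction "k - r" arbitrary: r e)
    case 0
    show ?case by (rule ker_filler_upper[OF f P 0(3), of "Suc n"]) (use 0 in simp_all)
  next
    case (Suc d)
    note e = Suc.prems(2) and lo = Suc.prems(3)
    have rk: "r < k" using Suc.hyps(2) by simp
    have R: "r \<le> Suc n" "r \<noteq> k" and l: "r \<le> n" using rk k by simp_all
    note et = ker_horn_simps[OF e]
    let ?w = "degen (src f) n r \<cdot> e r"
    note w = ker_horn_degen[OF f e P R l]
    obtain e' where e': "ker_horn f P n k e'" "\<And>i. \<lbrakk>i \<le> Suc n; i \<noteq> k\<rbrakk> \<Longrightarrow> e' i \<boxplus> face (src f) n i \<cdot> ?w = e i"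
      "ker_filler f P n k e' \<Longrightarrow> ker_filler f P n k e"
      using ker_horn_diff[OF f e w] by blast
    note et' = ker_horn_simps[OF e'(1)]
    have "e' i = Zero E P (sob (src f) n)" if i: "i < Suc r" for i
    proof -
      have ik: "i \<le> Suc n" "i \<noteq> k" using i rk R by simp_all
      have fw: "face (src f) n i \<cdot> ?w = e i"
      proof (cases "i = r")
        case True
        then show ?thesis using face_degen_id[OF AB(1) l, of i "e r"] et(1-3)[OF R] by simp
      next
        case False
        then have ir: "i < r" using i by simp
        then obtain m where m: "n = Suc m" using l by (cases n) auto
        have "face (src f) m i \<cdot> e r = face (src f) m (r - 1) \<cdot> e i"
          using ker_horn_compat[OF e[unfolded m], of r i] ik ir R m by simp
        also have "\<dots> = Zero E P (sob (src f) m)" using lo[OF ir] AB P m by simp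
        moreover have "r - 1 \<le> m" using l m by simp
        ultimately show ?thesis
          using face_degen_less[OF AB(1) ir, of m "e r"] et(1-3)[OF R] lo[OF ir] l m AB P by simp
      qed
      show ?thesis using e'(2)[OF ik] et'(1-3)[OF ik] et(1-3)[OF ik] unfolding fw by simp
    qed
    moreover have "d = k - Suc r" "Suc r \<le> k" using Suc.hyps(2) rk by simp_all
    ultimately have "ker_filler f P n k e'" using Suc.hyps(1)[of "Suc r" e'] e'(1) by simp
    then show ?case by (rule e'(3))
  qed
  from this[of 0 e] show ?thesis using e by simp
qed

end

lemma Hom_sset_simps [simp]:
  "simps (Hom_sset E P A) n = Hom E P (sob A n)"
  "sset_act (Hom_sset E P A) \<alpha> x = sact A \<alpha> \<cdot>\<^bsub>E\<^esub> x"
  "sface (Hom_sset E P A) n i x = face A n i \<cdot>\<^bsub>E\<^esub> x"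
  by (simp_all add: Hom_sset_def sface_def)

section \<open>Kan fibrations in terms of normalized elements\<close>

context exact_enough_projectives
begin

definition norm_surj :: "'a \<Rightarrow> ('a, 'b) simp_map \<Rightarrow> bool" where
  "norm_surj P f \<longleftrightarrow> (\<forall>n y. normalized (tgt f) (Suc n) y \<and> Dom E y = P \<longrightarrow>
     (\<exists>x. normalized (src f) (Suc n) x \<and> Dom E x = P \<and> ap f (Suc n) \<cdot> x = y))"

lemma norm_surj_iff:
  assumes f: "f \<in> Arr (sCat E)"
  shows "norm_surj P f \<longleftrightarrow> (\<forall>n y. y \<in> Arr E \<and> Dom E y = P \<and> Cod E y = ob (tgt (norm_map E f)) (Suc n) \<longrightarrow>
     (\<exists>x\<in>Arr E. Dom E x = P \<and> Cod E x = ob (src (norm_map E f)) (Suc n) \<and> ap (norm_map E f) (Suc n) \<cdot> x = y))"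
    (is "_ \<longleftrightarrow> ?R")
proof -
  note AB = Arr_sCat_simps(1,2)[OF f]
  note obs = norm_map_simps(1,2)[OF f] norm_chain_simps(1)[OF AB(1)] norm_chain_simps(1)[OF AB(2)]
  show ?thesis
    unfolding obs
  proof (intro iffI allI impI; (elim conjE)?)
    fix n y assume s: "norm_surj P f" and y: "y \<in> Arr E" "Dom E y = P" "Cod E y = Dom E (norm_in E (tgt f) (Suc n))"
    have "normalized (tgt f) (Suc n) (norm_in E (tgt f) (Suc n) \<cdot> y)" using normalized_norm_in[OF AB(2) y(1,3)] .
    moreover have "Dom E (norm_in E (tgt f) (Suc n) \<cdot> y) = P" using y AB by simp
    ultimately obtain x where x: "normalized (src f) (Suc n) x" "Dom E x = P"
      "ap f (Suc n) \<cdot> x = norm_in E (tgt f) (Suc n) \<cdot> y" using s unfolding norm_surj_def by blast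
    obtain u where u: "u \<in> Arr E" "Dom E u = P" "Cod E u = Dom E (norm_in E (src f) (Suc n))" "norm_in E (src f) (Suc n) \<cdot> u = x"
      using norm_lift[OF AB(1) x(1)] x(2) by metis
    have "norm_in E (tgt f) (Suc n) \<cdot> (ap (norm_map E f) (Suc n) \<cdot> u) = norm_in E (tgt f) (Suc n) \<cdot> y"
      using norm_map_elem[OF f, of u "Suc n"] u x(3) by simp
    then have "ap (norm_map E f) (Suc n) \<cdot> u = y"
      using norm_mono[OF AB(2), of "ap (norm_map E f) (Suc n) \<cdot> u" y "Suc n"] u y norm_map_simps(3-5)[OF f, of "Suc n"] by simp
    then show "\<exists>x\<in>Arr E. Dom E x = P \<and> Cod E x = Dom E (norm_in E (src f) (Suc n)) \<and> ap (norm_map E f) (Suc n) \<cdot> x = y"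
      using u by blast
  next
    assume R: "\<forall>n y. y \<in> Arr E \<and> Dom E y = P \<and> Cod E y = Dom E (norm_in E (tgt f) (Suc n)) \<longrightarrow>
     (\<exists>x\<in>Arr E. Dom E x = P \<and> Cod E x = Dom E (norm_in E (src f) (Suc n)) \<and> ap (norm_map E f) (Suc n) \<cdot> x = y)"
    show "norm_surj P f"
      unfolding norm_surj_def
    proof (intro allI impI; elim conjE)
      fix n y assume y: "normalized (tgt f) (Suc n) y" "Dom E y = P"
      obtain u where u: "u \<in> Arr E" "Dom E u = P" "Cod E u = Dom E (norm_in E (tgt f) (Suc n))" "norm_in E (tgt f) (Suc n) \<cdot> u = y"
        using norm_lift[OF AB(2) y(1)] y(2) by metis
      obtain x where x: "x \<in> Arr E" "Dom E x = P" "Cod E x = Dom E (norm_in E (src f) (Suc n))"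
        "ap (norm_map E f) (Suc n) \<cdot> x = u" using R u(1-3) by blast
      show "\<exists>x. normalized (src f) (Suc n) x \<and> Dom E x = P \<and> ap f (Suc n) \<cdot> x = y"
        using normalized_norm_in[OF AB(1) x(1,3)] norm_map_elem[OF f x(1,3)] x u AB
        by (intro exI[of _ "norm_in E (src f) (Suc n) \<cdot> x"]) simp
    qed
  qed
qed

text \<open>Use the zero horn without last face: it lies over y because the other faces of a
  normalized y vanish, and a filler of it is normalized.\<close>

lemma kan_fibration_imp_norm_surj:
  assumes f: "f \<in> Arr (sCat E)" and P: "P \<in> Obj E"
    and kan: "kan_fibration (Hom_sset E P (src f)) (Hom_sset E P (tgt f)) (Hom_sset_map E f)"
  shows "norm_surj P f"
  unfolding norm_surj_def
proof (intro allI impI; elim conjE)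
  note AB = Arr_sCat_simps(1,2)[OF f]
  fix n y assume y: "normalized (tgt f) (Suc n) y" "Dom E y = P"
  then have yt: "y \<in> Arr E" "Cod E y = sob (tgt f) (Suc n)" and yz: "\<And>i. i \<le> n \<Longrightarrow> face (tgt f) n i \<cdot> y = Zero E P (sob (tgt f) n)"
    by (simp_all add: normalized_def)
  let ?x = "\<lambda>i::nat. Zero E P (sob (src f) n)"
  have "\<exists>w \<in> simps (Hom_sset E P (src f)) (Suc n). (\<forall>i \<le> Suc n. i \<noteq> Suc n \<longrightarrow> sface (Hom_sset E P (src f)) n i w = ?x i) \<and>
      Hom_sset_map E f (Suc n) w = y"
  proof (rule kan[unfolded kan_fibration_def, rule_format, of "Suc n"])
    show "y \<in> simps (Hom_sset E P (tgt f)) (Suc n)" using y yt by simp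
    show "(\<forall>i \<le> Suc n. i \<noteq> Suc n \<longrightarrow> ?x i \<in> simps (Hom_sset E P (src f)) n \<and>
        sface (Hom_sset E P (tgt f)) n i y = Hom_sset_map E f n (?x i)) \<and>
      (\<forall>j \<le> Suc n. \<forall>i < j. i \<noteq> Suc n \<and> j \<noteq> Suc n \<longrightarrow>
        sface (Hom_sset E P (src f)) (n - 1) i (?x j) = sface (Hom_sset E P (src f)) (n - 1) (j - 1) (?x i))"
    proof (intro conjI allI impI)
      fix i j assume "j \<le> Suc n" "i < j" "i \<noteq> Suc n \<and> j \<noteq> Suc n"
      then have "Suc (n - 1) = n" by simp
      then show "sface (Hom_sset E P (src f)) (n - 1) i (?x j) = sface (Hom_sset E P (src f)) (n - 1) (j - 1) (?x i)"
        using AB P by simp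
    qed (use yz AB P f in \<open>simp_all add: Hom_sset_map_def\<close>)
  qed simp
  then obtain w where w: "w \<in> Arr E" "Dom E w = P" "Cod E w = sob (src f) (Suc n)"
    "\<And>i. i \<le> n \<Longrightarrow> face (src f) n i \<cdot> w = Zero E P (sob (src f) n)" "ap f (Suc n) \<cdot> w = y"
    by (auto simp: Hom_sset_map_def)
  then show "\<exists>x. normalized (src f) (Suc n) x \<and> Dom E x = P \<and> ap f (Suc n) \<cdot> x = y"
    by (intro exI[of _ w]) (simp add: normalized_def)
qed

text \<open>Surjectivity in positive degrees means surjectivity up to constant simplices.\<close>

lemma norm_surj_lift:
  assumes f: "f \<in> Arr (sCat E)" and P: "P \<in> Obj E" and s: "norm_surj P f"
    and y: "y \<in> Arr E" "Dom E y = P" "Cod E y = sob (tgt f) n"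
  shows "\<exists>a b. a \<in> Arr E \<and> Dom E a = P \<and> Cod E a = sob (src f) n \<and> b \<in> Arr E \<and> Dom E b = P \<and> Cod E b = sob (tgt f) 0 \<and>
    y = ap f n \<cdot> a \<boxplus> sact (tgt f) (to_point n) \<cdot> b"
proof -
  note AB = Arr_sCat_simps(1,2)[OF f]
  show ?thesis
  proof (rule simplicial_induct[OF AB(2), where T=P, OF _ _ _ y])
    fix n x assume x: "normalized (tgt f) n x" "Dom E x = P"
    then have xt: "x \<in> Arr E" "Cod E x = sob (tgt f) n" by (simp_all add: normalized_def)
    show "\<exists>a b. a \<in> Arr E \<and> Dom E a = P \<and> Cod E a = sob (src f) n \<and> b \<in> Arr E \<and> Dom E b = P \<and> Cod E b = sob (tgt f) 0 \<and>
      x = ap f n \<cdot> a \<boxplus> sact (tgt f) (to_point n) \<cdot> b"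
    proof (cases n)
      case 0
      \<comment> \<open>In degree 0, where \<open>norm_surj\<close> says nothing, all of x is
        counted as constant.\<close>
      then show ?thesis using xt x AB P f
        by (intro exI[of _ "Zero E P (sob (src f) 0)"] exI[of _ x]) (simp add: to_point_0)
    next
      case (Suc m)
      then obtain a where a: "normalized (src f) (Suc m) a" "Dom E a = P" "ap f (Suc m) \<cdot> a = x"
        using s x unfolding norm_surj_def by blast
      then show ?thesis using xt x AB P f Suc
        by (intro exI[of _ a] exI[of _ "Zero E P (sob (tgt f) 0)"]) (simp add: normalized_def)
    qed
  next
    fix n x y assume "\<exists>a b. a \<in> Arr E \<and> Dom E a = P \<and> Cod E a = sob (src f) n \<and> b \<in> Arr E \<and> Dom E b = P \<and> Cod E b = sob (tgt f) 0 \<and>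
      x = ap f n \<cdot> a \<boxplus> sact (tgt f) (to_point n) \<cdot> b"
      "\<exists>a b. a \<in> Arr E \<and> Dom E a = P \<and> Cod E a = sob (src f) n \<and> b \<in> Arr E \<and> Dom E b = P \<and> Cod E b = sob (tgt f) 0 \<and>
      y = ap f n \<cdot> a \<boxplus> sact (tgt f) (to_point n) \<cdot> b"
    then obtain a b a' b' where ab: "a \<in> Arr E" "Dom E a = P" "Cod E a = sob (src f) n" "b \<in> Arr E" "Dom E b = P" "Cod E b = sob (tgt f) 0"
      "a' \<in> Arr E" "Dom E a' = P" "Cod E a' = sob (src f) n" "b' \<in> Arr E" "Dom E b' = P" "Cod E b' = sob (tgt f) 0"
      and xy: "x = ap f n \<cdot> a \<boxplus> sact (tgt f) (to_point n) \<cdot> b" "y = ap f n \<cdot> a' \<boxplus> sact (tgt f) (to_point n) \<cdot> b'"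
      by blast
    show "\<exists>a b. a \<in> Arr E \<and> Dom E a = P \<and> Cod E a = sob (src f) n \<and> b \<in> Arr E \<and> Dom E b = P \<and> Cod E b = sob (tgt f) 0 \<and>
      x \<boxplus> y = ap f n \<cdot> a \<boxplus> sact (tgt f) (to_point n) \<cdot> b"
      unfolding xy using ab AB f by (intro exI[of _ "a \<boxplus> a'"] exI[of _ "b \<boxplus> b'"]) (simp add: Add_ac)
  next
    fix n k x assume k: "k \<le> n" and "\<exists>a b. a \<in> Arr E \<and> Dom E a = P \<and> Cod E a = sob (src f) n \<and> b \<in> Arr E \<and> Dom E b = P \<and> Cod E b = sob (tgt f) 0 \<and>
      x = ap f n \<cdot> a \<boxplus> sact (tgt f) (to_point n) \<cdot> b"
    then obtain a b where ab: "a \<in> Arr E" "Dom E a = P" "Cod E a = sob (src f) n" "b \<in> Arr E" "Dom E b = P" "Cod E b = sob (tgt f) 0"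
      and x: "x = ap f n \<cdot> a \<boxplus> sact (tgt f) (to_point n) \<cdot> b" by blast
    have "degen (tgt f) n k \<cdot> (sact (tgt f) (to_point n) \<cdot> b) = sact (tgt f) (to_point (Suc n)) \<cdot> b"
      using ab AB k by (simp add: sact_sact to_point_Comp)
    then show "\<exists>a b. a \<in> Arr E \<and> Dom E a = P \<and> Cod E a = sob (src f) (Suc n) \<and> b \<in> Arr E \<and> Dom E b = P \<and> Cod E b = sob (tgt f) 0 \<and>
      degen (tgt f) n k \<cdot> x = ap f (Suc n) \<cdot> a \<boxplus> sact (tgt f) (to_point (Suc n)) \<cdot> b"
      unfolding x using ab AB k f simp_map_sact_elem[OF f, of "codeg n k" n a]
      by (intro exI[of _ "degen (src f) n k \<cdot> a"] exI[of _ b]) simp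
  qed
qed

text \<open>Write y as f a plus the constant simplex on b. A horn of dimension n + 1 has at least
  one face, and the image of that face shows that the constant lifts too, so y = f a1. Subtracting
  the faces of a1 leaves a horn in the kernel, which \<open>ker_filler_ex\<close> fills.\<close>

lemma norm_surj_imp_kan_fibration:
  assumes f: "f \<in> Arr (sCat E)" and P: "P \<in> Obj E" and s: "norm_surj P f"
  shows "kan_fibration (Hom_sset E P (src f)) (Hom_sset E P (tgt f)) (Hom_sset_map E f)"
  unfolding kan_fibration_def
proof (intro allI ballI impI, elim conjE)
  note AB = Arr_sCat_simps(1,2)[OF f]
  fix n k x y assume k: "k \<le> Suc n" and "y \<in> simps (Hom_sset E P (tgt f)) (Suc n)"
    and xs: "\<forall>i \<le> Suc n. i \<noteq> k \<longrightarrow> x i \<in> simps (Hom_sset E P (src f)) n \<and> sface (Hom_sset E P (tgt f)) n i y = Hom_sset_map E f n (x i)"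
    and xc: "\<forall>j \<le> Suc n. \<forall>i < j. i \<noteq> k \<and> j \<noteq> k \<longrightarrow>
        sface (Hom_sset E P (src f)) (n - 1) i (x j) = sface (Hom_sset E P (src f)) (n - 1) (j - 1) (x i)"
  then have y: "y \<in> Arr E" "Dom E y = P" "Cod E y = sob (tgt f) (Suc n)" by simp_all
  have xt: "x i \<in> Arr E" "Dom E (x i) = P" "Cod E (x i) = sob (src f) n" "ap f n \<cdot> x i = face (tgt f) n i \<cdot> y"
    if "i \<le> Suc n" "i \<noteq> k" for i using xs that by (simp_all add: Hom_sset_map_def)
  obtain a b where a: "a \<in> Arr E" "Dom E a = P" "Cod E a = sob (src f) (Suc n)" and b: "b \<in> Arr E" "Dom E b = P" "Cod E b = sob (tgt f) 0"
    and yab: "y = ap f (Suc n) \<cdot> a \<boxplus> sact (tgt f) (to_point (Suc n)) \<cdot> b"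
    using norm_surj_lift[OF f P s y] by blast
  \<comment> \<open>Some face index other than k; it exists because n + 1 \<ge> 1.\<close>
  define i where "i = (if k = 0 then 1 else 0 :: nat)"
  have i: "i \<le> Suc n" "i \<noteq> k" by (simp_all add: i_def)
  obtain z where z: "z \<in> Arr E" "Dom E z = P" "Cod E z = sob (src f) n" "z \<boxplus> face (src f) n i \<cdot> a = x i"
    using diff_ex[of "x i" "face (src f) n i \<cdot> a"] xt[OF i] a AB by auto
  have fa: "face (tgt f) n i \<cdot> (ap f (Suc n) \<cdot> a) = ap f n \<cdot> (face (src f) n i \<cdot> a)" for i
    using simp_map_sact_elem[OF f, of "coface n i" "Suc n" a] a by simp
  have "ap f n \<cdot> (z \<boxplus> face (src f) n i \<cdot> a) = face (tgt f) n i \<cdot> y" using z xt[OF i] by simp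
  moreover have "face (tgt f) n i \<cdot> y = ap f n \<cdot> (face (src f) n i \<cdot> a) \<boxplus> sact (tgt f) (to_point n) \<cdot> b"
    unfolding yab using a b AB f fa[of i] by (simp add: sact_sact to_point_Comp)
  ultimately have fz: "ap f n \<cdot> z = sact (tgt f) (to_point n) \<cdot> b"
    using z(1-3) a b AB f Add_comm[of "ap f n \<cdot> z" "ap f n \<cdot> (face (src f) n i \<cdot> a)"] by simp
  \<comment> \<open>A vertex [0] -> [n], splitting the map to the point: restricting the constant
    n-simplex along it returns b.\<close>
  define \<nu> where "\<nu> = mk_sop 0 (\<lambda>_. 0) n"
  have \<nu>: "\<nu> \<in> Arr Simplex" "src \<nu> = 0" "tgt \<nu> = n" by (auto simp: \<nu>_def intro!: mk_sop_Arr)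
  have "b = sact (tgt f) \<nu> \<cdot> (sact (tgt f) (to_point n) \<cdot> b)"
    using \<nu> b AB by (simp add: sact_sact to_point_Comp to_point_0)
  also have "\<dots> = ap f 0 \<cdot> (sact (src f) \<nu> \<cdot> z)"
    unfolding fz[symmetric] using simp_map_sact_elem[OF f \<nu>(1,3), of z] z \<nu> by simp
  finally have bz: "b = ap f 0 \<cdot> (sact (src f) \<nu> \<cdot> z)" .
  let ?c = "sact (src f) (to_point (Suc n)) \<cdot> (sact (src f) \<nu> \<cdot> z)"
  let ?a = "a \<boxplus> ?c"
  have c: "?c \<in> Arr E" "Dom E ?c = P" "Cod E ?c = sob (src f) (Suc n)" using z \<nu> AB by simp_all
  have "ap f (Suc n) \<cdot> ?c = sact (tgt f) (to_point (Suc n)) \<cdot> b"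
    using simp_map_sact_elem[OF f, of "to_point (Suc n)" 0 "sact (src f) \<nu> \<cdot> z"] z \<nu> AB bz by simp
  then have ya: "ap f (Suc n) \<cdot> ?a = y" unfolding yab using a c f by simp
  have at: "?a \<in> Arr E" "Dom E ?a = P" "Cod E ?a = sob (src f) (Suc n)" using a c by simp_all
  obtain a1 where a1: "a1 \<in> Arr E" "Dom E a1 = P" "Cod E a1 = sob (src f) (Suc n)" "ap f (Suc n) \<cdot> a1 = y"
    using at ya by blast
  have fa1: "face (tgt f) n i \<cdot> y = ap f n \<cdot> (face (src f) n i \<cdot> a1)" for i
    using simp_map_sact_elem[OF f, of "coface n i" "Suc n" a1] a1 by simp
  have "\<exists>h. i \<le> Suc n \<and> i \<noteq> k \<longrightarrow> h \<in> Arr E \<and> Dom E h = P \<and> Cod E h = sob (src f) n \<and> h \<boxplus> face (src f) n i \<cdot> a1 = x i" for i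
  proof (cases "i \<le> Suc n \<and> i \<noteq> k")
    case True
    then have "x i \<in> Arr E" "Dom E (x i) = P" "Cod E (x i) = sob (src f) n" using xt by blast+
    then obtain h where "h \<in> Arr E" "Dom E h = Dom E (face (src f) n i \<cdot> a1)" "Cod E h = Cod E (face (src f) n i \<cdot> a1)"
      "h \<boxplus> face (src f) n i \<cdot> a1 = x i"
      using diff_ex[of "x i" "face (src f) n i \<cdot> a1"] a1 AB by auto
    then show ?thesis using a1 AB by auto
  qed blast
  then obtain e where e: "\<And>i. i \<le> Suc n \<and> i \<noteq> k \<longrightarrow> e i \<in> Arr E \<and> Dom E (e i) = P \<and> Cod E (e i) = sob (src f) n \<and>
      e i \<boxplus> face (src f) n i \<cdot> a1 = x i" by metis
  have "ker_horn f P n k e"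
    unfolding ker_horn_def
  proof (intro conjI allI impI; (elim conjE)?)
    fix i assume i: "i \<le> Suc n" "i \<noteq> k"
    show t: "e i \<in> Arr E" "Dom E (e i) = P" "Cod E (e i) = sob (src f) n" using e i by blast+
    have "ap f n \<cdot> (e i \<boxplus> face (src f) n i \<cdot> a1) = ap f n \<cdot> (face (src f) n i \<cdot> a1)"
      using e i xt(4)[OF i] fa1 by simp
    then show "ap f n \<cdot> e i = Zero E P (sob (tgt f) n)" using t a1(1-3) f AB by simp
  next
    fix m i j assume q: "n = Suc m" "j \<le> Suc n" "i < j" "i \<noteq> k" "j \<noteq> k"
    then have i: "i \<le> Suc n" by simp
    have c: "face (src f) m i \<cdot> (e j \<boxplus> face (src f) n j \<cdot> a1) = face (src f) m (j - 1) \<cdot> (e i \<boxplus> face (src f) n i \<cdot> a1)"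
      using xc q e i by simp
    have t: "e j \<in> Arr E" "Dom E (e j) = P" "Cod E (e j) = sob (src f) (Suc m)"
      "e i \<in> Arr E" "Dom E (e i) = P" "Cod E (e i) = sob (src f) (Suc m)" using e[of i] e[of j] q i by simp_all
    show "face (src f) m i \<cdot> e j = face (src f) m (j - 1) \<cdot> e i"
      using c t a1(1-3) AB face_face[OF AB(1) q(3), of a1 m] q(1) by simp
  qed
  then obtain v where v: "v \<in> Arr E" "Dom E v = P" "Cod E v = sob (src f) (Suc n)"
     "ap f (Suc n) \<cdot> v = Zero E P (sob (tgt f) (Suc n))" "\<And>i. \<lbrakk>i \<le> Suc n; i \<noteq> k\<rbrakk> \<Longrightarrow> face (src f) n i \<cdot> v = e i"
    using ker_filler_ex[OF f P k] unfolding ker_filler_def by blast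
  have "ap f (Suc n) \<cdot> (v \<boxplus> a1) = y" using v(1-4) a1 f y by simp
  moreover have "face (src f) n i \<cdot> (v \<boxplus> a1) = x i" if i: "i \<le> Suc n" "i \<noteq> k" for i
    using v(1-3) v(5)[OF i] a1(1-3) AB e i by simp
  ultimately show "\<exists>w \<in> simps (Hom_sset E P (src f)) (Suc n). (\<forall>i \<le> Suc n. i \<noteq> k \<longrightarrow> sface (Hom_sset E P (src f)) n i w = x i) \<and>
      Hom_sset_map E f (Suc n) w = y"
    using v(1-3) a1(1-3) by (intro bexI[of _ "v \<boxplus> a1"]) (simp_all add: Hom_sset_map_def)
qed

lemma s_fibrations_iff: "f \<in> s_fibrations E \<longleftrightarrow> f \<in> Arr (sCat E) \<and> norm_map E f \<in> Ch_fibrations E"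
proof (cases "f \<in> Arr (sCat E)")
  case True
  have "kan_fibration (Hom_sset E P (src f)) (Hom_sset E P (tgt f)) (Hom_sset_map E f) \<longleftrightarrow>
      (\<forall>n y. y \<in> Arr E \<and> Dom E y = P \<and> Cod E y = ob (tgt (norm_map E f)) (Suc n) \<longrightarrow>
     (\<exists>x\<in>Arr E. Dom E x = P \<and> Cod E x = ob (src (norm_map E f)) (Suc n) \<and> ap (norm_map E f) (Suc n) \<cdot> x = y))"
    if "projective E P" for P
    using kan_fibration_imp_norm_surj[OF True] norm_surj_imp_kan_fibration[OF True] norm_surj_iff[OF True] that
    unfolding projective_def by blast
  then show ?thesis unfolding s_fibrations_def Ch_fibrations_iff using True norm_map_Arr[OF True] by blast
qed (simp add: s_fibrations_def)

end

section \<open>Weak equivalences of simplicial objects and quasi-isomorphisms\<close>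

text \<open>Compatibility of f makes the image of a class generate the class of the image, so
  bijectivity on quotients is injectivity and surjectivity modulo the relations; homotopy sets then
  need no group structure.\<close>

lemma bij_betw_quotient_iff:
  assumes r: "equiv S r" and s: "equiv T s" and f: "\<And>x. x \<in> S \<Longrightarrow> f x \<in> T"
    and resp: "\<And>x y. (x, y) \<in> r \<Longrightarrow> (f x, f y) \<in> s"
  shows "bij_betw (\<lambda>c. s `` (f ` c)) (S // r) (T // s) \<longleftrightarrow>
    (\<forall>x\<in>S. \<forall>y\<in>S. (f x, f y) \<in> s \<longrightarrow> (x, y) \<in> r) \<and> (\<forall>y\<in>T. \<exists>x\<in>S. (f x, y) \<in> s)"
proof -
  have key: "s `` (f ` (r `` {x})) = s `` {f x}" if x: "x \<in> S" for x
  proof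
    show "s `` (f ` (r `` {x})) \<subseteq> s `` {f x}"
      using resp s by (auto simp: equiv_def dest: transD)
    have "x \<in> r `` {x}" using r x by (rule equiv_class_self)
    then show "s `` {f x} \<subseteq> s `` (f ` (r `` {x}))" by blast
  qed
  have Sr: "r `` {x} \<in> S // r" if "x \<in> S" for x using that by (rule quotientI)
  show ?thesis
  proof (intro iffI conjI ballI impI)
    fix x y assume b: "bij_betw (\<lambda>c. s `` (f ` c)) (S // r) (T // s)" and xy: "x \<in> S" "y \<in> S" "(f x, f y) \<in> s"
    have "s `` {f x} = s `` {f y}" using equiv_class_eq[OF s xy(3)] .
    then have "r `` {x} = r `` {y}"
      using b Sr xy key unfolding bij_betw_def inj_on_def by metis
    then show "(x, y) \<in> r" using eq_equiv_class[OF _ r xy(2)] by blast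
  next
    fix y assume b: "bij_betw (\<lambda>c. s `` (f ` c)) (S // r) (T // s)" and y: "y \<in> T"
    have "s `` {y} \<in> (\<lambda>c. s `` (f ` c)) ` (S // r)" using b quotientI[OF y] unfolding bij_betw_def by blast
    then obtain x where x: "x \<in> S" "s `` {y} = s `` {f x}" using key by (auto elim!: quotientE)
    then have "(f x, y) \<in> s" using eq_equiv_class[OF x(2)[symmetric] s y] by simp
    then show "\<exists>x\<in>S. (f x, y) \<in> s" using x(1) by blast
  next
    assume a: "(\<forall>x\<in>S. \<forall>y\<in>S. (f x, f y) \<in> s \<longrightarrow> (x, y) \<in> r) \<and> (\<forall>y\<in>T. \<exists>x\<in>S. (f x, y) \<in> s)"
    show "bij_betw (\<lambda>c. s `` (f ` c)) (S // r) (T // s)"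
    proof (rule bij_betw_imageI)
      show "inj_on (\<lambda>c. s `` (f ` c)) (S // r)"
      proof (rule inj_onI)
        fix c d assume "c \<in> S // r" "d \<in> S // r" and e: "s `` (f ` c) = s `` (f ` d)"
        then obtain x y where xy: "x \<in> S" "c = r `` {x}" "y \<in> S" "d = r `` {y}" by (auto elim!: quotientE)
        then have "s `` {f x} = s `` {f y}" using e key by simp
        then have "(f x, f y) \<in> s" using eq_equiv_class[OF _ s f[OF xy(3)]] by blast
        then show "c = d" using a xy equiv_class_eq[OF r] by blast
      qed
      show "(\<lambda>c. s `` (f ` c)) ` (S // r) = T // s"
      proof
        show "(\<lambda>c. s `` (f ` c)) ` (S // r) \<subseteq> T // s"
        proof
          fix d assume "d \<in> (\<lambda>c. s `` (f ` c)) ` (S // r)"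
          then obtain x where x: "x \<in> S" "d = s `` (f ` (r `` {x}))" by (auto elim!: quotientE)
          then show "d \<in> T // s" using key quotientI[OF f[OF x(1)], of s] by simp
        qed
        show "T // s \<subseteq> (\<lambda>c. s `` (f ` c)) ` (S // r)"
        proof
          fix d assume "d \<in> T // s"
          then obtain y where y: "y \<in> T" "d = s `` {y}" by (auto elim!: quotientE)
          obtain x where x: "x \<in> S" "(f x, y) \<in> s" using a y by blast
          then have "d = s `` (f ` (r `` {x}))" using key y equiv_class_eq[OF s x(2)] by simp
          then show "d \<in> (\<lambda>c. s `` (f ` c)) ` (S // r)" using Sr[OF x(1)] by blast
        qed
      qed
    qed
  qed
qed

context exact_enough_projectives
begin

text \<open>\<open>sph P A n v\<close> is the set of spheres in \<open>Hom(P, A)\<close>, extended to \<open>n = 0\<close> by all vertices, and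
  \<open>bnd P A n\<close> consists of the boundaries of normalized simplices.\<close>

definition sph :: "'a \<Rightarrow> ('a, 'b) simp_obj \<Rightarrow> nat \<Rightarrow> 'b \<Rightarrow> 'b set" where
  "sph P A n v = {x \<in> Arr E. Dom E x = P \<and> Cod E x = sob A n \<and>
     (\<forall>m i. n = Suc m \<and> i \<le> n \<longrightarrow> face A m i \<cdot> x = sact A (to_point m) \<cdot> v)}"

definition bnd :: "'a \<Rightarrow> ('a, 'b) simp_obj \<Rightarrow> nat \<Rightarrow> 'b set" where
  "bnd P A n = {g. \<exists>z. normalized A (Suc n) z \<and> Dom E z = P \<and> g = face A n (Suc n) \<cdot> z}"

text \<open>Agrees with \<open>pi0_rel\<close> for n = 0 and with \<open>pi_rel\<close> for n > 0,
  so that components and higher homotopy are handled by one argument.\<close>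

definition sph_rel :: "'a \<Rightarrow> ('a, 'b) simp_obj \<Rightarrow> nat \<Rightarrow> 'b \<Rightarrow> ('b \<times> 'b) set" where
  "sph_rel P A n v = {(x, y). x \<in> sph P A n v \<and> y \<in> sph P A n v \<and>
     (\<exists>w \<in> Hom E P (sob A (Suc n)). (\<forall>i<n. face A n i \<cdot> w = sact A (to_point n) \<cdot> v) \<and>
        face A n n \<cdot> w = x \<and> face A n (Suc n) \<cdot> w = y)}"

lemma sph_simps:
  assumes "x \<in> sph P A n v"
  shows "x \<in> Arr E" "Dom E x = P" "Cod E x = sob A n"
    "\<lbrakk>n = Suc m; i \<le> n\<rbrakk> \<Longrightarrow> face A m i \<cdot> x = sact A (to_point m) \<cdot> v"
  using assms by (simp_all add: sph_def)

lemma bnd_simps: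
  assumes "A \<in> simplicial_objects E" "g \<in> bnd P A n"
  shows "g \<in> Arr E" "Dom E g = P" "Cod E g = sob A n"
  using assms by (auto simp: bnd_def normalized_def)

context
  fixes A P v
  assumes A: "A \<in> simplicial_objects E" and P: "P \<in> Obj E"
    and v: "v \<in> Arr E" "Dom E v = P" "Cod E v = sob A 0"
begin

lemma face_const: "i \<le> Suc n \<Longrightarrow> face A n i \<cdot> (sact A (to_point (Suc n)) \<cdot> v) = sact A (to_point n) \<cdot> v"
  using A v by (simp add: sact_sact to_point_Comp)

lemma degen_const: "k \<le> n \<Longrightarrow> degen A n k \<cdot> (sact A (to_point n) \<cdot> v) = sact A (to_point (Suc n)) \<cdot> v"
  using A v by (simp add: sact_sact to_point_Comp)

lemma face_top_degen:
  assumes x: "x \<in> sph P A n v" and i: "i \<le> Suc n"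
  shows "face A n i \<cdot> (degen A n n \<cdot> x) = (if i < n then sact A (to_point n) \<cdot> v else x)"
proof (cases "i < n")
  case True
  then obtain m where m: "n = Suc m" by (cases n) auto
  then show ?thesis
    using face_degen_less[OF A True, of m x] sph_simps(1-3)[OF x] sph_simps(4)[OF x m, of i] True degen_const[of m m] by simp
next
  case False
  then have "i = n \<or> i = Suc n" using i by linarith
  then show ?thesis using face_degen_id[OF A order_refl, of i n x] sph_simps(1-3)[OF x] False by simp
qed

text \<open>If w is a homotopy from x to y, then s_n x and w have the same faces below n + 1, so s_n
  x - w is normalized, and its last face is x - y. The passage is reversible.\<close>

lemma sph_rel_iff:
  "(x, y) \<in> sph_rel P A n v \<longleftrightarrow> x \<in> sph P A n v \<and> y \<in> sph P A n v \<and> (\<exists>g\<in>bnd P A n. y \<boxplus> g = x)"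
proof (cases "x \<in> sph P A n v \<and> y \<in> sph P A n v")
  case True
  then have x: "x \<in> sph P A n v" and y: "y \<in> sph P A n v" by auto
  note xs = sph_simps(1-3)[OF x] and ys = sph_simps(1-3)[OF y]
  let ?s = "degen A n n \<cdot> x" and ?c = "sact A (to_point n) \<cdot> v"
  have s: "?s \<in> Arr E" "Dom E ?s = P" "Cod E ?s = sob A (Suc n)" using xs A by simp_all
  have c: "?c \<in> Arr E" "Dom E ?c = P" "Cod E ?c = sob A n" using v A by simp_all
  note fs = face_top_degen[OF x]
  have "(\<exists>w \<in> Hom E P (sob A (Suc n)). (\<forall>i<n. face A n i \<cdot> w = ?c) \<and> face A n n \<cdot> w = x \<and> face A n (Suc n) \<cdot> w = y)
      \<longleftrightarrow> (\<exists>g\<in>bnd P A n. y \<boxplus> g = x)"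
  proof
    assume "\<exists>w \<in> Hom E P (sob A (Suc n)). (\<forall>i<n. face A n i \<cdot> w = ?c) \<and> face A n n \<cdot> w = x \<and> face A n (Suc n) \<cdot> w = y"
    then obtain w where w: "w \<in> Arr E" "Dom E w = P" "Cod E w = sob A (Suc n)"
      "\<And>i. i < n \<Longrightarrow> face A n i \<cdot> w = ?c" "face A n n \<cdot> w = x" "face A n (Suc n) \<cdot> w = y" by auto
    obtain z where z: "z \<in> Arr E" "Dom E z = P" "Cod E z = sob A (Suc n)" "z \<boxplus> w = ?s"
      using diff_ex[of ?s w] s w by auto
    have sum: "face A n i \<cdot> z \<boxplus> face A n i \<cdot> w = face A n i \<cdot> ?s" for i
      using arg_cong[OF z(4), of "\<lambda>h. face A n i \<cdot> h"] z(1-3) w(1-3) A by simp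
    have "face A n i \<cdot> z = Zero E P (sob A n)" if i: "i < Suc n" for i
    proof (cases "i < n")
      case True
      then show ?thesis using sum[of i] fs[of i] w(4)[OF True] c z(1-3) A by simp
    next
      case False
      then have "i = n" using i by simp
      then show ?thesis using sum[of n] fs[of n] w(5) xs z(1-3) A by simp
    qed
    then have nz: "normalized A (Suc n) z" using z by (simp add: normalized_def)
    have "face A n (Suc n) \<cdot> z \<boxplus> y = x" using sum[of "Suc n"] fs[of "Suc n"] w(6) by simp
    then have "y \<boxplus> face A n (Suc n) \<cdot> z = x" using Add_comm[of "face A n (Suc n) \<cdot> z" y] z(1-3) ys A by simp
    then show "\<exists>g\<in>bnd P A n. y \<boxplus> g = x" using nz z(2) by (auto simp: bnd_def)
  next
    assume "\<exists>g\<in>bnd P A n. y \<boxplus> g = x"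
    then obtain z where nz: "normalized A (Suc n) z" and z2: "Dom E z = P" and yz: "y \<boxplus> face A n (Suc n) \<cdot> z = x"
      by (auto simp: bnd_def)
    have z: "z \<in> Arr E" "Cod E z = sob A (Suc n)" "\<And>i. i < Suc n \<Longrightarrow> face A n i \<cdot> z = Zero E P (sob A n)"
      using nz z2 by (simp_all add: normalized_def)
    obtain w where w: "w \<in> Arr E" "Dom E w = P" "Cod E w = sob A (Suc n)" "w \<boxplus> z = ?s"
      using diff_ex[of ?s z] s z z2 by auto
    have sum: "face A n i \<cdot> w \<boxplus> face A n i \<cdot> z = face A n i \<cdot> ?s" for i
      using arg_cong[OF w(4), of "\<lambda>h. face A n i \<cdot> h"] z(1,2) z2 w(1-3) A by simp
    have 1: "face A n i \<cdot> w = ?c" if i: "i < n" for i using sum[of i] fs[of i] z(3)[of i] w(1-3) i A by simp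
    have 2: "face A n n \<cdot> w = x" using sum[of n] fs[of n] z(3)[of n] w(1-3) A by simp
    have "face A n (Suc n) \<cdot> w \<boxplus> face A n (Suc n) \<cdot> z = y \<boxplus> face A n (Suc n) \<cdot> z"
      using sum[of "Suc n"] fs[of "Suc n"] yz by simp
    then have 3: "face A n (Suc n) \<cdot> w = y" using w(1-3) z(1,2) z2 ys A by simp
    show "\<exists>w \<in> Hom E P (sob A (Suc n)). (\<forall>i<n. face A n i \<cdot> w = ?c) \<and> face A n n \<cdot> w = x \<and> face A n (Suc n) \<cdot> w = y"
      using w(1-3) 1 2 3 by (intro bexI[of _ w]) simp_all
  qed
  then show ?thesis using True by (simp add: sph_rel_def)
qed (auto simp: sph_rel_def)

lemma bnd_Zero: "Zero E P (sob A n) \<in> bnd P A n"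
  unfolding bnd_def using A P
  by (intro CollectI exI[of _ "Zero E P (sob A (Suc n))"]) (simp add: normalized_def)

lemma bnd_Add: "\<lbrakk>g \<in> bnd P A n; h \<in> bnd P A n\<rbrakk> \<Longrightarrow> g \<boxplus> h \<in> bnd P A n"
proof -
  assume "g \<in> bnd P A n" "h \<in> bnd P A n"
  then obtain y z where yz: "normalized A (Suc n) y" "Dom E y = P" "g = face A n (Suc n) \<cdot> y"
    "normalized A (Suc n) z" "Dom E z = P" "h = face A n (Suc n) \<cdot> z" by (auto simp: bnd_def)
  then show ?thesis
    unfolding bnd_def using A P by (intro CollectI exI[of _ "y \<boxplus> z"]) (simp add: normalized_def)
qed

lemma bnd_Neg: "g \<in> bnd P A n \<Longrightarrow> Neg E g \<in> bnd P A n"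
proof -
  assume "g \<in> bnd P A n"
  then obtain y where "normalized A (Suc n) y" "Dom E y = P" "g = face A n (Suc n) \<cdot> y" by (auto simp: bnd_def)
  then show ?thesis
    unfolding bnd_def using A P by (intro CollectI exI[of _ "Neg E y"]) (simp add: normalized_def)
qed

lemma equiv_sph_rel: "equiv (sph P A n v) (sph_rel P A n v)"
proof (rule equivI)
  show "sph_rel P A n v \<subseteq> sph P A n v \<times> sph P A n v" by (auto simp: sph_rel_def)
  show "refl_on (sph P A n v) (sph_rel P A n v)"
  proof (rule refl_onI)
    fix x assume x: "x \<in> sph P A n v"
    show "(x, x) \<in> sph_rel P A n v"
      unfolding sph_rel_iff using x bnd_Zero sph_simps(1-3)[OF x] by (intro conjI bexI[of _ "Zero E P (sob A n)"]) simp_all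
  qed
  show "sym (sph_rel P A n v)"
  proof (rule symI)
    fix x y assume "(x, y) \<in> sph_rel P A n v"
    then obtain g where xy: "x \<in> sph P A n v" "y \<in> sph P A n v" and g: "g \<in> bnd P A n" "y \<boxplus> g = x"
      unfolding sph_rel_iff by blast
    have "(y \<boxplus> g) \<boxplus> Neg E g = y"
      using sph_simps(1-3)[OF xy(2)] bnd_simps[OF A g(1)] by (simp add: Add_assoc)
    then show "(y, x) \<in> sph_rel P A n v" unfolding sph_rel_iff using xy g bnd_Neg by auto
  qed
  show "trans (sph_rel P A n v)"
  proof (rule transI)
    fix x y z assume "(x, y) \<in> sph_rel P A n v" "(y, z) \<in> sph_rel P A n v"
    then obtain g h where xy: "x \<in> sph P A n v" "y \<in> sph P A n v" "z \<in> sph P A n v"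
      and g: "g \<in> bnd P A n" "y \<boxplus> g = x" and h: "h \<in> bnd P A n" "z \<boxplus> h = y"
      unfolding sph_rel_iff by blast
    have "z \<boxplus> (h \<boxplus> g) = x"
      using sph_simps(1-3)[OF xy(3)] bnd_simps[OF A g(1)] bnd_simps[OF A h(1)] unfolding g(2)[symmetric] h(2)[symmetric]
      by (simp add: Add_assoc)
    then show "(x, z) \<in> sph_rel P A n v" unfolding sph_rel_iff using xy bnd_Add[OF h(1) g(1)] by auto
  qed
qed

text \<open>Adding the constant simplex at v moves the base vertex from 0 to v; homotopy at any
  vertex is thereby compared with homology.\<close>

lemma sph_shift:
  assumes x: "x \<in> Arr E" "Dom E x = P" "Cod E x = sob A n"
  shows "x \<boxplus> sact A (to_point n) \<cdot> v \<in> sph P A n v \<longleftrightarrow> x \<in> sph P A n (Zero E P (sob A 0))"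
proof -
  have "face A m i \<cdot> (x \<boxplus> sact A (to_point n) \<cdot> v) = sact A (to_point m) \<cdot> v \<longleftrightarrow>
      face A m i \<cdot> x = sact A (to_point m) \<cdot> Zero E P (sob A 0)" if "n = Suc m" "i \<le> n" for m i
    using that x A P v face_const[of i m] by simp
  then show ?thesis unfolding sph_def mem_Collect_eq using x v A by simp
qed

lemma const_sph: "sact A (to_point n) \<cdot> v \<in> sph P A n v"
  unfolding sph_def using A v face_const by auto

end

lemma pi_rel_eq:
  shows "pi0_rel (Hom_sset E P A) = sph_rel P A 0 v" "simps (Hom_sset E P A) 0 = sph P A 0 v"
    "spheres (Hom_sset E P A) (Suc n) v = sph P A (Suc n) v"
    "pi_rel (Hom_sset E P A) (Suc n) v = sph_rel P A (Suc n) v"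
proof -
  show 0: "simps (Hom_sset E P A) 0 = sph P A 0 v" by (auto simp: sph_def)
  show "pi0_rel (Hom_sset E P A) = sph_rel P A 0 v"
    unfolding pi0_rel_def sph_rel_def 0 by simp
  show 1: "spheres (Hom_sset E P A) (Suc n) v = sph P A (Suc n) v"
    by (auto simp: sph_def spheres_def)
  show "pi_rel (Hom_sset E P A) (Suc n) v = sph_rel P A (Suc n) v"
    unfolding pi_rel_def sph_rel_def 1 by simp
qed

text \<open>Injectivity and surjectivity on homology, in terms of simplices instead of the subobjects \<open>NA\<close>.\<close>

definition hom_iso_in_degree :: "'a \<Rightarrow> ('a, 'b) simp_map \<Rightarrow> nat \<Rightarrow> bool" where
  "hom_iso_in_degree P f n \<longleftrightarrow>
     (\<forall>x \<in> sph P (src f) n (Zero E P (sob (src f) 0)). ap f n \<cdot> x \<in> bnd P (tgt f) n \<longrightarrow> x \<in> bnd P (src f) n) \<and>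
     (\<forall>y \<in> sph P (tgt f) n (Zero E P (sob (tgt f) 0)). \<exists>x \<in> sph P (src f) n (Zero E P (sob (src f) 0)). \<exists>g \<in> bnd P (tgt f) n.
        ap f n \<cdot> x \<boxplus> g = y)"

context
  fixes f P assumes f: "f \<in> Arr (sCat E)" and P: "P \<in> Obj E"
begin

private abbreviation (input) "A \<equiv> src f"
private abbreviation (input) "B \<equiv> tgt f"
private abbreviation (input) "G \<equiv> ap f"

lemma sph_map:
  assumes v: "v \<in> Arr E" "Dom E v = P" "Cod E v = sob A 0" and x: "x \<in> sph P A n v"
  shows "G n \<cdot> x \<in> sph P B n (G 0 \<cdot> v)"
proof -
  note xs = sph_simps(1-3)[OF x]
  have "face B m i \<cdot> (G n \<cdot> x) = sact B (to_point m) \<cdot> (G 0 \<cdot> v)" if "n = Suc m" "i \<le> n" for m i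
    using simp_map_sact_elem[OF f, of "coface m i" n x] simp_map_sact_elem[OF f, of "to_point m" 0 v] xs v sph_simps(4)[OF x that] that
    by simp
  then show ?thesis using xs f by (simp add: sph_def)
qed

lemma bnd_map:
  assumes "g \<in> bnd P A n"
  shows "G n \<cdot> g \<in> bnd P B n"
proof -
  note AB = Arr_sCat_simps(1,2)[OF f]
  obtain z where z: "normalized A (Suc n) z" "Dom E z = P" "g = face A n (Suc n) \<cdot> z" using assms by (auto simp: bnd_def)
  have zt: "z \<in> Arr E" "Cod E z = sob A (Suc n)" "\<And>i. i < Suc n \<Longrightarrow> face A n i \<cdot> z = Zero E P (sob A n)"
    using z by (simp_all add: normalized_def)
  have fz: "face B n i \<cdot> (G (Suc n) \<cdot> z) = G n \<cdot> (face A n i \<cdot> z)" for i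
    using simp_map_sact_elem[OF f, of "coface n i" "Suc n" z] zt by simp
  have "normalized B (Suc n) (G (Suc n) \<cdot> z)" using zt z(2) fz f P by (simp add: normalized_def)
  then show ?thesis unfolding bnd_def using fz[of "Suc n"] zt z f by (intro CollectI exI[of _ "G (Suc n) \<cdot> z"]) simp
qed

text \<open>By \<open>sph_rel_iff\<close> both relations are translation by \<open>bnd\<close>, and
  adding the constant simplices at v and at f v identifies spheres at 0 with spheres at these
  vertices. Hence one condition in degree n serves all base vertices.\<close>

lemma bij_sph_iff:
  assumes v: "v \<in> Arr E" "Dom E v = P" "Cod E v = sob A 0"
  shows "bij_betw (\<lambda>c. sph_rel P B n (G 0 \<cdot> v) `` ((\<lambda>x. G n \<cdot> x) ` c)) (sph P A n v // sph_rel P A n v)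
      (sph P B n (G 0 \<cdot> v) // sph_rel P B n (G 0 \<cdot> v)) \<longleftrightarrow> hom_iso_in_degree P f n"
proof -
  note AB = Arr_sCat_simps(1,2)[OF f]
  let ?w = "G 0 \<cdot> v" and ?c = "sact A (to_point n) \<cdot> v" and ?d = "sact B (to_point n) \<cdot> (G 0 \<cdot> v)"
  have w: "?w \<in> Arr E" "Dom E ?w = P" "Cod E ?w = sob B 0" using v f by simp_all
  note relA = sph_rel_iff[OF AB(1) P v] and relB = sph_rel_iff[OF AB(2) P w]
  have c: "?c \<in> Arr E" "Dom E ?c = P" "Cod E ?c = sob A n" "G n \<cdot> ?c = ?d"
    using v AB simp_map_sact_elem[OF f, of "to_point n" 0 v] by simp_all
  have d: "?d \<in> Arr E" "Dom E ?d = P" "Cod E ?d = sob B n" using w AB by simp_all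
  have Ft: "G n \<in> Arr E" "Dom E (G n) = sob A n" "Cod E (G n) = sob B n" using f by simp_all
  have resp: "(G n \<cdot> x, G n \<cdot> y) \<in> sph_rel P B n ?w" if xy: "(x, y) \<in> sph_rel P A n v" for x y
  proof -
    obtain g where g: "x \<in> sph P A n v" "y \<in> sph P A n v" "g \<in> bnd P A n" "y \<boxplus> g = x" using xy unfolding relA by blast
    have "G n \<cdot> y \<boxplus> G n \<cdot> g = G n \<cdot> x"
      using g(4) sph_simps(1-3)[OF g(2)] bnd_simps[OF AB(1) g(3)] Ft by (simp flip: Comp_Add)
    then show ?thesis unfolding relB using sph_map[OF v] bnd_map g by blast
  qed
  have "(\<forall>x\<in>sph P A n v. \<forall>y\<in>sph P A n v. (G n \<cdot> x, G n \<cdot> y) \<in> sph_rel P B n ?w \<longrightarrow> (x, y) \<in> sph_rel P A n v) \<and>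
      (\<forall>y\<in>sph P B n ?w. \<exists>x\<in>sph P A n v. (G n \<cdot> x, y) \<in> sph_rel P B n ?w) \<longleftrightarrow> hom_iso_in_degree P f n"
    unfolding hom_iso_in_degree_def
  proof (intro iffI conjI ballI impI; (elim conjE)?)
    fix x assume inj: "\<forall>x\<in>sph P A n v. \<forall>y\<in>sph P A n v. (G n \<cdot> x, G n \<cdot> y) \<in> sph_rel P B n ?w \<longrightarrow> (x, y) \<in> sph_rel P A n v"
      and x: "x \<in> sph P A n (Zero E P (sob A 0))" and b: "G n \<cdot> x \<in> bnd P B n"
    note xs = sph_simps(1-3)[OF x]
    have 1: "x \<boxplus> ?c \<in> sph P A n v" "?c \<in> sph P A n v" using sph_shift[OF AB(1) P v xs] const_sph[OF AB(1) P v] x by simp_all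
    have "G n \<cdot> ?c \<boxplus> G n \<cdot> x = G n \<cdot> (x \<boxplus> ?c)"
      using Add_comm[of "G n \<cdot> ?c" "G n \<cdot> x"] xs c(1-3) Ft by simp
    then have "(G n \<cdot> (x \<boxplus> ?c), G n \<cdot> ?c) \<in> sph_rel P B n ?w" unfolding relB using 1 b sph_map[OF v] by blast
    then obtain g where g: "g \<in> bnd P A n" "?c \<boxplus> g = x \<boxplus> ?c" using inj 1 unfolding relA by blast
    then have "g = x" using Add_comm[of x ?c] xs c(1-3) bnd_simps[OF AB(1) g(1)] by simp
    then show "x \<in> bnd P A n" using g(1) by simp
  next
    fix y assume surj: "\<forall>y\<in>sph P B n ?w. \<exists>x\<in>sph P A n v. (G n \<cdot> x, y) \<in> sph_rel P B n ?w"
      and y: "y \<in> sph P B n (Zero E P (sob B 0))"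
    note ys = sph_simps(1-3)[OF y]
    have "y \<boxplus> ?d \<in> sph P B n ?w" using sph_shift[OF AB(2) P w ys] y by simp
    then obtain x g where x: "x \<in> sph P A n v" and g: "g \<in> bnd P B n" "(y \<boxplus> ?d) \<boxplus> g = G n \<cdot> x"
      using surj unfolding relB by blast
    note xs = sph_simps(1-3)[OF x] and gs = bnd_simps[OF AB(2) g(1)]
    obtain x' where x': "x' \<in> Arr E" "Dom E x' = P" "Cod E x' = sob A n" "x' \<boxplus> ?c = x"
      using diff_ex[of x ?c] xs c by auto
    have 1: "x' \<in> sph P A n (Zero E P (sob A 0))" using sph_shift[OF AB(1) P v x'(1-3)] x' x by simp
    have "?d \<boxplus> (y \<boxplus> g) = (y \<boxplus> ?d) \<boxplus> g" using ys gs d by (simp add: Add_ac)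
    also have "\<dots> = G n \<cdot> (x' \<boxplus> ?c)" using g(2) x'(4) by simp
    also have "\<dots> = ?d \<boxplus> G n \<cdot> x'" using x'(1-3) c Ft Add_comm[of "G n \<cdot> x'" ?d] d by simp
    finally have "y \<boxplus> g = G n \<cdot> x'" using ys gs d x'(1-3) Ft by simp
    then have "G n \<cdot> x' \<boxplus> Neg E g = y" using ys gs Add_assoc[of y g "Neg E g"] by (metis Add_Zero(1) Neg_simps(1,2,3,5))
    then show "\<exists>x\<in>sph P A n (Zero E P (sob A 0)). \<exists>g\<in>bnd P B n. G n \<cdot> x \<boxplus> g = y"
      using 1 bnd_Neg[OF AB(2) P w g(1)] by blast
  next
    fix x y assume inj: "\<forall>x\<in>sph P A n (Zero E P (sob A 0)). G n \<cdot> x \<in> bnd P B n \<longrightarrow> x \<in> bnd P A n"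
      and xy: "x \<in> sph P A n v" "y \<in> sph P A n v" and r: "(G n \<cdot> x, G n \<cdot> y) \<in> sph_rel P B n ?w"
    note xs = sph_simps(1-3)[OF xy(1)] and ys = sph_simps(1-3)[OF xy(2)]
    obtain g where g: "g \<in> bnd P B n" "G n \<cdot> y \<boxplus> g = G n \<cdot> x" using r unfolding relB by blast
    obtain z where z: "z \<in> Arr E" "Dom E z = P" "Cod E z = sob A n" "z \<boxplus> y = x" using diff_ex[of x y] xs ys by auto
    have "G n \<cdot> y \<boxplus> g = G n \<cdot> (z \<boxplus> y)" using g(2) z(4) by simp
    also have "\<dots> = G n \<cdot> y \<boxplus> G n \<cdot> z" using z(1-3) Add_comm[of "G n \<cdot> y" "G n \<cdot> z"] ys Ft by simp
    finally have "G n \<cdot> y \<boxplus> G n \<cdot> z = G n \<cdot> y \<boxplus> g" by simp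
    then have "G n \<cdot> z = g" using z(1-3) ys Ft bnd_simps[OF AB(2) g(1)] by simp
    moreover have "z \<in> sph P A n (Zero E P (sob A 0))"
    proof -
      have "face A m i \<cdot> z = Zero E P (sob A m)" if mi: "n = Suc m" "i \<le> n" for m i
      proof -
        have "face A m i \<cdot> (z \<boxplus> y) = face A m i \<cdot> x" using z by simp
        then show ?thesis using z(1-3) ys mi AB v sph_simps(4)[OF xy(1) mi] sph_simps(4)[OF xy(2) mi] by simp
      qed
      then show ?thesis using z(1-3) AB P by (simp add: sph_def)
    qed
    ultimately have "z \<in> bnd P A n" using inj g(1) by simp
    then show "(x, y) \<in> sph_rel P A n v" unfolding relA using xy z Add_comm[of z y] ys by auto
  next
    fix y assume surj: "\<forall>y\<in>sph P B n (Zero E P (sob B 0)). \<exists>x\<in>sph P A n (Zero E P (sob A 0)). \<exists>g\<in>bnd P B n. G n \<cdot> x \<boxplus> g = y"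
      and y: "y \<in> sph P B n ?w"
    note ys = sph_simps(1-3)[OF y]
    obtain y' where y': "y' \<in> Arr E" "Dom E y' = P" "Cod E y' = sob B n" "y' \<boxplus> ?d = y"
      using diff_ex[of y ?d] ys d by auto
    have "y' \<in> sph P B n (Zero E P (sob B 0))" using sph_shift[OF AB(2) P w y'(1-3)] y' y by simp
    then obtain x g where x: "x \<in> sph P A n (Zero E P (sob A 0))" and g: "g \<in> bnd P B n" "G n \<cdot> x \<boxplus> g = y'" using surj by blast
    note xs = sph_simps(1-3)[OF x] and gs = bnd_simps[OF AB(2) g(1)]
    have xc: "x \<boxplus> ?c \<in> sph P A n v" using sph_shift[OF AB(1) P v xs] x by simp
    let ?fx = "G n \<cdot> x"
    have fx: "?fx \<in> Arr E" "Dom E ?fx = P" "Cod E ?fx = sob B n" using xs Ft by simp_all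
    have "G n \<cdot> (x \<boxplus> ?c) = ?fx \<boxplus> ?d" using xs c Ft by simp
    also have "\<dots> = ((?fx \<boxplus> g) \<boxplus> ?d) \<boxplus> Neg E g"
    proof -
      have "((?fx \<boxplus> g) \<boxplus> ?d) \<boxplus> Neg E g = (?fx \<boxplus> ?d) \<boxplus> (g \<boxplus> Neg E g)"
        using fx gs d by (simp add: Add_ac del: Neg_simps(4,5))
      then show ?thesis using fx gs d by simp
    qed
    finally have "y \<boxplus> Neg E g = G n \<cdot> (x \<boxplus> ?c)" using g(2) y'(4) by simp
    then have "(G n \<cdot> (x \<boxplus> ?c), y) \<in> sph_rel P B n ?w"
      unfolding relB using sph_map[OF v xc] y bnd_Neg[OF AB(2) P w g(1)] by blast
    then show "\<exists>x\<in>sph P A n v. (G n \<cdot> x, y) \<in> sph_rel P B n ?w" using xc by blast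
  qed
  then show ?thesis
    using bij_betw_quotient_iff[OF equiv_sph_rel[OF AB(1) P v] equiv_sph_rel[OF AB(2) P w], where f="\<lambda>x. G n \<cdot> x"] sph_map[OF v] resp
    by simp
qed

lemma kan_weak_equivalence_iff:
  "kan_weak_equivalence (Hom_sset E P A) (Hom_sset E P B) (Hom_sset_map E f) \<longleftrightarrow> (\<forall>n. hom_iso_in_degree P f n)"
proof -
  note AB = Arr_sCat_simps(1,2)[OF f]
  have F: "Hom_sset_map E f n = (\<lambda>x. G n \<cdot> x)" for n by (simp add: Hom_sset_map_def fun_eq_iff)
  let ?z = "Zero E P (sob A 0)"
  have z: "?z \<in> Arr E" "Dom E ?z = P" "Cod E ?z = sob A 0" using AB P by simp_all
  have "bij_betw (\<lambda>c. pi0_rel (Hom_sset E P B) `` (Hom_sset_map E f 0 ` c))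
      (simps (Hom_sset E P A) 0 // pi0_rel (Hom_sset E P A)) (simps (Hom_sset E P B) 0 // pi0_rel (Hom_sset E P B))
      \<longleftrightarrow> hom_iso_in_degree P f 0"
    unfolding pi_rel_eq(2)[where v="?z" and A=A] pi_rel_eq(1)[where v="?z" and A=A]
      pi_rel_eq(1,2)[where v="G 0 \<cdot> ?z" and A=B] F by (rule bij_sph_iff[OF z])
  moreover have "bij_betw (\<lambda>c. pi_rel (Hom_sset E P B) (Suc n) (Hom_sset_map E f 0 v) `` (Hom_sset_map E f (Suc n) ` c))
          (spheres (Hom_sset E P A) (Suc n) v // pi_rel (Hom_sset E P A) (Suc n) v)
          (spheres (Hom_sset E P B) (Suc n) (Hom_sset_map E f 0 v) // pi_rel (Hom_sset E P B) (Suc n) (Hom_sset_map E f 0 v))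
      \<longleftrightarrow> hom_iso_in_degree P f (Suc n)" if "v \<in> simps (Hom_sset E P A) 0" for n v
    unfolding pi_rel_eq(3,4) F by (rule bij_sph_iff) (use that in simp_all)
  moreover have "?z \<in> simps (Hom_sset E P A) 0" using z by simp
  ultimately show ?thesis
    unfolding kan_weak_equivalence_def by (metis gr0_implies_Suc not0_implies_Suc zero_less_Suc)
qed

end

section \<open>Spheres and boundaries inside the normalized complex\<close>

lemma bnd_norm_in_iff:
  assumes A: "A \<in> simplicial_objects E" and c: "c \<in> Arr E" "Dom E c = P" "Cod E c = Dom E (norm_in E A n)"
  shows "norm_in E A n \<cdot> c \<in> bnd P A n \<longleftrightarrow>
    (\<exists>a\<in>Arr E. Dom E a = P \<and> Cod E a = Dom E (norm_in E A (Suc n)) \<and> bd (norm_chain E A) n \<cdot> a = c)"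
proof
  assume "norm_in E A n \<cdot> c \<in> bnd P A n"
  then obtain z where z: "normalized A (Suc n) z" "Dom E z = P" "norm_in E A n \<cdot> c = face A n (Suc n) \<cdot> z"
    by (auto simp: bnd_def)
  obtain u where u: "u \<in> Arr E" "Dom E u = P" "Cod E u = Dom E (norm_in E A (Suc n))" "norm_in E A (Suc n) \<cdot> u = z"
    using norm_lift[OF A z(1)] z(2) by metis
  \<comment> \<open>The sign absorbs the factor (-1)^{n+1} in the differential of N.\<close>
  let ?a = "sgn_arr E (Suc n) u"
  have a: "?a \<in> Arr E" "Dom E ?a = P" "Cod E ?a = Dom E (norm_in E A (Suc n))" using u by simp_all
  have "norm_in E A n \<cdot> (bd (norm_chain E A) n \<cdot> ?a) = sgn_arr E (Suc n) (sgn_arr E (Suc n) (face A n (Suc n) \<cdot> (norm_in E A (Suc n) \<cdot> u)))"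
    using norm_bd_elem[OF A a(1,3)] u(1-3) A by simp
  also have "\<dots> = norm_in E A n \<cdot> c" unfolding z(3) u(4) using z(1) A by (simp add: normalized_def)
  finally have "bd (norm_chain E A) n \<cdot> ?a = c"
    using norm_mono[OF A, of "bd (norm_chain E A) n \<cdot> ?a" c n] a c norm_chain_simps(2-4)[OF A, of n] by simp
  then show "\<exists>a\<in>Arr E. Dom E a = P \<and> Cod E a = Dom E (norm_in E A (Suc n)) \<and> bd (norm_chain E A) n \<cdot> a = c" using a by blast
next
  assume "\<exists>a\<in>Arr E. Dom E a = P \<and> Cod E a = Dom E (norm_in E A (Suc n)) \<and> bd (norm_chain E A) n \<cdot> a = c"
  then obtain a where a: "a \<in> Arr E" "Dom E a = P" "Cod E a = Dom E (norm_in E A (Suc n))" "bd (norm_chain E A) n \<cdot> a = c" by blast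
  have s: "sgn_arr E (Suc n) a \<in> Arr E" "Cod E (sgn_arr E (Suc n) a) = Dom E (norm_in E A (Suc n))" using a by simp_all
  have "norm_in E A n \<cdot> c = face A n (Suc n) \<cdot> (norm_in E A (Suc n) \<cdot> sgn_arr E (Suc n) a)"
    unfolding a(4)[symmetric] using norm_bd_elem[OF A a(1,3)] a A by simp
  then show "norm_in E A n \<cdot> c \<in> bnd P A n"
    unfolding bnd_def using normalized_norm_in[OF A s] a A
    by (intro CollectI exI[of _ "norm_in E A (Suc n) \<cdot> sgn_arr E (Suc n) a"]) simp
qed

lemma sph_norm_in_iff:
  assumes A: "A \<in> simplicial_objects E" and P: "P \<in> Obj E" and c: "c \<in> Arr E" "Dom E c = P" "Cod E c = Dom E (norm_in E A n)"
  shows "norm_in E A n \<cdot> c \<in> sph P A n (Zero E P (sob A 0)) \<longleftrightarrow> cycle (norm_chain E A) n P c"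
proof (cases n)
  case 0
  then show ?thesis using c A norm_chain_simps(1)[OF A, of 0] by (simp add: sph_def cycle_0)
next
  case (Suc k)
  note s = norm_chain_simps[OF A, of k]
  have "bd (norm_chain E A) k \<cdot> c = Zero E P (Dom E (norm_in E A k)) \<longleftrightarrow>
      norm_in E A k \<cdot> (bd (norm_chain E A) k \<cdot> c) = norm_in E A k \<cdot> Zero E P (Dom E (norm_in E A k))"
    using norm_mono[OF A, of "bd (norm_chain E A) k \<cdot> c" "Zero E P (Dom E (norm_in E A k))" k] c s(2-4) Suc P A by simp
  also have "\<dots> \<longleftrightarrow> face A k (Suc k) \<cdot> (norm_in E A n \<cdot> c) = Zero E P (sob A k)"
    using norm_bd_elem[OF A, of c k] c Suc P A by simp
  finally have 1: "bd (norm_chain E A) k \<cdot> c = Zero E P (Dom E (norm_in E A k)) \<longleftrightarrow>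
      face A k (Suc k) \<cdot> (norm_in E A n \<cdot> c) = Zero E P (sob A k)" .
  have "(\<forall>m i. n = Suc m \<and> i \<le> n \<longrightarrow> face A m i \<cdot> (norm_in E A n \<cdot> c) = Zero E P (sob A m)) \<longleftrightarrow>
      face A k (Suc k) \<cdot> (norm_in E A n \<cdot> c) = Zero E P (sob A k)"
    using face_norm_in[OF A, of _ k c] c Suc by (auto simp: le_Suc_eq)
  then show ?thesis
    using 1 c Suc A P norm_chain_simps(1)[OF A] by (simp add: sph_def cycle_Suc)
qed

lemma sph_normalized:
  assumes A: "A \<in> simplicial_objects E" and P: "P \<in> Obj E" and x: "x \<in> sph P A n (Zero E P (sob A 0))"
  obtains c where "cycle (norm_chain E A) n P c" "norm_in E A n \<cdot> c = x"
proof -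
  have n: "normalized A n x" using x A P by (simp add: sph_def normalized_def)
  obtain c where c: "c \<in> Arr E" "Dom E c = Dom E x" "Cod E c = Dom E (norm_in E A n)" "norm_in E A n \<cdot> c = x"
    using norm_lift[OF A n] .
  then have "cycle (norm_chain E A) n P c" using sph_norm_in_iff[OF A P, of c n] x sph_simps(2)[OF x] by simp
  then show ?thesis using that c by blast
qed

text \<open>Composition with the inclusions \<open>norm_in\<close> matches cycles with spheres at 0
  and boundaries with \<open>bnd\<close>; both conditions then speak about the same
  elements.\<close>

lemma hom_quasi_iso_norm_iff:
  assumes f: "f \<in> Arr (sCat E)" and P: "P \<in> Obj E"
  shows "hom_quasi_iso P (norm_map E f) \<longleftrightarrow> (\<forall>n. hom_iso_in_degree P f n)"
proof -
  note AB = Arr_sCat_simps(1,2)[OF f]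
  let ?A = "src f" and ?B = "tgt f"
  note obs = norm_map_simps(1,2)[OF f] norm_chain_simps(1)[OF AB(1)] norm_chain_simps(1)[OF AB(2)]
  have cycA: "c \<in> Arr E" "Dom E c = P" "Cod E c = Dom E (norm_in E ?A n)" if "cycle (norm_chain E ?A) n P c" for c n
    using cycle_simps(1-3)[OF that] obs by simp_all
  have cycB: "c \<in> Arr E" "Dom E c = P" "Cod E c = Dom E (norm_in E ?B n)" if "cycle (norm_chain E ?B) n P c" for c n
    using cycle_simps(1-3)[OF that] obs by simp_all
  have cm: "cycle (norm_chain E ?B) n P (ap (norm_map E f) n \<cdot> c)" if "cycle (norm_chain E ?A) n P c" for c n
    using cycle_map[OF norm_map_Arr[OF f], of n P c] that obs by simp
  show ?thesis
  proof
    assume q: "hom_quasi_iso P (norm_map E f)"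
    show "\<forall>n. hom_iso_in_degree P f n"
      unfolding hom_iso_in_degree_def
    proof (intro allI conjI ballI impI)
      fix n x assume x: "x \<in> sph P ?A n (Zero E P (sob ?A 0))" and b: "ap f n \<cdot> x \<in> bnd P ?B n"
      obtain c where c: "cycle (norm_chain E ?A) n P c" "norm_in E ?A n \<cdot> c = x" using sph_normalized[OF AB(1) P x] .
      have "norm_in E ?B n \<cdot> (ap (norm_map E f) n \<cdot> c) \<in> bnd P ?B n"
        using norm_map_elem[OF f, of c n] cycA[OF c(1)] c(2) b by simp
      then obtain a where a: "a \<in> Arr E" "Dom E a = P" "Cod E a = Dom E (norm_in E ?B (Suc n))"
        "bd (norm_chain E ?B) n \<cdot> a = ap (norm_map E f) n \<cdot> c"
        using bnd_norm_in_iff[OF AB(2) cycB[OF cm[OF c(1)]]] by blast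
      obtain a' where "a' \<in> Arr E" "Dom E a' = P" "Cod E a' = Dom E (norm_in E ?A (Suc n))" "bd (norm_chain E ?A) n \<cdot> a' = c"
        using hom_quasi_iso_inj[OF q, unfolded obs, OF c(1) a] by blast
      then show "x \<in> bnd P ?A n" using bnd_norm_in_iff[OF AB(1) cycA[OF c(1)]] c(2) by auto
    next
      fix n y assume y: "y \<in> sph P ?B n (Zero E P (sob ?B 0))"
      obtain d where d: "cycle (norm_chain E ?B) n P d" "norm_in E ?B n \<cdot> d = y" using sph_normalized[OF AB(2) P y] .
      obtain c b where c: "cycle (norm_chain E ?A) n P c" and b: "b \<in> Arr E" "Dom E b = P" "Cod E b = Dom E (norm_in E ?B (Suc n))"
        "ap (norm_map E f) n \<cdot> c \<boxplus> bd (norm_chain E ?B) n \<cdot> b = d"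
        using hom_quasi_iso_surj[OF q, unfolded obs, OF d(1)] by blast
      note cs = cycA[OF c] and ms = norm_map_simps(3-5)[OF f, of n] and bs = norm_chain_simps(2-4)[OF AB(2), of n]
      have "norm_in E ?B n \<cdot> (ap (norm_map E f) n \<cdot> c \<boxplus> bd (norm_chain E ?B) n \<cdot> b) = y" using b d by simp
      then have "ap f n \<cdot> (norm_in E ?A n \<cdot> c) \<boxplus> norm_in E ?B n \<cdot> (bd (norm_chain E ?B) n \<cdot> b) = y"
        using norm_map_elem[OF f, of c n] cs ms bs b(1-3) AB by simp
      moreover have "norm_in E ?B n \<cdot> (bd (norm_chain E ?B) n \<cdot> b) \<in> bnd P ?B n"
        using bnd_norm_in_iff[OF AB(2), of "bd (norm_chain E ?B) n \<cdot> b" P n] b(1-3) bs by auto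
      moreover have "norm_in E ?A n \<cdot> c \<in> sph P ?A n (Zero E P (sob ?A 0))" using sph_norm_in_iff[OF AB(1) P cs] c by simp
      ultimately show "\<exists>x\<in>sph P ?A n (Zero E P (sob ?A 0)). \<exists>g\<in>bnd P ?B n. ap f n \<cdot> x \<boxplus> g = y" by blast
    qed
  next
    assume h: "\<forall>n. hom_iso_in_degree P f n"
    show "hom_quasi_iso P (norm_map E f)"
    proof (rule hom_quasi_isoI; unfold obs)
      fix n c b assume c: "cycle (norm_chain E ?A) n P c" and b: "b \<in> Arr E" "Dom E b = P" "Cod E b = Dom E (norm_in E ?B (Suc n))"
        "bd (norm_chain E ?B) n \<cdot> b = ap (norm_map E f) n \<cdot> c"
      have "norm_in E ?B n \<cdot> (ap (norm_map E f) n \<cdot> c) \<in> bnd P ?B n"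
        using bnd_norm_in_iff[OF AB(2) cycB[OF cm[OF c]]] b by blast
      then have "ap f n \<cdot> (norm_in E ?A n \<cdot> c) \<in> bnd P ?B n" using norm_map_elem[OF f, of c n] cycA[OF c] by simp
      moreover have "norm_in E ?A n \<cdot> c \<in> sph P ?A n (Zero E P (sob ?A 0))" using sph_norm_in_iff[OF AB(1) P cycA[OF c]] c by simp
      ultimately have "norm_in E ?A n \<cdot> c \<in> bnd P ?A n" using h unfolding hom_iso_in_degree_def by blast
      then show "\<exists>a\<in>Arr E. Dom E a = P \<and> Cod E a = Dom E (norm_in E ?A (Suc n)) \<and> bd (norm_chain E ?A) n \<cdot> a = c"
        using bnd_norm_in_iff[OF AB(1) cycA[OF c]] by blast
    next
      fix n d assume d: "cycle (norm_chain E ?B) n P d"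
      have "norm_in E ?B n \<cdot> d \<in> sph P ?B n (Zero E P (sob ?B 0))" using sph_norm_in_iff[OF AB(2) P cycB[OF d]] d by simp
      then obtain x g where x: "x \<in> sph P ?A n (Zero E P (sob ?A 0))" and g: "g \<in> bnd P ?B n"
        "ap f n \<cdot> x \<boxplus> g = norm_in E ?B n \<cdot> d" using h unfolding hom_iso_in_degree_def by blast
      obtain c where c: "cycle (norm_chain E ?A) n P c" "norm_in E ?A n \<cdot> c = x" using sph_normalized[OF AB(1) P x] .
      note cs = cycA[OF c(1)] and ds = cycB[OF d] and ms = norm_map_simps(3-5)[OF f, of n] and bs = norm_chain_simps(2-4)[OF AB(2), of n]
      obtain e where e: "e \<in> Arr E" "Dom E e = P" "Cod E e = Dom E (norm_in E ?B n)" "e \<boxplus> ap (norm_map E f) n \<cdot> c = d"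
        using diff_ex[of d "ap (norm_map E f) n \<cdot> c"] cs ds ms by auto
      let ?fx = "ap f n \<cdot> x"
      have fx: "?fx \<in> Arr E" "Dom E ?fx = P" "Cod E ?fx = sob ?B n" using sph_simps(1-3)[OF x] f by simp_all
      have "?fx \<boxplus> g = norm_in E ?B n \<cdot> (e \<boxplus> ap (norm_map E f) n \<cdot> c)" using g(2) e(4) by simp
      also have "\<dots> = ?fx \<boxplus> norm_in E ?B n \<cdot> e"
        using norm_map_elem[OF f, of c n] c(2) cs ms e(1-3) AB Add_comm[of "norm_in E ?B n \<cdot> e" ?fx] fx by simp
      finally have "g = norm_in E ?B n \<cdot> e" using fx bnd_simps[OF AB(2) g(1)] e(1-3) AB by simp
      then obtain b where b: "b \<in> Arr E" "Dom E b = P" "Cod E b = Dom E (norm_in E ?B (Suc n))" "bd (norm_chain E ?B) n \<cdot> b = e"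
        using bnd_norm_in_iff[OF AB(2) e(1-3)] g(1) by blast
      have "ap (norm_map E f) n \<cdot> c \<boxplus> bd (norm_chain E ?B) n \<cdot> b = d"
        using e b(4) Add_comm[of e "ap (norm_map E f) n \<cdot> c"] cs ms by simp
      then show "\<exists>x b. cycle (norm_chain E ?A) n P x \<and> b \<in> Arr E \<and> Dom E b = P \<and> Cod E b = Dom E (norm_in E ?B (Suc n)) \<and>
        ap (norm_map E f) n \<cdot> x \<boxplus> bd (norm_chain E ?B) n \<cdot> b = d" using c(1) b by blast
    qed
  qed
qed

lemma s_weqs_iff: "f \<in> s_weqs E \<longleftrightarrow> f \<in> Arr (sCat E) \<and> norm_map E f \<in> quasi_isos E"
proof (cases "f \<in> Arr (sCat E)")
  case True
  then show ?thesis
    unfolding s_weqs_def quasi_isos_iff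
    using kan_weak_equivalence_iff[OF True] hom_quasi_iso_norm_iff[OF True] norm_map_Arr[OF True]
    unfolding projective_def by blast
qed (simp add: s_weqs_def)

section \<open>The Dold--Kan correspondence\<close>

abbreviation gpr :: "('a, 'b) chain \<Rightarrow> nat \<Rightarrow> sop \<Rightarrow> 'b" where
  "gpr C n \<equiv> dsum_pr (gamma_index n) (\<lambda>\<eta>. ob C (tgt \<eta>))"

abbreviation gid :: "('a, 'b) chain \<Rightarrow> nat \<Rightarrow> 'b" where
  "gid C n \<equiv> gamma_in E C n (Ident Simplex n)"

section \<open>The functor Gamma\<close>

lemma gamma_biproduct:
  assumes "C \<in> chain_complexes E"
  shows "is_biproduct E (gamma_index n) (\<lambda>\<eta>. ob C (tgt \<eta>)) (gamma_ob E C n) (gamma_in E C n) (gpr C n)"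
  unfolding gamma_ob_def gamma_in_def
  by (rule dsum_biproduct) (use assms finite_gamma_index in simp_all)

lemma gamma_simps [simp]:
  assumes C: "C \<in> chain_complexes E"
  shows "gamma_ob E C n \<in> Obj E"
    "\<eta> \<in> gamma_index n \<Longrightarrow> gamma_in E C n \<eta> \<in> Arr E"
    "\<eta> \<in> gamma_index n \<Longrightarrow> Dom E (gamma_in E C n \<eta>) = ob C (tgt \<eta>)"
    "\<eta> \<in> gamma_index n \<Longrightarrow> Cod E (gamma_in E C n \<eta>) = gamma_ob E C n"
    "\<eta> \<in> gamma_index n \<Longrightarrow> gpr C n \<eta> \<in> Arr E"
    "\<eta> \<in> gamma_index n \<Longrightarrow> Dom E (gpr C n \<eta>) = gamma_ob E C n"
    "\<eta> \<in> gamma_index n \<Longrightarrow> Cod E (gpr C n \<eta>) = ob C (tgt \<eta>)"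
  using biproduct_simps(2,4-9)[OF gamma_biproduct[OF C, of n]] by simp_all

lemma gid_simps [simp]:
  assumes C: "C \<in> chain_complexes E"
  shows "gid C n \<in> Arr E" "Dom E (gid C n) = ob C n" "Cod E (gid C n) = gamma_ob E C n"
  using gamma_simps(2-4)[OF C gamma_index_id, of n] by simp_all

lemma gamma_ext:
  assumes C: "C \<in> chain_complexes E" and "u \<in> Arr E" "v \<in> Arr E" "Dom E u = gamma_ob E C n" "Dom E v = gamma_ob E C n"
    "Cod E u = Cod E v" "\<And>\<eta>. \<eta> \<in> gamma_index n \<Longrightarrow> u \<cdot> gamma_in E C n \<eta> = v \<cdot> gamma_in E C n \<eta>"
  shows "u = v"
  by (rule biproduct_ext_inc[OF gamma_biproduct[OF C, of n]]) (use assms in simp_all)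

lemma gamma_copair:
  assumes C: "C \<in> chain_complexes E" and y: "y \<in> Obj E"
    and g: "\<And>\<eta>. \<eta> \<in> gamma_index n \<Longrightarrow> g \<eta> \<in> Arr E \<and> Dom E (g \<eta>) = ob C (tgt \<eta>) \<and> Cod E (g \<eta>) = y"
  obtains u where "u \<in> Arr E" "Dom E u = gamma_ob E C n" "Cod E u = y"
    "\<And>\<eta>. \<eta> \<in> gamma_index n \<Longrightarrow> u \<cdot> gamma_in E C n \<eta> = g \<eta>"
proof -
  obtain u where "u \<in> Arr E" "Dom E u = gamma_ob E C n" "Cod E u = y"
    "\<And>\<eta>. \<eta> \<in> gamma_index n \<Longrightarrow> u \<cdot> gamma_in E C n \<eta> = g \<eta>"
    unfolding gamma_ob_def gamma_in_def
    by (rule copair_ex[of "gamma_index n" g "\<lambda>\<eta>. ob C (tgt \<eta>)" y]) (use finite_gamma_index g y in simp_all)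
  then show ?thesis by (rule that)
qed

lemma gamma_coeff_zero:
  "\<lbrakk>src \<mu> \<noteq> tgt \<mu>; \<mu> \<noteq> coface (src \<mu>) (Suc (src \<mu>))\<rbrakk> \<Longrightarrow> gamma_coeff E C \<mu> = Zero E (ob C (tgt \<mu>)) (ob C (src \<mu>))"
  by (simp add: gamma_coeff_def)

lemma gamma_coeff_last: "gamma_coeff E C (coface n (Suc n)) = sgn_arr E (Suc n) (bd C n)"
  by (simp add: gamma_coeff_def)

lemma gamma_coeff_simps [simp]:
  assumes C: "C \<in> chain_complexes E"
  shows "gamma_coeff E C \<mu> \<in> Arr E" "Dom E (gamma_coeff E C \<mu>) = ob C (tgt \<mu>)"
    "Cod E (gamma_coeff E C \<mu>) = ob C (src \<mu>)"
proof -
  consider "src \<mu> = tgt \<mu>" | n where "\<mu> = coface n (Suc n)"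
    | "src \<mu> \<noteq> tgt \<mu>" "\<mu> \<noteq> coface (src \<mu>) (Suc (src \<mu>))" by blast
  then have "gamma_coeff E C \<mu> \<in> Arr E \<and> Dom E (gamma_coeff E C \<mu>) = ob C (tgt \<mu>) \<and>
      Cod E (gamma_coeff E C \<mu>) = ob C (src \<mu>)"
  proof cases
    case 1
    then show ?thesis using C by (simp add: gamma_coeff_def)
  next
    case 2
    then show ?thesis using C by (simp add: gamma_coeff_last)
  next
    case 3
    then show ?thesis using C by (simp add: gamma_coeff_zero)
  qed
  then show "gamma_coeff E C \<mu> \<in> Arr E" "Dom E (gamma_coeff E C \<mu>) = ob C (tgt \<mu>)"
    "Cod E (gamma_coeff E C \<mu>) = ob C (src \<mu>)" by blast+
qed

lemma gamma_coeff_Ident [simp]: "gamma_coeff E C (Ident Simplex n) = Ident E (ob C n)"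
  by (simp add: gamma_coeff_def)

lemma gamma_coeff_coface:
  assumes "i \<le> n"
  shows "gamma_coeff E C (coface n i) = Zero E (ob C (Suc n)) (ob C n)"
proof -
  have "ap (coface n i) n \<noteq> ap (coface n (Suc n)) n" using assms by simp
  then have "coface n i \<noteq> coface n (Suc n)" by metis
  then show ?thesis by (simp add: gamma_coeff_def)
qed

text \<open>Two proper injections lower the dimension by at least two, where the coefficient is
  zero. The product on the right could differ from zero only for two consecutive last cofaces, and
  then it is d d = 0 up to sign.\<close>

lemma gamma_coeff_Comp:
  assumes C: "C \<in> chain_complexes E" and i: "inj_sop \<mu>" "inj_sop \<mu>'" "tgt \<mu>' = src \<mu>"
  shows "gamma_coeff E C (\<mu> \<odot> \<mu>') = gamma_coeff E C \<mu>' \<cdot> gamma_coeff E C \<mu>"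
proof -
  have a: "\<mu> \<in> Arr Simplex" "\<mu>' \<in> Arr Simplex" using i by (simp_all add: inj_sop_def)
  consider "src \<mu> = tgt \<mu>" | "src \<mu>' = tgt \<mu>'" | "src \<mu> < tgt \<mu>" "src \<mu>' < tgt \<mu>'"
    using inj_sop_le[OF i(1)] inj_sop_le[OF i(2)] by linarith
  then show ?thesis
  proof cases
    case 1
    then have e: "\<mu> = Ident Simplex (tgt \<mu>)" using inj_sop_Ident[OF i(1)] by simp
    have "\<mu> \<odot> \<mu>' = \<mu>'" using Simplex.Ident_Comp_simp[of \<mu>' "tgt \<mu>"] a i(3) 1 e by simp
    moreover have "gamma_coeff E C \<mu> = Ident E (ob C (tgt \<mu>))" using 1 by (simp add: gamma_coeff_def)
    ultimately show ?thesis using C i(3) 1 by simp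
  next
    case 2
    then have e: "\<mu>' = Ident Simplex (tgt \<mu>')" using inj_sop_Ident[OF i(2)] by simp
    have "\<mu> \<odot> \<mu>' = \<mu>" using Simplex.Comp_Ident_simp[of \<mu> "tgt \<mu>'"] a i(3) e by simp
    moreover have "gamma_coeff E C \<mu>' = Ident E (ob C (tgt \<mu>'))" using 2 by (simp add: gamma_coeff_def)
    ultimately show ?thesis using C i(3) by simp
  next
    case 3
    have s: "src (\<mu> \<odot> \<mu>') = src \<mu>'" "tgt (\<mu> \<odot> \<mu>') = tgt \<mu>" by simp_all
    have "\<mu> \<odot> \<mu>' \<noteq> coface (src \<mu>') (Suc (src \<mu>'))"
    proof
      assume "\<mu> \<odot> \<mu>' = coface (src \<mu>') (Suc (src \<mu>'))"
      then have "tgt \<mu> = Suc (src \<mu>')" using s(2) coface_simps(3) by metis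
      then show False using 3 i(3) by simp
    qed
    then have L: "gamma_coeff E C (\<mu> \<odot> \<mu>') = Zero E (ob C (tgt \<mu>)) (ob C (src \<mu>'))"
      using gamma_coeff_zero[of "\<mu> \<odot> \<mu>'" C] s 3 i(3) by simp
    show ?thesis
    proof (cases "\<mu> = coface (src \<mu>) (Suc (src \<mu>)) \<and> \<mu>' = coface (src \<mu>') (Suc (src \<mu>'))")
      case True
      have m: "gamma_coeff E C \<mu> = sgn_arr E (Suc (src \<mu>)) (bd C (src \<mu>))" "tgt \<mu> = Suc (src \<mu>)"
        using True gamma_coeff_last[of C "src \<mu>"] coface_simps(3)[of "src \<mu>" "Suc (src \<mu>)"] by metis+
      have m': "gamma_coeff E C \<mu>' = sgn_arr E (Suc (src \<mu>')) (bd C (src \<mu>'))" "tgt \<mu>' = Suc (src \<mu>')"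
        using True gamma_coeff_last[of C "src \<mu>'"] coface_simps(3)[of "src \<mu>'" "Suc (src \<mu>')"] by metis+
      have "src \<mu> = Suc (src \<mu>')" using m'(2) i(3) by simp
      then show ?thesis unfolding L m(1) m'(1) using C m(2) by simp
    next
      case False
      then have "gamma_coeff E C \<mu> = Zero E (ob C (tgt \<mu>)) (ob C (src \<mu>)) \<or>
          gamma_coeff E C \<mu>' = Zero E (ob C (tgt \<mu>')) (ob C (src \<mu>'))"
        using gamma_coeff_zero[of \<mu> C] gamma_coeff_zero[of \<mu>' C] 3 by auto
      then show ?thesis
      proof
        assume z: "gamma_coeff E C \<mu> = Zero E (ob C (tgt \<mu>)) (ob C (src \<mu>))"
        show ?thesis unfolding L z using C i(3) by simp
      next
        assume z: "gamma_coeff E C \<mu>' = Zero E (ob C (tgt \<mu>')) (ob C (src \<mu>'))"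
        show ?thesis unfolding L z using C i(3) by simp
      qed
    qed
  qed
qed

lemma gamma_coeff_natural:
  assumes a: "a \<in> Arr (Ch E)"
  shows "gamma_coeff E (tgt a) \<mu> \<cdot> ap a (tgt \<mu>) = ap a (src \<mu>) \<cdot> gamma_coeff E (src a) \<mu>"
proof -
  note CD = Arr_Ch_simps(1,2)[OF a]
  have t: "tgt \<mu> = Suc (src \<mu>)" if "\<mu> = coface (src \<mu>) (Suc (src \<mu>))"
    using coface_simps(3)[of "src \<mu>" "Suc (src \<mu>)"] that by metis
  consider "src \<mu> = tgt \<mu>" | "src \<mu> \<noteq> tgt \<mu>" "\<mu> = coface (src \<mu>) (Suc (src \<mu>))"
    | "src \<mu> \<noteq> tgt \<mu>" "\<mu> \<noteq> coface (src \<mu>) (Suc (src \<mu>))" by blast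
  then show ?thesis
  proof cases
    case 1
    then show ?thesis using a CD by (simp add: gamma_coeff_def)
  next
    case 2
    have c: "gamma_coeff E X \<mu> = sgn_arr E (Suc (src \<mu>)) (bd X (src \<mu>))" for X
      using 2(2) gamma_coeff_last[of X "src \<mu>"] by metis
    show ?thesis unfolding c t[OF 2(2)] using a CD by simp
  next
    case 3
    show ?thesis unfolding gamma_coeff_zero[OF 3] using a CD by simp
  qed
qed

text \<open>Epi-mono factorization justifies the definite description: existence of (\<theta>,
  \<mu>) for each \<eta> gives a map by copairing, and uniqueness makes the prescription
  consistent.\<close>

lemma gamma_act_props:
  assumes C: "C \<in> chain_complexes E" and \<alpha>: "\<alpha> \<in> Arr Simplex"
  shows "gamma_act E C \<alpha> \<in> Arr E" "Dom E (gamma_act E C \<alpha>) = gamma_ob E C (tgt \<alpha>)"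
    "Cod E (gamma_act E C \<alpha>) = gamma_ob E C (src \<alpha>)"
    "\<lbrakk>\<eta> \<in> gamma_index (tgt \<alpha>); \<theta> \<in> gamma_index (src \<alpha>); inj_sop \<mu>; src \<mu> = tgt \<theta>; tgt \<mu> = tgt \<eta>;
      \<mu> \<odot> \<theta> = \<eta> \<odot> \<alpha>\<rbrakk> \<Longrightarrow>
      gamma_act E C \<alpha> \<cdot> gamma_in E C (tgt \<alpha>) \<eta> = gamma_in E C (src \<alpha>) \<theta> \<cdot> gamma_coeff E C \<mu>"
proof -
  let ?Q = "\<lambda>u. u \<in> Hom E (gamma_ob E C (tgt \<alpha>)) (gamma_ob E C (src \<alpha>)) \<and>
       (\<forall>\<eta> \<in> gamma_index (tgt \<alpha>). \<forall>\<theta> \<in> gamma_index (src \<alpha>). \<forall>\<mu> \<in> Hom Simplex (tgt \<theta>) (tgt \<eta>).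
          inj_sop \<mu> \<and> \<mu> \<odot> \<theta> = \<eta> \<odot> \<alpha> \<longrightarrow>
          u \<cdot> gamma_in E C (tgt \<alpha>) \<eta> = gamma_in E C (src \<alpha>) \<theta> \<cdot> gamma_coeff E C \<mu>)"
  have "\<exists>\<theta> \<mu>. \<theta> \<in> gamma_index (src \<alpha>) \<and> inj_sop \<mu> \<and> src \<mu> = tgt \<theta> \<and> tgt \<mu> = tgt \<eta> \<and> \<mu> \<odot> \<theta> = \<eta> \<odot> \<alpha>"
    if \<eta>: "\<eta> \<in> gamma_index (tgt \<alpha>)" for \<eta>
  proof -
    have "\<eta> \<odot> \<alpha> \<in> Arr Simplex" using gamma_indexD(1,2)[OF \<eta>] \<alpha> by simp
    then obtain \<theta> \<mu> where "\<theta> \<in> gamma_index (src (\<eta> \<odot> \<alpha>))" "inj_sop \<mu>" "src \<mu> = tgt \<theta>"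
      "tgt \<mu> = tgt (\<eta> \<odot> \<alpha>)" "\<mu> \<odot> \<theta> = \<eta> \<odot> \<alpha>" by (rule epi_mono_ex)
    then show ?thesis by (intro exI[of _ \<theta>] exI[of _ \<mu>]) simp
  qed
  then obtain th mu where tm: "\<And>\<eta>. \<eta> \<in> gamma_index (tgt \<alpha>) \<Longrightarrow> th \<eta> \<in> gamma_index (src \<alpha>) \<and> inj_sop (mu \<eta>) \<and>
      src (mu \<eta>) = tgt (th \<eta>) \<and> tgt (mu \<eta>) = tgt \<eta> \<and> mu \<eta> \<odot> th \<eta> = \<eta> \<odot> \<alpha>"
    by metis
  obtain u where u: "u \<in> Arr E" "Dom E u = gamma_ob E C (tgt \<alpha>)" "Cod E u = gamma_ob E C (src \<alpha>)"
    "\<And>\<eta>. \<eta> \<in> gamma_index (tgt \<alpha>) \<Longrightarrow> u \<cdot> gamma_in E C (tgt \<alpha>) \<eta> = gamma_in E C (src \<alpha>) (th \<eta>) \<cdot> gamma_coeff E C (mu \<eta>)"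
    by (rule gamma_copair[OF C, of "gamma_ob E C (src \<alpha>)" "tgt \<alpha>" "\<lambda>\<eta>. gamma_in E C (src \<alpha>) (th \<eta>) \<cdot> gamma_coeff E C (mu \<eta>)"])
      (use C tm in auto)
  have Qu: "?Q u"
  proof (intro conjI ballI impI; (elim conjE)?)
    show "u \<in> Hom E (gamma_ob E C (tgt \<alpha>)) (gamma_ob E C (src \<alpha>))" using u by simp
    fix \<eta> \<theta> \<mu> assume a: "\<eta> \<in> gamma_index (tgt \<alpha>)" "\<theta> \<in> gamma_index (src \<alpha>)" "\<mu> \<in> Hom Simplex (tgt \<theta>) (tgt \<eta>)" "inj_sop \<mu>"
      "\<mu> \<odot> \<theta> = \<eta> \<odot> \<alpha>"
    have "mu \<eta> = \<mu>" "th \<eta> = \<theta>"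
      using epi_mono_unique[of "th \<eta>" "src \<alpha>" \<theta> "mu \<eta>" \<mu>] tm[OF a(1)] a by simp_all
    then show "u \<cdot> gamma_in E C (tgt \<alpha>) \<eta> = gamma_in E C (src \<alpha>) \<theta> \<cdot> gamma_coeff E C \<mu>" using u(4)[OF a(1)] by simp
  qed
  have uniq: "v = u" if v: "?Q v" for v
  proof (rule gamma_ext[OF C, of _ _ "tgt \<alpha>"])
    fix \<eta> assume \<eta>: "\<eta> \<in> gamma_index (tgt \<alpha>)"
    have "mu \<eta> \<in> Hom Simplex (tgt (th \<eta>)) (tgt \<eta>)" using tm[OF \<eta>] by (simp add: inj_sop_def)
    then have "v \<cdot> gamma_in E C (tgt \<alpha>) \<eta> = gamma_in E C (src \<alpha>) (th \<eta>) \<cdot> gamma_coeff E C (mu \<eta>)"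
      using v tm[OF \<eta>] \<eta> by blast
    then show "v \<cdot> gamma_in E C (tgt \<alpha>) \<eta> = u \<cdot> gamma_in E C (tgt \<alpha>) \<eta>"
      unfolding u(4)[OF \<eta>] .
  qed (use v u in simp_all)
  have eq: "gamma_act E C \<alpha> = (THE u. ?Q u)"
    unfolding gamma_act_def by (rule restrict_apply'[OF \<alpha>])
  have "?Q (gamma_act E C \<alpha>)" unfolding eq by (rule theI[of ?Q, OF Qu uniq])
  then have Q1: "gamma_act E C \<alpha> \<in> Hom E (gamma_ob E C (tgt \<alpha>)) (gamma_ob E C (src \<alpha>))"
    and Q2: "\<forall>\<eta> \<in> gamma_index (tgt \<alpha>). \<forall>\<theta> \<in> gamma_index (src \<alpha>). \<forall>\<mu> \<in> Hom Simplex (tgt \<theta>) (tgt \<eta>).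
        inj_sop \<mu> \<and> \<mu> \<odot> \<theta> = \<eta> \<odot> \<alpha> \<longrightarrow>
        gamma_act E C \<alpha> \<cdot> gamma_in E C (tgt \<alpha>) \<eta> = gamma_in E C (src \<alpha>) \<theta> \<cdot> gamma_coeff E C \<mu>" by blast+
  show "gamma_act E C \<alpha> \<in> Arr E" "Dom E (gamma_act E C \<alpha>) = gamma_ob E C (tgt \<alpha>)"
    "Cod E (gamma_act E C \<alpha>) = gamma_ob E C (src \<alpha>)" using Q1 by simp_all
  show "gamma_act E C \<alpha> \<cdot> gamma_in E C (tgt \<alpha>) \<eta> = gamma_in E C (src \<alpha>) \<theta> \<cdot> gamma_coeff E C \<mu>"
    if a: "\<eta> \<in> gamma_index (tgt \<alpha>)" "\<theta> \<in> gamma_index (src \<alpha>)" "inj_sop \<mu>" "src \<mu> = tgt \<theta>" "tgt \<mu> = tgt \<eta>"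
      "\<mu> \<odot> \<theta> = \<eta> \<odot> \<alpha>"
  proof -
    have "\<mu> \<in> Hom Simplex (tgt \<theta>) (tgt \<eta>)" using a by (simp add: inj_sop_def)
    then show ?thesis using Q2 a by blast
  qed
qed

lemma gamma_act_inj:
  assumes C: "C \<in> chain_complexes E" and \<mu>: "inj_sop \<mu>" "tgt \<mu> = n"
  shows "gamma_act E C \<mu> \<cdot> gid C n = gid C (src \<mu>) \<cdot> gamma_coeff E C \<mu>"
proof -
  have a: "\<mu> \<in> Arr Simplex" using \<mu> by (simp add: inj_sop_def)
  then have "\<mu> \<odot> Ident Simplex (src \<mu>) = Ident Simplex n \<odot> \<mu>"
    using Simplex.Comp_Ident_simp[of \<mu> "src \<mu>"] Simplex.Ident_Comp_simp[of \<mu> n] \<mu> by simp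
  then show ?thesis
    using gamma_act_props(4)[OF C a, of "Ident Simplex n" "Ident Simplex (src \<mu>)" \<mu>] \<mu> gamma_index_id by simp
qed

text \<open>Every summand is a degeneracy of an identity summand, so a simplicial map out of
  \<open>gamma_obj E C\<close> is determined by its restrictions to these.\<close>

lemma gamma_act_surj:
  assumes C: "C \<in> chain_complexes E" and \<eta>: "\<eta> \<in> gamma_index n"
  shows "gamma_act E C \<eta> \<cdot> gid C (tgt \<eta>) = gamma_in E C n \<eta>"
  using gamma_act_props(4)[OF C gamma_indexD(1)[OF \<eta>], of "Ident Simplex (tgt \<eta>)" \<eta> "Ident Simplex (tgt \<eta>)"]
    \<eta> gamma_indexD(2)[OF \<eta>] gamma_index_id inj_sop_id C by simp

lemma gamma_obj_simps [simp]:
  "sob (gamma_obj E C) n = gamma_ob E C n" "sact (gamma_obj E C) \<alpha> = gamma_act E C \<alpha>"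
  by (simp_all add: gamma_obj_def)

lemma gamma_obj_simplicial:
  assumes C: "C \<in> chain_complexes E"
  shows "gamma_obj E C \<in> simplicial_objects E"
proof -
  note ga = gamma_act_props[OF C]
  have I: "gamma_act E C (Ident Simplex n) = Ident E (gamma_ob E C n)" for n
  proof (rule gamma_ext[OF C, of _ _ n])
    fix \<eta> assume \<eta>: "\<eta> \<in> gamma_index n"
    have "Ident Simplex (tgt \<eta>) \<odot> \<eta> = \<eta> \<odot> Ident Simplex n"
      using gamma_indexD(1,2)[OF \<eta>] Simplex.Comp_Ident_simp[of \<eta> n] Simplex.Ident_Comp_simp[of \<eta> "tgt \<eta>"] by simp
    then show "gamma_act E C (Ident Simplex n) \<cdot> gamma_in E C n \<eta> = Ident E (gamma_ob E C n) \<cdot> gamma_in E C n \<eta>"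
      using ga(4)[of "Ident Simplex n" \<eta> \<eta> "Ident Simplex (tgt \<eta>)"] \<eta> inj_sop_id C by simp
  qed (use ga(1-3)[of "Ident Simplex n"] C in simp_all)
  have comp: "gamma_act E C (\<beta> \<odot> \<alpha>) = gamma_act E C \<alpha> \<cdot> gamma_act E C \<beta>"
    if ab: "\<alpha> \<in> Arr Simplex" "\<beta> \<in> Arr Simplex" "tgt \<alpha> = src \<beta>" for \<alpha> \<beta>
  proof (rule gamma_ext[OF C, of _ _ "tgt \<beta>"])
    note ba = Comp_Simplex_Arr[OF ab]
    fix \<eta> assume \<eta>: "\<eta> \<in> gamma_index (tgt \<beta>)"
    note e = gamma_indexD(1,2)[OF \<eta>]
    \<comment> \<open>Factor \<eta> \<beta> as \<mu> \<theta>, then \<theta> \<alpha> as \<mu>'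
      \<theta>'. The factorization of \<eta> \<beta> \<alpha> is (\<mu> \<mu>') \<theta>', and
      \<open>gamma_coeff_Comp\<close> splits its coefficient.\<close>
    obtain \<theta> \<mu> where 1: "\<theta> \<in> gamma_index (src \<beta>)" "inj_sop \<mu>" "src \<mu> = tgt \<theta>" "tgt \<mu> = tgt \<eta>" "\<mu> \<odot> \<theta> = \<eta> \<odot> \<beta>"
      using epi_mono_ex[of "\<eta> \<odot> \<beta>"] e ab by auto
    note t = gamma_indexD(1,2)[OF 1(1)]
    obtain \<theta>' \<mu>' where 2: "\<theta>' \<in> gamma_index (src \<alpha>)" "inj_sop \<mu>'" "src \<mu>' = tgt \<theta>'" "tgt \<mu>' = tgt \<theta>" "\<mu>' \<odot> \<theta>' = \<theta> \<odot> \<alpha>"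
      using epi_mono_ex[of "\<theta> \<odot> \<alpha>"] t ab by auto
    note t' = gamma_indexD(1,2)[OF 2(1)]
    have m: "\<mu> \<in> Arr Simplex" "\<mu>' \<in> Arr Simplex" using 1(2) 2(2) by (simp_all add: inj_sop_def)
    have mm: "inj_sop (\<mu> \<odot> \<mu>')" using inj_sop_Comp[OF 2(2) 1(2)] 1 2 by simp
    have "(\<mu> \<odot> \<mu>') \<odot> \<theta>' = \<mu> \<odot> (\<theta> \<odot> \<alpha>)" using m t' 1 2 by simp
    also have "\<dots> = (\<eta> \<odot> \<beta>) \<odot> \<alpha>" unfolding 1(5)[symmetric] using m t 1(3) ab by simp
    also have "\<dots> = \<eta> \<odot> (\<beta> \<odot> \<alpha>)" using e ab by simp
    finally have "gamma_act E C (\<beta> \<odot> \<alpha>) \<cdot> gamma_in E C (tgt \<beta>) \<eta> = gamma_in E C (src \<alpha>) \<theta>' \<cdot> gamma_coeff E C (\<mu> \<odot> \<mu>')"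
      using ga(4)[OF ba, of \<eta> \<theta>' "\<mu> \<odot> \<mu>'"] \<eta> 1 2 mm by simp
    also have "\<dots> = (gamma_in E C (src \<alpha>) \<theta>' \<cdot> gamma_coeff E C \<mu>') \<cdot> gamma_coeff E C \<mu>"
      using gamma_coeff_Comp[OF C 1(2) 2(2)] 1 2 C by simp
    also have "\<dots> = (gamma_act E C \<alpha> \<cdot> gamma_in E C (src \<beta>) \<theta>) \<cdot> gamma_coeff E C \<mu>"
      using ga(4)[OF ab(1), of \<theta> \<theta>' \<mu>'] 1(1) 2 ab(3) by simp
    also have "\<dots> = gamma_act E C \<alpha> \<cdot> (gamma_act E C \<beta> \<cdot> gamma_in E C (tgt \<beta>) \<eta>)"
      using ga(4)[OF ab(2) \<eta> 1] ga(1-3)[OF ab(1)] 1(1,3) ab(3) C by simp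
    finally show "gamma_act E C (\<beta> \<odot> \<alpha>) \<cdot> gamma_in E C (tgt \<beta>) \<eta> = (gamma_act E C \<alpha> \<cdot> gamma_act E C \<beta>) \<cdot> gamma_in E C (tgt \<beta>) \<eta>"
      using ga(1-3)[OF ab(1)] ga(1-3)[OF ab(2)] ab(3) \<eta> C by simp
  qed (use ga(1-3)[OF ab(1)] ga(1-3)[OF ab(2)] ga(1-3)[OF Comp_Simplex_Arr[OF ab]] ab(3) in simp_all)
  have "sact (gamma_obj E C) \<in> extensional (Arr Simplex)" by (simp add: gamma_obj_def gamma_act_def)
  moreover have "\<forall>m n. \<forall>\<alpha> \<in> Hom Simplex m n. gamma_act E C \<alpha> \<in> Hom E (gamma_ob E C n) (gamma_ob E C m)"
    using ga(1-3) by simp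
  moreover have "\<forall>l m n. \<forall>\<alpha> \<in> Hom Simplex l m. \<forall>\<beta> \<in> Hom Simplex m n.
      gamma_act E C (\<beta> \<odot> \<alpha>) = gamma_act E C \<alpha> \<cdot> gamma_act E C \<beta>"
    using comp by simp
  ultimately show ?thesis
    unfolding simplicial_objects_def mem_Collect_eq gamma_obj_simps using gamma_simps(1)[OF C] I by blast
qed

lemma gamma_map_props:
  assumes a: "a \<in> Arr (Ch E)"
  shows "src (gamma_map E a) = gamma_obj E (src a)" "tgt (gamma_map E a) = gamma_obj E (tgt a)"
    "ap (gamma_map E a) n \<in> Arr E" "Dom E (ap (gamma_map E a) n) = gamma_ob E (src a) n"
    "Cod E (ap (gamma_map E a) n) = gamma_ob E (tgt a) n"
    "\<eta> \<in> gamma_index n \<Longrightarrow> ap (gamma_map E a) n \<cdot> gamma_in E (src a) n \<eta> =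
        gamma_in E (tgt a) n \<eta> \<cdot> ap a (tgt \<eta>)"
proof -
  note CD = Arr_Ch_simps(1,2)[OF a]
  show "src (gamma_map E a) = gamma_obj E (src a)" "tgt (gamma_map E a) = gamma_obj E (tgt a)"
    by (simp_all add: gamma_map_def)
  let ?Q = "\<lambda>u. u \<in> Hom E (gamma_ob E (src a) n) (gamma_ob E (tgt a) n) \<and>
       (\<forall>\<eta> \<in> gamma_index n. u \<cdot> gamma_in E (src a) n \<eta> = gamma_in E (tgt a) n \<eta> \<cdot> ap a (tgt \<eta>))"
  obtain u where u: "u \<in> Arr E" "Dom E u = gamma_ob E (src a) n" "Cod E u = gamma_ob E (tgt a) n"
    "\<And>\<eta>. \<eta> \<in> gamma_index n \<Longrightarrow> u \<cdot> gamma_in E (src a) n \<eta> = gamma_in E (tgt a) n \<eta> \<cdot> ap a (tgt \<eta>)"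
    by (rule gamma_copair[OF CD(1), of "gamma_ob E (tgt a) n" n "\<lambda>\<eta>. gamma_in E (tgt a) n \<eta> \<cdot> ap a (tgt \<eta>)"])
      (use CD a in auto)
  have Qu: "?Q u" using u by simp
  have uniq: "v = u" if "?Q v" for v
    by (rule gamma_ext[OF CD(1), of _ _ n]) (use that u in simp_all)
  have "?Q (ap (gamma_map E a) n)" unfolding gamma_map_def arrow.sel by (rule theI[of ?Q, OF Qu uniq])
  then show "ap (gamma_map E a) n \<in> Arr E" "Dom E (ap (gamma_map E a) n) = gamma_ob E (src a) n"
    "Cod E (ap (gamma_map E a) n) = gamma_ob E (tgt a) n"
    "\<eta> \<in> gamma_index n \<Longrightarrow> ap (gamma_map E a) n \<cdot> gamma_in E (src a) n \<eta> =
        gamma_in E (tgt a) n \<eta> \<cdot> ap a (tgt \<eta>)" by simp_all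
qed

lemma gamma_map_Arr:
  assumes a: "a \<in> Arr (Ch E)"
  shows "gamma_map E a \<in> Arr (sCat E)"
proof -
  note CD = Arr_Ch_simps(1,2)[OF a] and g = gamma_map_props[OF a]
  have "gamma_act E (tgt a) \<alpha> \<cdot> ap (gamma_map E a) (tgt \<alpha>) = ap (gamma_map E a) (src \<alpha>) \<cdot> gamma_act E (src a) \<alpha>"
    if \<alpha>: "\<alpha> \<in> Arr Simplex" for \<alpha>
  proof (rule gamma_ext[OF CD(1), of _ _ "tgt \<alpha>"])
    note ac = gamma_act_props[OF CD(1) \<alpha>] and ad = gamma_act_props[OF CD(2) \<alpha>]
    fix \<eta> assume \<eta>: "\<eta> \<in> gamma_index (tgt \<alpha>)"
    note e = gamma_indexD(1,2)[OF \<eta>]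
    obtain \<theta> \<mu> where 1: "\<theta> \<in> gamma_index (src \<alpha>)" "inj_sop \<mu>" "src \<mu> = tgt \<theta>" "tgt \<mu> = tgt \<eta>" "\<mu> \<odot> \<theta> = \<eta> \<odot> \<alpha>"
      using epi_mono_ex[of "\<eta> \<odot> \<alpha>"] e \<alpha> by auto
    have "gamma_act E (tgt a) \<alpha> \<cdot> (ap (gamma_map E a) (tgt \<alpha>) \<cdot> gamma_in E (src a) (tgt \<alpha>) \<eta>)
        = (gamma_act E (tgt a) \<alpha> \<cdot> gamma_in E (tgt a) (tgt \<alpha>) \<eta>) \<cdot> ap a (tgt \<eta>)"
      using g(6)[OF \<eta>] ad(1-3) \<eta> CD a by simp
    also have "\<dots> = gamma_in E (tgt a) (src \<alpha>) \<theta> \<cdot> (gamma_coeff E (tgt a) \<mu> \<cdot> ap a (tgt \<mu>))"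
      using ad(4)[OF \<eta> 1] 1(1,3,4) CD a by simp
    also have "\<dots> = (gamma_in E (tgt a) (src \<alpha>) \<theta> \<cdot> ap a (tgt \<theta>)) \<cdot> gamma_coeff E (src a) \<mu>"
      unfolding gamma_coeff_natural[OF a] using 1(1,3) CD a by simp
    also have "\<dots> = ap (gamma_map E a) (src \<alpha>) \<cdot> (gamma_act E (src a) \<alpha> \<cdot> gamma_in E (src a) (tgt \<alpha>) \<eta>)"
      unfolding g(6)[OF 1(1), symmetric] ac(4)[OF \<eta> 1] using g(3-5)[of "src \<alpha>"] 1(1,3) CD by simp
    finally show "(gamma_act E (tgt a) \<alpha> \<cdot> ap (gamma_map E a) (tgt \<alpha>)) \<cdot> gamma_in E (src a) (tgt \<alpha>) \<eta>
        = (ap (gamma_map E a) (src \<alpha>) \<cdot> gamma_act E (src a) \<alpha>) \<cdot> gamma_in E (src a) (tgt \<alpha>) \<eta>"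
      using g(3-5)[of "src \<alpha>"] g(3-5)[of "tgt \<alpha>"] ac(1-3) ad(1-3) \<eta> CD by simp
  qed (use g(3-5)[of "src \<alpha>"] g(3-5)[of "tgt \<alpha>"] gamma_act_props(1-3)[OF CD(1) \<alpha>] gamma_act_props(1-3)[OF CD(2) \<alpha>] in simp_all)
  then show ?thesis
    unfolding Arr_sCat_iff g(1,2) gamma_obj_simps using g(3-5) gamma_obj_simplicial CD by blast
qed

lemma is_functor_Gamma: "is_functor (Ch E) (sCat E) (DK_Gamma E)"
proof -
  interpret Ch: category "Ch E" by (rule category_Ch)
  have id: "gamma_map E (Ident (Ch E) C) = Ident (sCat E) (gamma_obj E C)" if C: "C \<in> chain_complexes E" for C
  proof (rule arrow_eqI)
    have I: "Ident (Ch E) C \<in> Arr (Ch E)" using C by simp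
    note g = gamma_map_props[OF I, unfolded Ident_Ch]
    show "ap (gamma_map E (Ident (Ch E) C)) n = ap (Ident (sCat E) (gamma_obj E C)) n" for n
      by (rule gamma_ext[OF C, of _ _ n]) (use g(3-5)[of n] g(6) C in simp_all)
  qed (simp_all add: gamma_map_def)
  have comp: "gamma_map E (b \<cdot>\<^bsub>Ch E\<^esub> a) = gamma_map E b \<cdot>\<^bsub>sCat E\<^esub> gamma_map E a"
    if a: "a \<in> Arr (Ch E)" and b: "b \<in> Arr (Ch E)" and ab: "tgt a = src b" for a b
  proof (rule arrow_eqI)
    have ba: "b \<cdot>\<^bsub>Ch E\<^esub> a \<in> Arr (Ch E)" using Ch.Comp_simps(1)[of a b] a b ab by simp
    note g = gamma_map_props[OF a, unfolded ab] and h = gamma_map_props[OF b] and gh = gamma_map_props[OF ba, unfolded Comp_Ch]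
    note as = Arr_Ch_simps(1-5)[OF a, unfolded ab] and bs = Arr_Ch_simps(1-5)[OF b]
    show "ap (gamma_map E (b \<cdot>\<^bsub>Ch E\<^esub> a)) n = ap (gamma_map E b \<cdot>\<^bsub>sCat E\<^esub> gamma_map E a) n" for n
    proof (rule gamma_ext[OF as(1), of _ _ n])
      fix \<eta> assume \<eta>: "\<eta> \<in> gamma_index n"
      show "ap (gamma_map E (b \<cdot>\<^bsub>Ch E\<^esub> a)) n \<cdot> gamma_in E (src a) n \<eta>
          = ap (gamma_map E b \<cdot>\<^bsub>sCat E\<^esub> gamma_map E a) n \<cdot> gamma_in E (src a) n \<eta>"
        using gh(6)[OF \<eta>] g(6)[OF \<eta>] reassoc[OF h(6)[OF \<eta>], of "ap a (tgt \<eta>)"] g(3-5)[of n] h(3-5)[of n]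
          as(1,2) as(3-5)[of "tgt \<eta>"] bs(1,2) bs(3-5)[of "tgt \<eta>"] \<eta> by simp
    qed (use g(3-5)[of n] h(3-5)[of n] gh(3-5)[of n] in simp_all)
  qed (simp_all add: gamma_map_def)
  show ?thesis
    unfolding is_functor_def DK_Gamma_def cfunctor.simps sCat_simps Ch_simps
    using gamma_obj_simplicial gamma_map_Arr gamma_map_props(1,2) id comp by simp
qed

lemma gid_normalized:
  assumes C: "C \<in> chain_complexes E" and u: "u \<in> Arr E" "Cod E u = ob C n"
  shows "normalized (gamma_obj E C) n (gid C n \<cdot> u)"
  unfolding normalized_def
proof (intro conjI allI impI)
  fix m i assume mi: "n = Suc m \<and> i < n"
  have "gamma_act E C (coface m i) \<cdot> gid C n = Zero E (ob C n) (gamma_ob E C m)"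
    using gamma_act_inj[OF C inj_sop_coface[of m i], of n] gamma_coeff_coface[of i m C] mi C by simp
  then show "face (gamma_obj E C) m i \<cdot> (gid C n \<cdot> u) = Zero E (Dom E (gid C n \<cdot> u)) (sob (gamma_obj E C) m)"
    using reassoc[of "gamma_act E C (coface m i)" "gid C n" _ u] gamma_act_props(1-3)[OF C, of "coface m i"] mi u C by simp
qed (use u C in simp_all)

lemma normalized_simp_map:
  assumes f: "f \<in> Arr (sCat E)" and x: "normalized (src f) n x"
  shows "normalized (tgt f) n (ap f n \<cdot> x)"
proof -
  have xt: "x \<in> Arr E" "Cod E x = sob (src f) n" using x by (simp_all add: normalized_def)
  show ?thesis
    unfolding normalized_def
  proof (intro conjI allI impI)
    fix m i assume mi: "n = Suc m \<and> i < n"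
    then have "face (src f) m i \<cdot> x = Zero E (Dom E x) (sob (src f) m)" using x by (simp add: normalized_def)
    then show "face (tgt f) m i \<cdot> (ap f n \<cdot> x) = Zero E (Dom E (ap f n \<cdot> x)) (sob (tgt f) m)"
      using simp_map_sact_elem[OF f, of "coface m i" n x] mi xt f Arr_sCat_simps(1,2)[OF f] by simp
  qed (use xt f in simp_all)
qed

lemma simp_map_gamma_in:
  assumes C: "C \<in> chain_complexes E" and f: "f \<in> Arr (sCat E)" "src f = gamma_obj E C" and \<eta>: "\<eta> \<in> gamma_index n"
  shows "ap f n \<cdot> gamma_in E C n \<eta> = sact (tgt f) \<eta> \<cdot> (ap f (tgt \<eta>) \<cdot> gid C (tgt \<eta>))"
  using simp_map_sact_elem[OF f(1) gamma_indexD(1)[OF \<eta>], of "tgt \<eta>" "gid C (tgt \<eta>)"] gamma_indexD(2)[OF \<eta>]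
    gamma_act_surj[OF C \<eta>] f C by simp

subsection \<open>The adjunction\<close>

text \<open>Restriction to the identity summands; these are normalized in
  \<open>gamma_obj E C\<close>, so the restriction factors through NB.\<close>

definition transpose_map :: "('a, 'b) chain \<Rightarrow> ('a, 'b) simp_obj \<Rightarrow> ('a, 'b) simp_map \<Rightarrow> ('a, 'b) chain_map" where
  "transpose_map C B f = Arrow C
     (\<lambda>n. THE u. u \<in> Hom E (ob C n) (Dom E (norm_in E B n)) \<and> norm_in E B n \<cdot> u = ap f n \<cdot> gid C n)
     (norm_chain E B)"

lemma transpose_simps:
  assumes C: "C \<in> chain_complexes E" and f: "f \<in> Arr (sCat E)" "src f = gamma_obj E C" "tgt f = B"
  shows "src (transpose_map C B f) = C" "tgt (transpose_map C B f) = norm_chain E B"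
    "ap (transpose_map C B f) n \<in> Arr E" "Dom E (ap (transpose_map C B f) n) = ob C n"
    "Cod E (ap (transpose_map C B f) n) = Dom E (norm_in E B n)"
    "norm_in E B n \<cdot> ap (transpose_map C B f) n = ap f n \<cdot> gid C n"
proof -
  note fs = Arr_sCat_simps[OF f(1), unfolded f(2,3) gamma_obj_simps]
  show "src (transpose_map C B f) = C" "tgt (transpose_map C B f) = norm_chain E B"
    by (simp_all add: transpose_map_def)
  let ?Q = "\<lambda>u. u \<in> Hom E (ob C n) (Dom E (norm_in E B n)) \<and> norm_in E B n \<cdot> u = ap f n \<cdot> gid C n"
  have "normalized (gamma_obj E C) n (gid C n)"
    using gid_normalized[OF C, of "Ident E (ob C n)" n] C by simp
  then have "normalized B n (ap f n \<cdot> gid C n)"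
    using normalized_simp_map[OF f(1), of n "gid C n"] f by simp
  then obtain u where "u \<in> Arr E" "Dom E u = Dom E (ap f n \<cdot> gid C n)"
    "Cod E u = Dom E (norm_in E B n)" "norm_in E B n \<cdot> u = ap f n \<cdot> gid C n"
    by (rule norm_lift[OF fs(2)])
  then have Qu: "?Q u" using C fs(3-5)[of n] by simp
  have uniq: "v = u" if "?Q v" for v
    using norm_mono[OF fs(2), of v u n] that Qu by simp
  have "?Q (ap (transpose_map C B f) n)"
    unfolding transpose_map_def arrow.sel by (rule theI[of ?Q, OF Qu uniq])
  then show "ap (transpose_map C B f) n \<in> Arr E" "Dom E (ap (transpose_map C B f) n) = ob C n"
    "Cod E (ap (transpose_map C B f) n) = Dom E (norm_in E B n)"
    "norm_in E B n \<cdot> ap (transpose_map C B f) n = ap f n \<cdot> gid C n"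
    by simp_all
qed

text \<open>The last face acts on the identity summand as (-1)^{n+1} d, and this sign cancels the
  one in the differential of N.\<close>

lemma transpose_Arr:
  assumes C: "C \<in> chain_complexes E" and f: "f \<in> Arr (sCat E)" "src f = gamma_obj E C" "tgt f = B"
  shows "transpose_map C B f \<in> Arr (Ch E)"
proof -
  let ?t = "ap (transpose_map C B f)"
  note fs = Arr_sCat_simps[OF f(1), unfolded f(2,3) gamma_obj_simps]
  note t = transpose_simps[OF C f]
  note B = norm_chain_simps[OF fs(2)]
  have "bd (norm_chain E B) n \<cdot> ?t (Suc n) = ?t n \<cdot> bd C n" for n
  proof -
    have "gamma_act E C (coface n (Suc n)) \<cdot> gid C (Suc n) = gid C n \<cdot> sgn_arr E (Suc n) (bd C n)"
      using gamma_act_inj[OF C inj_sop_coface[of n "Suc n"], of "Suc n"] gamma_coeff_last[of C n] by simp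
    then have "face B n (Suc n) \<cdot> (ap f (Suc n) \<cdot> gid C (Suc n))
        = ap f n \<cdot> (gid C n \<cdot> sgn_arr E (Suc n) (bd C n))"
      using simp_map_sact_elem[OF f(1), of "coface n (Suc n)" "Suc n" "gid C (Suc n)"] f C by simp
    also have "\<dots> = sgn_arr E (Suc n) (norm_in E B n \<cdot> (?t n \<cdot> bd C n))"
      using reassoc[OF t(6)[of n], of "bd C n"] t(3-5)[of n] fs(2) fs(3-5)[of n] C by simp
    finally have "norm_in E B n \<cdot> (bd (norm_chain E B) n \<cdot> ?t (Suc n)) = norm_in E B n \<cdot> (?t n \<cdot> bd C n)"
      using norm_bd_elem[OF fs(2), of "?t (Suc n)" n] t(3-6)[of "Suc n"] t(3-5)[of n] fs(2) C by simp
    then show ?thesis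
      using norm_mono[OF fs(2), of "bd (norm_chain E B) n \<cdot> ?t (Suc n)" "?t n \<cdot> bd C n" n]
        t(3-5)[of n] t(3-5)[of "Suc n"] B(2-4)[of n] C by simp
  qed
  then show ?thesis
    unfolding Arr_Ch_iff t(1,2) B(1) using t(3-5) C norm_chain_complex[OF fs(2)] by blast
qed

lemma transpose_inj:
  assumes C: "C \<in> chain_complexes E" and f: "f \<in> Arr (sCat E)" "src f = gamma_obj E C" "tgt f = B"
    and g: "g \<in> Arr (sCat E)" "src g = gamma_obj E C" "tgt g = B"
    and e: "transpose_map C B f = transpose_map C B g"
  shows "f = g"
proof (rule arrow_eqI)
  have gi: "ap f p \<cdot> gid C p = ap g p \<cdot> gid C p" for p
    using transpose_simps(6)[OF C f, of p] transpose_simps(6)[OF C g, of p] e by metis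
  show "ap f n = ap g n" for n
  proof (rule gamma_ext[OF C])
    fix \<eta> assume \<eta>: "\<eta> \<in> gamma_index n"
    show "ap f n \<cdot> gamma_in E C n \<eta> = ap g n \<cdot> gamma_in E C n \<eta>"
      unfolding simp_map_gamma_in[OF C f(1,2) \<eta>] simp_map_gamma_in[OF C g(1,2) \<eta>] f(3) g(3) gi ..
  qed (use f g in simp_all)
qed (use f g in simp_all)

text \<open>The origin of \<open>gamma_coeff\<close>: on normalized elements the last coface acts as
  the signed differential, and every other proper injection acts through some d_i with i \<le> p
  applied first, which annihilates them.\<close>

lemma norm_coeff:
  assumes B: "B \<in> simplicial_objects E" and g: "g \<in> Arr (Ch E)" "tgt g = norm_chain E B" and \<mu>: "inj_sop \<mu>"
  shows "sact B \<mu> \<cdot> (norm_in E B (tgt \<mu>) \<cdot> ap g (tgt \<mu>))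
    = (norm_in E B (src \<mu>) \<cdot> ap g (src \<mu>)) \<cdot> gamma_coeff E (src g) \<mu>"
proof -
  note gs = Arr_Ch_simps[OF g(1), unfolded g(2) norm_chain_simps(1)[OF B]] and Bs = norm_chain_simps[OF B]
  have a: "\<mu> \<in> Arr Simplex" using \<mu> by (simp add: inj_sop_def)
  consider "src \<mu> = tgt \<mu>" | n where "\<mu> = coface n (Suc n)"
    | "src \<mu> < tgt \<mu>" "\<mu> \<noteq> coface (src \<mu>) (Suc (src \<mu>))" using inj_sop_le[OF \<mu>] by fastforce
  then show ?thesis
  proof cases
    case 1
    have i: "\<mu> = Ident Simplex (tgt \<mu>)" by (rule inj_sop_Ident[OF \<mu> 1])
    have "sact B \<mu> = Ident E (sob B (tgt \<mu>))" using sact_simps(5)[OF B, of "tgt \<mu>"] i by metis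
    moreover have "gamma_coeff E (src g) \<mu> = Ident E (ob (src g) (tgt \<mu>))" using 1 by (simp add: gamma_coeff_def)
    ultimately show ?thesis using 1 gs(1) gs(3-5)[of "tgt \<mu>"] B by simp
  next
    case 2
    have s: "src \<mu> = n" "tgt \<mu> = Suc n" unfolding 2 by simp_all
    have "norm_in E B n \<cdot> (bd (norm_chain E B) n \<cdot> ap g (Suc n))
        = sgn_arr E (Suc n) (face B n (Suc n) \<cdot> (norm_in E B (Suc n) \<cdot> ap g (Suc n)))"
      using norm_bd_elem[OF B, of "ap g (Suc n)" n] gs(3-5)[of "Suc n"] by simp
    then have "face B n (Suc n) \<cdot> (norm_in E B (Suc n) \<cdot> ap g (Suc n))
        = sgn_arr E (Suc n) (norm_in E B n \<cdot> (ap g n \<cdot> bd (src g) n))"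
      using sgn_arr_simps(4)[of "face B n (Suc n) \<cdot> (norm_in E B (Suc n) \<cdot> ap g (Suc n))" "Suc n"]
        gs(3-5)[of "Suc n"] gs(6)[of n] B by simp
    then show ?thesis
      unfolding s unfolding 2 gamma_coeff_last using gs(1) gs(3-5)[of n] gs(3-5)[of "Suc n"] B by simp
  next
    case 3
    obtain p i h where h: "tgt \<mu> = Suc p" "i \<le> p" "h \<in> Arr Simplex" "src h = src \<mu>" "tgt h = p" "\<mu> = coface p i \<odot> h"
      using inj_sop_cases[OF \<mu> 3(1)] 3(2) by blast
    have "sact B \<mu> = sact B h \<cdot> face B p i" using sact_Comp[OF B, of h "coface p i"] h(3,5,6) by simp
    moreover have "face B p i \<cdot> (norm_in E B (Suc p) \<cdot> ap g (Suc p)) = Zero E (ob (src g) (Suc p)) (sob B p)"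
      using face_norm_in[OF B h(2), of "ap g (Suc p)"] gs(3-5)[of "Suc p"] by simp
    ultimately have L: "sact B \<mu> \<cdot> (norm_in E B (tgt \<mu>) \<cdot> ap g (tgt \<mu>)) = Zero E (ob (src g) (tgt \<mu>)) (sob B (src \<mu>))"
      unfolding h(1) using h(3,4,5) gs(1) gs(3-5)[of "Suc p"] B by simp
    have "gamma_coeff E (src g) \<mu> = Zero E (ob (src g) (tgt \<mu>)) (ob (src g) (src \<mu>))"
      using gamma_coeff_zero[of \<mu> "src g"] 3 by simp
    then show ?thesis unfolding L using gs(1) gs(3-5)[of "src \<mu>"] B by simp
  qed
qed

text \<open>On the summand of \<eta> the map must be the degeneracy along \<eta> of the given
  element of NB. Compatibility with \<alpha> follows by factoring \<eta> \<alpha> and applying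
  \<open>norm_coeff\<close> to the injective part.\<close>

lemma transpose_surj:
  assumes B: "B \<in> simplicial_objects E" and g: "g \<in> Arr (Ch E)" "tgt g = norm_chain E B" and C: "src g = C"
  obtains f where "f \<in> Arr (sCat E)" "src f = gamma_obj E C" "tgt f = B" "transpose_map C B f = g"
proof -
  note gs = Arr_Ch_simps[OF g(1), unfolded g(2) norm_chain_simps(1)[OF B] C]
  let ?i = "\<lambda>p. norm_in E B p \<cdot> ap g p"
  have i: "?i p \<in> Arr E" "Dom E (?i p) = ob C p" "Cod E (?i p) = sob B p" for p using gs(3-5)[of p] B by simp_all
  have "\<exists>u. u \<in> Arr E \<and> Dom E u = gamma_ob E C n \<and> Cod E u = sob B n \<and>
      (\<forall>\<eta>\<in>gamma_index n. u \<cdot> gamma_in E C n \<eta> = sact B \<eta> \<cdot> ?i (tgt \<eta>))" for n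
  proof -
    obtain u where "u \<in> Arr E" "Dom E u = gamma_ob E C n" "Cod E u = sob B n"
      "\<And>\<eta>. \<eta> \<in> gamma_index n \<Longrightarrow> u \<cdot> gamma_in E C n \<eta> = sact B \<eta> \<cdot> ?i (tgt \<eta>)"
      by (rule gamma_copair[OF gs(1), of "sob B n" n "\<lambda>\<eta>. sact B \<eta> \<cdot> ?i (tgt \<eta>)"])
        (use B i gamma_indexD(1,2) in simp_all)
    then show ?thesis by blast
  qed
  then obtain F where F: "\<And>n. F n \<in> Arr E" "\<And>n. Dom E (F n) = gamma_ob E C n" "\<And>n. Cod E (F n) = sob B n"
    "\<And>n \<eta>. \<eta> \<in> gamma_index n \<Longrightarrow> F n \<cdot> gamma_in E C n \<eta> = sact B \<eta> \<cdot> ?i (tgt \<eta>)"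
    by metis
  have nat: "sact B \<alpha> \<cdot> F (tgt \<alpha>) = F (src \<alpha>) \<cdot> gamma_act E C \<alpha>" if \<alpha>: "\<alpha> \<in> Arr Simplex" for \<alpha>
  proof (rule gamma_ext[OF gs(1), of _ _ "tgt \<alpha>"])
    note ac = gamma_act_props[OF gs(1) \<alpha>]
    fix \<eta> assume \<eta>: "\<eta> \<in> gamma_index (tgt \<alpha>)"
    note e = gamma_indexD(1,2)[OF \<eta>]
    obtain \<theta> \<mu> where 1: "\<theta> \<in> gamma_index (src \<alpha>)" "inj_sop \<mu>" "src \<mu> = tgt \<theta>" "tgt \<mu> = tgt \<eta>" "\<mu> \<odot> \<theta> = \<eta> \<odot> \<alpha>"
      using epi_mono_ex[of "\<eta> \<odot> \<alpha>"] e \<alpha> by auto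
    note t = gamma_indexD(1,2)[OF 1(1)]
    have m: "\<mu> \<in> Arr Simplex" using 1(2) by (simp add: inj_sop_def)
    have "sact B \<alpha> \<cdot> (F (tgt \<alpha>) \<cdot> gamma_in E C (tgt \<alpha>) \<eta>) = sact B (\<eta> \<odot> \<alpha>) \<cdot> ?i (tgt \<eta>)"
      unfolding F(4)[OF \<eta>] by (rule sact_sact[OF B \<alpha> e(1)]) (use e(2) i in simp_all)
    also have "\<dots> = sact B \<theta> \<cdot> (sact B \<mu> \<cdot> ?i (tgt \<eta>))"
      unfolding 1(5)[symmetric] by (rule sact_sact[OF B t(1) m, symmetric]) (use 1(3,4) i in simp_all)
    also have "\<dots> = sact B \<theta> \<cdot> (?i (tgt \<theta>) \<cdot> gamma_coeff E C \<mu>)"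
      using norm_coeff[OF B g 1(2)] unfolding 1(3,4) C by simp
    also have "\<dots> = (F (src \<alpha>) \<cdot> gamma_in E C (src \<alpha>) \<theta>) \<cdot> gamma_coeff E C \<mu>"
      unfolding F(4)[OF 1(1)] using i[of "tgt \<theta>"] t 1(3) gs(1) B gs(3-5)[of "tgt \<theta>"] by simp
    also have "\<dots> = F (src \<alpha>) \<cdot> (gamma_act E C \<alpha> \<cdot> gamma_in E C (tgt \<alpha>) \<eta>)"
      unfolding ac(4)[OF \<eta> 1] using F(1-3) 1(1,3) gs(1) by simp
    finally show "(sact B \<alpha> \<cdot> F (tgt \<alpha>)) \<cdot> gamma_in E C (tgt \<alpha>) \<eta> = (F (src \<alpha>) \<cdot> gamma_act E C \<alpha>) \<cdot> gamma_in E C (tgt \<alpha>) \<eta>"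
      using F(1-3) ac(1-3) \<eta> \<alpha> gs(1) B by simp
  qed (use F(1-3) gamma_act_props(1-3)[OF gs(1) \<alpha>] \<alpha> B in simp_all)
  let ?f = "Arrow (gamma_obj E C) F B"
  have f: "?f \<in> Arr (sCat E)"
    unfolding Arr_sCat_iff arrow.sel gamma_obj_simps using F(1-3) nat gamma_obj_simplicial[OF gs(1)] B by blast
  have f': "src ?f = gamma_obj E C" "tgt ?f = B" by simp_all
  note t = transpose_simps[OF gs(1) f f']
  have "transpose_map C B ?f = g"
  proof (rule arrow_eqI)
    fix n
    have "norm_in E B n \<cdot> ap (transpose_map C B ?f) n = norm_in E B n \<cdot> ap g n"
      using t(6)[of n] F(4)[OF gamma_index_id, of n] i[of n] B by simp
    then show "ap (transpose_map C B ?f) n = ap g n"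
      using norm_mono[OF B, of "ap (transpose_map C B ?f) n" "ap g n" n] t(3-5)[of n] gs(3-5)[of n] by simp
  qed (use t(1,2) g C in simp_all)
  then show ?thesis by (rule that[OF f f'])
qed

lemma transpose_natural:
  assumes a: "a \<in> Arr (Ch E)" and f: "f \<in> Arr (sCat E)" "src f = gamma_obj E (tgt a)"
    and b: "b \<in> Arr (sCat E)" "tgt f = src b"
  shows "transpose_map (src a) (tgt b) (b \<cdot>\<^bsub>sCat E\<^esub> (f \<cdot>\<^bsub>sCat E\<^esub> gamma_map E a))
    = norm_map E b \<cdot>\<^bsub>Ch E\<^esub> (transpose_map (tgt a) (src b) f \<cdot>\<^bsub>Ch E\<^esub> a)"
proof (rule arrow_eqI)
  interpret S: category "sCat E" by (rule category_sCat)
  let ?h = "b \<cdot>\<^bsub>sCat E\<^esub> (f \<cdot>\<^bsub>sCat E\<^esub> gamma_map E a)"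
  note g = gamma_map_props[OF a] and as = Arr_Ch_simps[OF a] and bs = Arr_sCat_simps[OF b(1)] and m = norm_map_simps[OF b(1)]
  note fs = Arr_sCat_simps[OF f(1), unfolded f(2) b(2) gamma_obj_simps]
  have h: "?h \<in> Arr (sCat E)" using gamma_map_Arr[OF a] g(2) f b by simp
  have h': "src ?h = gamma_obj E (src a)" "tgt ?h = tgt b" using g(1) by simp_all
  note t = transpose_simps[OF as(1) h h'] and u = transpose_simps[OF as(2) f b(2)]
  show "ap (transpose_map (src a) (tgt b) ?h) n
      = ap (norm_map E b \<cdot>\<^bsub>Ch E\<^esub> (transpose_map (tgt a) (src b) f \<cdot>\<^bsub>Ch E\<^esub> a)) n" for n
  proof -
    let ?u = "ap (transpose_map (tgt a) (src b) f) n"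
    have "norm_in E (tgt b) n \<cdot> (ap (norm_map E b) n \<cdot> (?u \<cdot> ap a n))
        = ap b n \<cdot> (norm_in E (src b) n \<cdot> (?u \<cdot> ap a n))"
      using norm_map_elem[OF b(1), of "?u \<cdot> ap a n" n] u(3-5)[of n] as(3-5)[of n] by simp
    also have "\<dots> = ap b n \<cdot> (ap f n \<cdot> (gid (tgt a) n \<cdot> ap a n))"
      using reassoc[OF u(6)[of n], of "ap a n"] u(3-5)[of n] as(3-5)[of n] as(2) fs(3-5)[of n] bs(1) by simp
    also have "gid (tgt a) n \<cdot> ap a n = ap (gamma_map E a) n \<cdot> gid (src a) n"
      using g(6)[OF gamma_index_id, of n] by simp
    finally have "norm_in E (tgt b) n \<cdot> (ap (norm_map E b) n \<cdot> (?u \<cdot> ap a n))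
        = norm_in E (tgt b) n \<cdot> ap (transpose_map (src a) (tgt b) ?h) n"
      unfolding t(6) using g(3-5)[of n] fs(3-5)[of n] bs(3-5)[of n] as(1) by simp
    then show ?thesis
      using norm_mono[OF bs(2), of "ap (norm_map E b) n \<cdot> (?u \<cdot> ap a n)"
          "ap (transpose_map (src a) (tgt b) ?h) n" n] u(3-5)[of n] as(3-5)[of n] m(3-5)[of n] t(3-5)[of n] by simp
  qed
qed (simp_all add: transpose_map_def norm_map_def)

lemma is_adjunction_DK: "is_adjunction (Ch E) (sCat E) (DK_Gamma E) (DK_N E) transpose_map"
proof -
  have "bij_betw (transpose_map C B) (Hom (sCat E) (gamma_obj E C) B) (Hom (Ch E) C (norm_chain E B))"
    if C: "C \<in> chain_complexes E" and B: "B \<in> simplicial_objects E" for C B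
    unfolding bij_betw_def
  proof (intro conjI)
    show "inj_on (transpose_map C B) (Hom (sCat E) (gamma_obj E C) B)"
      by (rule inj_onI) (use transpose_inj[OF C] in simp)
    show "transpose_map C B ` Hom (sCat E) (gamma_obj E C) B = Hom (Ch E) C (norm_chain E B)"
    proof
      show "transpose_map C B ` Hom (sCat E) (gamma_obj E C) B \<subseteq> Hom (Ch E) C (norm_chain E B)"
        using transpose_Arr[OF C] by (auto simp: transpose_map_def)
      show "Hom (Ch E) C (norm_chain E B) \<subseteq> transpose_map C B ` Hom (sCat E) (gamma_obj E C) B"
      proof
        fix g assume "g \<in> Hom (Ch E) C (norm_chain E B)"
        then have g: "g \<in> Arr (Ch E)" "tgt g = norm_chain E B" "src g = C" by simp_all
        obtain f where "f \<in> Arr (sCat E)" "src f = gamma_obj E C" "tgt f = B" "transpose_map C B f = g"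
          by (rule transpose_surj[OF B g])
        then show "g \<in> transpose_map C B ` Hom (sCat E) (gamma_obj E C) B" by force
      qed
    qed
  qed
  moreover have "transpose_map x' y' ((b \<cdot>\<^bsub>sCat E\<^esub> f) \<cdot>\<^bsub>sCat E\<^esub> gamma_map E a) = (norm_map E b \<cdot>\<^bsub>Ch E\<^esub> transpose_map x y f) \<cdot>\<^bsub>Ch E\<^esub> a"
    if a: "a \<in> Hom (Ch E) x' x" and f: "f \<in> Hom (sCat E) (gamma_obj E x) y" and b: "b \<in> Hom (sCat E) y y'" for x' x y y' a f b
  proof -
    interpret S: category "sCat E" by (rule category_sCat)
    interpret Ch: category "Ch E" by (rule category_Ch)
    have A: "a \<in> Arr (Ch E)" "f \<in> Arr (sCat E)" "src f = gamma_obj E (tgt a)" "b \<in> Arr (sCat E)" "tgt f = src b"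
      and e: "x' = src a" "x = tgt a" "y = src b" "y' = tgt b" using a f b by simp_all
    have 1: "(b \<cdot>\<^bsub>sCat E\<^esub> f) \<cdot>\<^bsub>sCat E\<^esub> gamma_map E a = b \<cdot>\<^bsub>sCat E\<^esub> (f \<cdot>\<^bsub>sCat E\<^esub> gamma_map E a)"
      using S.Comp_assoc_simp[of "gamma_map E a" f b] A gamma_map_Arr[OF A(1)] gamma_map_props(2)[OF A(1)] by simp
    have 2: "transpose_map (tgt a) (src b) f \<in> Arr (Ch E)" by (rule transpose_Arr) (use A in simp_all)
    have "(norm_map E b \<cdot>\<^bsub>Ch E\<^esub> transpose_map (tgt a) (src b) f) \<cdot>\<^bsub>Ch E\<^esub> a
        = norm_map E b \<cdot>\<^bsub>Ch E\<^esub> (transpose_map (tgt a) (src b) f \<cdot>\<^bsub>Ch E\<^esub> a)"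
      using Ch.Comp_assoc_simp[of a "transpose_map (tgt a) (src b) f" "norm_map E b"] A 2 norm_map_Arr[OF A(4)]
      by (simp add: transpose_map_def norm_map_def)
    then show ?thesis unfolding e 1 using transpose_natural[OF A] by simp
  qed
  ultimately show ?thesis
    unfolding is_adjunction_def DK_N_def DK_Gamma_def cfunctor.simps sCat_simps Ch_simps
    using is_functor_Gamma is_functor_N unfolding DK_N_def DK_Gamma_def by blast
qed

subsection \<open>Unit and counit\<close>

text \<open>Degreewise inverses of a chain map commute with the differentials automatically, so no
  such condition on g is imposed.\<close>

lemma Ch_isoI:
  assumes f: "f \<in> Arr (Ch E)"
    and g: "\<And>n. g n \<in> Arr E" "\<And>n. Dom E (g n) = ob (tgt f) n" "\<And>n. Cod E (g n) = ob (src f) n"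
    and gf: "\<And>n. g n \<cdot> ap f n = Ident E (ob (src f) n)" "\<And>n. ap f n \<cdot> g n = Ident E (ob (tgt f) n)"
  shows "is_iso (Ch E) f"
proof -
  note fs = Arr_Ch_simps[OF f]
  let ?g = "Arrow (tgt f) g (src f)"
  have "bd (src f) n \<cdot> g (Suc n) = g n \<cdot> bd (tgt f) n" for n
  proof -
    have "bd (src f) n \<cdot> g (Suc n) = (g n \<cdot> ap f n) \<cdot> (bd (src f) n \<cdot> g (Suc n))"
      unfolding gf(1) using fs(1) g by simp
    also have "\<dots> = g n \<cdot> (bd (tgt f) n \<cdot> (ap f (Suc n) \<cdot> g (Suc n)))"
      using f fs(1,2) g by simp
    finally show ?thesis unfolding gf(2) using fs(2) g by simp
  qed
  then have "?g \<in> Arr (Ch E)" unfolding Arr_Ch_iff arrow.sel using fs(1,2) g by blast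
  moreover have "?g \<cdot>\<^bsub>Ch E\<^esub> f = Ident (Ch E) (src f)" by (rule arrow_eqI) (simp_all add: gf)
  moreover have "f \<cdot>\<^bsub>Ch E\<^esub> ?g = Ident (Ch E) (tgt f)" by (rule arrow_eqI) (simp_all add: gf)
  ultimately show ?thesis unfolding is_iso_def using f by (intro conjI bexI[of _ ?g]) simp_all
qed

lemma sCat_isoI:
  assumes f: "f \<in> Arr (sCat E)"
    and g: "\<And>n. g n \<in> Arr E" "\<And>n. Dom E (g n) = sob (tgt f) n" "\<And>n. Cod E (g n) = sob (src f) n"
    and gf: "\<And>n. g n \<cdot> ap f n = Ident E (sob (src f) n)" "\<And>n. ap f n \<cdot> g n = Ident E (sob (tgt f) n)"
  shows "is_iso (sCat E) f"
proof -
  note fs = Arr_sCat_simps[OF f]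
  let ?g = "Arrow (tgt f) g (src f)"
  have "sact (src f) \<alpha> \<cdot> g (tgt \<alpha>) = g (src \<alpha>) \<cdot> sact (tgt f) \<alpha>" if \<alpha>: "\<alpha> \<in> Arr Simplex" for \<alpha>
  proof -
    have "sact (src f) \<alpha> \<cdot> g (tgt \<alpha>) = (g (src \<alpha>) \<cdot> ap f (src \<alpha>)) \<cdot> (sact (src f) \<alpha> \<cdot> g (tgt \<alpha>))"
      unfolding gf(1) using fs(1) g \<alpha> by simp
    also have "\<dots> = g (src \<alpha>) \<cdot> (sact (tgt f) \<alpha> \<cdot> (ap f (tgt \<alpha>) \<cdot> g (tgt \<alpha>)))"
      using simp_map_sact_elem[OF f \<alpha> refl, of "g (tgt \<alpha>)"] f fs(1,2) g \<alpha> by simp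
    finally show ?thesis unfolding gf(2) using fs(2) g \<alpha> by simp
  qed
  then have "?g \<in> Arr (sCat E)" unfolding Arr_sCat_iff arrow.sel using fs(1,2) g by blast
  moreover have "?g \<cdot>\<^bsub>sCat E\<^esub> f = Ident (sCat E) (src f)" by (rule arrow_eqI) (simp_all add: gf)
  moreover have "f \<cdot>\<^bsub>sCat E\<^esub> ?g = Ident (sCat E) (tgt f)" by (rule arrow_eqI) (simp_all add: gf)
  ultimately show ?thesis unfolding is_iso_def using f by (intro conjI bexI[of _ ?g]) simp_all
qed

text \<open>Pulling back along the maximal sections of surjections recovers the components of an element of
  \<open>\<Gamma>(C)\<^sub>n\<close> one at a time, in an order refining the pointwise order of surjections.\<close>

lemma gamma_detect:
  assumes C: "C \<in> chain_complexes E" and f: "f \<in> Arr (sCat E)" "src f = gamma_obj E C"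
    and inj: "\<And>p u. \<lbrakk>u \<in> Arr E; Cod E u = ob C p; ap f p \<cdot> (gid C p \<cdot> u) = Zero E (Dom E u) (sob (tgt f) p)\<rbrakk>
        \<Longrightarrow> u = Zero E (Dom E u) (ob C p)"
    and down: "\<And>\<eta> \<eta>'. \<lbrakk>\<eta> \<in> S; \<eta>' \<in> gamma_index n; \<And>i. i \<le> n \<Longrightarrow> ap \<eta>' i \<le> ap \<eta> i\<rbrakk> \<Longrightarrow> \<eta>' \<in> S"
    and S: "S \<subseteq> gamma_index n" and x: "x \<in> Arr E" "Cod E x = gamma_ob E C n"
    and zero: "\<And>\<eta>. \<eta> \<in> S \<Longrightarrow> sact (tgt f) (sec \<eta>) \<cdot> (ap f n \<cdot> x) = Zero E (Dom E x) (sob (tgt f) (tgt \<eta>))"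
    and \<eta>: "\<eta> \<in> S"
  shows "gpr C n \<eta> \<cdot> x = Zero E (Dom E x) (ob C (tgt \<eta>))"
  using \<eta>
\<comment> \<open>The sum of the values is strictly monotone for the pointwise order of surjections,
  so it serves as induction measure.\<close>
proof (induction "\<Sum>i\<le>n. ap \<eta> i" arbitrary: \<eta> rule: less_induct)
  case less
  note fs = Arr_sCat_simps[OF f(1), unfolded f(2) gamma_obj_simps]
  have \<eta>: "\<eta> \<in> gamma_index n" using less.prems S by blast
  note e = gamma_indexD(1,2)[OF \<eta>] and s = sec_props[OF \<eta>]
  note ac = gamma_act_props[OF C s(1), unfolded s(2,3)]
  let ?v = "sact (tgt f) (sec \<eta>) \<cdot> ap f n"
  have v: "?v \<in> Arr E" "Dom E ?v = gamma_ob E C n" "Cod E ?v = sob (tgt f) (tgt \<eta>)" using s(1-3) fs(2) fs(3-5)[of n] by simp_all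
  have vx: "?v \<cdot> x = Zero E (Dom E x) (sob (tgt f) (tgt \<eta>))"
    using zero[OF less.prems] s(1-3) fs(2) fs(3-5)[of n] x by simp
  have vin: "?v \<cdot> gamma_in E C n \<eta>' = ap f (tgt \<eta>) \<cdot> (gamma_in E C (tgt \<eta>) \<theta> \<cdot> gamma_coeff E C \<mu>)"
    if "\<eta>' \<in> gamma_index n" "\<theta> \<in> gamma_index (tgt \<eta>)" "inj_sop \<mu>" "src \<mu> = tgt \<theta>" "tgt \<mu> = tgt \<eta>'"
      "\<mu> \<odot> \<theta> = \<eta>' \<odot> sec \<eta>" for \<eta>' \<theta> \<mu>
    using simp_map_sact_elem[OF f(1) s(1,3), of "gamma_in E C n \<eta>'"] ac(4)[OF that] s(1-3) that(1) C f(2) fs(2) fs(3-5)[of n] by simp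
  \<comment> \<open>If \<mu> is an identity, \<eta>' lies strictly below \<eta>, and its component
    of x is zero by induction, S being closed downwards. Otherwise the coefficient vanishes, since
    \<mu> is not the last coface.\<close>
  have others: "?v \<cdot> (gamma_in E C n \<eta>' \<cdot> (gpr C n \<eta>' \<cdot> x)) = Zero E (Dom E x) (Cod E ?v)"
    if \<eta>': "\<eta>' \<in> gamma_index n" "\<eta>' \<noteq> \<eta>" for \<eta>'
  proof -
    note e' = gamma_indexD(1,2)[OF \<eta>'(1)]
    obtain \<theta> \<mu> where 1: "\<theta> \<in> gamma_index (tgt \<eta>)" "inj_sop \<mu>" "src \<mu> = tgt \<theta>" "tgt \<mu> = tgt \<eta>'" "\<mu> \<odot> \<theta> = \<eta>' \<odot> sec \<eta>"
      using epi_mono_ex[of "\<eta>' \<odot> sec \<eta>"] e' s(1-3) by auto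
    note tri = sec_triangular[OF \<eta> \<eta>'(1) 1]
    show ?thesis
    proof (cases "src \<mu> = tgt \<mu>")
      case True
      have le: "ap \<eta>' i \<le> ap \<eta> i" if "i \<le> n" for i using tri(2)[OF True that] .
      have "(\<Sum>i\<le>n. ap \<eta>' i) < (\<Sum>i\<le>n. ap \<eta> i)"
      proof (rule ccontr)
        assume "\<not> ?thesis"
        then have eq: "(\<Sum>i\<le>n. ap \<eta>' i) = (\<Sum>i\<le>n. ap \<eta> i)" using sum_mono[of "{..n}" "ap \<eta>'" "ap \<eta>"] le by simp
        have same: "ap \<eta>' i = ap \<eta> i" if "i \<le> n" for i
          by (rule sum_mono_inv[OF eq]) (use le that in simp_all)
        have "tgt \<eta>' = tgt \<eta>" using same[of n] gamma_index_last[OF \<eta>] gamma_index_last[OF \<eta>'(1)] by simp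
        then have "\<eta>' = \<eta>" using sop_eqI[of \<eta>' \<eta>] same e e' by simp
        then show False using \<eta>'(2) by simp
      qed
      then have "gpr C n \<eta>' \<cdot> x = Zero E (Dom E x) (ob C (tgt \<eta>'))"
        using less.hyps[of \<eta>'] down[OF less.prems \<eta>'(1)] le by blast
      then show ?thesis using v \<eta>'(1) x C by simp
    next
      case False
      then have "?v \<cdot> gamma_in E C n \<eta>' = Zero E (ob C (tgt \<eta>')) (Cod E ?v)"
        using vin[OF \<eta>'(1) 1] gamma_coeff_zero[OF False tri(1)] 1(1,3,4) C fs(2) fs(3-5)[of "tgt \<eta>"] v(3) by simp
      then show ?thesis using reassoc[of ?v "gamma_in E C n \<eta>'" _ "gpr C n \<eta>' \<cdot> x"] v \<eta>'(1) x C fs(2) by simp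
    qed
  qed
  let ?u = "gpr C n \<eta> \<cdot> x"
  have u: "?u \<in> Arr E" "Dom E ?u = Dom E x" "Cod E ?u = ob C (tgt \<eta>)" using \<eta> x C by simp_all
  have "?v \<cdot> x = ?v \<cdot> (gamma_in E C n \<eta> \<cdot> ?u)"
    by (rule biproduct_Comp_single[OF gamma_biproduct[OF C] x v(1,2) \<eta>]) (use others in blast)
  \<comment> \<open>The diagonal entry: \<eta> after its section is the identity, so the summand of
    \<eta> is carried to the identity summand.\<close>
  moreover have "?v \<cdot> gamma_in E C n \<eta> = ap f (tgt \<eta>) \<cdot> gid C (tgt \<eta>)"
    using vin[OF \<eta>, of "Ident Simplex (tgt \<eta>)" "Ident Simplex (tgt \<eta>)"] gamma_index_id inj_sop_id s(6)
      Simplex.Comp_Ident_simp[of "Ident Simplex (tgt \<eta>)" "tgt \<eta>"] C by simp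
  ultimately have "ap f (tgt \<eta>) \<cdot> (gid C (tgt \<eta>) \<cdot> ?u) = Zero E (Dom E x) (sob (tgt f) (tgt \<eta>))"
    using reassoc[of ?v "gamma_in E C n \<eta>" _ ?u] vx v u \<eta> C fs(3-5)[of "tgt \<eta>"] by simp
  then show ?case using inj[of ?u "tgt \<eta>"] u by simp
qed

lemma gpr_gid:
  assumes C: "C \<in> chain_complexes E" and \<eta>: "\<eta> \<in> gamma_index n"
  shows "gpr C n \<eta> \<cdot> gid C n = (if \<eta> = Ident Simplex n then Ident E (ob C n) else Zero E (ob C n) (ob C (tgt \<eta>)))"
  using gamma_biproduct[OF C, of n] gamma_index_id[of n] \<eta> unfolding is_biproduct_def by (auto split: if_splits)

text \<open>The normalized part of \<open>gamma_ob E C n\<close> lies in the identity summand: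
  \<open>gamma_detect\<close> for the identity map kills the components at all other surjections,
  which form a downward closed set because the identity is the greatest surjection.\<close>

lemma gid_proj_norm_in:
  assumes C: "C \<in> chain_complexes E"
  shows "gid C n \<cdot> (gpr C n (Ident Simplex n) \<cdot> norm_in E (gamma_obj E C) n) = norm_in E (gamma_obj E C) n"
proof (rule biproduct_ext_prj[OF gamma_biproduct[OF C, of n]])
  let ?G = "gamma_obj E C" and ?f = "Ident (sCat E) (gamma_obj E C)"
  let ?k = "norm_in E ?G n"
  note G = gamma_obj_simplicial[OF C]
  interpret S: category "sCat E" by (rule category_sCat)
  note k = norm_in_simps[OF G, of n, unfolded gamma_obj_simps]
  note I = gamma_simps(5-7)[OF C gamma_index_id, of n]
  show "gid C n \<cdot> (gpr C n (Ident Simplex n) \<cdot> ?k) \<in> Arr E" "?k \<in> Arr E"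
    "Cod E (gid C n \<cdot> (gpr C n (Ident Simplex n) \<cdot> ?k)) = gamma_ob E C n" "Cod E ?k = gamma_ob E C n"
    "Dom E (gid C n \<cdot> (gpr C n (Ident Simplex n) \<cdot> ?k)) = Dom E ?k"
    using k I C by simp_all
  have f: "?f \<in> Arr (sCat E)" "src ?f = ?G" using G by simp_all
  fix \<eta> assume \<eta>: "\<eta> \<in> gamma_index n"
  have "gpr C n \<eta> \<cdot> ?k = Zero E (Dom E ?k) (ob C (tgt \<eta>))" if ne: "\<eta> \<noteq> Ident Simplex n"
  proof (rule gamma_detect[OF C f, where S = "gamma_index n - {Ident Simplex n}"])
    show "u = Zero E (Dom E u) (ob C p)"
      if u: "u \<in> Arr E" "Cod E u = ob C p" "ap ?f p \<cdot> (gid C p \<cdot> u) = Zero E (Dom E u) (sob (tgt ?f) p)" for p u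
    proof -
      have "gid C p \<cdot> u = Zero E (Dom E u) (gamma_ob E C p)" using u C by simp
      then have "gpr C p (Ident Simplex p) \<cdot> (gid C p \<cdot> u) = Zero E (Dom E u) (ob C p)"
        using gamma_simps(5-7)[OF C gamma_index_id, of p] u(1) by simp
      then show ?thesis
        using reassoc[OF gpr_gid[OF C gamma_index_id, of p], of u] gamma_simps(5-7)[OF C gamma_index_id, of p] u(1,2) C by simp
    qed
    show "\<eta>2 \<in> gamma_index n - {Ident Simplex n}"
      if a: "\<eta>1 \<in> gamma_index n - {Ident Simplex n}" "\<eta>2 \<in> gamma_index n" "\<And>i. i \<le> n \<Longrightarrow> ap \<eta>2 i \<le> ap \<eta>1 i" for \<eta>1 \<eta>2
    proof -
      have "\<eta>2 \<noteq> Ident Simplex n"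
      proof
        assume eq: "\<eta>2 = Ident Simplex n"
        have \<eta>1: "\<eta>1 \<in> gamma_index n" using a(1) by simp
        have p: "ap \<eta>1 i = i" if "i \<le> n" for i
          using a(3)[OF that] gamma_index_le[OF \<eta>1 that] that eq by simp
        have "\<eta>1 = Ident Simplex n"
          by (rule sop_eqI) (use p gamma_indexD(1,2)[OF \<eta>1] gamma_index_last[OF \<eta>1] in simp_all)
        then show False using a(1) by simp
      qed
      then show ?thesis using a(2) by simp
    qed
    show "sact (tgt ?f) (sec \<eta>1) \<cdot> (ap ?f n \<cdot> ?k) = Zero E (Dom E ?k) (sob (tgt ?f) (tgt \<eta>1))"
      if a: "\<eta>1 \<in> gamma_index n - {Ident Simplex n}" for \<eta>1
    proof -
      obtain p i g where g: "n = Suc p" "i \<le> p" "g \<in> Arr Simplex" "src g = tgt \<eta>1" "tgt g = p" "sec \<eta>1 = coface p i \<odot> g"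
        using sec_factor_coface[of \<eta>1 n] a by blast
      have "face ?G p i \<cdot> norm_in E ?G (Suc p) = Zero E (Dom E ?k) (sob ?G p)"
        using face_norm_in[OF G g(2), of "Ident E (Dom E ?k)"] g(1) G by simp
      moreover have "sact ?G (sec \<eta>1) \<cdot> ?k = sact ?G g \<cdot> (face ?G p i \<cdot> ?k)"
        unfolding g(6) by (rule sact_sact[OF G g(3), symmetric]) (use g(1,5) G in simp_all)
      ultimately show ?thesis using sact_simps(2-4)[OF G g(3)] g(1,4,5) k C by simp
    qed
  qed (use k \<eta> ne in simp_all)
  then show "gpr C n \<eta> \<cdot> (gid C n \<cdot> (gpr C n (Ident Simplex n) \<cdot> ?k)) = gpr C n \<eta> \<cdot> ?k"
    using reassoc[OF gpr_gid[OF C \<eta>], of "gpr C n (Ident Simplex n) \<cdot> ?k"] I k \<eta> C by (cases "\<eta> = Ident Simplex n") simp_all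
qed

text \<open>The inverse projects the normalized part onto the identity summand;
  \<open>gid_proj_norm_in\<close> makes it a right inverse, the biproduct equations a left
  one.\<close>

lemma unit_iso:
  assumes C: "C \<in> chain_complexes E"
  shows "is_iso (Ch E) (transpose_map C (gamma_obj E C) (Ident (sCat E) (gamma_obj E C)))"
proof (rule Ch_isoI)
  let ?G = "gamma_obj E C"
  let ?f = "Ident (sCat E) ?G" and ?w = "\<lambda>n. gpr C n (Ident Simplex n) \<cdot> norm_in E ?G n"
  let ?t = "transpose_map C ?G ?f"
  note G = gamma_obj_simplicial[OF C]
  interpret S: category "sCat E" by (rule category_sCat)
  have f: "?f \<in> Arr (sCat E)" "src ?f = ?G" "tgt ?f = ?G" using G by simp_all
  note t = transpose_simps[OF C f]
  note k = norm_in_simps[OF G, unfolded gamma_obj_simps]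
  note I = gamma_simps(5-7)[OF C gamma_index_id]
  show "?t \<in> Arr (Ch E)" by (rule transpose_Arr[OF C f])
  show w: "?w n \<in> Arr E" "Dom E (?w n) = ob (tgt ?t) n" "Cod E (?w n) = ob (src ?t) n" for n
    unfolding t(1,2) norm_chain_simps(1)[OF G] using I[of n] k[of n] by simp_all
  have tk: "norm_in E ?G n \<cdot> ap ?t n = gid C n" for n using t(6)[of n] C by simp
  show "?w n \<cdot> ap ?t n = Ident E (ob (src ?t) n)" for n
    using tk[of n] gpr_gid[OF C gamma_index_id, of n] t(1) t(3-5)[of n] I[of n] k[of n] by simp
  show "ap ?t n \<cdot> ?w n = Ident E (ob (tgt ?t) n)" for n
  proof -
    have "norm_in E ?G n \<cdot> (ap ?t n \<cdot> ?w n) = norm_in E ?G n"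
      using reassoc[OF tk[of n], of "?w n"] gid_proj_norm_in[OF C, of n] t(3-5)[of n] I[of n] k[of n] by simp
    then show ?thesis
      unfolding t(2) norm_chain_simps(1)[OF G]
      using norm_mono[OF G, of "ap ?t n \<cdot> ?w n" "Ident E (Dom E (norm_in E ?G n))" n] t(3-5)[of n] I[of n] k[of n] by simp
  qed
qed

text \<open>The transpose e of the identity is injective on generalized elements by
  \<open>gamma_detect\<close> with all surjections, and surjective by
  \<open>simplicial_induct\<close>. Lifting the identity of B_n gives a section of e, which is
  two-sided by injectivity.\<close>

lemma counit_iso:
  assumes B: "B \<in> simplicial_objects E"
  shows "\<exists>e\<in>Hom (sCat E) (gamma_obj E (norm_chain E B)) B.
    is_iso (sCat E) e \<and> transpose_map (norm_chain E B) B e = Ident (Ch E) (norm_chain E B)"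
proof -
  let ?C = "norm_chain E B"
  note C = norm_chain_complex[OF B] and N = norm_chain_simps(1)[OF B]
  interpret Ch: category "Ch E" by (rule category_Ch)
  have "Ident (Ch E) ?C \<in> Arr (Ch E)" using C by simp
  then obtain e where e: "e \<in> Arr (sCat E)" "src e = gamma_obj E ?C" "tgt e = B" "transpose_map ?C B e = Ident (Ch E) ?C"
    by (rule transpose_surj[OF B]) simp_all
  note es = Arr_sCat_simps[OF e(1), unfolded e(2,3) gamma_obj_simps]
  have eg: "ap e n \<cdot> gid ?C n = norm_in E B n" for n
    using transpose_simps(6)[OF C e(1-3), of n] norm_in_simps[OF B, of n] N unfolding e(4) by simp
  have eg': "ap e n \<cdot> (gid ?C n \<cdot> u) = norm_in E B n \<cdot> u" if "u \<in> Arr E" "Cod E u = ob ?C n" for n u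
    using reassoc[OF eg[of n], of u] es(3-5)[of n] that C by simp
  have inj0: "x = Zero E (Dom E x) (gamma_ob E ?C n)"
    if x: "x \<in> Arr E" "Cod E x = gamma_ob E ?C n" "ap e n \<cdot> x = Zero E (Dom E x) (sob B n)" for x n
  proof (rule biproduct_ext_prj[OF gamma_biproduct[OF C, of n]])
    fix \<eta> assume \<eta>: "\<eta> \<in> gamma_index n"
    have "gpr ?C n \<eta> \<cdot> x = Zero E (Dom E x) (ob ?C (tgt \<eta>))"
    proof (rule gamma_detect[OF C e(1,2), where S = "gamma_index n"])
      show "u = Zero E (Dom E u) (ob ?C p)"
        if u: "u \<in> Arr E" "Cod E u = ob ?C p" "ap e p \<cdot> (gid ?C p \<cdot> u) = Zero E (Dom E u) (sob (tgt e) p)" for p u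
        using norm_mono[OF B, of u "Zero E (Dom E u) (ob ?C p)" p] u eg'[OF u(1,2)] N[of p] norm_in_simps[OF B, of p] e(3) by simp
      show "sact (tgt e) (sec \<eta>1) \<cdot> (ap e n \<cdot> x) = Zero E (Dom E x) (sob (tgt e) (tgt \<eta>1))"
        if "\<eta>1 \<in> gamma_index n" for \<eta>1
        unfolding x(3) e(3) using sec_props(1-3)[OF that] B x(1) by simp
    qed (use x \<eta> in simp_all)
    then show "gpr ?C n \<eta> \<cdot> x = gpr ?C n \<eta> \<cdot> Zero E (Dom E x) (gamma_ob E ?C n)" using \<eta> x(1) C by simp
  qed (use x C in simp_all)
  have inj: "x = y"
    if xy: "x \<in> Arr E" "y \<in> Arr E" "Dom E x = Dom E y" "Cod E x = gamma_ob E ?C n" "Cod E y = gamma_ob E ?C n"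
      "ap e n \<cdot> x = ap e n \<cdot> y" for x y n
  proof -
    obtain z where z: "z \<in> Arr E" "Dom E z = Dom E y" "Cod E z = Cod E y" "z \<boxplus> y = x"
      using diff_ex[of x y] xy by auto
    have "ap e n \<cdot> (z \<boxplus> y) = ap e n \<cdot> y" unfolding z(4) by (rule xy(6))
    then have "ap e n \<cdot> z = Zero E (Dom E z) (sob B n)" using z(1-3) xy es(3-5)[of n] by simp
    then have "z = Zero E (Dom E z) (gamma_ob E ?C n)" using inj0[of z n] z xy by simp
    then show ?thesis using z xy by (metis Add_Zero)
  qed
  have surj: "\<exists>y. y \<in> Arr E \<and> Dom E y = T \<and> Cod E y = gamma_ob E ?C n \<and> ap e n \<cdot> y = x"
    if x: "x \<in> Arr E" "Dom E x = T" "Cod E x = sob B n" for x n T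
  proof (rule simplicial_induct[OF B, where S = "\<lambda>n x. \<exists>y. y \<in> Arr E \<and> Dom E y = T \<and> Cod E y = gamma_ob E ?C n \<and> ap e n \<cdot> y = x"])
    fix n x assume "normalized B n x" "Dom E x = T"
    then obtain u where u: "u \<in> Arr E" "Dom E u = T" "Cod E u = Dom E (norm_in E B n)" "norm_in E B n \<cdot> u = x"
      using norm_lift[OF B, of n x] by metis
    then show "\<exists>y. y \<in> Arr E \<and> Dom E y = T \<and> Cod E y = gamma_ob E ?C n \<and> ap e n \<cdot> y = x"
      using eg'[of u n] N[of n] C by (intro exI[of _ "gid ?C n \<cdot> u"]) simp
  next
    fix n :: nat and x x'
    assume "\<exists>y. y \<in> Arr E \<and> Dom E y = T \<and> Cod E y = gamma_ob E ?C n \<and> ap e n \<cdot> y = x"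
      "\<exists>y. y \<in> Arr E \<and> Dom E y = T \<and> Cod E y = gamma_ob E ?C n \<and> ap e n \<cdot> y = x'"
    then obtain y y' where y: "y \<in> Arr E" "Dom E y = T" "Cod E y = gamma_ob E ?C n" "ap e n \<cdot> y = x"
      "y' \<in> Arr E" "Dom E y' = T" "Cod E y' = gamma_ob E ?C n" "ap e n \<cdot> y' = x'" by blast
    then show "\<exists>y. y \<in> Arr E \<and> Dom E y = T \<and> Cod E y = gamma_ob E ?C n \<and> ap e n \<cdot> y = x \<boxplus> x'"
      using es(3-5)[of n] by (intro exI[of _ "y \<boxplus> y'"]) simp
  next
    fix n k :: nat and x assume k: "k \<le> n"
    assume "\<exists>y. y \<in> Arr E \<and> Dom E y = T \<and> Cod E y = gamma_ob E ?C n \<and> ap e n \<cdot> y = x"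
    then obtain y where y: "y \<in> Arr E" "Dom E y = T" "Cod E y = gamma_ob E ?C n" "ap e n \<cdot> y = x" by blast
    have "degen B n k \<cdot> (ap e n \<cdot> y) = ap e (Suc n) \<cdot> (gamma_act E ?C (codeg n k) \<cdot> y)"
      using simp_map_sact_elem[OF e(1), of "codeg n k" n y] k y e(2,3) by simp
    then show "\<exists>y. y \<in> Arr E \<and> Dom E y = T \<and> Cod E y = gamma_ob E ?C (Suc n) \<and> ap e (Suc n) \<cdot> y = degen B n k \<cdot> x"
      using gamma_act_props(1-3)[OF C, of "codeg n k"] k y by (intro exI[of _ "gamma_act E ?C (codeg n k) \<cdot> y"]) simp
  qed (use x in simp_all)
  have "\<exists>s. s \<in> Arr E \<and> Dom E s = sob B n \<and> Cod E s = gamma_ob E ?C n \<and> ap e n \<cdot> s = Ident E (sob B n)" for n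
    by (rule surj) (use B in simp_all)
  then obtain s where s: "\<And>n. s n \<in> Arr E" "\<And>n. Dom E (s n) = sob B n" "\<And>n. Cod E (s n) = gamma_ob E ?C n"
    "\<And>n. ap e n \<cdot> s n = Ident E (sob B n)" by metis
  have se: "s n \<cdot> ap e n = Ident E (gamma_ob E ?C n)" for n
    by (rule inj[of _ _ n]) (use s(1-3)[of n] es(3-5)[of n] C reassoc[OF s(4)[of n], of "ap e n"] in simp_all)
  have "is_iso (sCat E) e"
    by (rule sCat_isoI[OF e(1), of s]) (use s se e(2,3) in simp_all)
  then show ?thesis using e by (intro bexI[of _ e]) simp_all
qed

end

theorem theorem4:
  fixes E :: "('o, 'm) exact_cat"
  assumes "exact_category E"
    and "weakly_idempotent_complete E"
    and "enough_projectives E"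
  shows "quillen_equivalence (Ch_proj E) (s_proj E) (DK_Gamma E) (DK_N E)"
proof -
  interpret exact_enough_projectives E
    using assms by (simp add: exact_enough_projectives_def exact_enough_projectives_axioms_def)
  interpret Ch: weq_fib_category "Ch E" "quasi_isos E" "Ch_fibrations E" by (rule weq_fib_category_Ch)
  interpret S: category "sCat E" by (rule category_sCat)
  interpret T: weq_fib_transport "Ch E" "quasi_isos E" "Ch_fibrations E" "sCat E" "DK_Gamma E" "DK_N E"
    transpose_map "s_weqs E" "s_fibrations E"
    by unfold_locales
      (use is_adjunction_DK unit_iso counit_iso s_weqs_iff s_fibrations_iff in \<open>simp_all add: DK_Gamma_def DK_N_def\<close>)
  show ?thesis unfolding Ch_proj_def s_proj_def by (rule T.quillen_equivalence)
qed

end
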